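(* Let $N\ge 3$, $2^*=\frac{2N}{N-2}$, and $G(s)=s^2\log|s|$ for $s\neq0$, $G(0)=0$. Then the sharp (i.e. largest possible) constant in the inequality $$\Big(\int_{\mathbb{R}^N}|\nabla u|^2\,dx\Big)^{\frac{N}{N-2}}\ge C_{N,G}\int_{\mathbb{R}^N}G(u)\,dx\quad\text{for all }u\in\mathcal{D}^{1,2}(\mathbb{R}^N)$$ is $$C_{N,G}=2^*\Big(\frac N2\Big)^{\frac{2}{N-2}}e^{\frac{2(N-1)}{N-2}}\pi^{\frac{N}{N-2}},$$ and the functions $u_\lambda(x)=e^{\frac{N-1}{2}-\frac{\lambda^2}{2}|x|^2}$ with $\lambda>0$ constitute the whole family of minimizers up to translations.
   Context: $\mathcal{D}^{1,2}(\mathbb{R}^N)$ is the completion of $\mathcal{C}_0^\infty(\mathbb{R}^N)$ with respect to the norm $\|u\|=\big(\int_{\mathbb{R}^N}|\nabla u|^2\,dx\big)^{1/2}$. The integral $\int_{\mathbb{R}^N} G(u)\,dx$ is well defined in $[-\infty,\infty)$ for every $u\in\mathcal{D}^{1,2}(\mathbb{R}^N)$, because the positive part of $G(u)$ is integrable. A minimizer is a function $u\ne0$ in $\mathcal{D}^{1,2}(\mathbb{R}^N)$ for which equality holds with the sharp constant.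
   Formalization: Since G and the gradient integral are even, −u_λ is also a minimizer, so the family is described up to translations and sign: the minimizers are exactly the functions ±u_λ(x−y), almost everywhere, with λ>0 and y in R^N. *)

theory Defs
  imports "HOL-Analysis.Analysis"
begin

primrec C_k :: "nat \<Rightarrow> (real ^ 'n \<Rightarrow> real) \<Rightarrow> bool" where
  "C_k 0 f \<longleftrightarrow> continuous_on UNIV f"
| "C_k (Suc k) f \<longleftrightarrow> (\<exists>g. (\<forall>x. GDERIV f x :> g x) \<and> (\<forall>i. C_k k (\<lambda>x. g x $ i)))"

definition test_function :: "(real ^ 'n \<Rightarrow> real) \<Rightarrow> bool" where
  "test_function \<phi> \<longleftrightarrow> (\<forall>k. C_k k \<phi>) \<and> compact (closure {x. \<phi> x \<noteq> 0})"

definition grad :: "(real ^ 'n \<Rightarrow> real) \<Rightarrow> real ^ 'n \<Rightarrow> real ^ 'n" where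
  "grad \<phi> x = (THE D. GDERIV \<phi> x :> D)"

definition critical_exponent :: "nat \<Rightarrow> real" where
  "critical_exponent N = 2 * real N / (real N - 2)"

text \<open>
  The completion of the test functions in the norm \<open>(\<integral> |\<nabla>\<phi>|\<^sup>2)\<^sup>1\<^sup>/\<^sup>2\<close> is
  realised as a space of functions in the usual way: by the Sobolev inequality a
  sequence of test functions that is Cauchy in this norm converges in the Lebesgue space
  of the critical exponent to some \<open>u\<close>, while its gradients converge in \<open>L\<^sup>2\<close> to some
  \<open>g\<close>; then \<open>u\<close> is the element of the completion and \<open>g\<close> is its (weak) gradient.
  Elements are Lebesgue measurable representatives, so equality of elements is
  equality almost everywhere.
\<close>

definition has_D12_gradient :: "(real ^ 'n \<Rightarrow> real) \<Rightarrow> (real ^ 'n \<Rightarrow> real ^ 'n) \<Rightarrow> bool" where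
  "has_D12_gradient u g \<longleftrightarrow>
     u \<in> borel_measurable lebesgue \<and> g \<in> borel_measurable lebesgue \<and>
     (\<exists>\<phi> :: nat \<Rightarrow> real ^ 'n \<Rightarrow> real.
        (\<forall>k. test_function (\<phi> k)) \<and>
        (\<lambda>k. \<integral>\<^sup>+x. ennreal ((norm (grad (\<phi> k) x - g x))\<^sup>2) \<partial>lebesgue) \<longlonglongrightarrow> 0 \<and>
        (\<lambda>k. \<integral>\<^sup>+x. ennreal (\<bar>\<phi> k x - u x\<bar> powr critical_exponent CARD('n)) \<partial>lebesgue)
          \<longlonglongrightarrow> 0)"

definition D12 :: "(real ^ 'n \<Rightarrow> real) set" where
  "D12 = {u. \<exists>g. has_D12_gradient u g}"

text \<open>The gradient is determined by \<open>u\<close> up to null sets only.\<close>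

definition D12_grad :: "(real ^ 'n \<Rightarrow> real) \<Rightarrow> real ^ 'n \<Rightarrow> real ^ 'n" where
  "D12_grad u = (SOME g. has_D12_gradient u g)"

definition Dirichlet_energy :: "(real ^ 'n \<Rightarrow> real) \<Rightarrow> real" where
  "Dirichlet_energy u = (LINT x|lebesgue. (norm (D12_grad u x))\<^sup>2)"

text \<open>
  Integral of the positive part minus integral of the negative part
  (\<open>ennreal\<close> truncates negative reals to 0). If the positive part is not
  integrable the value is \<open>\<infinity>\<close>, even when the negative part is not integrable either.
\<close>

definition extended_integral :: "(real ^ 'n \<Rightarrow> real) \<Rightarrow> ereal" where
  "extended_integral f =
     enn2ereal (\<integral>\<^sup>+x. ennreal (f x) \<partial>lebesgue) - enn2ereal (\<integral>\<^sup>+x. ennreal (- f x) \<partial>lebesgue)"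

definition G_log :: "real \<Rightarrow> real" where
  "G_log s = (if s = 0 then 0 else s\<^sup>2 * ln \<bar>s\<bar>)"

definition energy_power :: "(real ^ 'n \<Rightarrow> real) \<Rightarrow> real" where
  "energy_power u = Dirichlet_energy u powr (real CARD('n) / (real CARD('n) - 2))"

definition Sobolev_inequality :: "'n::finite itself \<Rightarrow> (real \<Rightarrow> real) \<Rightarrow> real \<Rightarrow> bool" where
  "Sobolev_inequality _ G C \<longleftrightarrow>
     (\<forall>u \<in> (D12 :: (real ^ 'n \<Rightarrow> real) set).
        ereal (energy_power u) \<ge> ereal C * extended_integral (\<lambda>x. G (u x)))"

definition sharp_constant :: "'n::finite itself \<Rightarrow> (real \<Rightarrow> real) \<Rightarrow> real \<Rightarrow> bool" where
  "sharp_constant T G C \<longleftrightarrow>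
     Sobolev_inequality T G C \<and> (\<forall>C'. Sobolev_inequality T G C' \<longrightarrow> C' \<le> C)"

definition minimizer :: "(real \<Rightarrow> real) \<Rightarrow> (real ^ 'n \<Rightarrow> real) \<Rightarrow> bool" where
  "minimizer G u \<longleftrightarrow>
     u \<in> D12 \<and> \<not> (AE x in lebesgue. u x = 0) \<and>
     (\<exists>C. sharp_constant TYPE('n) G C \<and>
        ereal (energy_power u) = ereal C * extended_integral (\<lambda>x. G (u x)))"

definition u_gauss :: "real \<Rightarrow> real ^ 'n \<Rightarrow> real" where
  "u_gauss l x = exp ((real CARD('n) - 1) / 2 - l\<^sup>2 / 2 * (norm x)\<^sup>2)"

end

theory Submission
  imports Defs "HOL-Probability.Probability" "HOL-Real_Asymp.Real_Asymp"
begin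

text \<open>
  The inequality is the Gaussian logarithmic Sobolev inequality in disguise. Write \<open>n\<close> for the dimension,
  \<open>m = \<integral> u\<^sup>2\<close>, \<open>E = \<integral> |\<nabla>u|\<^sup>2\<close> and \<open>I = \<integral> G(u)\<close>. Substituting \<open>h = u / sqrt \<gamma>\<close>, with \<open>\<gamma>\<close> the
  standard Gaussian density, turns the Gaussian inequality \<open>Ent(h\<^sup>2) \<le> 2 \<integral> |\<nabla>h|\<^sup>2 d\<gamma>\<close> into an inequality between
  \<open>I\<close>, \<open>m\<close> and \<open>E\<close> for Lebesgue measure. Dilations of \<open>u\<close> put a free scale \<open>s\<close> into it, and the best
  \<open>s\<close> leaves \<open>2 I \<le> (n - 2)/2 * m * (1 + ln (M / m))\<close>, where \<open>M\<close> is a multiple of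
  \<open>E\<close> to the power \<open>n/(n - 2)\<close>. The right-hand side is largest at \<open>m = M\<close>, and the value found there is exactly the
  asserted inequality (\<open>scaled_logsob\<close>, \<open>optimise_scale_and_amplitude\<close>). So equality
  determines the scale, the amplitude, and equality in the Gaussian inequality.

  The Gaussian inequality is proved in dimension one by monotone transport of \<open>F \<gamma>\<close> to \<open>\<gamma>\<close>
  (\<open>gauss_logsob_1d\<close>), and in every finite dimension by subadditivity of entropy
  (\<open>gauss_logsob_PiM\<close>).
  Transport alone does not give access to the equality case after a limit. Hence a quantitative form
  (\<open>gauss_logsob_deficit\<close>): \<open>\<gamma>\<close> is the law of \<open>(s + t) / sqrt 2\<close> for independent Gaussian \<open>s\<close> and \<open>t\<close>;
  applying the inequality in \<open>s\<close> for fixed \<open>t\<close>, and then to the average over \<open>s\<close> as a function of \<open>t\<close>,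
  stays below \<open>2 \<integral> |\<nabla>h|\<^sup>2 d\<gamma>\<close> by a gap in the Cauchy-Schwarz inequality for \<open>h\<close> and \<open>\<nabla>h\<close>. This gap bounds the
  deficit from below and passes to limits by Fatou's lemma. If it vanishes, \<open>\<nabla>h\<close> is a constant multiple \<open>\<beta> h\<close> of \<open>h\<close>
  (\<open>logsob_limit\<close>), so \<open>h\<close> is an exponential and \<open>u\<close> a Gaussian (\<open>log_gradient_rigidity\<close>).

  On the completion: either \<open>I = -\<infinity>\<close>, or \<open>u\<close> is square integrable (\<open>D12_dichotomy\<close>), and then cutoffs of the
  approximating test functions converge to \<open>u\<close> strongly enough, \<open>G\<close> being bounded below
  (\<open>D12_smooth_approximation\<close>). The gradient does not depend on the approximating sequence
  (\<open>D12_approx_grad_unique\<close>), so the energies of the Gaussians can be computed explicitly; they give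
  equality (\<open>u_gauss_facts\<close>), which shows both that the constant is sharp and that the
  Gaussians are minimizers.
\<close>

section \<open>The normal distribution function\<close>

lemma integral_derivative_vanishing:
  fixes W W' :: "real \<Rightarrow> real"
  assumes D: "\<And>x. (W has_real_derivative W' x) (at x)"
    and c: "continuous_on UNIV W'" and i: "integrable lborel W'"
    and t: "(W \<longlongrightarrow> 0) at_top" and b: "(W \<longlongrightarrow> 0) at_bot"
  shows "(\<integral>x. W' x \<partial>lborel) = 0"
proof -
  have "(LBINT x=-\<infinity>..\<infinity>. W' x) = 0 - 0"
  proof (rule interval_integral_FTC_integrable[where F=W])
    show "(W has_vector_derivative W' x) (at x)" for x
      using D by (simp add: has_real_derivative_iff_has_vector_derivative)
    show "isCont W' x" for x using c by (simp add: continuous_on_eq_continuous_at)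
    show "set_integrable lborel (einterval (-\<infinity>) \<infinity>) W'"
      using i by (simp add: set_integrable_def)
    show "((W \<circ> real_of_ereal) \<longlongrightarrow> 0) (at_right (- \<infinity>))"
      using b by (simp add: ereal_tendsto_simps)
    show "((W \<circ> real_of_ereal) \<longlongrightarrow> 0) (at_left \<infinity>)"
      using t by (simp add: ereal_tendsto_simps)
  qed simp
  then show ?thesis by (simp add: interval_lebesgue_integral_def set_lebesgue_integral_def)
qed

lemma cdf_has_derivative:
  fixes f :: "real \<Rightarrow> real"
  assumes c: "continuous_on UNIV f" and i: "integrable lborel f"
  shows "((\<lambda>x. \<integral>t. indicator {..x} t * f t \<partial>lborel) has_real_derivative f x) (at x)"
proof -
  let ?G = "\<lambda>x. \<integral>t. indicator {..x} t * f t \<partial>lborel"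
  have ii: "integrable lborel (\<lambda>t. indicator {..x} t * f t)" for x
    using integrable_mult_indicator[OF _ i, of "{..x}"] by simp
  have split: "?G y = ?G (x - 1) + integral {x-1..y} f" if "y \<ge> x - 1" for y
  proof -
    have cc: "continuous_on {x-1..y} f" using c continuous_on_subset by blast
    have si: "set_integrable lborel {x-1..y} f"
      by (rule borel_integrable_atLeastAtMost') (rule cc)
    have "?G y = (\<integral>t. indicator {..x-1} t * f t + indicator {x-1..y} t * f t \<partial>lborel)"
    proof (rule integral_cong_AE)
      show "AE t in lborel. indicator {..y} t * f t = indicator {..x-1} t * f t + indicator {x-1..y} t * f t"
        using AE_lborel_singleton[of "x-1"]
        by eventually_elim (use that in \<open>auto simp: indicator_def\<close>)
      have m: "f \<in> borel_measurable borel" using c by (rule borel_measurable_continuous_onI)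
      show "(\<lambda>t. indicator {..y} t * f t) \<in> borel_measurable lborel" using m by measurable
      show "(\<lambda>t. indicator {..x-1} t * f t + indicator {x-1..y} t * f t) \<in> borel_measurable lborel" using m by measurable
    qed
    also have "\<dots> = ?G (x-1) + (\<integral>t. indicator {x-1..y} t * f t \<partial>lborel)"
      using si by (intro Bochner_Integration.integral_add ii) (simp add: set_integrable_def)
    also have "(\<integral>t. indicator {x-1..y} t * f t \<partial>lborel) = integral {x-1..y} f"
      using set_borel_integral_eq_integral(2)[OF si] by (simp add: set_lebesgue_integral_def)
    finally show ?thesis .
  qed
  have cc: "continuous_on {x-1..x+1} f" using c continuous_on_subset by blast
  have "((\<lambda>y. integral {x-1..y} f) has_real_derivative f x) (at x within {x-1..x+1})"
    by (rule integral_has_real_derivative[OF cc]) simp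
  then have "((\<lambda>y. integral {x-1..y} f) has_real_derivative f x) (at x)"
    by (simp add: at_within_Icc_at)
  then have "((\<lambda>y. ?G (x-1) + integral {x-1..y} f) has_real_derivative f x) (at x)"
    by (auto intro!: derivative_eq_intros)
  moreover have "eventually (\<lambda>y. ?G y = ?G (x-1) + integral {x-1..y} f) (nhds x)"
    using eventually_nhds_in_open[of "{x-1<..}" x] by (auto elim!: eventually_mono intro!: split)
  ultimately show ?thesis
    by (subst DERIV_cong_ev[OF refl _ refl]) auto
qed

definition normal_cdf :: "real \<Rightarrow> real" where
  "normal_cdf x = (\<integral>t. indicator {..x} t * std_normal_density t \<partial>lborel)"

lemma std_normal_density_positive: "0 < std_normal_density x"
  by (simp add: normal_density_pos)

lemma continuous_std_normal_density: "continuous_on A std_normal_density"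
  unfolding std_normal_density_def by (intro continuous_intros) auto

lemma normal_cdf_deriv: "(normal_cdf has_real_derivative std_normal_density x) (at x)"
  unfolding normal_cdf_def[abs_def]
  by (rule cdf_has_derivative) (auto intro: continuous_std_normal_density)

lemma normal_cdf_strict_mono: "strict_mono normal_cdf"
proof (rule strict_monoI)
  fix x y :: real assume "x < y"
  then show "normal_cdf x < normal_cdf y"
    by (rule DERIV_pos_imp_increasing) (use normal_cdf_deriv std_normal_density_positive in blast)
qed

lemma normal_cdf_less_iff [simp]: "normal_cdf x < normal_cdf y \<longleftrightarrow> x < y"
  using normal_cdf_strict_mono by (rule strict_mono_less)

lemma normal_cdf_isCont: "isCont normal_cdf x"
  by (rule DERIV_isCont[OF normal_cdf_deriv])

lemma normal_cdf_mass_tendsto: "(\<lambda>n. normal_cdf (real n) - normal_cdf (- real n)) \<longlonglongrightarrow> 1"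
proof -
  have m: "std_normal_density \<in> borel_measurable borel" by simp
  have eq: "normal_cdf (real n) - normal_cdf (- real n)
    = (\<integral>t. indicator {- real n<..real n} t * std_normal_density t \<partial>lborel)" for n
  proof -
    have ii: "integrable lborel (\<lambda>t. indicator {..x::real} t * std_normal_density t)" for x
      using integrable_mult_indicator[of "{..x}" lborel std_normal_density] by simp
    show ?thesis unfolding normal_cdf_def
      by (subst Bochner_Integration.integral_diff[symmetric, OF ii ii])
        (auto intro!: Bochner_Integration.integral_cong simp: indicator_def)
  qed
  have "(\<lambda>n. \<integral>t. indicator {- real n<..real n} t * std_normal_density t \<partial>lborel)
     \<longlonglongrightarrow> (\<integral>t. std_normal_density t \<partial>lborel)"
  proof (rule integral_dominated_convergence[where w=std_normal_density])
    show "AE x in lborel. (\<lambda>n. indicator {- real n<..real n} x * std_normal_density x) \<longlonglongrightarrow> std_normal_density x"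
    proof (rule AE_I2)
      fix x :: real
      obtain k :: nat where k: "\<bar>x\<bar> < k" using reals_Archimedean2 by blast
      have "eventually (\<lambda>n. indicator {- real n<..real n} x * std_normal_density x = std_normal_density x) sequentially"
        using eventually_ge_at_top[of k] by eventually_elim (use k in \<open>auto simp: indicator_def\<close>)
      then show "(\<lambda>n. indicator {- real n<..real n} x * std_normal_density x) \<longlonglongrightarrow> std_normal_density x"
        by (rule tendsto_eventually)
    qed
    show "AE x in lborel. norm (indicator {- real n<..real n} x * std_normal_density x) \<le> std_normal_density x" for n
      by (auto simp: indicator_def)
  qed auto
  then show ?thesis unfolding eq by simp
qed

lemma normal_cdf_inverse_deriv:
  "(inv normal_cdf has_real_derivative 1 / std_normal_density x) (at (normal_cdf x))"
proof -
  have inj: "inj normal_cdf" using normal_cdf_strict_mono by (rule strict_mono_imp_inj_on)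
  have inv: "inv normal_cdf (normal_cdf z) = z" for z using inj by simp
  have "(inv normal_cdf has_real_derivative inverse (std_normal_density x)) (at (normal_cdf x))"
  proof (rule DERIV_inverse_function[where f=normal_cdf and a="normal_cdf (x-1)" and b="normal_cdf (x+1)"])
    show "(normal_cdf has_real_derivative std_normal_density x) (at (inv normal_cdf (normal_cdf x)))"
      by (simp add: inv normal_cdf_deriv)
    show "std_normal_density x \<noteq> 0" using std_normal_density_positive[of x] by simp
    show "normal_cdf (inv normal_cdf y) = y" if "normal_cdf (x-1) < y" "y < normal_cdf (x+1)" for y
    proof -
      have "\<exists>z\<ge>x-1. z \<le> x+1 \<and> normal_cdf z = y"
        by (rule IVT) (use that in \<open>auto intro: normal_cdf_isCont\<close>)
      then show ?thesis using inv by metis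
    qed
    show "isCont (inv normal_cdf) (normal_cdf x)"
      by (rule isCont_inverse_function[where d=1]) (auto simp: inv normal_cdf_isCont)
  qed auto
  then show ?thesis by (simp add: inverse_eq_divide)
qed

lemma std_normal_density_tendsto_0:
  "(std_normal_density \<longlongrightarrow> 0) at_top" "(std_normal_density \<longlongrightarrow> 0) at_bot"
  "((\<lambda>x. x * std_normal_density x) \<longlongrightarrow> 0) at_top" "((\<lambda>x. x * std_normal_density x) \<longlongrightarrow> 0) at_bot"
  unfolding std_normal_density_def by (real_asymp, real_asymp, real_asymp, real_asymp)

section \<open>The one-dimensional Gaussian logarithmic Sobolev inequality\<close>

text \<open>
  Let \<open>T\<close> be the increasing map that sends \<open>F \<gamma> / m\<close> to \<open>\<gamma>\<close> conditioned on \<open>[-R, R]\<close>. The logarithm of the Jacobian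
  equation \<open>T' = Z F(x) \<gamma>(x) / (m \<gamma>(T x))\<close> expresses \<open>ln F\<close> through \<open>x\<^sup>2 - T(x)\<^sup>2\<close> and \<open>ln T' \<le> T' - 1\<close>.
  What remains is the derivative of \<open>F \<gamma> (T - x)\<close>, whose integral vanishes, plus a
  quadratic expression in \<open>T - x\<close> that is at most \<open>F'\<^sup>2 / (2 F)\<close>. Transport to a bounded interval keeps \<open>T\<close>
  and \<open>T'\<close> bounded, which makes every integral here converge; the price is the term \<open>m * ln Z\<close>.
\<close>

lemma gauss_logsob_1d_truncated:
  fixes F F' :: "real \<Rightarrow> real"
  assumes D: "\<And>x. (F has_real_derivative F' x) (at x)"
    and c: "continuous_on UNIV F'"
    and d: "0 < \<delta>" "\<And>x. \<delta> \<le> F x" and B: "\<And>x. F x \<le> B" "\<And>x. \<bar>F' x\<bar> \<le> B"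
    and R: "0 < R"
  defines "m \<equiv> \<integral>x. std_normal_density x * F x \<partial>lborel"
    and "Z \<equiv> normal_cdf R - normal_cdf (-R)"
  shows "(\<integral>x. std_normal_density x * (F x * ln (F x)) \<partial>lborel) + m * ln Z
     \<le> m * ln m + (\<integral>x. std_normal_density x * ((F' x)\<^sup>2 / F x) \<partial>lborel) / 2"
proof -
  let ?g = std_normal_density
  have gp: "0 < ?g x" for x by (rule std_normal_density_positive)
  have Fp: "0 < F x" for x using d less_le_trans by blast
  have B0: "0 \<le> B" using B(2)[of 0] abs_ge_zero[of "F' 0"] by linarith
  have cF: "continuous_on UNIV F" using D by (auto intro!: DERIV_continuous_on)
  have mF[measurable]: "F \<in> borel_measurable borel" using cF by (rule borel_measurable_continuous_onI)
  have mF'[measurable]: "F' \<in> borel_measurable borel" using c by (rule borel_measurable_continuous_onI)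
  define f where "f x = ?g x * F x" for x
  have ib: "integrable lborel (\<lambda>x. ?g x * h x)" if [measurable]: "h \<in> borel_measurable borel"
      and "\<And>x. \<bar>h x\<bar> \<le> K" for h :: "real \<Rightarrow> real" and K
  proof (rule Bochner_Integration.integrable_bound[where f="\<lambda>x. K * ?g x"])
    show "AE x in lborel. norm (?g x * h x) \<le> norm (K * ?g x)"
      using that(2) gp by (intro AE_I2) (metis abs_ge_self abs_mult abs_of_pos mult.commute mult_right_mono order_trans real_norm_def less_imp_le)
  qed auto
  have ibx: "integrable lborel (\<lambda>x. ?g x * (x^k * h x))" if [measurable]: "h \<in> borel_measurable borel"
      and "\<And>x. \<bar>h x\<bar> \<le> K" for h :: "real \<Rightarrow> real" and K k
  proof (rule Bochner_Integration.integrable_bound[where f="\<lambda>x. K * (?g x * \<bar>x\<bar>^k)"])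
    show "integrable lborel (\<lambda>x. K * (?g x * \<bar>x\<bar>^k))"
      using integrable_std_normal_moment_abs[of k] by simp
    show "AE x in lborel. norm (?g x * (x^k * h x)) \<le> norm (K * (?g x * \<bar>x\<bar>^k))"
    proof (rule AE_I2)
      fix x
      have "\<bar>h x\<bar> \<le> \<bar>K\<bar>" using that(2)[of x] by linarith
      then have "\<bar>h x\<bar> * (?g x * \<bar>x\<bar>^k) \<le> \<bar>K\<bar> * (?g x * \<bar>x\<bar>^k)"
        by (intro mult_right_mono) auto
      then show "norm (?g x * (x^k * h x)) \<le> norm (K * (?g x * \<bar>x\<bar>^k))"
        by (simp add: abs_mult power_abs mult_ac)
    qed
  qed auto
  have FB: "\<bar>F x\<bar> \<le> B" for x using B(1)[of x] Fp[of x] by simp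
  have fi0: "integrable lborel (\<lambda>x. ?g x * F x)" by (rule ib[OF _ FB]) simp
  then have fi: "integrable lborel f" by (simp add: f_def[abs_def])
  have fc: "continuous_on UNIV f" unfolding f_def[abs_def] by (intro continuous_intros continuous_std_normal_density cF)
  have fp: "0 < f x" for x using gp Fp by (simp add: f_def)
  have mp: "0 < m"
  proof -
    have "\<delta> * (\<integral>x. ?g x \<partial>lborel) = (\<integral>x. ?g x * \<delta> \<partial>lborel)" by simp
    also have "\<dots> \<le> m" unfolding m_def
      by (rule integral_mono) (use d gp fi0 in \<open>auto intro: mult_left_mono\<close>)
    finally show ?thesis using d by simp
  qed
  have Zp: "0 < Z" using R by (simp add: Z_def)
  define A where "A x = (\<integral>t. indicator {..x} t * f t \<partial>lborel)" for x
  have Ad: "(A has_real_derivative f x) (at x)" for x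
    unfolding A_def[abs_def] by (rule cdf_has_derivative[OF fc fi])
  have Ab: "0 \<le> A x" "A x \<le> m" for x
  proof -
    have ii: "integrable lborel (\<lambda>t. indicator {..x} t * f t)"
      using integrable_mult_indicator[OF _ fi, of "{..x}"] by simp
    show "0 \<le> A x" unfolding A_def using fp less_imp_le by (intro integral_nonneg_AE AE_I2) (auto simp: indicator_def)
    show "A x \<le> m" unfolding A_def m_def f_def[symmetric] using fp less_imp_le
      by (intro integral_mono ii fi) (auto simp: indicator_def)
  qed
  define P where "P x = normal_cdf (-R) + Z * A x / m" for x
  define T where "T x = inv normal_cdf (P x)" for x
  have inj: "inj normal_cdf" using normal_cdf_strict_mono by (rule strict_mono_imp_inj_on)
  have ex: "\<exists>y. -R \<le> y \<and> y \<le> R \<and> normal_cdf y = P x" for x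
  proof -
    have "Z * A x / m \<le> Z" using Ab[of x] mp Zp by (simp add: field_simps)
    moreover have "0 \<le> Z * A x / m" using Ab[of x] mp Zp by simp
    ultimately show ?thesis using R
      by (intro IVT) (auto simp: P_def Z_def intro: normal_cdf_isCont)
  qed
  have TP: "normal_cdf (T x) = P x" and TR: "-R \<le> T x" "T x \<le> R" for x
  proof -
    obtain y where y: "-R \<le> y" "y \<le> R" "normal_cdf y = P x" using ex by blast
    have "T x = y" unfolding T_def using y(3) inj by (metis inv_f_f)
    then show "normal_cdf (T x) = P x" "-R \<le> T x" "T x \<le> R" using y by auto
  qed
  define T' where "T' x = Z * f x / (m * ?g (T x))" for x
  have Pd: "(P has_real_derivative Z * f x / m) (at x)" for x
    unfolding P_def[abs_def] using mp by (auto intro!: derivative_eq_intros Ad)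
  have Td: "(T has_real_derivative T' x) (at x)" for x
  proof -
    have "((\<lambda>x. inv normal_cdf (P x)) has_real_derivative 1 / ?g (T x) * (Z * f x / m)) (at x)"
      by (rule DERIV_chain2[OF _ Pd]) (use normal_cdf_inverse_deriv[of "T x"] TP in simp)
    then show ?thesis unfolding T_def[abs_def] T'_def by (simp add: T_def mult_ac)
  qed
  have Tc: "continuous_on UNIV T" using Td by (auto intro!: DERIV_continuous_on)
  have T'c: "continuous_on UNIV T'" unfolding T'_def[abs_def]
    using mp gp by (intro continuous_intros fc continuous_on_compose2[OF continuous_std_normal_density Tc])
      (auto simp: less_imp_neq[symmetric])
  have T'p: "0 < T' x" for x unfolding T'_def using mp Zp gp fp by simp
  have [measurable]: "T \<in> borel_measurable borel" "T' \<in> borel_measurable borel"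
    using Tc T'c by (auto intro: borel_measurable_continuous_onI)
  have gT: "?g R \<le> ?g (T x)" for x
  proof -
    have "\<bar>T x\<bar> \<le> \<bar>R\<bar>" using TR[of x] by linarith
    then have "(T x)\<^sup>2 \<le> R\<^sup>2" using abs_le_square_iff by blast
    then show ?thesis unfolding std_normal_density_def by (intro mult_left_mono) auto
  qed
  have g1: "?g x \<le> 1" for x
  proof -
    have "1 \<le> sqrt (2*pi)" using pi_gt3 by simp
    moreover have "exp (- x\<^sup>2 / 2) \<le> 1" by simp
    ultimately show ?thesis unfolding std_normal_density_def
      by (metis divide_le_eq_1 exp_ge_zero less_le_trans mult_le_one zero_less_one mult.commute
          le_divide_eq_1 zero_le_divide_1_iff order_trans zero_le_one)
  qed
  have T'B: "\<bar>T' x\<bar> \<le> Z * B / (m * ?g R)" for x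
  proof -
    have "f x \<le> B" unfolding f_def using g1[of x] B(1)[of x] Fp[of x] gp[of x]
      by (metis mult_left_le_one_le less_imp_le order_trans)
    then have "T' x \<le> Z * B / (m * ?g R)"
      unfolding T'_def using mp Zp gp[of R] gp[of "T x"] fp[of x] gT[of x] B0
      by (intro frac_le mult_left_mono mult_pos_pos mult_nonneg_nonneg) auto
    then show ?thesis using T'p[of x] by simp
  qed
  define W where "W x = f x * (T x - x)" for x
  define f' where "f' x = ?g x * (F' x - x * F x)" for x
  have gd: "(?g has_real_derivative - x * ?g x) (at x)" for x
  proof -
    have "((\<lambda>x. exp (- x\<^sup>2 / 2)) has_real_derivative (- x * exp (- x\<^sup>2 / 2))) (at x)"
      by (auto intro!: derivative_eq_intros)
    from DERIV_cmult[OF this, of "1 / sqrt (2*pi)"] show ?thesis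
      by (simp only: std_normal_density_def[abs_def] mult_ac)
  qed
  have fd: "(f has_real_derivative f' x) (at x)" for x
    unfolding f_def[abs_def] f'_def
    by (rule derivative_eq_intros gd D refl)+ (simp add: algebra_simps)
  define W' where "W' x = f' x * (T x - x) + f x * (T' x - 1)" for x
  have Wd: "(W has_real_derivative W' x) (at x)" for x
    unfolding W_def[abs_def] W'_def by (rule derivative_eq_intros fd Td refl)+ simp
  have FT: "\<bar>F x * T x\<bar> \<le> B * R" for x
    unfolding abs_mult using FB[of x] TR[of x] B0 by (intro mult_mono) auto
  have W'_eq: "W' = (\<lambda>x. ?g x * (F' x * T x) - ?g x * (x^1 * F' x) - ?g x * (x^1 * (F x * T x))
      + ?g x * (x^2 * F x) + ?g x * (F x * T' x) - ?g x * F x)"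
    by (rule ext) (simp add: W'_def f'_def f_def algebra_simps power2_eq_square)
  have TA: "\<bar>T x\<bar> \<le> R" for x using TR[of x] by linarith
  have W'i: "integrable lborel W'"
    unfolding W'_eq
  proof (intro Bochner_Integration.integrable_add Bochner_Integration.integrable_diff)
    show "integrable lborel (\<lambda>x. ?g x * (F' x * T x))"
      by (rule ib[where K="B * R"]) (use B(2) TA B0 in \<open>auto simp: abs_mult intro!: mult_mono\<close>)
    show "integrable lborel (\<lambda>x. ?g x * (x^1 * F' x))" by (rule ibx[OF _ B(2)]) simp
    show "integrable lborel (\<lambda>x. ?g x * (x^1 * (F x * T x)))" by (rule ibx[OF _ FT]) simp
    show "integrable lborel (\<lambda>x. ?g x * (x^2 * F x))" by (rule ibx[OF _ FB]) simp
    show "integrable lborel (\<lambda>x. ?g x * (F x * T' x))"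
      by (rule ib[where K="B * (Z * B / (m * ?g R))"])
        (simp, unfold abs_mult, intro mult_mono FB T'B B0 abs_ge_zero)
    show "integrable lborel (\<lambda>x. ?g x * F x)" by (rule ib[OF _ FB]) simp
  qed
  have W'c: "continuous_on UNIV W'"
    unfolding W'_eq by (intro continuous_intros continuous_std_normal_density c cF Tc T'c)
  have lim: "(W \<longlongrightarrow> 0) G" if g0: "(?g \<longlongrightarrow> 0) G" and g1: "((\<lambda>x. x * ?g x) \<longlongrightarrow> 0) G" for G
  proof (rule Lim_null_comparison)
    show "\<forall>\<^sub>F x in G. norm (W x) \<le> (B*R) * \<bar>?g x\<bar> + B * \<bar>x * ?g x\<bar>"
    proof (rule always_eventually, rule allI)
      fix x
      have "\<bar>W x\<bar> = \<bar>?g x * (F x * T x) - F x * (x * ?g x)\<bar>" by (simp add: W_def f_def algebra_simps)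
      also have "\<dots> \<le> \<bar>?g x * (F x * T x)\<bar> + \<bar>F x * (x * ?g x)\<bar>" by (rule abs_triangle_ineq4)
      also have "\<dots> \<le> (B*R) * \<bar>?g x\<bar> + B * \<bar>x * ?g x\<bar>"
      proof (rule add_mono)
        show "\<bar>?g x * (F x * T x)\<bar> \<le> (B*R) * \<bar>?g x\<bar>"
          unfolding abs_mult[of "?g x"] mult.commute[of "\<bar>?g x\<bar>"] by (rule mult_right_mono[OF FT]) simp
        show "\<bar>F x * (x * ?g x)\<bar> \<le> B * \<bar>x * ?g x\<bar>"
          unfolding abs_mult[of "F x"] by (rule mult_right_mono[OF FB]) simp
      qed
      finally show "norm (W x) \<le> (B*R) * \<bar>?g x\<bar> + B * \<bar>x * ?g x\<bar>" by simp
    qed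
    show "((\<lambda>x. (B*R) * \<bar>?g x\<bar> + B * \<bar>x * ?g x\<bar>) \<longlongrightarrow> 0) G"
      using tendsto_add[OF tendsto_mult_right_zero[OF tendsto_rabs_zero[OF g0], of "B*R"]
          tendsto_mult_right_zero[OF tendsto_rabs_zero[OF g1], of B]] by simp
  qed
  have W0: "(\<integral>x. W' x \<partial>lborel) = 0"
    by (rule integral_derivative_vanishing[OF Wd W'c W'i lim lim])
      (rule std_normal_density_tendsto_0)+
  \<comment> \<open>Jacobian equation, then \<open>ln T' \<le> T' - 1\<close>, then completion of the square in \<open>T x - x\<close>\<close>
  have pt: "?g x * (F x * ln (F x)) + ?g x * F x * ln Z - ?g x * F x * ln m
     \<le> W' x + ?g x * ((F' x)\<^sup>2 / F x) / 2" for x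
  proof -
    have g_eq: "ln (?g y) = - ln (sqrt (2*pi)) - y\<^sup>2/2" for y
      unfolding std_normal_density_def by (subst ln_mult) (auto simp: ln_div)
    have "T' x * (m * ?g (T x)) = Z * (?g x * F x)"
      using mp gp[of "T x"] by (simp add: T'_def f_def)
    then have "ln (T' x * (m * ?g (T x))) = ln (Z * (?g x * F x))" by simp
    then have "ln (F x) + ln Z - ln m = (x\<^sup>2 - (T x)\<^sup>2) / 2 + ln (T' x)"
      using T'p[of x] mp Zp gp[of x] gp[of "T x"] Fp[of x]
      by (simp add: ln_mult ln_mult_pos g_eq field_simps)
    also have "\<dots> \<le> (x\<^sup>2 - (T x)\<^sup>2) / 2 + (T' x - 1)"
      using ln_le_minus_one[OF T'p[of x]] by simp
    finally have "F x * (ln (F x) + ln Z - ln m) \<le> F x * ((x\<^sup>2 - (T x)\<^sup>2) / 2 + (T' x - 1))"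
      using Fp[of x] by (intro mult_left_mono) auto
    also have "\<dots> = (F x * (T' x - 1) + (F' x - x * F x) * (T x - x)) - (F' x * (T x - x) + F x * (T x - x)\<^sup>2 / 2)"
      by (simp add: field_simps power2_eq_square)
    also have "\<dots> \<le> (F x * (T' x - 1) + (F' x - x * F x) * (T x - x)) + (F' x)\<^sup>2 / F x / 2"
    proof -
      have "0 \<le> (F' x + F x * (T x - x))\<^sup>2 / F x" using Fp[of x] by simp
      also have "\<dots> = (F' x)\<^sup>2 / F x + 2 * (F' x * (T x - x)) + F x * (T x - x)\<^sup>2"
        using Fp[of x] by (simp add: field_simps power2_eq_square)
      finally show ?thesis by simp
    qed
    finally have "?g x * (F x * (ln (F x) + ln Z - ln m))
      \<le> ?g x * ((F x * (T' x - 1) + (F' x - x * F x) * (T x - x)) + (F' x)\<^sup>2 / F x / 2)"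
      using gp[of x] by (intro mult_left_mono) auto
    then show ?thesis by (simp add: W'_def f'_def f_def algebra_simps)
  qed
  have lnB: "\<bar>F x * ln (F x)\<bar> \<le> B * (\<bar>ln \<delta>\<bar> + \<bar>ln B\<bar>)" for x
  proof -
    have "ln \<delta> \<le> ln (F x)" "ln (F x) \<le> ln B" using d(1) d(2)[of x] Fp[of x] B(1)[of x] by auto
    then have "\<bar>ln (F x)\<bar> \<le> \<bar>ln \<delta>\<bar> + \<bar>ln B\<bar>" by linarith
    then show ?thesis unfolding abs_mult using FB[of x] B0 by (intro mult_mono) auto
  qed
  have i1: "integrable lborel (\<lambda>x. ?g x * (F x * ln (F x)))" by (rule ib[OF _ lnB]) simp
  have i2: "integrable lborel (\<lambda>x. ?g x * ((F' x)\<^sup>2 / F x))"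
  proof (rule ib[where K="B\<^sup>2/\<delta>"])
    show "\<bar>(F' x)\<^sup>2 / F x\<bar> \<le> B\<^sup>2 / \<delta>" for x
    proof -
      have "(F' x)\<^sup>2 \<le> B\<^sup>2" using B(2)[of x] B0 abs_le_square_iff[of "F' x" B] by simp
      then show ?thesis using d(1) d(2)[of x] Fp[of x] by (simp add: frac_le)
    qed
  qed simp
  have i2h: "integrable lborel (\<lambda>x. ?g x * ((F' x)\<^sup>2 / F x) / 2)"
    by (rule integrable_divide_zero) (rule i2)
  have "(\<integral>x. ?g x * (F x * ln (F x)) + ?g x * F x * ln Z - ?g x * F x * ln m \<partial>lborel)
     \<le> (\<integral>x. W' x + ?g x * ((F' x)\<^sup>2 / F x) / 2 \<partial>lborel)"
    by (rule integral_mono[OF _ _ pt])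
      (intro Bochner_Integration.integrable_add Bochner_Integration.integrable_diff i1 W'i i2h
        integrable_mult_left fi0)+
  also have "\<dots> = 0 + (\<integral>x. ?g x * ((F' x)\<^sup>2 / F x) / 2 \<partial>lborel)"
    by (subst Bochner_Integration.integral_add[OF W'i i2h]) (simp only: W0)
  also have "\<dots> = (\<integral>x. ?g x * ((F' x)\<^sup>2 / F x) \<partial>lborel) / 2"
    by (simp only: integral_divide_zero add_0_left)
  also have "(\<integral>x. ?g x * (F x * ln (F x)) + ?g x * F x * ln Z - ?g x * F x * ln m \<partial>lborel)
    = (\<integral>x. ?g x * (F x * ln (F x)) \<partial>lborel) + m * ln Z - m * ln m"
    using i1 fi0 by (simp add: m_def)
  finally show ?thesis by simp
qed

text \<open>
  The truncation error \<open>m * ln Z\<close> vanishes as the interval exhausts the line.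
\<close>

lemma gauss_logsob_1d:
  fixes F F' :: "real \<Rightarrow> real"
  assumes D: "\<And>x. (F has_real_derivative F' x) (at x)"
    and c: "continuous_on UNIV F'"
    and d: "0 < \<delta>" "\<And>x. \<delta> \<le> F x" and B: "\<And>x. F x \<le> B" "\<And>x. \<bar>F' x\<bar> \<le> B"
  defines "m \<equiv> \<integral>x. std_normal_density x * F x \<partial>lborel"
  shows "(\<integral>x. std_normal_density x * (F x * ln (F x)) \<partial>lborel)
     \<le> m * ln m + (\<integral>x. std_normal_density x * ((F' x)\<^sup>2 / F x) \<partial>lborel) / 2"
proof (rule LIMSEQ_le_const2)
  show "(\<lambda>n. (\<integral>x. std_normal_density x * (F x * ln (F x)) \<partial>lborel)
     + m * ln (normal_cdf (real n) - normal_cdf (- real n)))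
     \<longlonglongrightarrow> (\<integral>x. std_normal_density x * (F x * ln (F x)) \<partial>lborel)"
    using tendsto_add[OF tendsto_const tendsto_mult[OF tendsto_const tendsto_ln[OF normal_cdf_mass_tendsto]],
      of "(\<integral>x. std_normal_density x * (F x * ln (F x)) \<partial>lborel)" m] by simp
  show "\<exists>N. \<forall>n\<ge>N. (\<integral>x. std_normal_density x * (F x * ln (F x)) \<partial>lborel)
     + m * ln (normal_cdf (real n) - normal_cdf (- real n)) \<le>
     m * ln m + (\<integral>x. std_normal_density x * ((F' x)\<^sup>2 / F x) \<partial>lborel) / 2"
    unfolding m_def
    by (intro exI[of _ 1] allI impI gauss_logsob_1d_truncated[OF D c d B]) auto
qed

section \<open>Tensorisation\<close>

definition std_gauss :: "real measure" where
  "std_gauss = density lborel (\<lambda>x. ennreal (std_normal_density x))"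

lemma sets_std_gauss [simp, measurable_cong]: "sets std_gauss = sets borel"
  by (simp add: std_gauss_def)

lemma space_std_gauss [simp]: "space std_gauss = UNIV"
  by (simp add: std_gauss_def)

interpretation std_gauss: prob_space std_gauss
  unfolding std_gauss_def by (rule prob_space_normal_density) simp

lemma integral_std_gauss:
  assumes "f \<in> borel_measurable borel"
  shows "(\<integral>x. f x \<partial>std_gauss) = (\<integral>x. std_normal_density x * f x \<partial>lborel)"
  unfolding std_gauss_def by (subst integral_density) (use assms in auto)

lemma std_gauss_logsob:
  fixes F F' :: "real \<Rightarrow> real"
  assumes D: "\<And>x. (F has_real_derivative F' x) (at x)"
    and c: "continuous_on UNIV F'"
    and d: "0 < \<delta>" "\<And>x. \<delta> \<le> F x" and B: "\<And>x. F x \<le> B" "\<And>x. \<bar>F' x\<bar> \<le> B"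
  shows "(\<integral>x. F x * ln (F x) \<partial>std_gauss)
     \<le> (\<integral>x. F x \<partial>std_gauss) * ln (\<integral>x. F x \<partial>std_gauss) + (\<integral>x. (F' x)\<^sup>2 / F x \<partial>std_gauss) / 2"
proof -
  have cF: "continuous_on UNIV F" using D by (auto intro!: DERIV_continuous_on)
  have mF[measurable]: "F \<in> borel_measurable borel" using cF by (rule borel_measurable_continuous_onI)
  have mF'[measurable]: "F' \<in> borel_measurable borel" using c by (rule borel_measurable_continuous_onI)
  show ?thesis using gauss_logsob_1d[OF D c d B] by (simp add: integral_std_gauss)
qed

text \<open>
  Nonnegativity of the relative entropy of \<open>F / m\<close> with respect to \<open>G / n\<close>. In the tensorisation \<open>G\<close> is the
  partial average of \<open>F\<close>, and this inequality takes the place of convexity of the entropy.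
\<close>

lemma (in prob_space) gibbs_inequality:
  fixes F G :: "'a \<Rightarrow> real"
  assumes [measurable]: "F \<in> borel_measurable M" "G \<in> borel_measurable M"
    and d: "0 < \<delta>" "\<And>x. x \<in> space M \<Longrightarrow> \<delta> \<le> F x" "\<And>x. x \<in> space M \<Longrightarrow> \<delta> \<le> G x"
    and B: "\<And>x. x \<in> space M \<Longrightarrow> F x \<le> B" "\<And>x. x \<in> space M \<Longrightarrow> G x \<le> B"
  defines "m \<equiv> \<integral>x. F x \<partial>M" and "n \<equiv> \<integral>x. G x \<partial>M"
  shows "(\<integral>x. F x * ln (G x) \<partial>M) \<le> (\<integral>x. F x * ln (F x) \<partial>M) - m * ln m + m * ln n"
proof -
  have lnb: "\<bar>ln H\<bar> \<le> \<bar>ln \<delta>\<bar> + \<bar>ln B\<bar>" if "\<delta> \<le> H" "H \<le> B" for H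
  proof -
    have "ln \<delta> \<le> ln H" "ln H \<le> ln B" using d(1) that by auto
    then show ?thesis by linarith
  qed
  have i1: "integrable M F" "integrable M G"
    using d B by (auto intro!: integrable_const_bound[where B=B] AE_I2 simp: abs_le_iff intro: order_trans less_imp_le)
      (smt (verit) d B)+
  have il: "integrable M (\<lambda>x. F x * ln (H x))" if [measurable]: "H \<in> borel_measurable M"
      and "\<And>x. x \<in> space M \<Longrightarrow> \<delta> \<le> H x" "\<And>x. x \<in> space M \<Longrightarrow> H x \<le> B" for H
  proof (rule integrable_const_bound[where B="B * (\<bar>ln \<delta>\<bar> + \<bar>ln B\<bar>)"])
    show "AE x in M. norm (F x * ln (H x)) \<le> B * (\<bar>ln \<delta>\<bar> + \<bar>ln B\<bar>)"
    proof (rule AE_I2)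
      fix x assume x: "x \<in> space M"
      have "\<bar>F x\<bar> \<le> B" using d(1) d(2)[OF x] B(1)[OF x] by simp
      then show "norm (F x * ln (H x)) \<le> B * (\<bar>ln \<delta>\<bar> + \<bar>ln B\<bar>)"
        unfolding real_norm_def abs_mult using lnb[OF that(2,3)[OF x]] by (intro mult_mono) auto
    qed
  qed measurable
  have pos: "\<delta> \<le> m" "\<delta> \<le> n"
    unfolding m_def n_def using i1 d by (auto intro!: integral_ge_const AE_I2)
  then have mp: "0 < m" "0 < n" using d(1) by auto
  have pt: "F x * ln (G x) - F x * ln (F x) + F x * ln m - F x * ln n \<le> G x * (m / n) - F x"
    if x: "x \<in> space M" for x
  proof -
    have p: "0 < F x" "0 < G x" using d(1) d(2,3)[OF x] by auto
    have "ln (G x * m / (F x * n)) \<le> G x * m / (F x * n) - 1"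
      by (rule ln_le_minus_one) (use p mp in auto)
    moreover have "ln (G x * m / (F x * n)) = ln (G x) + ln m - ln (F x) - ln n"
      using p mp by (simp add: ln_mult ln_div)
    ultimately have "F x * (ln (G x) + ln m - ln (F x) - ln n) \<le> F x * (G x * m / (F x * n) - 1)"
      using p by (intro mult_left_mono) auto
    also have "F x * (G x * m / (F x * n) - 1) = G x * (m / n) - F x"
      using p mp by (simp add: field_simps)
    finally show ?thesis by (simp add: algebra_simps)
  qed
  have ig: "integrable M (\<lambda>x. F x * ln (G x))" by (rule il) (use d B in auto)
  have if': "integrable M (\<lambda>x. F x * ln (F x))" by (rule il) (use d B in auto)
  have "(\<integral>x. F x * ln (G x) - F x * ln (F x) + F x * ln m - F x * ln n \<partial>M) \<le> (\<integral>x. G x * (m / n) - F x \<partial>M)"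
    by (rule integral_mono[OF _ _ pt]) (use ig if' i1 in auto)
  also have "\<dots> = n * (m / n) - m" using i1 by (subst Bochner_Integration.integral_diff) (auto simp: m_def n_def)
  also have "\<dots> = 0" using mp by simp
  also have "(\<integral>x. F x * ln (G x) - F x * ln (F x) + F x * ln m - F x * ln n \<partial>M)
     = (\<integral>x. F x * ln (G x) \<partial>M) - (\<integral>x. F x * ln (F x) \<partial>M) + m * ln m - m * ln n"
    using ig if' i1 by (simp add: m_def)
  finally show ?thesis by simp
qed

abbreviation gauss_PiM :: "'i set \<Rightarrow> ('i \<Rightarrow> real) measure" where
  "gauss_PiM I \<equiv> PiM I (\<lambda>_. std_gauss)"

text \<open>
  Bounds that are uniform in all variables make the class stable under fixing one coordinate, which the
  induction over the index set needs. The derivatives \<open>d i\<close> are carried along because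
  they are evaluated inside integrals.
\<close>

definition logsob_class :: "'i set \<Rightarrow> real \<Rightarrow> real \<Rightarrow> (('i \<Rightarrow> real) \<Rightarrow> real) \<Rightarrow> ('i \<Rightarrow> ('i \<Rightarrow> real) \<Rightarrow> real) \<Rightarrow> bool" where
  "logsob_class I \<delta> B F d \<longleftrightarrow>
     F \<in> borel_measurable (gauss_PiM I) \<and> (\<forall>i\<in>I. d i \<in> borel_measurable (gauss_PiM I)) \<and>
     (\<forall>x\<in>PiE I (\<lambda>_. UNIV). \<delta> \<le> F x \<and> F x \<le> B \<and>
        (\<forall>i\<in>I. \<bar>d i x\<bar> \<le> B \<and> continuous_on UNIV (\<lambda>t. d i (x(i := t))) \<and>
          (\<forall>t. ((\<lambda>t. F (x(i := t))) has_real_derivative d i (x(i := t))) (at t))))"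

lemma space_gauss_PiM: "space (gauss_PiM I) = PiE I (\<lambda>_. UNIV)"
  by (simp add: space_PiM)

lemma logsob_class_slice:
  assumes "logsob_class (insert i I) \<delta> B F d" "i \<notin> I"
  shows "logsob_class I \<delta> B (\<lambda>x. F (x(i := y))) (\<lambda>j x. d j (x(i := y)))"
proof -
  have m: "(\<lambda>x. x(i := y)) \<in> measurable (gauss_PiM I) (gauss_PiM (insert i I))"
    by (rule measurable_fun_upd[where J=I]) auto
  have e: "x(i := y) \<in> PiE (insert i I) (\<lambda>_. UNIV)" if "x \<in> PiE I (\<lambda>_. UNIV)" for x
    using that by (auto simp: PiE_def extensional_def)
  have tw: "x(j := t, i := y) = x(i := y, j := t)" if "j \<in> I" for x :: "'a \<Rightarrow> real" and j t
    using that assms(2) by (auto simp: fun_upd_twist)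
  show ?thesis
    using assms(1) measurable_compose[OF m] e unfolding logsob_class_def
    by (auto simp: tw cong: continuous_on_cong)
qed

text \<open>
  Averaging out one coordinate \<open>y\<close>, the one-dimensional inequality bounds the entropy of each slice
  \<open>F(x, .)\<close> and leaves \<open>\<integral> Fb * ln Fb\<close> for the average \<open>Fb\<close>. Instead of
  differentiating \<open>Fb\<close>, write this as \<open>\<integral> F(., y) * ln Fb\<close> averaged over \<open>y\<close> and bound it with
  \<open>gibbs_inequality\<close> and the induction hypothesis for the slices \<open>F(., y)\<close>.
\<close>

lemma gauss_logsob_PiM:
  assumes "finite I" "logsob_class I \<delta> B F d" "0 < \<delta>"
  shows "(\<integral>x. F x * ln (F x) \<partial>gauss_PiM I) \<le>
     (\<integral>x. F x \<partial>gauss_PiM I) * ln (\<integral>x. F x \<partial>gauss_PiM I)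
      + (\<Sum>i\<in>I. \<integral>x. (d i x)\<^sup>2 / F x \<partial>gauss_PiM I) / 2"
  using assms
proof (induction I arbitrary: F d rule: finite_induct)
  case empty
  then show ?case by (simp add: PiM_empty lebesgue_integral_count_space_finite)
next
  case (insert i I)
  note cls = \<open>logsob_class (insert i I) \<delta> B F d\<close>
  interpret L: prob_space "gauss_PiM I" by (intro prob_space_PiM std_gauss.prob_space_axioms)
  interpret E: prob_space "gauss_PiM (insert i I)" by (intro prob_space_PiM std_gauss.prob_space_axioms)
  interpret S: product_sigma_finite "\<lambda>_. std_gauss" by standard
  interpret P: pair_prob_space "gauss_PiM I" std_gauss ..
  define K where "K x y = F (x(i := y))" for x y
  define k where "k j x y = d j (x(i := y))" for j x y
  have e: "x(i := y) \<in> PiE (insert i I) (\<lambda>_. UNIV)" if "x \<in> PiE I (\<lambda>_. UNIV)" for x and y :: real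
    using that by (auto simp: PiE_def extensional_def)
  have md: "(\<lambda>(x, y). x(i := y)) \<in> measurable (gauss_PiM I \<Otimes>\<^sub>M std_gauss) (gauss_PiM (insert i I))"
    by (rule measurable_add_dim)
  have mF[measurable]: "F \<in> borel_measurable (gauss_PiM (insert i I))" using cls by (simp add: logsob_class_def)
  have mdj: "d j \<in> borel_measurable (gauss_PiM (insert i I))" if "j \<in> insert i I" for j
    using cls that by (auto simp: logsob_class_def)
  have uc: "(\<lambda>z. H (case z of (x, y) \<Rightarrow> x(i := y))) = (\<lambda>(x, y). H (x(i := y)))" for H :: "('a \<Rightarrow> real) \<Rightarrow> real"
    by auto
  have mK[measurable]: "(\<lambda>(x, y). K x y) \<in> borel_measurable (gauss_PiM I \<Otimes>\<^sub>M std_gauss)"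
    using measurable_compose[OF md mF] unfolding uc K_def .
  have mk: "(\<lambda>(x, y). k j x y) \<in> borel_measurable (gauss_PiM I \<Otimes>\<^sub>M std_gauss)" if "j \<in> insert i I" for j
    using measurable_compose[OF md mdj[OF that]] unfolding uc k_def .
  have Kd: "\<delta> \<le> K x y" "K x y \<le> B" "j \<in> insert i I \<Longrightarrow> \<bar>k j x y\<bar> \<le> B" if "x \<in> PiE I (\<lambda>_. UNIV)" for x y j
    using cls e[OF that, of y] by (auto simp: logsob_class_def K_def k_def)
  have Kp: "0 < K x y" if "x \<in> PiE I (\<lambda>_. UNIV)" for x y using Kd(1)[OF that] \<open>0 < \<delta>\<close> less_le_trans by blast
  obtain x0 :: "'a \<Rightarrow> real" where x0: "x0 \<in> PiE I (\<lambda>_. UNIV)" using PiE_eq_empty_iff[of I "\<lambda>_. UNIV::real set"] by auto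
  have B0: "0 < B" using Kp[OF x0, of 0] Kd(2)[OF x0, of 0] by linarith
  have lnb: "\<bar>ln H\<bar> \<le> \<bar>ln \<delta>\<bar> + \<bar>ln B\<bar>" if "\<delta> \<le> H" "H \<le> B" for H
  proof -
    have "ln \<delta> \<le> ln H" "ln H \<le> ln B" using \<open>0 < \<delta>\<close> that by auto
    then show ?thesis by linarith
  qed
  define C where "C = B * (\<bar>ln \<delta>\<bar> + \<bar>ln B\<bar>) + B + B\<^sup>2 / \<delta>"
  have Cb: "\<bar>a * ln b\<bar> \<le> C" if "\<delta> \<le> a" "a \<le> B" "\<delta> \<le> b" "b \<le> B" for a b
  proof -
    have "\<bar>a * ln b\<bar> \<le> B * (\<bar>ln \<delta>\<bar> + \<bar>ln B\<bar>)"
      unfolding abs_mult using lnb[OF that(3,4)] that \<open>0 < \<delta>\<close> by (intro mult_mono) auto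
    then show ?thesis using B0 \<open>0 < \<delta>\<close> by (simp add: C_def add_increasing2)
  qed
  have Cq: "\<bar>a\<^sup>2 / b\<bar> \<le> C" if "\<bar>a\<bar> \<le> B" "\<delta> \<le> b" for a b
  proof -
    have "a\<^sup>2 \<le> B\<^sup>2" using that(1) B0 abs_le_square_iff[of a B] by simp
    then have "\<bar>a\<^sup>2 / b\<bar> \<le> B\<^sup>2 / \<delta>" using that \<open>0 < \<delta>\<close> by (simp add: frac_le)
    then show ?thesis using B0 by (simp add: C_def add_increasing)
  qed
  have CB: "B \<le> C" using B0 \<open>0 < \<delta>\<close> by (simp add: C_def add_increasing add_increasing2)
  have iP: "integrable (gauss_PiM I \<Otimes>\<^sub>M std_gauss) (\<lambda>(x, y). H x y)"
    if "(\<lambda>(x, y). H x y) \<in> borel_measurable (gauss_PiM I \<Otimes>\<^sub>M std_gauss)"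
      "\<And>x y. x \<in> PiE I (\<lambda>_. UNIV) \<Longrightarrow> \<bar>H x y\<bar> \<le> C" for H :: "('a \<Rightarrow> real) \<Rightarrow> real \<Rightarrow> real"
    by (rule P.integrable_const_bound[where B=C])
      (use that in \<open>auto intro!: AE_I2 simp: space_pair_measure space_gauss_PiM\<close>)
  have iE: "integrable (gauss_PiM (insert i I)) H"
    if "H \<in> borel_measurable (gauss_PiM (insert i I))"
      "\<And>x. x \<in> PiE (insert i I) (\<lambda>_. UNIV) \<Longrightarrow> \<bar>H x\<bar> \<le> C" for H :: "('a \<Rightarrow> real) \<Rightarrow> real"
    by (rule E.integrable_const_bound[where B=C])
      (use that in \<open>auto intro!: AE_I2 simp: space_pair_measure space_gauss_PiM\<close>)
  have FE: "\<delta> \<le> F x" "F x \<le> B" "j \<in> insert i I \<Longrightarrow> \<bar>d j x\<bar> \<le> B" if "x \<in> PiE (insert i I) (\<lambda>_. UNIV)" for x j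
    using cls that by (auto simp: logsob_class_def)
  have FEa: "\<bar>F x\<bar> \<le> C" if "x \<in> PiE (insert i I) (\<lambda>_. UNIV)" for x
    using FE(1,2)[OF that] CB \<open>0 < \<delta>\<close> by linarith
  have FlnF: "(\<integral>z. F z * ln (F z) \<partial>gauss_PiM (insert i I)) = (\<integral>x. (\<integral>y. K x y * ln (K x y) \<partial>std_gauss) \<partial>gauss_PiM I)"
    unfolding K_def
    by (rule S.product_integral_insert[OF insert(1,2)]) (intro iE Cb FE, measurable)
  have dF: "(\<integral>z. (d j z)\<^sup>2 / F z \<partial>gauss_PiM (insert i I)) = (\<integral>x. (\<integral>y. (k j x y)\<^sup>2 / K x y \<partial>std_gauss) \<partial>gauss_PiM I)"
    if j: "j \<in> insert i I" for j
  proof -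
    have [measurable]: "d j \<in> borel_measurable (gauss_PiM (insert i I))" by (rule mdj[OF j])
    show ?thesis unfolding K_def k_def
      by (rule S.product_integral_insert[OF insert(1,2)], intro iE Cq FE j) measurable
  qed
  have mEq: "(\<integral>z. F z \<partial>gauss_PiM (insert i I)) = (\<integral>x. (\<integral>y. K x y \<partial>std_gauss) \<partial>gauss_PiM I)"
    unfolding K_def
    by (rule S.product_integral_insert[OF insert(1,2)], rule iE[OF mF FEa])
  define m where "m = (\<integral>z. F z \<partial>gauss_PiM (insert i I))"
  define Fb where "Fb x = (\<integral>y. K x y \<partial>std_gauss)" for x
  have mFb[measurable]: "Fb \<in> borel_measurable (gauss_PiM I)" unfolding Fb_def by measurable
  have mKx: "K x \<in> borel_measurable borel" if "x \<in> PiE I (\<lambda>_. UNIV)" for x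
    using measurable_compose_Pair1[of x "gauss_PiM I", OF _ mK] that by (simp add: space_gauss_PiM cong: measurable_cong_sets)
  have Fbb: "\<delta> \<le> Fb x" "Fb x \<le> B" if x: "x \<in> PiE I (\<lambda>_. UNIV)" for x
  proof -
    have i: "integrable std_gauss (K x)"
    proof (rule std_gauss.integrable_const_bound[where B=B], rule AE_I2)
      show "norm (K x y) \<le> B" for y using Kd(2)[OF x, of y] Kp[OF x, of y] by simp
      show "K x \<in> borel_measurable std_gauss" using mKx[OF x] by (simp cong: measurable_cong_sets)
    qed
    show "\<delta> \<le> Fb x" "Fb x \<le> B" unfolding Fb_def
      using i Kd[OF x] by (auto intro!: std_gauss.integral_ge_const std_gauss.integral_le_const AE_I2)
  qed
  have oneD: "(\<integral>y. K x y * ln (K x y) \<partial>std_gauss) \<le> Fb x * ln (Fb x) + (\<integral>y. (k i x y)\<^sup>2 / K x y \<partial>std_gauss) / 2"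
    if x: "x \<in> PiE I (\<lambda>_. UNIV)" for x
    unfolding Fb_def
  proof (rule std_gauss_logsob[where \<delta>=\<delta> and B=B])
    have h: "x(i := 0) \<in> PiE (insert i I) (\<lambda>_. UNIV)" using e[OF x] .
    show "(K x has_real_derivative k i x y) (at y)" for y
      using cls h by (auto simp: logsob_class_def K_def[abs_def] k_def dest!: bspec[OF _ h])
    show "continuous_on UNIV (k i x)"
      using cls h by (auto simp: logsob_class_def k_def[abs_def] dest!: bspec[OF _ h])
  qed (use Kd[OF x] \<open>0 < \<delta>\<close> in auto)
  have mi[measurable]: "(\<lambda>(x, y). k i x y) \<in> borel_measurable (gauss_PiM I \<Otimes>\<^sub>M std_gauss)" by (rule mk) simp
  have iKl: "integrable (gauss_PiM I \<Otimes>\<^sub>M std_gauss) (\<lambda>(x, y). K x y * ln (K x y))"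
    by (rule iP, measurable) (rule Cb[OF Kd(1,2) Kd(1,2)])
  have iKq: "integrable (gauss_PiM I \<Otimes>\<^sub>M std_gauss) (\<lambda>(x, y). (k j x y)\<^sup>2 / K x y)" if j: "j \<in> insert i I" for j
  proof -
    have [measurable]: "(\<lambda>(x, y). k j x y) \<in> borel_measurable (gauss_PiM I \<Otimes>\<^sub>M std_gauss)" by (rule mk[OF j])
    show ?thesis by (rule iP, measurable) (rule Cq[OF Kd(3)[OF _ j] Kd(1)])
  qed
  have iKF: "integrable (gauss_PiM I \<Otimes>\<^sub>M std_gauss) (\<lambda>(x, y). K x y * ln (Fb x))"
    by (rule iP, measurable) (rule Cb[OF Kd(1,2) Fbb])
  have iK: "integrable (gauss_PiM I \<Otimes>\<^sub>M std_gauss) (\<lambda>(x, y). K x y)"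
  proof (rule iP[OF mK])
    show "\<bar>K x y\<bar> \<le> C" if "x \<in> PiE I (\<lambda>_. UNIV)" for x y
      using Kd(1,2)[OF that, of y] CB \<open>0 < \<delta>\<close> by linarith
  qed
  have iFb: "integrable (gauss_PiM I) (\<lambda>x. Fb x * ln (Fb x))"
    by (rule L.integrable_const_bound[where B=C]) (auto intro!: AE_I2 Cb Fbb simp: space_gauss_PiM)
  have "(\<integral>z. F z * ln (F z) \<partial>gauss_PiM (insert i I)) \<le>
     (\<integral>x. Fb x * ln (Fb x) + (\<integral>y. (k i x y)\<^sup>2 / K x y \<partial>std_gauss) / 2 \<partial>gauss_PiM I)"
    unfolding FlnF
    by (rule integral_mono[OF P.integrable_fst'[OF iKl, simplified] _ oneD])
      (use iFb P.integrable_fst'[OF iKq[of i], simplified] in \<open>auto simp: space_gauss_PiM\<close>)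
  also have "\<dots> = (\<integral>x. Fb x * ln (Fb x) \<partial>gauss_PiM I) + (\<integral>z. (d i z)\<^sup>2 / F z \<partial>gauss_PiM (insert i I)) / 2"
    using iFb P.integrable_fst'[OF iKq[of i], simplified] by (subst Bochner_Integration.integral_add) (auto simp: dF)
  also have "(\<integral>x. Fb x * ln (Fb x) \<partial>gauss_PiM I) = (\<integral>x. (\<integral>y. K x y * ln (Fb x) \<partial>std_gauss) \<partial>gauss_PiM I)"
    by (simp add: Fb_def)
  also have "\<dots> = (\<integral>y. (\<integral>x. K x y * ln (Fb x) \<partial>gauss_PiM I) \<partial>std_gauss)"
    using P.Fubini_integral[OF iKF] by simp
  also have "\<dots> \<le> (\<integral>y. (\<Sum>j\<in>I. \<integral>x. (k j x y)\<^sup>2 / K x y \<partial>gauss_PiM I) / 2 + (\<integral>x. K x y \<partial>gauss_PiM I) * ln m \<partial>std_gauss)"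
  proof (rule integral_mono)
    show "integrable std_gauss (\<lambda>y. \<integral>x. K x y * ln (Fb x) \<partial>gauss_PiM I)"
      using P.integrable_snd[OF iKF] by simp
    show "integrable std_gauss (\<lambda>y. (\<Sum>j\<in>I. \<integral>x. (k j x y)\<^sup>2 / K x y \<partial>gauss_PiM I) / 2 + (\<integral>x. K x y \<partial>gauss_PiM I) * ln m)"
      using P.integrable_snd[OF iKq] P.integrable_snd[OF iK]
      by (intro Bochner_Integration.integrable_add integrable_divide_zero Bochner_Integration.integrable_sum integrable_mult_left) auto
    fix y :: real
    have sl: "logsob_class I \<delta> B (\<lambda>x. K x y) (\<lambda>j x. k j x y)"
      unfolding K_def k_def by (rule logsob_class_slice[OF cls insert(2)])
    have [measurable]: "(\<lambda>x. K x y) \<in> borel_measurable (gauss_PiM I)" using sl by (simp add: logsob_class_def)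
    have g: "(\<integral>x. K x y * ln (Fb x) \<partial>gauss_PiM I) \<le> (\<integral>x. K x y * ln (K x y) \<partial>gauss_PiM I)
       - (\<integral>x. K x y \<partial>gauss_PiM I) * ln (\<integral>x. K x y \<partial>gauss_PiM I)
       + (\<integral>x. K x y \<partial>gauss_PiM I) * ln (\<integral>x. Fb x \<partial>gauss_PiM I)"
      by (rule L.gibbs_inequality[where \<delta>=\<delta> and B=B]) (use Kd Fbb \<open>0 < \<delta>\<close> in \<open>auto simp: space_gauss_PiM\<close>)
    have "(\<integral>x. Fb x \<partial>gauss_PiM I) = m" by (simp add: m_def mEq Fb_def)
    then show "(\<integral>x. K x y * ln (Fb x) \<partial>gauss_PiM I) \<le> (\<Sum>j\<in>I. \<integral>x. (k j x y)\<^sup>2 / K x y \<partial>gauss_PiM I) / 2 + (\<integral>x. K x y \<partial>gauss_PiM I) * ln m"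
      using g insert.IH[OF sl \<open>0 < \<delta>\<close>] by simp
  qed
  also have "\<dots> = (\<integral>y. (\<Sum>j\<in>I. \<integral>x. (k j x y)\<^sup>2 / K x y \<partial>gauss_PiM I) / 2 \<partial>std_gauss) + (\<integral>y. (\<integral>x. K x y \<partial>gauss_PiM I) * ln m \<partial>std_gauss)"
    using P.integrable_snd[OF iKq] P.integrable_snd[OF iK]
    by (intro Bochner_Integration.integral_add integrable_divide_zero Bochner_Integration.integrable_sum integrable_mult_left) auto
  also have "(\<integral>y. (\<integral>x. K x y \<partial>gauss_PiM I) * ln m \<partial>std_gauss) = m * ln m"
    using P.Fubini_integral[OF iK] by (simp add: m_def mEq)
  also have "(\<integral>y. (\<Sum>j\<in>I. \<integral>x. (k j x y)\<^sup>2 / K x y \<partial>gauss_PiM I) / 2 \<partial>std_gauss)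
     = (\<Sum>j\<in>I. \<integral>z. (d j z)\<^sup>2 / F z \<partial>gauss_PiM (insert i I)) / 2"
  proof -
    have "(\<integral>y. (\<Sum>j\<in>I. \<integral>x. (k j x y)\<^sup>2 / K x y \<partial>gauss_PiM I) \<partial>std_gauss)
       = (\<Sum>j\<in>I. \<integral>y. \<integral>x. (k j x y)\<^sup>2 / K x y \<partial>gauss_PiM I \<partial>std_gauss)"
      using P.integrable_snd[OF iKq] by (intro Bochner_Integration.integral_sum) auto
    also have "\<dots> = (\<Sum>j\<in>I. \<integral>z. (d j z)\<^sup>2 / F z \<partial>gauss_PiM (insert i I))"
      using P.Fubini_integral[OF iKq] by (intro sum.cong) (auto simp: dF)
    finally show ?thesis by simp
  qed
  finally show ?case using insert(1,2) by (simp add: m_def add_divide_distrib)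
qed

section \<open>The standard Gaussian measure on a Euclidean space\<close>

definition gauss_dens :: "'a::euclidean_space \<Rightarrow> real" where
  "gauss_dens x = (1 / sqrt (2 * pi)) ^ DIM('a) * exp (- (norm x)\<^sup>2 / 2)"

lemma gauss_dens_pos: "0 < gauss_dens x" "0 \<le> gauss_dens x" "gauss_dens x \<noteq> 0"
proof -
  show "0 < gauss_dens x" unfolding gauss_dens_def by simp
  then show "0 \<le> gauss_dens x" "gauss_dens x \<noteq> 0" by auto
qed

lemma continuous_gauss_dens: "continuous_on A gauss_dens"
  unfolding gauss_dens_def by (intro continuous_intros) auto

lemma measurable_gauss_dens [measurable]: "gauss_dens \<in> borel_measurable borel"
  by (rule borel_measurable_continuous_onI[OF continuous_gauss_dens])

lemma gauss_dens_prod: "gauss_dens (x::'a::euclidean_space) = (\<Prod>b\<in>Basis. std_normal_density (x \<bullet> b))"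
proof -
  have "(norm x)\<^sup>2 = (\<Sum>b\<in>Basis. (x \<bullet> b)\<^sup>2)"
    unfolding power2_norm_eq_inner euclidean_inner[of x x] by (simp add: power2_eq_square)
  then have "(\<Sum>b\<in>Basis. - (x \<bullet> b)\<^sup>2 / 2) = - (norm x)\<^sup>2 / 2"
    by (simp add: sum_negf sum_divide_distrib)
  then have "exp (- (norm x)\<^sup>2 / 2) = (\<Prod>b\<in>Basis. exp (- (x \<bullet> b)\<^sup>2 / 2))"
    by (metis exp_sum finite_Basis)
  then show ?thesis
    unfolding gauss_dens_def std_normal_density_def by (simp only: prod.distrib prod_constant)
qed

definition gaussE :: "'a::euclidean_space measure" where
  "gaussE = density lborel (\<lambda>x. ennreal (gauss_dens x))"

lemma sets_gaussE [simp, measurable_cong]: "sets gaussE = sets borel"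
  by (simp add: gaussE_def)

lemma space_gaussE [simp]: "space gaussE = UNIV"
  by (simp add: gaussE_def)

text \<open>
  Both sides are determined by their values on boxes, where the left-hand side factorises.
\<close>

lemma PiM_density_prod:
  fixes d :: "'i \<Rightarrow> real \<Rightarrow> ennreal"
  assumes I: "finite I" and [measurable]: "\<And>i. d i \<in> borel_measurable borel"
    and sf: "\<And>i. sigma_finite_measure (density lborel (d i))"
  shows "density (PiM I (\<lambda>_. lborel)) (\<lambda>x. \<Prod>i\<in>I. d i (x i)) = PiM I (\<lambda>i. density lborel (d i))"
proof -
  interpret S: product_sigma_finite "\<lambda>i. density lborel (d i)" using sf by unfold_locales (auto simp: sigma_finite_measure_def)
  interpret L: product_sigma_finite "\<lambda>i::'i. lborel :: real measure" by standard
  have m[measurable]: "(\<lambda>x. \<Prod>i\<in>I. d i (x i)) \<in> borel_measurable (PiM I (\<lambda>_. lborel))"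
    by measurable
  show ?thesis
  proof (rule S.PiM_eqI[OF I])
    show "sets (density (PiM I (\<lambda>_. lborel)) (\<lambda>x. \<Prod>i\<in>I. d i (x i))) = sets (PiM I (\<lambda>i. density lborel (d i)))"
      by (simp cong: sets_PiM_cong)
    fix A assume A: "\<And>i. i \<in> I \<Longrightarrow> A i \<in> sets (density lborel (d i))"
    have sA: "PiE I A \<in> sets (PiM I (\<lambda>_. lborel))"
      using A I by (intro sets_PiM_I_finite) auto
    have "emeasure (density (PiM I (\<lambda>_. lborel)) (\<lambda>x. \<Prod>i\<in>I. d i (x i))) (PiE I A)
       = (\<integral>\<^sup>+x. (\<Prod>i\<in>I. d i (x i)) * indicator (PiE I A) x \<partial>PiM I (\<lambda>_. lborel))"
      by (rule emeasure_density[OF m sA])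
    also have "\<dots> = (\<integral>\<^sup>+x. (\<Prod>i\<in>I. d i (x i) * indicator (A i) (x i)) \<partial>PiM I (\<lambda>_. lborel))"
    proof (rule nn_integral_cong)
      fix x assume "x \<in> space (PiM I (\<lambda>_. lborel :: real measure))"
      then have "x \<in> extensional I" by (simp add: space_PiM PiE_def)
      then have "indicator (PiE I A) x = (\<Prod>i\<in>I. indicator (A i) (x i) :: ennreal)"
        using I by (auto simp: indicator_def PiE_def Pi_def prod_zero_iff)
      then show "(\<Prod>i\<in>I. d i (x i)) * indicator (PiE I A) x = (\<Prod>i\<in>I. d i (x i) * indicator (A i) (x i))"
        by (simp add: prod.distrib)
    qed
    also have "\<dots> = (\<Prod>i\<in>I. \<integral>\<^sup>+x. d i x * indicator (A i) x \<partial>lborel)"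
      using A by (intro L.product_nn_integral_prod[OF I]) auto
    also have "\<dots> = (\<Prod>i\<in>I. emeasure (density lborel (d i)) (A i))"
      using A by (intro prod.cong refl emeasure_density[symmetric]) auto
    finally show "emeasure (density (PiM I (\<lambda>_. lborel)) (\<lambda>x. \<Prod>i\<in>I. d i (x i))) (PiE I A)
      = (\<Prod>i\<in>I. emeasure (density lborel (d i)) (A i))" .
  qed
qed

lemma inner_sum_scale_Basis: "b \<in> Basis \<Longrightarrow> (\<Sum>i\<in>Basis. f i *\<^sub>R i) \<bullet> b = (f b :: real)"
  by (simp add: inner_sum_left inner_Basis if_distrib cong: if_cong)

lemma gaussE_eq_distr:
  "(gaussE :: 'a::euclidean_space measure) = distr (gauss_PiM Basis) borel (\<lambda>f. \<Sum>b\<in>Basis. f b *\<^sub>R b)"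
proof -
  let ?S = "\<lambda>f. \<Sum>b\<in>Basis. f b *\<^sub>R b :: 'a"
  have "(gaussE :: 'a measure) = density (distr (\<Pi>\<^sub>M b\<in>Basis. lborel) borel ?S) (\<lambda>x. ennreal (gauss_dens x))"
    unfolding gaussE_def lborel_eq[symmetric] ..
  also have "\<dots> = distr (density (\<Pi>\<^sub>M b\<in>Basis. lborel) (\<lambda>f. ennreal (gauss_dens (?S f)))) borel ?S"
    by (rule density_distr) measurable
  also have "(\<lambda>f. ennreal (gauss_dens (?S f))) = (\<lambda>f. \<Prod>b\<in>Basis. ennreal (std_normal_density (f b)))"
    by (rule ext) (simp add: gauss_dens_prod inner_sum_scale_Basis prod_ennreal)
  also have "density (\<Pi>\<^sub>M b\<in>Basis. lborel) (\<lambda>f. \<Prod>b\<in>(Basis::'a set). ennreal (std_normal_density (f b)))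
    = gauss_PiM Basis"
    unfolding std_gauss_def
    by (rule PiM_density_prod) (use std_gauss.sigma_finite_measure_axioms in \<open>auto simp: std_gauss_def\<close>)
  finally show ?thesis .
qed

interpretation gaussE: prob_space "gaussE :: 'a::euclidean_space measure"
proof -
  interpret prob_space "gauss_PiM (Basis :: 'a set)" by (intro prob_space_PiM std_gauss.prob_space_axioms)
  show "prob_space (gaussE :: 'a measure)" unfolding gaussE_eq_distr by (rule prob_space_distr) measurable
qed

lemma integral_gaussE:
  fixes f :: "'a::euclidean_space \<Rightarrow> real"
  assumes [measurable]: "f \<in> borel_measurable borel"
  shows "(\<integral>x. f x \<partial>gaussE) = (\<integral>x. gauss_dens x * f x \<partial>lborel)"
    and "integrable gaussE f \<longleftrightarrow> integrable lborel (\<lambda>x. gauss_dens x * f x)"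
proof -
  show "(\<integral>x. f x \<partial>gaussE) = (\<integral>x. gauss_dens x * f x \<partial>lborel)"
    unfolding gaussE_def by (subst integral_density) (use gauss_dens_pos in auto)
  show "integrable gaussE f \<longleftrightarrow> integrable lborel (\<lambda>x. gauss_dens x * f x)"
    unfolding gaussE_def by (subst integrable_density) (use gauss_dens_pos in auto)
qed

lemma integrable_gaussE_bounded:
  fixes f :: "'a::euclidean_space \<Rightarrow> real"
  assumes "f \<in> borel_measurable borel" "\<And>x. \<bar>f x\<bar> \<le> B"
  shows "integrable gaussE f"
  by (rule gaussE.integrable_const_bound[where B=B]) (use assms in \<open>auto simp: gaussE_def\<close>)

lemma gauss_logsob:
  fixes F :: "'a::euclidean_space \<Rightarrow> real" and D :: "'a \<Rightarrow> 'a \<Rightarrow> real"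
  assumes der: "\<And>x b t. b \<in> Basis \<Longrightarrow> ((\<lambda>t. F (x + t *\<^sub>R b)) has_real_derivative D b (x + t *\<^sub>R b)) (at t)"
    and cF: "continuous_on UNIV F" and cD: "\<And>b. b \<in> Basis \<Longrightarrow> continuous_on UNIV (D b)"
    and d: "0 < \<delta>" "\<And>x. \<delta> \<le> F x" and B: "\<And>x. F x \<le> B" "\<And>x b. b \<in> Basis \<Longrightarrow> \<bar>D b x\<bar> \<le> B"
  shows "(\<integral>x. F x * ln (F x) \<partial>gaussE) \<le> (\<integral>x. F x \<partial>gaussE) * ln (\<integral>x. F x \<partial>gaussE)
      + (\<Sum>b\<in>Basis. \<integral>x. (D b x)\<^sup>2 / F x \<partial>gaussE) / 2"
proof -
  let ?S = "\<lambda>f. \<Sum>b\<in>Basis. f b *\<^sub>R b :: 'a"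
  have [measurable]: "F \<in> borel_measurable borel" using cF by (rule borel_measurable_continuous_onI)
  have mD: "D b \<in> borel_measurable borel" if "b \<in> Basis" for b
    using cD[OF that] by (rule borel_measurable_continuous_onI)
  have mS[measurable]: "?S \<in> measurable (gauss_PiM Basis) borel" by measurable
  have upd: "?S (x(i := t)) = (\<Sum>b\<in>Basis - {i}. x b *\<^sub>R b) + t *\<^sub>R i" if "i \<in> Basis" for x i t
    using that by (subst sum.remove[of _ i]) (auto intro!: sum.cong simp: add.commute)
  have "logsob_class Basis \<delta> B (\<lambda>f. F (?S f)) (\<lambda>b f. D b (?S f))"
    unfolding logsob_class_def
  proof (intro conjI ballI allI)
    show "(\<lambda>f. F (?S f)) \<in> borel_measurable (gauss_PiM Basis)" by measurable
    show "(\<lambda>f. D b (?S f)) \<in> borel_measurable (gauss_PiM Basis)" if "b \<in> Basis" for b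
      using measurable_compose[OF mS mD[OF that]] .
    fix x b assume b: "b \<in> (Basis::'a set)"
    show "continuous_on UNIV (\<lambda>t. D b (?S (x(b := t))))"
      unfolding upd[OF b] by (rule continuous_on_compose2[OF cD[OF b]]) (auto intro!: continuous_intros)
    show "((\<lambda>t. F (?S (x(b := t)))) has_real_derivative D b (?S (x(b := t)))) (at t)" for t
      unfolding upd[OF b] by (rule der[OF b])
  qed (use d B in auto)
  from gauss_logsob_PiM[OF finite_Basis this d(1)]
  show ?thesis unfolding gaussE_eq_distr
    using mD by (simp add: integral_distr cong: sum.cong)
qed

lemma nn_integral_lborel_affine:
  fixes f :: "'a::euclidean_space \<Rightarrow> ennreal"
  assumes [measurable]: "f \<in> borel_measurable borel" and "c \<noteq> 0"
  shows "(\<integral>\<^sup>+x. f x \<partial>lborel) = ennreal (\<bar>c\<bar> ^ DIM('a)) * (\<integral>\<^sup>+x. f (t + c *\<^sub>R x) \<partial>lborel)"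
  by (subst lborel_affine[OF assms(2), of t])
    (simp add: nn_integral_density nn_integral_distr nn_integral_cmult)

lemma integral_lborel_affine:
  fixes f :: "'a::euclidean_space \<Rightarrow> real"
  assumes [measurable]: "f \<in> borel_measurable borel" and "c \<noteq> 0"
  shows "(\<integral>x. f x \<partial>lborel) = \<bar>c\<bar> ^ DIM('a) * (\<integral>x. f (t + c *\<^sub>R x) \<partial>lborel)"
  by (subst lborel_affine[OF assms(2), of t])
    (simp add: integral_density integral_distr)

lemma integrable_lborel_affine:
  fixes f :: "'a::euclidean_space \<Rightarrow> real"
  assumes [measurable]: "f \<in> borel_measurable borel" and "c \<noteq> 0"
  shows "integrable lborel f \<longleftrightarrow> integrable lborel (\<lambda>x. f (t + c *\<^sub>R x))"
  using assms(2)
  by (subst lborel_affine[OF assms(2), of t])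
    (simp add: integrable_density integrable_distr_eq)

definition rsqrt2 :: real where "rsqrt2 = 1 / sqrt 2"

lemma rsqrt2: "0 < rsqrt2" "rsqrt2 * rsqrt2 = 1/2" "rsqrt2\<^sup>2 = 1/2"
  by (auto simp: rsqrt2_def power2_eq_square field_simps)

text \<open>
  Rotation invariance of the product density in the form needed below: after the shear \<open>s \<mapsto> s - t\<close>,
  the dependence on \<open>t\<close> is a translate of a fixed function, so integration over \<open>t\<close> gives a constant.
\<close>

lemma gauss_dens_product_rotate:
  "gauss_dens (s - t) * gauss_dens (t::'a::euclidean_space)
    = gauss_dens (rsqrt2 *\<^sub>R s) * (exp (- (norm (t - (1/2) *\<^sub>R s))\<^sup>2) * (1 / sqrt (2 * pi)) ^ DIM('a))"
proof -
  have "- (norm (s - t))\<^sup>2 / 2 + - (norm t)\<^sup>2 / 2 = - (norm (rsqrt2 *\<^sub>R s))\<^sup>2 / 2 + - (norm (t - (1/2) *\<^sub>R s))\<^sup>2"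
    unfolding power2_norm_eq_inner by (simp add: inner_simps inner_commute rsqrt2(2) field_simps)
  then have "exp (- (norm (s - t))\<^sup>2 / 2) * exp (- (norm t)\<^sup>2 / 2)
      = exp (- (norm (rsqrt2 *\<^sub>R s))\<^sup>2 / 2) * exp (- (norm (t - (1/2) *\<^sub>R s))\<^sup>2)"
    by (simp only: exp_add[symmetric])
  then show ?thesis by (simp add: gauss_dens_def)
qed

text \<open>
  The normalised sum of two independent standard Gaussians is standard Gaussian. The identity is computed up
  to a factor independent of \<open>f\<close>, and the factor is found by taking \<open>f = 1\<close>.
\<close>

lemma nn_integral_rotated_gauss:
  fixes f :: "'a::euclidean_space \<Rightarrow> ennreal"
  assumes [measurable]: "f \<in> borel_measurable borel"
  shows "(\<integral>\<^sup>+t. (\<integral>\<^sup>+s. f (rsqrt2 *\<^sub>R (s + t)) \<partial>gaussE) \<partial>gaussE) = (\<integral>\<^sup>+x. f x \<partial>gaussE)"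
proof -
  define c where "c = (\<integral>\<^sup>+t. ennreal (exp (- (norm (t::'a))\<^sup>2) * (1 / sqrt (2 * pi)) ^ DIM('a)) \<partial>lborel)"
  have main: "\<exists>k. \<forall>f \<in> borel_measurable borel. (\<integral>\<^sup>+t. (\<integral>\<^sup>+s. f (rsqrt2 *\<^sub>R (s + t)) \<partial>gaussE) \<partial>gaussE) = k * (\<integral>\<^sup>+x. f (x::'a) \<partial>gaussE)"
  proof (rule exI[of _ "c * ennreal (\<bar>1/rsqrt2\<bar> ^ DIM('a))"], rule ballI)
    fix f :: "'a \<Rightarrow> ennreal" assume [measurable]: "f \<in> borel_measurable borel"
    have "(\<integral>\<^sup>+t. (\<integral>\<^sup>+s. f (rsqrt2 *\<^sub>R (s + t)) \<partial>gaussE) \<partial>gaussE)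
       = (\<integral>\<^sup>+t. gauss_dens t * (\<integral>\<^sup>+s. gauss_dens s * f (rsqrt2 *\<^sub>R (s + t)) \<partial>lborel) \<partial>lborel)"
      unfolding gaussE_def by (simp add: nn_integral_density)
    also have "\<dots> = (\<integral>\<^sup>+t. gauss_dens t * (\<integral>\<^sup>+s. gauss_dens (s - t) * f (rsqrt2 *\<^sub>R s) \<partial>lborel) \<partial>lborel)"
    proof (rule nn_integral_cong, rule arg_cong2[where f="(*)", OF refl])
      fix t :: 'a
      show "(\<integral>\<^sup>+s. gauss_dens s * f (rsqrt2 *\<^sub>R (s + t)) \<partial>lborel) = (\<integral>\<^sup>+s. gauss_dens (s - t) * f (rsqrt2 *\<^sub>R s) \<partial>lborel)"
        by (subst nn_integral_lborel_affine[where c=1 and t="-t"]) simp_all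
    qed
    also have "\<dots> = (\<integral>\<^sup>+t. (\<integral>\<^sup>+s. f (rsqrt2 *\<^sub>R s) * ennreal (gauss_dens (s - t) * gauss_dens t) \<partial>lborel) \<partial>lborel)"
    proof (rule nn_integral_cong)
      fix t :: 'a
      have "gauss_dens t * (\<integral>\<^sup>+s. gauss_dens (s - t) * f (rsqrt2 *\<^sub>R s) \<partial>lborel)
         = (\<integral>\<^sup>+s. gauss_dens t * (gauss_dens (s - t) * f (rsqrt2 *\<^sub>R s)) \<partial>lborel)"
        by (rule nn_integral_cmult[symmetric]) measurable
      also have "\<dots> = (\<integral>\<^sup>+s. f (rsqrt2 *\<^sub>R s) * ennreal (gauss_dens (s - t) * gauss_dens t) \<partial>lborel)"
        by (rule nn_integral_cong) (simp only: ennreal_mult[OF gauss_dens_pos(2) gauss_dens_pos(2)] mult_ac)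
      finally show "gauss_dens t * (\<integral>\<^sup>+s. gauss_dens (s - t) * f (rsqrt2 *\<^sub>R s) \<partial>lborel)
         = (\<integral>\<^sup>+s. f (rsqrt2 *\<^sub>R s) * ennreal (gauss_dens (s - t) * gauss_dens t) \<partial>lborel)" .
    qed
    also have "\<dots> = (\<integral>\<^sup>+s. (\<integral>\<^sup>+t. f (rsqrt2 *\<^sub>R s) * ennreal (gauss_dens (s - t) * gauss_dens t) \<partial>lborel) \<partial>lborel)"
      by (rule lborel_pair.Fubini') measurable
    also have "\<dots> = (\<integral>\<^sup>+s. f (rsqrt2 *\<^sub>R s) * gauss_dens (rsqrt2 *\<^sub>R s) * c \<partial>lborel)"
    proof (rule nn_integral_cong)
      fix s :: 'a
      have "(\<integral>\<^sup>+t. ennreal (exp (- (norm (t - (1/2) *\<^sub>R s))\<^sup>2) * (1 / sqrt (2 * pi)) ^ DIM('a)) \<partial>lborel) = c"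
        unfolding c_def by (subst nn_integral_lborel_affine[where c=1 and t="(1/2) *\<^sub>R s"]) simp_all
      then show "(\<integral>\<^sup>+t. f (rsqrt2 *\<^sub>R s) * ennreal (gauss_dens (s - t) * gauss_dens t) \<partial>lborel) = f (rsqrt2 *\<^sub>R s) * gauss_dens (rsqrt2 *\<^sub>R s) * c"
        unfolding gauss_dens_product_rotate ennreal_mult'[OF gauss_dens_pos(2)]
        by (subst nn_integral_cmult, measurable, subst nn_integral_cmult, measurable) (simp only: mult.assoc)
    qed
    also have "\<dots> = (\<integral>\<^sup>+s. f (rsqrt2 *\<^sub>R s) * gauss_dens (rsqrt2 *\<^sub>R s) \<partial>lborel) * c"
      by (rule nn_integral_multc) measurable
    also have "(\<integral>\<^sup>+s. f (rsqrt2 *\<^sub>R s) * gauss_dens (rsqrt2 *\<^sub>R s) \<partial>lborel)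
      = ennreal (\<bar>1/rsqrt2\<bar> ^ DIM('a)) * (\<integral>\<^sup>+s. f (rsqrt2 *\<^sub>R (0 + (1/rsqrt2) *\<^sub>R s)) * gauss_dens (rsqrt2 *\<^sub>R (0 + (1/rsqrt2) *\<^sub>R s)) \<partial>lborel)"
      by (rule nn_integral_lborel_affine) (use rsqrt2 in simp_all)
    also have "(\<integral>\<^sup>+s. f (rsqrt2 *\<^sub>R (0 + (1/rsqrt2) *\<^sub>R s)) * gauss_dens (rsqrt2 *\<^sub>R (0 + (1/rsqrt2) *\<^sub>R s)) \<partial>lborel) = (\<integral>\<^sup>+x. f x \<partial>gaussE)"
      unfolding gaussE_def using rsqrt2 by (simp add: nn_integral_density mult.commute)
    finally show "(\<integral>\<^sup>+t. (\<integral>\<^sup>+s. f (rsqrt2 *\<^sub>R (s + t)) \<partial>gaussE) \<partial>gaussE) = (c * ennreal (\<bar>1/rsqrt2\<bar> ^ DIM('a))) * (\<integral>\<^sup>+x. f x \<partial>gaussE)"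
      by (simp only: mult_ac)
  qed
  then obtain k where k: "\<And>f. f \<in> borel_measurable borel \<Longrightarrow>
     (\<integral>\<^sup>+t. (\<integral>\<^sup>+s. f (rsqrt2 *\<^sub>R (s + t)) \<partial>gaussE) \<partial>gaussE) = k * (\<integral>\<^sup>+x. f (x::'a) \<partial>gaussE)" by blast
  have "emeasure (gaussE :: 'a measure) UNIV = 1"
    using gaussE.emeasure_space_1[where 'a='a] by (simp only: space_gaussE)
  then have "k = 1" using k[of "\<lambda>_. 1"] by (simp only: nn_integral_const borel_measurable_const space_gaussE mult_1_right mult_1_left simp_thms)
  then show ?thesis using k[OF assms] by (simp only: mult_1_left)
qed

section \<open>The deficit of the Gaussian inequality\<close>

text \<open>
  Conditional expectation of \<open>f\<close> given \<open>t\<close> when its argument is \<open>(s + t) / sqrt 2\<close>, i.e. the Ornstein-Uhlenbeck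
  semigroup at the time for which both weights in Mehler's formula are \<open>1 / sqrt 2\<close>.
\<close>

definition mehler :: "('a::euclidean_space \<Rightarrow> real) \<Rightarrow> 'a \<Rightarrow> real" where
  "mehler f t = (\<integral>s. f (rsqrt2 *\<^sub>R (s + t)) \<partial>gaussE)"

lemma integrable_mehler_bounded:
  fixes f :: "'a::euclidean_space \<Rightarrow> real"
  assumes "f \<in> borel_measurable borel" "\<And>x. \<bar>f x\<bar> \<le> B"
  shows "integrable gaussE (\<lambda>s. f (rsqrt2 *\<^sub>R (s + t)))"
  using measurable_compose[of "\<lambda>s. rsqrt2 *\<^sub>R (s + t)" borel borel f] assms
  by (intro integrable_gaussE_bounded[where B=B]) auto

lemma mehler_bounds:
  fixes f :: "'a::euclidean_space \<Rightarrow> real"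
  assumes "f \<in> borel_measurable borel" "\<And>x. \<bar>f x\<bar> \<le> B"
  shows "(\<And>x. f x \<le> C) \<Longrightarrow> mehler f t \<le> C" "(\<And>x. C \<le> f x) \<Longrightarrow> C \<le> mehler f t" "\<bar>mehler f t\<bar> \<le> B"
proof -
  note i = integrable_mehler_bounded[OF assms, of t]
  show 1: "mehler f t \<le> C" if "\<And>x. f x \<le> C" for C
    unfolding mehler_def by (rule gaussE.integral_le_const[OF i]) (use that in auto)
  show 2: "C \<le> mehler f t" if "\<And>x. C \<le> f x" for C
    unfolding mehler_def by (rule gaussE.integral_ge_const[OF i]) (use that in auto)
  show "\<bar>mehler f t\<bar> \<le> B" using 1[of B] 2[of "-B"] assms(2) by (simp add: abs_le_iff minus_le_iff)
qed

lemma measure_gaussE_UNIV [simp]: "measure gaussE UNIV = 1"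
  using gaussE.prob_space by (simp only: space_gaussE)

lemma gaussE_eq_rotated_product:
  "(gaussE :: 'a::euclidean_space measure) = distr (gaussE \<Otimes>\<^sub>M gaussE) borel (\<lambda>z. rsqrt2 *\<^sub>R (snd z + fst z))"
proof (rule measure_eqI)
  interpret P: pair_prob_space "gaussE :: 'a measure" "gaussE :: 'a measure" ..
  fix A :: "'a set" assume "A \<in> sets gaussE"
  then have A[measurable]: "A \<in> sets borel" by simp
  have m: "(\<lambda>z. rsqrt2 *\<^sub>R (snd z + fst z)) \<in> measurable (gaussE \<Otimes>\<^sub>M (gaussE :: 'a measure)) borel" by measurable
  have "emeasure gaussE A = (\<integral>\<^sup>+x. indicator A x \<partial>gaussE)" by simp
  also have "\<dots> = (\<integral>\<^sup>+t. (\<integral>\<^sup>+s. indicator A (rsqrt2 *\<^sub>R (s + t)) \<partial>gaussE) \<partial>gaussE)"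
    by (rule nn_integral_rotated_gauss[symmetric]) measurable
  also have "\<dots> = (\<integral>\<^sup>+z. indicator A (rsqrt2 *\<^sub>R (snd z + fst z)) \<partial>(gaussE \<Otimes>\<^sub>M gaussE))"
    using gaussE.nn_integral_fst[where f="\<lambda>z. indicator A (rsqrt2 *\<^sub>R (snd z + fst z))"] by simp
  also have "\<dots> = (\<integral>\<^sup>+x. indicator A x \<partial>distr (gaussE \<Otimes>\<^sub>M gaussE) borel (\<lambda>z. rsqrt2 *\<^sub>R (snd z + fst z)))"
    by (subst nn_integral_distr[OF m]) auto
  finally show "emeasure gaussE A = emeasure (distr (gaussE \<Otimes>\<^sub>M gaussE) borel (\<lambda>z. rsqrt2 *\<^sub>R (snd z + fst z))) A"
    using A by simp
qed simp

lemma integral_mehler: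
  fixes f :: "'a::euclidean_space \<Rightarrow> real"
  assumes f: "integrable gaussE f"
  shows "(\<integral>t. mehler f t \<partial>gaussE) = (\<integral>x. f x \<partial>gaussE)" and "integrable gaussE (mehler f)"
proof -
  interpret P: pair_prob_space "gaussE :: 'a measure" "gaussE :: 'a measure" ..
  have [measurable]: "f \<in> borel_measurable borel" using f by (simp add: integrable_iff_bounded cong: measurable_cong_sets)
  have m: "(\<lambda>z. rsqrt2 *\<^sub>R (snd z + fst z)) \<in> measurable (gaussE \<Otimes>\<^sub>M (gaussE :: 'a measure)) borel" by measurable
  have "integrable (gaussE \<Otimes>\<^sub>M gaussE) (\<lambda>z. f (rsqrt2 *\<^sub>R (snd z + fst z)))"
    using f by (subst (asm) gaussE_eq_rotated_product, subst (asm) integrable_distr_eq[OF m]) auto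
  moreover have e: "(\<lambda>z. f (rsqrt2 *\<^sub>R (snd z + fst z))) = (\<lambda>(t, s). f (rsqrt2 *\<^sub>R (s + t)))" by auto
  ultimately have i: "integrable (gaussE \<Otimes>\<^sub>M gaussE) (\<lambda>(t, s). f (rsqrt2 *\<^sub>R (s + t)))" by simp
  have "(\<integral>x. f x \<partial>gaussE) = (\<integral>z. f (rsqrt2 *\<^sub>R (snd z + fst z)) \<partial>(gaussE \<Otimes>\<^sub>M gaussE))"
    by (subst gaussE_eq_rotated_product, subst integral_distr[OF m]) auto
  also have "\<dots> = (\<integral>z. (case z of (t, s) \<Rightarrow> f (rsqrt2 *\<^sub>R (s + t))) \<partial>(gaussE \<Otimes>\<^sub>M gaussE))"
    by (simp only: e)
  finally show "(\<integral>t. mehler f t \<partial>gaussE) = (\<integral>x. f x \<partial>gaussE)"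
    using P.integral_fst[OF i] unfolding mehler_def by simp
  show "integrable gaussE (mehler f)"
    using P.integrable_fst[OF i] unfolding mehler_def[abs_def] .
qed

lemma continuous_mehler:
  fixes f :: "'a::euclidean_space \<Rightarrow> real"
  assumes c: "continuous_on UNIV f" and B: "\<And>x. \<bar>f x\<bar> \<le> B"
  shows "continuous_on UNIV (mehler f)"
proof -
  have m[measurable]: "f \<in> borel_measurable borel" using c by (rule borel_measurable_continuous_onI)
  show ?thesis
  proof (rule continuous_on_sequentiallyI)
    fix u :: "nat \<Rightarrow> 'a" and a assume u: "u \<longlonglongrightarrow> a"
    show "(\<lambda>n. mehler f (u n)) \<longlonglongrightarrow> mehler f a"
      unfolding mehler_def
    proof (rule integral_dominated_convergence[where w="\<lambda>_. B"])
      show "AE s in gaussE. (\<lambda>n. f (rsqrt2 *\<^sub>R (s + u n))) \<longlonglongrightarrow> f (rsqrt2 *\<^sub>R (s + a))"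
        by (intro AE_I2 continuous_on_tendsto_compose[OF c] tendsto_intros u) auto
    qed (use B in auto)
  qed
qed

text \<open>
  The factor \<open>1 / sqrt 2\<close> from the chain rule is what halves the Dirichlet energy of the average and of the
  slices, so that the two applications of the inequality together cost no more than one.
\<close>

lemma mehler_has_derivative:
  fixes f D :: "'a::euclidean_space \<Rightarrow> real"
  assumes der: "\<And>x t. ((\<lambda>t. f (x + t *\<^sub>R b)) has_real_derivative D (x + t *\<^sub>R b)) (at t)"
    and cf: "continuous_on UNIV f" and cD: "continuous_on UNIV D"
    and B: "\<And>x. \<bar>f x\<bar> \<le> B" "\<And>x. \<bar>D x\<bar> \<le> B"
  shows "((\<lambda>t. mehler f (x + t *\<^sub>R b)) has_real_derivative rsqrt2 * mehler D (x + t *\<^sub>R b)) (at t)"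
proof -
  have m[measurable]: "f \<in> borel_measurable borel" "D \<in> borel_measurable borel"
    using cf cD by (auto intro: borel_measurable_continuous_onI)
  define F where "F s t = f (rsqrt2 *\<^sub>R (s + (x + t *\<^sub>R b)))" for s t
  have Fd: "(F s has_real_derivative rsqrt2 * D (rsqrt2 *\<^sub>R (s + (x + t *\<^sub>R b)))) (at t)" for s t
  proof -
    have "((\<lambda>t. f (rsqrt2 *\<^sub>R (s + x) + t *\<^sub>R b)) has_real_derivative D (rsqrt2 *\<^sub>R (s + x) + (rsqrt2 * t) *\<^sub>R b)) (at (rsqrt2 * t))"
      by (rule der)
    then have "((\<lambda>t. f (rsqrt2 *\<^sub>R (s + x) + (rsqrt2 * t) *\<^sub>R b)) has_real_derivative D (rsqrt2 *\<^sub>R (s + x) + (rsqrt2 * t) *\<^sub>R b) * rsqrt2) (at t)"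
      by (rule DERIV_chain2) (auto intro!: derivative_eq_intros)
    then show ?thesis unfolding F_def[abs_def] by (simp add: scaleR_add_right add.assoc mult.commute)
  qed
  have iF: "integrable gaussE (\<lambda>s. F s t)" for t
    unfolding F_def by (rule integrable_mehler_bounded[OF m(1) B(1)])
  have lip: "\<bar>(F s (t + h) - F s t) / h\<bar> \<le> rsqrt2 * B" if "h \<noteq> 0" for s t h
  proof -
    have "norm (F s (t + h) - F s t) \<le> rsqrt2 * B * norm (t + h - t)"
    proof (rule field_differentiable_bound[of UNIV])
      show "norm (rsqrt2 * D (rsqrt2 *\<^sub>R (s + (x + z *\<^sub>R b)))) \<le> rsqrt2 * B" for z
        using B(2) rsqrt2(1) by (simp add: abs_mult)
    qed (use Fd in auto)
    then show ?thesis using that by (simp add: abs_divide divide_le_eq)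
  qed
  show ?thesis
    unfolding DERIV_def tendsto_at_iff_sequentially
  proof (intro allI impI)
    fix X :: "nat \<Rightarrow> real" assume X: "\<forall>i. X i \<in> UNIV - {0}" "X \<longlonglongrightarrow> 0"
    have conv: "(\<lambda>n. \<integral>s. (F s (t + X n) - F s t) / X n \<partial>gaussE) \<longlonglongrightarrow> (\<integral>s. rsqrt2 * D (rsqrt2 *\<^sub>R (s + (x + t *\<^sub>R b))) \<partial>gaussE)"
    proof (rule integral_dominated_convergence[where w="\<lambda>_. rsqrt2 * B"])
      show "AE s in gaussE. (\<lambda>n. (F s (t + X n) - F s t) / X n) \<longlonglongrightarrow> rsqrt2 * D (rsqrt2 *\<^sub>R (s + (x + t *\<^sub>R b)))"
      proof (rule AE_I2)
        fix s
        show "(\<lambda>n. (F s (t + X n) - F s t) / X n) \<longlonglongrightarrow> rsqrt2 * D (rsqrt2 *\<^sub>R (s + (x + t *\<^sub>R b)))"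
          using Fd[of s t] X unfolding DERIV_def tendsto_at_iff_sequentially by (auto simp: comp_def)
      qed
      show "AE s in gaussE. norm ((F s (t + X n) - F s t) / X n) \<le> rsqrt2 * B" for n
        using lip[of "X n"] X(1) by auto
      show "(\<lambda>s. (F s (t + X n) - F s t) / X n) \<in> borel_measurable gaussE" for n unfolding F_def by measurable
    qed (auto simp: F_def)
    have eq: "(\<integral>s. (F s (t + X n) - F s t) / X n \<partial>gaussE) = (mehler f (x + (t + X n) *\<^sub>R b) - mehler f (x + t *\<^sub>R b)) / X n" for n
    proof -
      have "(\<integral>s. (F s (t + X n) - F s t) / X n \<partial>gaussE) = (\<integral>s. F s (t + X n) - F s t \<partial>gaussE) / X n"
        by (rule integral_divide_zero)
      also have "(\<integral>s. F s (t + X n) - F s t \<partial>gaussE) = (\<integral>s. F s (t + X n) \<partial>gaussE) - (\<integral>s. F s t \<partial>gaussE)"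
        by (rule Bochner_Integration.integral_diff[OF iF iF])
      finally show ?thesis by (simp only: mehler_def F_def)
    qed
    have e2: "(\<integral>s. rsqrt2 * D (rsqrt2 *\<^sub>R (s + (x + t *\<^sub>R b))) \<partial>gaussE) = rsqrt2 * mehler D (x + t *\<^sub>R b)"
      unfolding mehler_def by (rule integral_mult_right_zero)
    show "((\<lambda>h. (mehler f (x + (t + h) *\<^sub>R b) - mehler f (x + t *\<^sub>R b)) / h) \<circ> X) \<longlonglongrightarrow> rsqrt2 * mehler D (x + t *\<^sub>R b)"
      using conv unfolding eq e2 comp_def .
  qed
qed

text \<open>
  For \<open>F = h\<^sup>2 + e\<close> the inequality in \<open>s\<close> for fixed \<open>t\<close> bounds the average of \<open>F * ln F\<close> by
  \<open>PF * ln PF\<close> plus the average \<open>R\<close> of \<open>|\<nabla>h|\<^sup>2\<close>, where \<open>PF\<close> is the average of \<open>F\<close>. The inequality for \<open>PF\<close> costs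
  another \<open>Q\<^sup>2 / PF\<close> with \<open>Q\<close> the average of \<open>h * \<nabla>h\<close>. Since the
  integral of \<open>R + R\<close> is the right-hand side, the total gain is the integral of \<open>R - Q\<^sup>2 / PF\<close>, a Cauchy-Schwarz
  gap. The summand \<open>e\<close> keeps \<open>F\<close> away from zero; it does not affect the gradient.
\<close>

lemma gauss_logsob_deficit:
  fixes h :: "'a::euclidean_space \<Rightarrow> real" and D :: "'a \<Rightarrow> 'a \<Rightarrow> real"
  assumes der: "\<And>x b t. b \<in> Basis \<Longrightarrow> ((\<lambda>t. h (x + t *\<^sub>R b)) has_real_derivative D b (x + t *\<^sub>R b)) (at t)"
    and ch: "continuous_on UNIV h" and cD: "\<And>b. b \<in> Basis \<Longrightarrow> continuous_on UNIV (D b)"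
    and B: "\<And>x. \<bar>h x\<bar> \<le> B" "\<And>x b. b \<in> Basis \<Longrightarrow> \<bar>D b x\<bar> \<le> B"
    and e: "0 < e"
  defines "m \<equiv> (\<integral>x. (h x)\<^sup>2 + e \<partial>gaussE)"
  shows "(\<integral>x. ((h x)\<^sup>2 + e) * ln ((h x)\<^sup>2 + e) \<partial>gaussE) - m * ln m
     + (\<Sum>b\<in>Basis. \<integral>t. mehler (\<lambda>x. (D b x)\<^sup>2) t - (mehler (\<lambda>x. h x * D b x) t)\<^sup>2 / (mehler (\<lambda>x. (h x)\<^sup>2) t + e) \<partial>gaussE)
     \<le> 2 * (\<Sum>b\<in>Basis. \<integral>x. (D b x)\<^sup>2 \<partial>gaussE)"
    and "\<And>b. b \<in> Basis \<Longrightarrow> integrable gaussE (\<lambda>t. mehler (\<lambda>x. (D b x)\<^sup>2) t - (mehler (\<lambda>x. h x * D b x) t)\<^sup>2 / (mehler (\<lambda>x. (h x)\<^sup>2) t + e))"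
proof -
  define F where "F x = (h x)\<^sup>2 + e" for x
  have B0: "0 \<le> B" using B(1)[of 0] by linarith
  have h2: "(h x)\<^sup>2 \<le> B\<^sup>2" for x using B(1)[of x] B0 abs_le_square_iff[of "h x" B] by simp
  have D2: "(D b x)\<^sup>2 \<le> B\<^sup>2" if "b \<in> Basis" for b x using B(2)[OF that, of x] B0 abs_le_square_iff[of "D b x" B] by simp
  have hD: "\<bar>h x * D b x\<bar> \<le> B\<^sup>2" if "b \<in> Basis" for b x
    unfolding abs_mult power2_eq_square using B(1) B(2)[OF that] B0 by (intro mult_mono) auto
  have mh[measurable]: "h \<in> borel_measurable borel" using ch by (rule borel_measurable_continuous_onI)
  have mD: "D b \<in> borel_measurable borel" if "b \<in> Basis" for b using cD[OF that] by (rule borel_measurable_continuous_onI)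
  have mF[measurable]: "F \<in> borel_measurable borel" unfolding F_def[abs_def] by measurable
  have Fe: "e \<le> F x" "0 < F x" "F x \<le> B\<^sup>2 + e" for x using h2[of x] e by (auto simp: F_def add_nonneg_pos)
  have FB: "\<bar>F x\<bar> \<le> B\<^sup>2 + e" for x using Fe[of x] by simp
  have cF: "continuous_on UNIV F" unfolding F_def[abs_def] by (intro continuous_intros ch)
  have Fd: "((\<lambda>t. F (x + t *\<^sub>R b)) has_real_derivative 2 * (h (x + t *\<^sub>R b) * D b (x + t *\<^sub>R b))) (at t)" if "b \<in> Basis" for x b t
    unfolding F_def[abs_def] by (rule derivative_eq_intros der[OF that] refl)+ (simp add: power2_eq_square)
  have lnb: "\<bar>H * ln H\<bar> \<le> (B\<^sup>2 + e) * (\<bar>ln e\<bar> + \<bar>ln (B\<^sup>2 + e)\<bar>)" if "e \<le> H" "H \<le> B\<^sup>2 + e" for H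
  proof -
    have "ln e \<le> ln H" "ln H \<le> ln (B\<^sup>2 + e)" using e that by auto
    then have "\<bar>ln H\<bar> \<le> \<bar>ln e\<bar> + \<bar>ln (B\<^sup>2 + e)\<bar>" by linarith
    then show ?thesis unfolding abs_mult using e that by (intro mult_mono) auto
  qed
  define Cl where "Cl = (B\<^sup>2 + e) * (\<bar>ln e\<bar> + \<bar>ln (B\<^sup>2 + e)\<bar>)"
  have mFl: "(\<lambda>x. F x * ln (F x)) \<in> borel_measurable borel" by measurable
  have FlB: "\<bar>F x * ln (F x)\<bar> \<le> Cl" for x unfolding Cl_def by (rule lnb[OF Fe(1,3)])
  define PF where "PF = mehler F"
  have PFb: "e \<le> PF t" "PF t \<le> B\<^sup>2 + e" for t
    unfolding PF_def using Fe mehler_bounds[OF mF FB] by auto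
  have PFp: "0 < PF t" for t using PFb(1)[of t] e by linarith
  have PFeq: "PF t = mehler (\<lambda>x. (h x)\<^sup>2) t + e" for t
  proof -
    have "integrable gaussE (\<lambda>s. (h (rsqrt2 *\<^sub>R (s + t)))\<^sup>2)"
      by (rule integrable_mehler_bounded[where B="B\<^sup>2"]) (use h2 in auto)
    then show ?thesis by (simp add: PF_def mehler_def F_def)
  qed
  have cPF: "continuous_on UNIV PF" unfolding PF_def by (rule continuous_mehler[OF cF FB])
  have mPF[measurable]: "PF \<in> borel_measurable borel" using cPF by (rule borel_measurable_continuous_onI)
  define Q where "Q b = mehler (\<lambda>x. h x * D b x)" for b
  have chD: "continuous_on UNIV (\<lambda>x. h x * D b x)" if "b \<in> Basis" for b by (intro continuous_intros ch cD that)
  have cQ: "continuous_on UNIV (Q b)" if "b \<in> Basis" for b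
    unfolding Q_def by (rule continuous_mehler[OF chD[OF that] hD[OF that]])
  have mQ: "Q b \<in> borel_measurable borel" if "b \<in> Basis" for b using cQ[OF that] by (rule borel_measurable_continuous_onI)
  have mhD: "(\<lambda>x. h x * D b x) \<in> borel_measurable borel" if "b \<in> Basis" for b
    using chD[OF that] by (rule borel_measurable_continuous_onI)
  have QB: "\<bar>Q b t\<bar> \<le> B\<^sup>2" if "b \<in> Basis" for b t
    unfolding Q_def by (rule mehler_bounds(3)[OF mhD[OF that] hD[OF that]])
  have PFd: "((\<lambda>t. PF (x + t *\<^sub>R b)) has_real_derivative rsqrt2 * (2 * Q b (x + t *\<^sub>R b))) (at t)" if b: "b \<in> Basis" for x b t
  proof -
    have "((\<lambda>t. PF (x + t *\<^sub>R b)) has_real_derivative rsqrt2 * mehler (\<lambda>x. 2 * (h x * D b x)) (x + t *\<^sub>R b)) (at t)"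
      unfolding PF_def
    proof (rule mehler_has_derivative[OF Fd[OF b] cF, where B="2 * B\<^sup>2 + e"])
      show "\<bar>F x\<bar> \<le> 2 * B\<^sup>2 + e" for x using FB[of x] zero_le_power2[of B] by linarith
      show "\<bar>2 * (h x * D b x)\<bar> \<le> 2 * B\<^sup>2 + e" for x using hD[OF b, of x] e by linarith
    qed (intro continuous_intros ch cD b)
    moreover have "mehler (\<lambda>x. 2 * (h x * D b x)) t = 2 * Q b t" for t by (simp add: Q_def mehler_def)
    ultimately show ?thesis by simp
  qed
  define R where "R b = mehler (\<lambda>x. (D b x)\<^sup>2)" for b
  have mD2: "(\<lambda>x. (D b x)\<^sup>2) \<in> borel_measurable borel" if "b \<in> Basis" for b using mD[OF that] by measurable
  have iD2: "integrable gaussE (\<lambda>x. (D b x)\<^sup>2)" if "b \<in> Basis" for b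
    by (rule integrable_gaussE_bounded[OF mD2[OF that], where B="B\<^sup>2"]) (use D2[OF that] in auto)
  have iR: "integrable gaussE (R b)" and R_eq: "(\<integral>t. R b t \<partial>gaussE) = (\<integral>x. (D b x)\<^sup>2 \<partial>gaussE)" if "b \<in> Basis" for b
    unfolding R_def using integral_mehler[OF iD2[OF that]] by auto
  have iFl: "integrable gaussE (\<lambda>x. F x * ln (F x))" by (rule integrable_gaussE_bounded[OF mFl FlB])
  have slice: "mehler (\<lambda>x. F x * ln (F x)) t \<le> PF t * ln (PF t) + (\<Sum>b\<in>Basis. R b t)" for t
  proof -
    define A where "A s = rsqrt2 *\<^sub>R (s + t)" for s
    have cA: "continuous_on UNIV A" unfolding A_def[abs_def] by (intro continuous_intros)
    have [measurable]: "A \<in> borel_measurable borel" using cA by (rule borel_measurable_continuous_onI)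
    have "(\<integral>s. F (A s) * ln (F (A s)) \<partial>gaussE) \<le> (\<integral>s. F (A s) \<partial>gaussE) * ln (\<integral>s. F (A s) \<partial>gaussE)
      + (\<Sum>b\<in>Basis. \<integral>s. (rsqrt2 * (2 * (h (A s) * D b (A s))))\<^sup>2 / F (A s) \<partial>gaussE) / 2"
    proof (rule gauss_logsob[where \<delta>=e and B="2 * B\<^sup>2 + e"])
      fix x b t' assume b: "b \<in> (Basis :: 'a set)"
      have A_eq: "A (x + t' *\<^sub>R b) = A x + (rsqrt2 * t') *\<^sub>R b" for t' by (simp add: A_def scaleR_add_right add_ac)
      have "((\<lambda>u. F (A x + (rsqrt2 * u) *\<^sub>R b)) has_real_derivative 2 * (h (A x + (rsqrt2 * t') *\<^sub>R b) * D b (A x + (rsqrt2 * t') *\<^sub>R b)) * rsqrt2) (at t')"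
        by (rule DERIV_chain2[OF Fd[OF b]]) (auto intro!: derivative_eq_intros)
      then show "((\<lambda>t. F (A (x + t *\<^sub>R b))) has_real_derivative rsqrt2 * (2 * (h (A (x + t' *\<^sub>R b)) * D b (A (x + t' *\<^sub>R b))))) (at t')"
        unfolding A_eq by (simp add: mult_ac)
    next
      show "continuous_on UNIV (\<lambda>x. F (A x))" by (rule continuous_on_compose2[OF cF cA]) auto
      show "continuous_on UNIV (\<lambda>s. rsqrt2 * (2 * (h (A s) * D b (A s))))" if "b \<in> Basis" for b
        by (intro continuous_intros continuous_on_compose2[OF ch cA] continuous_on_compose2[OF cD[OF that] cA]) auto
      show "F (A x) \<le> 2 * B\<^sup>2 + e" for x using Fe(3)[of "A x"] zero_le_power2[of B] by linarith
      show "\<bar>rsqrt2 * (2 * (h (A x) * D b (A x)))\<bar> \<le> 2 * B\<^sup>2 + e" if "b \<in> Basis" for x b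
      proof -
        have "rsqrt2 \<le> 1" by (simp add: rsqrt2_def)
        then have "\<bar>rsqrt2 * (2 * (h (A x) * D b (A x)))\<bar> \<le> \<bar>2 * (h (A x) * D b (A x))\<bar>"
          using rsqrt2(1) by (subst abs_mult) (auto intro!: mult_left_le_one_le)
        then show ?thesis using hD[OF that, of "A x"] e by linarith
      qed
    qed (use e Fe in auto)
    also have "(\<Sum>b\<in>Basis. \<integral>s. (rsqrt2 * (2 * (h (A s) * D b (A s))))\<^sup>2 / F (A s) \<partial>gaussE) / 2 \<le> (\<Sum>b\<in>Basis. R b t)"
      unfolding sum_divide_distrib
    proof (rule sum_mono)
      fix b assume b: "b \<in> (Basis :: 'a set)"
      have [measurable]: "D b \<in> borel_measurable borel" by (rule mD[OF b])
      have pt: "(rsqrt2 * (2 * (h x * D b x)))\<^sup>2 / F x \<le> 2 * (D b x)\<^sup>2" for x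
      proof -
        have "(rsqrt2 * (2 * (h x * D b x)))\<^sup>2 = 2 * (h x)\<^sup>2 * (D b x)\<^sup>2"
          by (simp add: power_mult_distrib rsqrt2)
        also have "\<dots> \<le> 2 * F x * (D b x)\<^sup>2" using e by (intro mult_right_mono) (auto simp: F_def)
        finally show ?thesis using Fe(2)[of x] by (simp add: divide_le_eq mult_ac)
      qed
      have iDA: "integrable gaussE (\<lambda>s. (D b (A s))\<^sup>2)"
        unfolding A_def by (rule integrable_mehler_bounded[OF mD2[OF b], where B="B\<^sup>2"]) (use D2[OF b] in auto)
      have "(\<integral>s. (rsqrt2 * (2 * (h (A s) * D b (A s))))\<^sup>2 / F (A s) \<partial>gaussE) \<le> (\<integral>s. 2 * (D b (A s))\<^sup>2 \<partial>gaussE)"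
      proof (rule integral_mono[OF _ _ pt])
        show "integrable gaussE (\<lambda>s. (rsqrt2 * (2 * (h (A s) * D b (A s))))\<^sup>2 / F (A s))"
        proof (rule integrable_gaussE_bounded[where B="2 * B\<^sup>2"])
          show "\<bar>(rsqrt2 * (2 * (h (A s) * D b (A s))))\<^sup>2 / F (A s)\<bar> \<le> 2 * B\<^sup>2" for s
            using pt[of "A s"] D2[OF b, of "A s"] Fe(2)[of "A s"] by (simp add: abs_of_nonneg)
        qed measurable
      qed (use iDA in simp)
      then show "(\<integral>s. (rsqrt2 * (2 * (h (A s) * D b (A s))))\<^sup>2 / F (A s) \<partial>gaussE) / 2 \<le> R b t"
        by (simp add: R_def mehler_def A_def)
    qed
    finally show ?thesis by (simp add: A_def mehler_def PF_def)
  qed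
  have marg: "(\<integral>t. PF t * ln (PF t) \<partial>gaussE) \<le> m * ln m + (\<Sum>b\<in>Basis. \<integral>t. (Q b t)\<^sup>2 / PF t \<partial>gaussE)"
  proof -
    have mm: "(\<integral>t. PF t \<partial>gaussE) = m"
      unfolding PF_def m_def F_def[symmetric] by (rule integral_mehler(1)) (rule integrable_gaussE_bounded[OF mF FB])
    have "(\<integral>t. PF t * ln (PF t) \<partial>gaussE) \<le> (\<integral>t. PF t \<partial>gaussE) * ln (\<integral>t. PF t \<partial>gaussE)
        + (\<Sum>b\<in>Basis. \<integral>t. (rsqrt2 * (2 * Q b t))\<^sup>2 / PF t \<partial>gaussE) / 2"
    proof (rule gauss_logsob[OF PFd cPF _ e PFb(1), where B="2 * B\<^sup>2 + e"])
      show "continuous_on UNIV (\<lambda>t. rsqrt2 * (2 * Q b t))" if "b \<in> Basis" for b by (intro continuous_intros cQ that)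
      show "PF t \<le> 2 * B\<^sup>2 + e" for t using PFb(2)[of t] zero_le_power2[of B] by linarith
      show "\<bar>rsqrt2 * (2 * Q b t)\<bar> \<le> 2 * B\<^sup>2 + e" if "b \<in> Basis" for b t
      proof -
        have "rsqrt2 \<le> 1" by (simp add: rsqrt2_def)
        then have "\<bar>rsqrt2 * (2 * Q b t)\<bar> \<le> \<bar>2 * Q b t\<bar>"
          using rsqrt2(1) by (subst abs_mult) (auto intro!: mult_left_le_one_le)
        then show ?thesis using QB[OF that, of t] e by linarith
      qed
    qed
    also have "(\<Sum>b\<in>Basis. \<integral>t. (rsqrt2 * (2 * Q b t))\<^sup>2 / PF t \<partial>gaussE) / 2 = (\<Sum>b\<in>Basis. \<integral>t. (Q b t)\<^sup>2 / PF t \<partial>gaussE)"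
    proof -
      have "(rsqrt2 * (2 * q))\<^sup>2 / p = 2 * (q\<^sup>2 / p)" for q p :: real by (simp add: power_mult_distrib rsqrt2)
      then show ?thesis by (simp only: integral_mult_right_zero sum_distrib_left[symmetric])
    qed
    finally show ?thesis by (simp add: mm)
  qed
  have iQ: "integrable gaussE (\<lambda>t. (Q b t)\<^sup>2 / PF t)" if b: "b \<in> Basis" for b
  proof (rule integrable_gaussE_bounded[where B="(B\<^sup>2)\<^sup>2 / e"])
    have [measurable]: "Q b \<in> borel_measurable borel" by (rule mQ[OF b])
    show "(\<lambda>t. (Q b t)\<^sup>2 / PF t) \<in> borel_measurable borel" by measurable
    show "\<bar>(Q b t)\<^sup>2 / PF t\<bar> \<le> (B\<^sup>2)\<^sup>2 / e" for t
    proof -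
      have "(Q b t)\<^sup>2 \<le> (B\<^sup>2)\<^sup>2" using QB[OF b, of t] abs_le_square_iff[of "Q b t" "B\<^sup>2"] by simp
      then show ?thesis using PFb(1)[of t] PFp[of t] e by (simp add: frac_le)
    qed
  qed
  have iPl: "integrable gaussE (\<lambda>t. PF t * ln (PF t))"
    by (rule integrable_gaussE_bounded[where B=Cl]) (use lnb[OF PFb] in \<open>auto simp: Cl_def\<close>)
  have "(\<integral>x. F x * ln (F x) \<partial>gaussE) = (\<integral>t. mehler (\<lambda>x. F x * ln (F x)) t \<partial>gaussE)"
    by (rule integral_mehler(1)[OF iFl, symmetric])
  also have "\<dots> \<le> (\<integral>t. PF t * ln (PF t) + (\<Sum>b\<in>Basis. R b t) \<partial>gaussE)"
    by (rule integral_mono[OF integral_mehler(2)[OF iFl] _ slice]) (intro Bochner_Integration.integrable_add iPl Bochner_Integration.integrable_sum iR)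
  also have "\<dots> = (\<integral>t. PF t * ln (PF t) \<partial>gaussE) + (\<Sum>b\<in>Basis. \<integral>x. (D b x)\<^sup>2 \<partial>gaussE)"
  proof -
    have "(\<integral>t. PF t * ln (PF t) + (\<Sum>b\<in>Basis. R b t) \<partial>gaussE) = (\<integral>t. PF t * ln (PF t) \<partial>gaussE) + (\<integral>t. (\<Sum>b\<in>Basis. R b t) \<partial>gaussE)"
      by (intro Bochner_Integration.integral_add iPl Bochner_Integration.integrable_sum iR)
    also have "(\<integral>t. (\<Sum>b\<in>Basis. R b t) \<partial>gaussE) = (\<Sum>b\<in>Basis. \<integral>t. R b t \<partial>gaussE)"
      by (rule Bochner_Integration.integral_sum[OF iR])
    finally show ?thesis by (simp add: R_eq)
  qed
  also have "\<dots> \<le> m * ln m + (\<Sum>b\<in>Basis. \<integral>t. (Q b t)\<^sup>2 / PF t \<partial>gaussE) + (\<Sum>b\<in>Basis. \<integral>x. (D b x)\<^sup>2 \<partial>gaussE)"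
    using marg by simp
  finally have fin: "(\<integral>x. F x * ln (F x) \<partial>gaussE) \<le> \<dots>" .
  have "(\<Sum>b\<in>Basis. \<integral>t. R b t - (Q b t)\<^sup>2 / PF t \<partial>gaussE)
      = (\<Sum>b\<in>Basis. \<integral>x. (D b x)\<^sup>2 \<partial>gaussE) - (\<Sum>b\<in>Basis. \<integral>t. (Q b t)\<^sup>2 / PF t \<partial>gaussE)"
    unfolding sum_subtractf[symmetric] using iR iQ R_eq by (intro sum.cong refl) simp
  with fin show "(\<integral>x. ((h x)\<^sup>2 + e) * ln ((h x)\<^sup>2 + e) \<partial>gaussE) - m * ln m
     + (\<Sum>b\<in>Basis. \<integral>t. mehler (\<lambda>x. (D b x)\<^sup>2) t - (mehler (\<lambda>x. h x * D b x) t)\<^sup>2 / (mehler (\<lambda>x. (h x)\<^sup>2) t + e) \<partial>gaussE)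
     \<le> 2 * (\<Sum>b\<in>Basis. \<integral>x. (D b x)\<^sup>2 \<partial>gaussE)"
    by (simp add: F_def[symmetric] PFeq[symmetric] Q_def[symmetric] R_def[symmetric])
  show "integrable gaussE (\<lambda>t. mehler (\<lambda>x. (D b x)\<^sup>2) t - (mehler (\<lambda>x. h x * D b x) t)\<^sup>2 / (mehler (\<lambda>x. (h x)\<^sup>2) t + e))"
    if "b \<in> Basis" for b
    using Bochner_Integration.integrable_diff[OF iR[OF that] iQ[OF that]] unfolding PFeq Q_def R_def .
qed

section \<open>Square-integrable functions and compactly supported functions\<close>

definition l2 :: "'a measure \<Rightarrow> ('a \<Rightarrow> real) \<Rightarrow> bool" where
  "l2 M f \<longleftrightarrow> f \<in> borel_measurable M \<and> integrable M (\<lambda>x. (f x)\<^sup>2)"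

lemma l2_measurable [measurable_dest]: "l2 M f \<Longrightarrow> f \<in> borel_measurable M"
  by (simp add: l2_def)

lemma l2_square: "l2 M f \<Longrightarrow> integrable M (\<lambda>x. (f x)\<^sup>2)"
  by (simp add: l2_def)

lemma l2_bound:
  assumes "l2 M f" "g \<in> borel_measurable M" "\<And>x. \<bar>g x\<bar> \<le> C * \<bar>f x\<bar>"
  shows "l2 M g"
  unfolding l2_def
proof
  show "integrable M (\<lambda>x. (g x)\<^sup>2)"
  proof (rule Bochner_Integration.integrable_bound[OF integrable_mult_right[OF l2_square[OF assms(1)], of "C\<^sup>2"]])
    show "AE x in M. norm ((g x)\<^sup>2) \<le> norm (C\<^sup>2 * (f x)\<^sup>2)"
    proof (rule AE_I2)
      fix x
      have "\<bar>g x\<bar>\<^sup>2 \<le> (C * \<bar>f x\<bar>)\<^sup>2" using assms(3) by (intro power_mono) auto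
      then show "norm ((g x)\<^sup>2) \<le> norm (C\<^sup>2 * (f x)\<^sup>2)" by (simp add: power_mult_distrib)
    qed
  qed (use assms(2) in measurable)
qed fact

lemma l2_mult_integrable:
  assumes "l2 M f" "l2 M g"
  shows "integrable M (\<lambda>x. f x * g x)"
proof (rule Bochner_Integration.integrable_bound[OF Bochner_Integration.integrable_add[OF l2_square[OF assms(1)] l2_square[OF assms(2)]]])
  show "AE x in M. norm (f x * g x) \<le> norm ((f x)\<^sup>2 + (g x)\<^sup>2)"
  proof (rule AE_I2)
    fix x
    have "2 * \<bar>f x\<bar> * \<bar>g x\<bar> \<le> \<bar>f x\<bar>\<^sup>2 + \<bar>g x\<bar>\<^sup>2" by (rule sum_squares_bound)
    moreover have "0 \<le> \<bar>f x\<bar> * \<bar>g x\<bar>" by simp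
    ultimately have "\<bar>f x\<bar> * \<bar>g x\<bar> \<le> \<bar>f x\<bar>\<^sup>2 + \<bar>g x\<bar>\<^sup>2" by linarith
    then show "norm (f x * g x) \<le> norm ((f x)\<^sup>2 + (g x)\<^sup>2)"
      by (simp add: abs_mult)
  qed
qed (use assms in measurable)

lemma l2_add: assumes "l2 M f" "l2 M g" shows "l2 M (\<lambda>x. f x + g x)"
proof -
  have "integrable M (\<lambda>x. (f x)\<^sup>2 + (g x)\<^sup>2 + 2 * (f x * g x))"
    using l2_square[OF assms(1)] l2_square[OF assms(2)] l2_mult_integrable[OF assms] by auto
  then show ?thesis using assms by (auto simp: l2_def power2_sum mult.assoc)
qed

lemma l2_cmult: "l2 M f \<Longrightarrow> l2 M (\<lambda>x. c * f x)"
  by (auto simp: l2_def power_mult_distrib)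

lemma l2_diff: "l2 M f \<Longrightarrow> l2 M g \<Longrightarrow> l2 M (\<lambda>x. f x - g x)"
  using l2_add[of M f "\<lambda>x. (-1) * g x"] l2_cmult[of M g "-1"] by simp

lemma l2_cauchy_schwarz:
  assumes f: "l2 M f" and g: "l2 M g"
  shows "(\<integral>x. f x * g x \<partial>M)\<^sup>2 \<le> (\<integral>x. (f x)\<^sup>2 \<partial>M) * (\<integral>x. (g x)\<^sup>2 \<partial>M)"
proof -
  define a b c where "a = (\<integral>x. (f x)\<^sup>2 \<partial>M)" and "b = (\<integral>x. f x * g x \<partial>M)" and "c = (\<integral>x. (g x)\<^sup>2 \<partial>M)"
  have q: "0 \<le> s\<^sup>2 * a + 2 * s * t * b + t\<^sup>2 * c" for s t
  proof -
    have "0 \<le> (\<integral>x. (s * f x + t * g x)\<^sup>2 \<partial>M)" by simp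
    also have "\<dots> = (\<integral>x. s\<^sup>2 * (f x)\<^sup>2 + 2 * s * t * (f x * g x) + t\<^sup>2 * (g x)\<^sup>2 \<partial>M)"
      by (simp add: power2_eq_square algebra_simps)
    also have "\<dots> = s\<^sup>2 * a + 2 * s * t * b + t\<^sup>2 * c"
      using l2_square[OF f] l2_square[OF g] l2_mult_integrable[OF f g]
      by (simp add: a_def b_def c_def)
    finally show ?thesis .
  qed
  have c0: "0 \<le> c" unfolding c_def by simp
  have "b\<^sup>2 \<le> a * c"
  proof (cases "c = 0")
    case True
    have "b = 0"
    proof (rule ccontr)
      assume "b \<noteq> 0"
      have "0 \<le> a + 2 * (- (a + 1) / (2 * b)) * b" using q[of 1 "- (a + 1) / (2 * b)"] True by simp
      also have "a + 2 * (- (a + 1) / (2 * b)) * b = -1" using \<open>b \<noteq> 0\<close> by (simp add: field_simps)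
      finally show False by simp
    qed
    then show ?thesis using True by simp
  next
    case False
    then have "0 < c" using c0 by simp
    have "0 \<le> c\<^sup>2 * a + 2 * c * (-b) * b + (-b)\<^sup>2 * c" by (rule q)
    also have "\<dots> = c * (a * c - b\<^sup>2)" by (simp add: algebra_simps power2_eq_square)
    finally show ?thesis using \<open>0 < c\<close> by (simp add: zero_le_mult_iff)
  qed
  then show ?thesis by (simp add: a_def b_def c_def)
qed

text \<open>
  Convergence in the norm of square-integrable functions, phrased for functions rather than equivalence classes.
\<close>

definition l2conv :: "'a measure \<Rightarrow> (nat \<Rightarrow> 'a \<Rightarrow> real) \<Rightarrow> ('a \<Rightarrow> real) \<Rightarrow> bool" where
  "l2conv M fs f \<longleftrightarrow> (\<forall>j. l2 M (fs j)) \<and> l2 M f \<and> (\<lambda>j. \<integral>x. (fs j x - f x)\<^sup>2 \<partial>M) \<longlonglongrightarrow> 0"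

lemma l2conv_add:
  assumes "l2conv M fs f" "l2conv M gs g"
  shows "l2conv M (\<lambda>j x. fs j x + gs j x) (\<lambda>x. f x + g x)"
  unfolding l2conv_def
proof (intro conjI allI)
  have f: "l2 M (fs j)" "l2 M f" "l2 M (gs j)" "l2 M g" for j using assms by (auto simp: l2conv_def)
  show "l2 M (\<lambda>x. fs j x + gs j x)" "l2 M (\<lambda>x. f x + g x)" for j using f by (auto intro: l2_add)
  show "(\<lambda>j. \<integral>x. (fs j x + gs j x - (f x + g x))\<^sup>2 \<partial>M) \<longlonglongrightarrow> 0"
  proof (rule tendsto_sandwich[OF _ _ tendsto_const])
    show "(\<lambda>j. 2 * (\<integral>x. (fs j x - f x)\<^sup>2 \<partial>M) + 2 * (\<integral>x. (gs j x - g x)\<^sup>2 \<partial>M)) \<longlonglongrightarrow> 0"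
      using assms by (auto simp: l2conv_def intro!: tendsto_eq_intros)
    show "\<forall>\<^sub>F j in sequentially. (\<integral>x. (fs j x + gs j x - (f x + g x))\<^sup>2 \<partial>M) \<le> 2 * (\<integral>x. (fs j x - f x)\<^sup>2 \<partial>M) + 2 * (\<integral>x. (gs j x - g x)\<^sup>2 \<partial>M)"
    proof (rule always_eventually, rule allI)
      fix j
      have i: "integrable M (\<lambda>x. (fs j x - f x)\<^sup>2)" "integrable M (\<lambda>x. (gs j x - g x)\<^sup>2)"
        using f by (auto intro!: l2_square l2_diff)
      have "(\<integral>x. (fs j x + gs j x - (f x + g x))\<^sup>2 \<partial>M) \<le> (\<integral>x. 2 * (fs j x - f x)\<^sup>2 + 2 * (gs j x - g x)\<^sup>2 \<partial>M)"
      proof (rule integral_mono)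
        show "integrable M (\<lambda>x. (fs j x + gs j x - (f x + g x))\<^sup>2)"
          using f by (auto intro!: l2_square l2_diff l2_add)
        show "(fs j x + gs j x - (f x + g x))\<^sup>2 \<le> 2 * (fs j x - f x)\<^sup>2 + 2 * (gs j x - g x)\<^sup>2" for x
        proof -
          have "(a + b)\<^sup>2 \<le> 2 * a\<^sup>2 + 2 * b\<^sup>2" for a b :: real
            using zero_le_power2[of "a - b"] by (simp add: power2_eq_square algebra_simps)
          from this[of "fs j x - f x" "gs j x - g x"] show ?thesis by (simp add: algebra_simps)
        qed
      qed (use i in auto)
      also have "\<dots> = 2 * (\<integral>x. (fs j x - f x)\<^sup>2 \<partial>M) + 2 * (\<integral>x. (gs j x - g x)\<^sup>2 \<partial>M)" using i by simp
      finally show "(\<integral>x. (fs j x + gs j x - (f x + g x))\<^sup>2 \<partial>M) \<le> 2 * (\<integral>x. (fs j x - f x)\<^sup>2 \<partial>M) + 2 * (\<integral>x. (gs j x - g x)\<^sup>2 \<partial>M)" .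
    qed
  qed simp
qed

lemma l2conv_bounded_mult:
  assumes c: "l2conv M fs f" and [measurable]: "r \<in> borel_measurable M" and r: "\<And>x. \<bar>r x\<bar> \<le> C"
  shows "l2conv M (\<lambda>j x. r x * fs j x) (\<lambda>x. r x * f x)"
  unfolding l2conv_def
proof (intro conjI allI)
  have f: "l2 M (fs j)" "l2 M f" for j using c by (auto simp: l2conv_def)
  have b: "\<bar>r x * y\<bar> \<le> C * \<bar>y\<bar>" for x y unfolding abs_mult by (rule mult_right_mono[OF r]) simp
  note [measurable] = f[THEN l2_measurable]
  show l: "l2 M (\<lambda>x. r x * fs j x)" "l2 M (\<lambda>x. r x * f x)" for j
    by (rule l2_bound[OF f(1) _ b], measurable) (rule l2_bound[OF f(2) _ b], measurable)
  show "(\<lambda>j. \<integral>x. (r x * fs j x - r x * f x)\<^sup>2 \<partial>M) \<longlonglongrightarrow> 0"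
  proof (rule tendsto_sandwich[OF _ _ tendsto_const])
    show "(\<lambda>j. C\<^sup>2 * (\<integral>x. (fs j x - f x)\<^sup>2 \<partial>M)) \<longlonglongrightarrow> 0"
      using c by (auto simp: l2conv_def intro!: tendsto_eq_intros)
    show "\<forall>\<^sub>F j in sequentially. (\<integral>x. (r x * fs j x - r x * f x)\<^sup>2 \<partial>M) \<le> C\<^sup>2 * (\<integral>x. (fs j x - f x)\<^sup>2 \<partial>M)"
    proof (rule always_eventually, rule allI)
      fix j
      have "(\<integral>x. (r x * fs j x - r x * f x)\<^sup>2 \<partial>M) \<le> (\<integral>x. C\<^sup>2 * (fs j x - f x)\<^sup>2 \<partial>M)"
      proof (rule integral_mono)
        show "integrable M (\<lambda>x. (r x * fs j x - r x * f x)\<^sup>2)" using l by (intro l2_square l2_diff)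
        show "integrable M (\<lambda>x. C\<^sup>2 * (fs j x - f x)\<^sup>2)" using f by (intro integrable_mult_right l2_square l2_diff)
        show "(r x * fs j x - r x * f x)\<^sup>2 \<le> C\<^sup>2 * (fs j x - f x)\<^sup>2" for x
        proof -
          have "\<bar>r x * (fs j x - f x)\<bar>\<^sup>2 \<le> (C * \<bar>fs j x - f x\<bar>)\<^sup>2" by (rule power_mono[OF b]) simp
          then show ?thesis by (simp add: power_mult_distrib right_diff_distrib)
        qed
      qed
      then show "(\<integral>x. (r x * fs j x - r x * f x)\<^sup>2 \<partial>M) \<le> C\<^sup>2 * (\<integral>x. (fs j x - f x)\<^sup>2 \<partial>M)" by simp
    qed
  qed simp
qed

lemma l2conv_square:
  assumes c: "l2conv M fs f"
  shows "(\<lambda>j. \<integral>x. (fs j x)\<^sup>2 \<partial>M) \<longlonglongrightarrow> (\<integral>x. (f x)\<^sup>2 \<partial>M)"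
proof -
  have f: "l2 M (fs j)" "l2 M f" for j using c by (auto simp: l2conv_def)
  have d: "l2 M (\<lambda>x. fs j x - f x)" for j using f by (intro l2_diff)
  define e where "e j = (\<integral>x. (fs j x - f x)\<^sup>2 \<partial>M)" for j
  define p where "p j = (\<integral>x. f x * (fs j x - f x) \<partial>M)" for j
  have e0: "e \<longlonglongrightarrow> 0" using c by (simp add: l2conv_def e_def[abs_def])
  have "(\<lambda>j. sqrt ((\<integral>x. (f x)\<^sup>2 \<partial>M) * e j)) \<longlonglongrightarrow> sqrt ((\<integral>x. (f x)\<^sup>2 \<partial>M) * 0)"
    by (intro tendsto_intros e0)
  then have s: "(\<lambda>j. sqrt ((\<integral>x. (f x)\<^sup>2 \<partial>M) * e j)) \<longlonglongrightarrow> 0" by simp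
  have p0: "p \<longlonglongrightarrow> 0"
  proof (rule Lim_null_comparison[OF _ s], rule always_eventually, rule allI)
    fix j
    show "norm (p j) \<le> sqrt ((\<integral>x. (f x)\<^sup>2 \<partial>M) * e j)"
      using l2_cauchy_schwarz[OF f(2) d[of j]] unfolding p_def e_def by (simp add: real_le_rsqrt)
  qed
  have eq: "(\<integral>x. (fs j x)\<^sup>2 \<partial>M) = (\<integral>x. (f x)\<^sup>2 \<partial>M) + e j + 2 * p j" for j
  proof -
    have "(\<integral>x. (fs j x)\<^sup>2 \<partial>M) = (\<integral>x. (f x)\<^sup>2 + (fs j x - f x)\<^sup>2 + 2 * (f x * (fs j x - f x)) \<partial>M)"
      by (rule Bochner_Integration.integral_cong) (auto simp: power2_eq_square algebra_simps)
    also have "\<dots> = (\<integral>x. (f x)\<^sup>2 \<partial>M) + e j + 2 * p j"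
      using l2_square[OF f(2)] l2_square[OF d] l2_mult_integrable[OF f(2) d]
      by (simp add: e_def p_def)
    finally show ?thesis .
  qed
  have "(\<lambda>j. (\<integral>x. (f x)\<^sup>2 \<partial>M) + e j + 2 * p j) \<longlonglongrightarrow> (\<integral>x. (f x)\<^sup>2 \<partial>M) + 0 + 2 * 0"
    by (intro tendsto_intros e0 p0)
  then show ?thesis by (simp add: eq)
qed

lemma l2conv_mult:
  assumes f: "l2conv M fs f" and g: "l2conv M gs g"
  shows "(\<lambda>j. \<integral>x. fs j x * gs j x \<partial>M) \<longlonglongrightarrow> (\<integral>x. f x * g x \<partial>M)"
proof -
  have pol: "(\<integral>x. a x * b x \<partial>M) = ((\<integral>x. (a x + b x)\<^sup>2 \<partial>M) - (\<integral>x. (a x)\<^sup>2 \<partial>M) - (\<integral>x. (b x)\<^sup>2 \<partial>M)) / 2"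
    if a: "l2 M a" and b: "l2 M b" for a b
  proof -
    have "(\<integral>x. (a x + b x)\<^sup>2 \<partial>M) = (\<integral>x. (a x)\<^sup>2 + (b x)\<^sup>2 + 2 * (a x * b x) \<partial>M)"
      by (simp add: power2_sum mult.assoc)
    also have "\<dots> = (\<integral>x. (a x)\<^sup>2 \<partial>M) + (\<integral>x. (b x)\<^sup>2 \<partial>M) + 2 * (\<integral>x. a x * b x \<partial>M)"
      using l2_square[OF a] l2_square[OF b] l2_mult_integrable[OF a b] by simp
    finally show ?thesis by simp
  qed
  have l: "l2 M (fs j)" "l2 M f" "l2 M (gs j)" "l2 M g" for j using f g by (auto simp: l2conv_def)
  show ?thesis unfolding pol[OF l(1) l(3)] pol[OF l(2) l(4)]
    by (intro tendsto_intros l2conv_square l2conv_add f g) simp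
qed

text \<open>
  Unlike the test functions, this class is closed under multiplication by cutoffs that are only once
  continuously differentiable.
\<close>

definition C1c :: "('a::euclidean_space \<Rightarrow> real) \<Rightarrow> ('a \<Rightarrow> 'a) \<Rightarrow> bool" where
  "C1c w Dw \<longleftrightarrow> (\<forall>x. GDERIV w x :> Dw x) \<and> continuous_on UNIV Dw \<and> (\<exists>R. \<forall>x. R < norm x \<longrightarrow> w x = 0 \<and> Dw x = 0)"

lemma emeasure_cball_less_top: "emeasure lborel (cball (a::'a::euclidean_space) R) < \<top>"
  using emeasure_bounded_finite[OF bounded_cball] by simp

lemma continuous_compact_support:
  fixes f :: "'a::euclidean_space \<Rightarrow> real"
  assumes c: "continuous_on UNIV f" and R: "\<And>x. R < norm x \<Longrightarrow> f x = 0"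
  shows "\<exists>B. \<forall>x. \<bar>f x\<bar> \<le> B" "integrable lborel f" "f \<in> borel_measurable borel"
proof -
  have "compact (f ` cball 0 R)" by (rule compact_continuous_image[OF continuous_on_subset[OF c] compact_cball]) simp
  then obtain B where B: "\<And>x. x \<in> cball 0 R \<Longrightarrow> norm (f x) \<le> B"
    using compact_imp_bounded bounded_iff by (metis imageI)
  have b: "\<bar>f x\<bar> \<le> max B 0" for x
    using B[of x] R[of x] by (cases "norm x \<le> R") (auto simp: not_le le_max_iff_disj)
  then show "\<exists>B. \<forall>x. \<bar>f x\<bar> \<le> B" by blast
  show m[measurable]: "f \<in> borel_measurable borel" using c by (rule borel_measurable_continuous_onI)
  show "integrable lborel f"
  proof (rule Bochner_Integration.integrable_bound[where f="\<lambda>x. max B 0 * indicator (cball 0 R) x"])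
    show "integrable lborel (\<lambda>x::'a. max B 0 * indicator (cball 0 R) x :: real)"
      by (intro integrable_mult_right integrable_real_indicator) (auto simp: emeasure_cball_less_top)
    show "AE x in lborel. norm (f x) \<le> norm (max B 0 * indicator (cball 0 R) x)"
      using b R by (intro AE_I2) (auto simp: indicator_def not_le)
  qed simp
qed

lemma GDERIV_line:
  assumes "\<And>x. GDERIV w x :> Dw x"
  shows "((\<lambda>t. w (x + t *\<^sub>R b)) has_real_derivative Dw (x + t *\<^sub>R b) \<bullet> b) (at t)"
proof -
  have "((\<lambda>t. w (x + t *\<^sub>R b)) has_derivative (\<lambda>h. (h *\<^sub>R b) \<bullet> Dw (x + t *\<^sub>R b))) (at t)"
  proof (rule has_derivative_compose[of "\<lambda>t. x + t *\<^sub>R b" "\<lambda>h. h *\<^sub>R b" t UNIV w])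
    show "((\<lambda>t. x + t *\<^sub>R b) has_derivative (\<lambda>h. h *\<^sub>R b)) (at t)" by (auto intro!: derivative_eq_intros)
    show "(w has_derivative (\<lambda>h. h \<bullet> Dw (x + t *\<^sub>R b))) (at (x + t *\<^sub>R b))"
      using assms[of "x + t *\<^sub>R b"] by (simp add: gderiv_def)
  qed
  moreover have "(\<lambda>h. (h *\<^sub>R b) \<bullet> Dw (x + t *\<^sub>R b)) = (*) (Dw (x + t *\<^sub>R b) \<bullet> b)"
    by (auto simp: inner_commute)
  ultimately show ?thesis by (simp only: has_field_derivative_def)
qed

lemma GDERIV_continuous: "(\<And>x. GDERIV w x :> Dw x) \<Longrightarrow> continuous_on UNIV w"
  unfolding gderiv_def by (intro continuous_at_imp_continuous_on ballI has_derivative_continuous) blast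

lemma C1cD:
  assumes "C1c w Dw"
  shows "GDERIV w x :> Dw x" "continuous_on UNIV w" "continuous_on UNIV Dw" "\<exists>R. \<forall>x. R < norm x \<longrightarrow> w x = 0 \<and> Dw x = 0"
  using assms GDERIV_continuous[of w Dw] by (auto simp: C1c_def)

text \<open>
  Lebesgue measure is translation invariant, so the integral of each difference quotient vanishes; the quotients
  converge boundedly on a fixed ball.
\<close>

lemma integral_partial_eq_0:
  fixes w :: "'a::euclidean_space \<Rightarrow> real"
  assumes w: "C1c w Dw" and b: "b \<in> Basis"
  shows "(\<integral>x. Dw x \<bullet> b \<partial>lborel) = 0"
proof -
  note c = C1cD[OF w]
  obtain R where R: "\<And>x. R < norm x \<Longrightarrow> w x = 0" "\<And>x. R < norm x \<Longrightarrow> Dw x = 0" using c(4) by blast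
  have cb: "continuous_on UNIV (\<lambda>x. Dw x \<bullet> b)" by (intro continuous_intros c(3))
  obtain B where B: "\<And>x. \<bar>Dw x \<bullet> b\<bar> \<le> B" using continuous_compact_support(1)[OF cb, of R] R by auto
  have iw: "integrable lborel w" and mw[measurable]: "w \<in> borel_measurable borel"
    using continuous_compact_support(2,3)[OF c(2), of R] R by auto
  have B0: "0 \<le> B" using B[of 0] by linarith
  define q where "q n x = (w (x + (1 / Suc n) *\<^sub>R b) - w x) / (1 / Suc n)" for n x
  have "(\<lambda>n. \<integral>x. q n x \<partial>lborel) \<longlonglongrightarrow> (\<integral>x. Dw x \<bullet> b \<partial>lborel)"
  proof (rule integral_dominated_convergence[where w="\<lambda>x. B * indicator (cball 0 (R + 1)) x"])
    show "(\<lambda>x. Dw x \<bullet> b) \<in> borel_measurable lborel" using borel_measurable_continuous_onI[OF cb] by simp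
    show "q n \<in> borel_measurable lborel" for n unfolding q_def[abs_def] by measurable
    show "integrable lborel (\<lambda>x::'a. B * indicator (cball 0 (R + 1)) x :: real)"
      by (intro integrable_mult_right integrable_real_indicator) (auto simp: emeasure_cball_less_top)
    show "AE x in lborel. (\<lambda>n. q n x) \<longlonglongrightarrow> Dw x \<bullet> b"
    proof (rule AE_I2)
      fix x
      have "((\<lambda>t. w (x + t *\<^sub>R b)) has_real_derivative Dw (x + 0 *\<^sub>R b) \<bullet> b) (at 0)" by (rule GDERIV_line[OF c(1)])
      then have "((\<lambda>h. (w (x + h *\<^sub>R b) - w x) / h) \<longlongrightarrow> Dw x \<bullet> b) (at 0)" by (simp add: DERIV_def)
      moreover have "filterlim (\<lambda>n. 1 / real (Suc n)) (at 0) sequentially"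
        by (rule filterlim_atI) (use LIMSEQ_inverse_real_of_nat in \<open>auto simp: inverse_eq_divide\<close>)
      ultimately have "(\<lambda>n. (w (x + (1 / real (Suc n)) *\<^sub>R b) - w x) / (1 / real (Suc n))) \<longlonglongrightarrow> Dw x \<bullet> b"
        by (rule filterlim_compose)
      then show "(\<lambda>n. q n x) \<longlonglongrightarrow> Dw x \<bullet> b" by (simp add: q_def)
    qed
    show "AE x in lborel. norm (q n x) \<le> B * indicator (cball 0 (R + 1)) x" for n
    proof (rule AE_I2)
      fix x
      define h where "h = 1 / real (Suc n)"
      have h: "0 < h" "h \<le> 1" by (auto simp: h_def)
      show "norm (q n x) \<le> B * indicator (cball 0 (R + 1)) x"
      proof (cases "norm x \<le> R + 1")
        case True
        have "norm (w (x + h *\<^sub>R b) - w (x + 0 *\<^sub>R b)) \<le> B * norm (h - 0)"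
          by (rule field_differentiable_bound[of UNIV "\<lambda>t. w (x + t *\<^sub>R b)" "\<lambda>t. Dw (x + t *\<^sub>R b) \<bullet> b"])
            (use GDERIV_line[OF c(1)] B in auto)
        then show ?thesis using True h by (simp add: q_def h_def[symmetric] divide_le_eq del: of_nat_Suc)
      next
        case False
        have "norm x \<le> norm (x + h *\<^sub>R b) + norm (h *\<^sub>R b)" using norm_triangle_ineq4[of "x + h *\<^sub>R b" "h *\<^sub>R b"] by simp
        also have "norm (h *\<^sub>R b) \<le> 1" using h b by simp
        finally have "R < norm (x + h *\<^sub>R b)" using False by linarith
        then show ?thesis using False R(1)[of x] R(1)[of "x + h *\<^sub>R b"] by (simp add: q_def h_def[symmetric] del: of_nat_Suc)
      qed
    qed
  qed
  moreover have "(\<integral>x. q n x \<partial>lborel) = 0" for n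
  proof -
    have t: "(\<integral>x. w (x + (1 / Suc n) *\<^sub>R b) \<partial>lborel) = (\<integral>x. w x \<partial>lborel)"
      by (subst (2) integral_lborel_affine[where c=1 and t="(1 / Suc n) *\<^sub>R b"]) (simp_all add: add.commute)
    have i: "integrable lborel (\<lambda>x. w (x + (1 / Suc n) *\<^sub>R b))"
      using iw by (subst (asm) integrable_lborel_affine[where c=1 and t="(1 / Suc n) *\<^sub>R b"]) (simp_all add: add.commute)
    have "(\<integral>x. q n x \<partial>lborel) = (\<integral>x. w (x + (1 / Suc n) *\<^sub>R b) - w x \<partial>lborel) / (1 / Suc n)"
      unfolding q_def by (rule integral_divide_zero)
    also have "(\<integral>x. w (x + (1 / Suc n) *\<^sub>R b) - w x \<partial>lborel) = 0"
      using t by (subst Bochner_Integration.integral_diff[OF i iw]) simp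
    finally show ?thesis by simp
  qed
  ultimately show ?thesis by (simp add: LIMSEQ_const_iff)
qed

section \<open>From the Gaussian measure to Lebesgue measure\<close>

definition inv_sqrt_gauss :: "'a::euclidean_space \<Rightarrow> real" where
  "inv_sqrt_gauss x = 1 / sqrt (gauss_dens x)"

lemma inv_sqrt_gauss_sq: "(inv_sqrt_gauss x)\<^sup>2 = 1 / gauss_dens x"
  using gauss_dens_pos[of x] by (simp add: inv_sqrt_gauss_def power_divide)

lemma GDERIV_norm_sq: "GDERIV (\<lambda>x::'a::real_inner. (norm x)\<^sup>2) x :> 2 *\<^sub>R x"
  unfolding gderiv_def power2_norm_eq_inner
  by (auto intro!: derivative_eq_intros simp: inner_commute)

lemma inv_sqrt_gauss_eq:
  "inv_sqrt_gauss (x::'a::euclidean_space) = (1 / sqrt ((1 / sqrt (2 * pi)) ^ DIM('a))) * exp ((norm x)\<^sup>2 / 4)"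
proof -
  have "sqrt (exp (- (norm x)\<^sup>2 / 2)) = exp (- (norm x)\<^sup>2 / 4)"
    by (rule real_sqrt_unique) (simp_all add: power2_eq_square flip: exp_add)
  moreover have "1 / (a * exp (- n / 4)) = (1 / a) * exp (n / 4)" for a n :: real
    by (simp add: exp_minus field_simps)
  ultimately show ?thesis
    unfolding inv_sqrt_gauss_def gauss_dens_def real_sqrt_mult by simp
qed

lemma GDERIV_inv_sqrt_gauss: "GDERIV inv_sqrt_gauss (x::'a::euclidean_space) :> (inv_sqrt_gauss x / 2) *\<^sub>R x"
proof -
  define k where "k = 1 / sqrt ((1 / sqrt (2 * pi)) ^ DIM('a))"
  have "((\<lambda>r. k * exp (r / 4)) has_real_derivative k * exp ((norm x)\<^sup>2 / 4) / 4) (at ((norm x)\<^sup>2))"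
    by (auto intro!: derivative_eq_intros)
  from GDERIV_DERIV_compose[OF GDERIV_norm_sq this]
  show ?thesis unfolding inv_sqrt_gauss_eq[abs_def] k_def[symmetric] by (simp add: mult.assoc)
qed

lemma continuous_inv_sqrt_gauss: "continuous_on A inv_sqrt_gauss"
  using GDERIV_continuous[OF GDERIV_inv_sqrt_gauss] continuous_on_subset by blast

lemma measurable_inv_sqrt_gauss [measurable]: "inv_sqrt_gauss \<in> borel_measurable borel"
  by (rule borel_measurable_continuous_onI[OF continuous_inv_sqrt_gauss])

lemma ln_gauss_dens: "ln (gauss_dens (x::'a::euclidean_space)) = - (real DIM('a) / 2 * ln (2 * pi)) - (norm x)\<^sup>2 / 2"
proof -
  have 1: "ln (c ^ n * exp z) = real n * ln c + z" if "0 < c" for c z :: real and n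
    using that by (simp add: ln_mult ln_realpow)
  have 2: "ln (1 / sqrt c) = - (1/2) * ln c" if "0 < c" for c :: real
    using that by (simp add: ln_div ln_sqrt)
  have "ln (gauss_dens x) = real DIM('a) * ln (1 / sqrt (2 * pi)) + - (norm x)\<^sup>2 / 2"
    unfolding gauss_dens_def by (rule 1) simp
  also have "ln (1 / sqrt (2 * pi)) = - (1/2) * ln (2 * pi)" by (rule 2) simp
  finally show ?thesis by linarith
qed

text \<open>
  The kernel of \<open>mehler\<close> with respect to Lebesgue measure, divided by the Gaussian density. Dividing out the
  density is what the substitution \<open>h = w / sqrt \<gamma>\<close> requires.
\<close>

definition mehler_weight :: "'a \<Rightarrow> 'a::euclidean_space \<Rightarrow> real" where
  "mehler_weight t x = (1 / rsqrt2) ^ DIM('a) * gauss_dens ((1 / rsqrt2) *\<^sub>R x - t) / gauss_dens x"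

lemma mehler_eq_weight:
  fixes f :: "'a::euclidean_space \<Rightarrow> real"
  assumes [measurable]: "f \<in> borel_measurable borel"
  shows "mehler (\<lambda>x. (inv_sqrt_gauss x)\<^sup>2 * f x) t = (\<integral>x. f x * mehler_weight t x \<partial>lborel)"
proof -
  have "mehler (\<lambda>x. (inv_sqrt_gauss x)\<^sup>2 * f x) t
     = (\<integral>s. gauss_dens s * ((inv_sqrt_gauss (rsqrt2 *\<^sub>R (s + t)))\<^sup>2 * f (rsqrt2 *\<^sub>R (s + t))) \<partial>lborel)"
    unfolding mehler_def by (rule integral_gaussE) measurable
  also have "\<dots> = \<bar>1 / rsqrt2\<bar> ^ DIM('a) * (\<integral>x. gauss_dens (-t + (1/rsqrt2) *\<^sub>R x) * ((inv_sqrt_gauss (rsqrt2 *\<^sub>R (-t + (1/rsqrt2) *\<^sub>R x + t)))\<^sup>2 * f (rsqrt2 *\<^sub>R (-t + (1/rsqrt2) *\<^sub>R x + t))) \<partial>lborel)"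
    by (rule integral_lborel_affine) (use rsqrt2 in auto)
  also have "\<dots> = (\<integral>x. f x * mehler_weight t x \<partial>lborel)"
    using rsqrt2 by (subst integral_mult_right_zero[symmetric], intro Bochner_Integration.integral_cong refl)
      (simp add: mehler_weight_def inv_sqrt_gauss_sq)
  finally show ?thesis .
qed

lemma abs_x_ln_x_le: "0 \<le> x \<Longrightarrow> \<bar>x * ln x\<bar> \<le> 1 + x\<^sup>2" for x :: real
proof (cases "x = 0")
  case False
  assume "0 \<le> x"
  then have x: "0 < x" using False by simp
  have "x * ln x \<le> x * (x - 1)" using x ln_le_minus_one[OF x] by (intro mult_left_mono) auto
  moreover have "- (x * ln x) \<le> 1 - x"
  proof -
    have "ln (1/x) \<le> 1/x - 1" using x by (intro ln_le_minus_one) auto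
    then have "x * (- ln x) \<le> x * (1/x - 1)" using x by (intro mult_left_mono) (auto simp: ln_div)
    also have "x * (1/x - 1) = 1 - x" using x by (simp add: right_diff_distrib)
    finally show ?thesis by simp
  qed
  moreover have "x * (x - 1) = x\<^sup>2 - x" by (simp add: power2_eq_square algebra_simps)
  moreover have "0 \<le> x\<^sup>2" by simp
  ultimately show ?thesis unfolding abs_le_iff using x by linarith
qed simp

text \<open>
  Used to remove the regularisation \<open>e\<close> from the entropy of \<open>h\<^sup>2 + e\<close>.
\<close>

lemma x_ln_x_superadd: "0 \<le> s \<Longrightarrow> 0 < e \<Longrightarrow> s * ln s + e * ln e \<le> (s + e) * ln (s + e)" for s e :: real
proof (cases "s = 0")
  case False
  assume "0 \<le> s" "0 < e"
  then have "s * ln s \<le> s * ln (s + e)" "e * ln e \<le> e * ln (s + e)" using False by auto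
  then show ?thesis by (simp add: algebra_simps)
qed simp

text \<open>
  \<open>twist w Dw b / sqrt \<gamma>\<close> is the partial derivative of \<open>w / sqrt \<gamma>\<close> in direction \<open>b\<close>.
\<close>

definition twist :: "('a::euclidean_space \<Rightarrow> real) \<Rightarrow> ('a \<Rightarrow> 'a) \<Rightarrow> 'a \<Rightarrow> 'a \<Rightarrow> real" where
  "twist w Dw b x = Dw x \<bullet> b + w x * (x \<bullet> b) / 2"

lemma C1c_integrable:
  fixes w :: "'a::euclidean_space \<Rightarrow> real"
  assumes w: "C1c w Dw" and c: "continuous_on UNIV f" and f: "\<And>x. w x = 0 \<Longrightarrow> Dw x = 0 \<Longrightarrow> f x = (0::real)"
  shows "integrable lborel f" "f \<in> borel_measurable borel" "\<exists>B. \<forall>x. \<bar>f x\<bar> \<le> B"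
proof -
  obtain R where R: "\<And>x. R < norm x \<Longrightarrow> w x = 0" "\<And>x. R < norm x \<Longrightarrow> Dw x = 0" using C1cD(4)[OF w] by blast
  then show "integrable lborel f" "f \<in> borel_measurable borel" "\<exists>B. \<forall>x. \<bar>f x\<bar> \<le> B"
    using continuous_compact_support[OF c, of R] f by auto
qed

lemma C1c_ibp:
  fixes w :: "'a::euclidean_space \<Rightarrow> real"
  assumes w: "C1c w Dw" and b: "b \<in> Basis"
  shows "(\<integral>x. 2 * (w x * (Dw x \<bullet> b) * (x \<bullet> b)) \<partial>lborel) = - (\<integral>x. (w x)\<^sup>2 \<partial>lborel)"
proof -
  note c = C1cD[OF w]
  have GDb: "GDERIV (\<lambda>x. x \<bullet> b) x :> b" for x :: 'a
    unfolding gderiv_def by (auto intro!: derivative_eq_intros)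
  define D2 where "D2 x = (w x * w x) *\<^sub>R b + (x \<bullet> b) *\<^sub>R (w x *\<^sub>R Dw x + w x *\<^sub>R Dw x)" for x
  have "C1c (\<lambda>x. (w x * w x) * (x \<bullet> b)) D2"
    unfolding C1c_def
  proof (intro conjI allI)
    show "GDERIV (\<lambda>x. (w x * w x) * (x \<bullet> b)) x :> D2 x" for x
      unfolding D2_def by (rule GDERIV_mult[OF GDERIV_mult[OF c(1) c(1)] GDb])
    show "continuous_on UNIV D2" unfolding D2_def[abs_def] by (intro continuous_intros c)
    obtain R where "\<And>x. R < norm x \<Longrightarrow> w x = 0 \<and> Dw x = 0" using c(4) by blast
    then show "\<exists>R. \<forall>x. R < norm x \<longrightarrow> w x * w x * (x \<bullet> b) = 0 \<and> D2 x = 0" by (auto simp: D2_def intro!: exI[of _ R])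
  qed
  from integral_partial_eq_0[OF this b]
  have "0 = (\<integral>x. D2 x \<bullet> b \<partial>lborel)" by simp
  also have "\<dots> = (\<integral>x. (w x)\<^sup>2 + 2 * (w x * (Dw x \<bullet> b) * (x \<bullet> b)) \<partial>lborel)"
    using b by (intro Bochner_Integration.integral_cong refl) (simp add: D2_def inner_add_left power2_eq_square algebra_simps)
  also have "\<dots> = (\<integral>x. (w x)\<^sup>2 \<partial>lborel) + (\<integral>x. 2 * (w x * (Dw x \<bullet> b) * (x \<bullet> b)) \<partial>lborel)"
    by (rule Bochner_Integration.integral_add; rule C1c_integrable(1)[OF w]) (auto intro!: continuous_intros c)
  finally show ?thesis by simp
qed

lemma G_log_eq: "2 * G_log s = s\<^sup>2 * ln (s\<^sup>2)"
proof (cases "s = 0")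
  case False
  then have "ln (s\<^sup>2) = 2 * ln \<bar>s\<bar>" using ln_realpow[of "\<bar>s\<bar>" 2] by simp
  then show ?thesis using False by (simp add: G_log_def)
qed (simp add: G_log_def)

text \<open>
  \<open>gauss_logsob_deficit\<close> for \<open>h = w / sqrt \<gamma>\<close>. The square of \<open>\<nabla>w + w x / 2\<close> has the cross term
  \<open>w * (\<nabla>w \<bullet> x)\<close>, which integrates by parts to \<open>- DIM('a) * m / 2\<close>, and the term \<open>|x|\<^sup>2 w\<^sup>2 / 4\<close>, which cancels against the
  one produced by \<open>ln \<gamma>\<close> on the entropy side.
\<close>

lemma lebesgue_logsob_deficit:
  fixes w :: "'a::euclidean_space \<Rightarrow> real" and e m :: real
  assumes w: "C1c w Dw" and e: "0 < e"
  defines "m \<equiv> \<integral>x. (w x)\<^sup>2 \<partial>lborel"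
  shows "2 * (\<integral>x. G_log (w x) \<partial>lborel) + real DIM('a) * m + real DIM('a) / 2 * ln (2 * pi) * m + e * ln e - (m + e) * ln (m + e)
    + (\<Sum>b\<in>Basis. \<integral>t. (\<integral>x. (twist w Dw b x)\<^sup>2 * mehler_weight t x \<partial>lborel)
        - (\<integral>x. (w x * twist w Dw b x) * mehler_weight t x \<partial>lborel)\<^sup>2 / ((\<integral>x. (w x)\<^sup>2 * mehler_weight t x \<partial>lborel) + e) \<partial>gaussE)
    \<le> 2 * (\<Sum>b\<in>Basis. \<integral>x. (Dw x \<bullet> b)\<^sup>2 \<partial>lborel)"
    and "integrable lborel (\<lambda>x. G_log (w x))"
    and "\<And>b. b \<in> Basis \<Longrightarrow> integrable gaussE (\<lambda>t. (\<integral>x. (twist w Dw b x)\<^sup>2 * mehler_weight t x \<partial>lborel)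
        - (\<integral>x. (w x * twist w Dw b x) * mehler_weight t x \<partial>lborel)\<^sup>2 / ((\<integral>x. (w x)\<^sup>2 * mehler_weight t x \<partial>lborel) + e))"
proof -
  note c = C1cD[OF w]
  define q where "q = (inv_sqrt_gauss :: 'a \<Rightarrow> real)"
  have cq: "continuous_on UNIV q" unfolding q_def by (rule continuous_inv_sqrt_gauss)
  have mq[measurable]: "q \<in> borel_measurable borel" unfolding q_def by measurable
  have q2: "gauss_dens x * (q x)\<^sup>2 = 1" "gauss_dens x * ((q x)\<^sup>2 * y) = y" for x y
    using gauss_dens_pos[of x] by (simp_all add: q_def inv_sqrt_gauss_sq)
  define h where "h x = q x * w x" for x
  define D where "D b x = q x * twist w Dw b x" for b x
  have ct: "continuous_on UNIV (twist w Dw b)" for b unfolding twist_def[abs_def] by (intro continuous_intros c) auto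
  have mt[measurable]: "twist w Dw b \<in> borel_measurable borel" for b using ct by (rule borel_measurable_continuous_onI)
  have mw[measurable]: "w \<in> borel_measurable borel" using c(2) by (rule borel_measurable_continuous_onI)
  have ch: "continuous_on UNIV h" unfolding h_def[abs_def] by (intro continuous_intros cq c)
  have cD: "continuous_on UNIV (D b)" for b unfolding D_def[abs_def] by (intro continuous_intros cq ct)
  have der: "((\<lambda>t. h (x + t *\<^sub>R b)) has_real_derivative D b (x + t *\<^sub>R b)) (at t)" for x b t
  proof -
    have "GDERIV h x :> q x *\<^sub>R Dw x + w x *\<^sub>R ((q x / 2) *\<^sub>R x)" for x
      unfolding h_def[abs_def] q_def by (rule GDERIV_mult[OF GDERIV_inv_sqrt_gauss c(1)])
    moreover have "(q y *\<^sub>R Dw y + w y *\<^sub>R ((q y / 2) *\<^sub>R y)) \<bullet> b = D b y" for y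
      by (simp add: D_def twist_def inner_add_left algebra_simps)
    ultimately show ?thesis using GDERIV_line[of h "\<lambda>x. q x *\<^sub>R Dw x + w x *\<^sub>R ((q x / 2) *\<^sub>R x)" x b t] by simp
  qed
  obtain B1 where B1: "\<And>x. \<bar>h x\<bar> \<le> B1" using C1c_integrable(3)[OF w ch] by (auto simp: h_def)
  have "\<forall>b. \<exists>B. \<forall>x. \<bar>D b x\<bar> \<le> B" using C1c_integrable(3)[OF w cD] by (auto simp: D_def twist_def)
  then obtain B2 where B2: "\<And>b x. \<bar>D b x\<bar> \<le> B2 b" by metis
  define B where "B = \<bar>B1\<bar> + (\<Sum>b\<in>Basis. \<bar>B2 b\<bar>)"
  have hB: "\<bar>h x\<bar> \<le> B" for x using B1[of x] sum_nonneg[of Basis "\<lambda>b. \<bar>B2 b\<bar>"] unfolding B_def by linarith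
  have DB: "\<bar>D b x\<bar> \<le> B" if "b \<in> Basis" for b x
    using B2[of b x] member_le_sum[OF that, of "\<lambda>b. \<bar>B2 b\<bar>"] by (auto simp: B_def)
  have mh[measurable]: "h \<in> borel_measurable borel" using ch by (rule borel_measurable_continuous_onI)
  have h2B: "\<bar>(h x)\<^sup>2\<bar> \<le> B\<^sup>2" for x using hB[of x] abs_le_square_iff[of "h x" B] by (simp add: abs_le_iff)
  have ih2: "integrable gaussE (\<lambda>x. (h x)\<^sup>2)" by (rule integrable_gaussE_bounded[OF _ h2B]) simp
  have m_eq: "(\<integral>x. (h x)\<^sup>2 + e \<partial>gaussE) = m + e"
  proof -
    have "(\<integral>x. (h x)\<^sup>2 + e \<partial>gaussE) = (\<integral>x. (h x)\<^sup>2 \<partial>gaussE) + e" using ih2 by simp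
    also have "(\<integral>x. (h x)\<^sup>2 \<partial>gaussE) = m"
      unfolding m_def by (subst integral_gaussE) (auto simp: h_def power_mult_distrib q2)
    finally show ?thesis .
  qed
  have lnB: "\<bar>H * ln H\<bar> \<le> 1 + (B\<^sup>2 + e)\<^sup>2" if "0 \<le> H" "H \<le> B\<^sup>2 + e" for H
    using abs_x_ln_x_le[OF that(1)] power_mono[OF that(2,1), of 2] by linarith
  have ihl: "integrable gaussE (\<lambda>x. (h x)\<^sup>2 * ln ((h x)\<^sup>2))"
    by (rule integrable_gaussE_bounded[where B="1 + (B\<^sup>2 + e)\<^sup>2"]) (use h2B e in \<open>auto intro!: lnB simp: add_increasing2\<close>)
  have ihel: "integrable gaussE (\<lambda>x. ((h x)\<^sup>2 + e) * ln ((h x)\<^sup>2 + e))"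
    by (rule integrable_gaussE_bounded[where B="1 + (B\<^sup>2 + e)\<^sup>2"]) (use h2B e in \<open>auto intro!: lnB\<close>)
  have iw2: "integrable lborel (\<lambda>x. (w x)\<^sup>2)" by (rule C1c_integrable(1)[OF w]) (auto intro!: continuous_intros c)
  have iwn: "integrable lborel (\<lambda>x. (w x)\<^sup>2 * (norm x)\<^sup>2)" by (rule C1c_integrable(1)[OF w]) (auto intro!: continuous_intros c)
  define K where "K = real DIM('a) / 2 * ln (2 * pi)"
  have pt: "gauss_dens x * ((h x)\<^sup>2 * ln ((h x)\<^sup>2)) = 2 * G_log (w x) + (1/2) * ((w x)\<^sup>2 * (norm x)\<^sup>2) + K * (w x)\<^sup>2" for x
  proof (cases "w x = 0")
    case False
    have "(h x)\<^sup>2 = (w x)\<^sup>2 / gauss_dens x" by (simp add: h_def q_def inv_sqrt_gauss_sq power_mult_distrib)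
    then have "ln ((h x)\<^sup>2) = ln ((w x)\<^sup>2) - ln (gauss_dens x)"
      using False gauss_dens_pos[of x] by (simp add: ln_div)
    also have "\<dots> = ln ((w x)\<^sup>2) + K + (norm x)\<^sup>2 / 2" by (simp add: ln_gauss_dens K_def)
    finally have "gauss_dens x * ((h x)\<^sup>2 * ln ((h x)\<^sup>2)) = (w x)\<^sup>2 * (ln ((w x)\<^sup>2) + K + (norm x)\<^sup>2 / 2)"
      using q2[of x] by (simp add: h_def power_mult_distrib mult.assoc)
    then show ?thesis unfolding G_log_eq by (simp add: algebra_simps)
  qed (simp add: h_def G_log_def)
  have "integrable lborel (\<lambda>x. gauss_dens x * ((h x)\<^sup>2 * ln ((h x)\<^sup>2)))"
    using ihl by (subst (asm) integral_gaussE(2)) auto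
  then have "integrable lborel (\<lambda>x. (2 * G_log (w x) + (1/2) * ((w x)\<^sup>2 * (norm x)\<^sup>2) + K * (w x)\<^sup>2) - (1/2) * ((w x)\<^sup>2 * (norm x)\<^sup>2) - K * (w x)\<^sup>2)"
    unfolding pt using iw2 iwn by (intro Bochner_Integration.integrable_diff integrable_mult_right) auto
  then have "integrable lborel (\<lambda>x. 2 * G_log (w x))" by simp
  then show iG: "integrable lborel (\<lambda>x. G_log (w x))" by simp
  have ent: "(\<integral>x. (h x)\<^sup>2 * ln ((h x)\<^sup>2) \<partial>gaussE) = 2 * (\<integral>x. G_log (w x) \<partial>lborel) + (1/2) * (\<integral>x. (w x)\<^sup>2 * (norm x)\<^sup>2 \<partial>lborel) + K * m"
    using iG iw2 iwn by (subst integral_gaussE) (simp_all add: pt m_def)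
  have ent_e: "(\<integral>x. (h x)\<^sup>2 * ln ((h x)\<^sup>2) \<partial>gaussE) + e * ln e \<le> (\<integral>x. ((h x)\<^sup>2 + e) * ln ((h x)\<^sup>2 + e) \<partial>gaussE)"
  proof -
    have "(\<integral>x. (h x)\<^sup>2 * ln ((h x)\<^sup>2) \<partial>gaussE) + e * ln e = (\<integral>x. (h x)\<^sup>2 * ln ((h x)\<^sup>2) + e * ln e \<partial>gaussE)"
      using ihl by simp
    also have "\<dots> \<le> (\<integral>x. ((h x)\<^sup>2 + e) * ln ((h x)\<^sup>2 + e) \<partial>gaussE)"
      by (rule integral_mono) (use ihl ihel e x_ln_x_superadd in auto)
    finally show ?thesis .
  qed
  have iDD: "integrable lborel (\<lambda>x. (Dw x \<bullet> b)\<^sup>2)" for b by (rule C1c_integrable(1)[OF w]) (auto intro!: continuous_intros c)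
  have iDx: "integrable lborel (\<lambda>x. 2 * (w x * (Dw x \<bullet> b) * (x \<bullet> b)))" for b by (rule C1c_integrable(1)[OF w]) (auto intro!: continuous_intros c)
  have iwx: "integrable lborel (\<lambda>x. (w x)\<^sup>2 * (x \<bullet> b)\<^sup>2)" for b by (rule C1c_integrable(1)[OF w]) (auto intro!: continuous_intros c)
  have D_int: "(\<integral>x. (D b x)\<^sup>2 \<partial>gaussE) = (\<integral>x. (Dw x \<bullet> b)\<^sup>2 \<partial>lborel) - m / 2 + (\<integral>x. (w x)\<^sup>2 * (x \<bullet> b)\<^sup>2 \<partial>lborel) / 4"
    if b: "b \<in> Basis" for b
  proof -
    have "(\<integral>x. (D b x)\<^sup>2 \<partial>gaussE) = (\<integral>x. gauss_dens x * (D b x)\<^sup>2 \<partial>lborel)"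
      by (rule integral_gaussE) (simp add: D_def[abs_def])
    also have "\<dots> = (\<integral>x. (Dw x \<bullet> b)\<^sup>2 + (1/2) * (2 * (w x * (Dw x \<bullet> b) * (x \<bullet> b))) + (1/4) * ((w x)\<^sup>2 * (x \<bullet> b)\<^sup>2) \<partial>lborel)"
    proof (intro Bochner_Integration.integral_cong refl)
      fix x
      have "gauss_dens x * (D b x)\<^sup>2 = (twist w Dw b x)\<^sup>2" by (simp add: D_def power_mult_distrib q2)
      then show "gauss_dens x * (D b x)\<^sup>2 = (Dw x \<bullet> b)\<^sup>2 + (1/2) * (2 * (w x * (Dw x \<bullet> b) * (x \<bullet> b))) + (1/4) * ((w x)\<^sup>2 * (x \<bullet> b)\<^sup>2)"
        by (simp add: twist_def power2_eq_square field_simps)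
    qed
    also have "\<dots> = (\<integral>x. (Dw x \<bullet> b)\<^sup>2 \<partial>lborel) + (1/2) * (- m) + (1/4) * (\<integral>x. (w x)\<^sup>2 * (x \<bullet> b)\<^sup>2 \<partial>lborel)"
      unfolding m_def C1c_ibp[OF w b, symmetric]
      by (simp only: Bochner_Integration.integral_add integrable_mult_right Bochner_Integration.integrable_add iDD iDx iwx integral_mult_right_zero)
    finally show ?thesis by simp
  qed
  have nsum: "(\<Sum>b\<in>Basis. \<integral>x. (w x)\<^sup>2 * (x \<bullet> b)\<^sup>2 \<partial>lborel) = (\<integral>x. (w x)\<^sup>2 * (norm x)\<^sup>2 \<partial>lborel)"
  proof -
    have "(\<Sum>b\<in>Basis. \<integral>x. (w x)\<^sup>2 * (x \<bullet> b)\<^sup>2 \<partial>lborel) = (\<integral>x. (\<Sum>b\<in>Basis. (w x)\<^sup>2 * (x \<bullet> b)\<^sup>2) \<partial>lborel)"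
      by (rule Bochner_Integration.integral_sum[symmetric]) (rule iwx)
    also have "(\<lambda>x. \<Sum>b\<in>Basis. (w x)\<^sup>2 * (x \<bullet> b)\<^sup>2) = (\<lambda>x. (w x)\<^sup>2 * (norm x)\<^sup>2)"
    proof
      fix x :: 'a
      have "(norm x)\<^sup>2 = (\<Sum>b\<in>Basis. (x \<bullet> b)\<^sup>2)"
        unfolding power2_norm_eq_inner euclidean_inner[of x x] by (simp add: power2_eq_square)
      then show "(\<Sum>b\<in>Basis. (w x)\<^sup>2 * (x \<bullet> b)\<^sup>2) = (w x)\<^sup>2 * (norm x)\<^sup>2" by (simp add: sum_distrib_left)
    qed
    finally show ?thesis .
  qed
  have main: "(\<integral>x. ((h x)\<^sup>2 + e) * ln ((h x)\<^sup>2 + e) \<partial>gaussE) - (m + e) * ln (m + e)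
     + (\<Sum>b\<in>Basis. \<integral>t. mehler (\<lambda>x. (D b x)\<^sup>2) t - (mehler (\<lambda>x. h x * D b x) t)\<^sup>2 / (mehler (\<lambda>x. (h x)\<^sup>2) t + e) \<partial>gaussE)
     \<le> 2 * (\<Sum>b\<in>Basis. \<integral>x. (D b x)\<^sup>2 \<partial>gaussE)"
    using gauss_logsob_deficit(1)[where h=h and D=D and B=B and e=e] der ch cD hB DB e unfolding m_eq by blast
  have e1: "mehler (\<lambda>x. (D b x)\<^sup>2) t = (\<integral>x. (twist w Dw b x)\<^sup>2 * mehler_weight t x \<partial>lborel)" for b t
    using mehler_eq_weight[of "\<lambda>x. (twist w Dw b x)\<^sup>2" t] by (simp add: D_def q_def power_mult_distrib)
  have e2: "mehler (\<lambda>x. (h x)\<^sup>2) t = (\<integral>x. (w x)\<^sup>2 * mehler_weight t x \<partial>lborel)" for t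
    using mehler_eq_weight[of "\<lambda>x. (w x)\<^sup>2" t] by (simp add: h_def q_def power_mult_distrib)
  have e3: "mehler (\<lambda>x. h x * D b x) t = (\<integral>x. (w x * twist w Dw b x) * mehler_weight t x \<partial>lborel)" for b t
    using mehler_eq_weight[of "\<lambda>x. w x * twist w Dw b x" t] by (simp add: h_def D_def q_def power2_eq_square mult_ac)
  have "2 * (\<Sum>b\<in>Basis. \<integral>x. (D b x)\<^sup>2 \<partial>gaussE) = 2 * (\<Sum>b\<in>Basis. \<integral>x. (Dw x \<bullet> b)\<^sup>2 \<partial>lborel) - real DIM('a) * m + (1/2) * (\<integral>x. (w x)\<^sup>2 * (norm x)\<^sup>2 \<partial>lborel)"
    using nsum by (simp add: D_int sum.distrib sum_subtractf flip: sum_divide_distrib)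
  with main ent ent_e show "2 * (\<integral>x. G_log (w x) \<partial>lborel) + real DIM('a) * m + real DIM('a) / 2 * ln (2 * pi) * m + e * ln e - (m + e) * ln (m + e)
    + (\<Sum>b\<in>Basis. \<integral>t. (\<integral>x. (twist w Dw b x)\<^sup>2 * mehler_weight t x \<partial>lborel)
        - (\<integral>x. (w x * twist w Dw b x) * mehler_weight t x \<partial>lborel)\<^sup>2 / ((\<integral>x. (w x)\<^sup>2 * mehler_weight t x \<partial>lborel) + e) \<partial>gaussE)
    \<le> 2 * (\<Sum>b\<in>Basis. \<integral>x. (Dw x \<bullet> b)\<^sup>2 \<partial>lborel)"
    unfolding e1 e2 e3 K_def by linarith
  show "integrable gaussE (\<lambda>t. (\<integral>x. (twist w Dw b x)\<^sup>2 * mehler_weight t x \<partial>lborel)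
        - (\<integral>x. (w x * twist w Dw b x) * mehler_weight t x \<partial>lborel)\<^sup>2 / ((\<integral>x. (w x)\<^sup>2 * mehler_weight t x \<partial>lborel) + e))"
    if "b \<in> Basis" for b
    using gauss_logsob_deficit(2)[where h=h and D=D and B=B and e=e, OF _ _ _ _ _ _ that] der ch cD hB DB e
    unfolding e1 e2 e3 by blast
qed

section \<open>Passage to the limit and the equality case\<close>

text \<open>
  As a function of \<open>x\<close> the kernel is a translated Gaussian, hence bounded even after multiplication by the
  coordinates that \<open>twist\<close> introduces.
\<close>

lemma mehler_weight_eq:
  fixes x t :: "'a::euclidean_space"
  shows "mehler_weight t x = (1 / rsqrt2) ^ DIM('a) * exp ((norm t)\<^sup>2 / 2) * exp (- (norm (x - (1 / rsqrt2) *\<^sub>R t))\<^sup>2 / 2)"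
proof -
  have s: "(1 / rsqrt2) * (1 / rsqrt2) = 2" using rsqrt2(2) rsqrt2(1) by (simp add: field_simps)
  define k where "k = (1 / sqrt (2 * pi)) ^ DIM('a)"
  have k: "0 < k" by (simp add: k_def)
  define c where "c = 1 / rsqrt2"
  have c1: "c * c = 2" using s by (simp only: c_def)
  have cc: "c * c = 2" "c * (c * y) = 2 * y" for y by (simp_all only: mult.assoc[symmetric] c1)
  have "- (norm (c *\<^sub>R x - t))\<^sup>2 / 2 - (- (norm x)\<^sup>2 / 2) = (norm t)\<^sup>2 / 2 + - (norm (x - c *\<^sub>R t))\<^sup>2 / 2"
    unfolding power2_norm_eq_inner by (simp add: inner_simps inner_commute cc field_simps)
  then have "exp (- (norm (c *\<^sub>R x - t))\<^sup>2 / 2) / exp (- (norm x)\<^sup>2 / 2) = exp ((norm t)\<^sup>2 / 2) * exp (- (norm (x - c *\<^sub>R t))\<^sup>2 / 2)"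
    by (simp only: exp_diff[symmetric] exp_add[symmetric])
  moreover have "gauss_dens (c *\<^sub>R x - t) / gauss_dens x = exp (- (norm (c *\<^sub>R x - t))\<^sup>2 / 2) / exp (- (norm x)\<^sup>2 / 2)"
    unfolding gauss_dens_def k_def[symmetric] using k by simp
  ultimately show ?thesis unfolding mehler_weight_def c_def[symmetric] by (simp only: times_divide_eq_right[symmetric] mult.assoc)
qed

lemma mehler_weight_pos: "0 < mehler_weight t x"
  unfolding mehler_weight_eq using rsqrt2(1) by simp

lemma measurable_mehler_weight [measurable]: "mehler_weight t \<in> borel_measurable borel"
  unfolding mehler_weight_def[abs_def] by measurable

lemma mehler_weight_bounds:
  fixes t :: "'a::euclidean_space"
  shows "\<exists>C. \<forall>x. \<bar>sqrt (mehler_weight t x)\<bar> \<le> C"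
    and "b \<in> Basis \<Longrightarrow> \<exists>C. \<forall>x. \<bar>sqrt (mehler_weight t x) * (x \<bullet> b)\<bar> \<le> C"
proof -
  define K where "K = sqrt ((1 / rsqrt2) ^ DIM('a) * exp ((norm t)\<^sup>2 / 2))"
  define a where "a = (1 / rsqrt2) *\<^sub>R t"
  have K0: "0 \<le> K" using rsqrt2(1) by (simp add: K_def)
  have eq: "sqrt (mehler_weight t x) = K * exp (- (norm (x - a))\<^sup>2 / 4)" for x
  proof -
    have "sqrt (exp (- (norm (x - a))\<^sup>2 / 2)) = exp (- (norm (x - a))\<^sup>2 / 4)"
      by (rule real_sqrt_unique) (simp_all add: power2_eq_square flip: exp_add)
    then show ?thesis unfolding mehler_weight_eq a_def K_def by (simp only: real_sqrt_mult)
  qed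
  have le1: "exp (- y\<^sup>2 / 4) \<le> 1" for y :: real by simp
  show "\<exists>C. \<forall>x. \<bar>sqrt (mehler_weight t x)\<bar> \<le> C"
    unfolding eq using mult_left_mono[OF le1 K0] K0 by (intro exI[of _ K]) (simp add: abs_mult)
  show "\<exists>C. \<forall>x. \<bar>sqrt (mehler_weight t x) * (x \<bullet> b)\<bar> \<le> C" if b: "b \<in> Basis"
  proof (intro exI allI)
    fix x
    have yexp: "y * exp (- y\<^sup>2 / 4) \<le> 1" for y :: real
    proof -
      have "y \<le> 1 + y\<^sup>2 / 4" using zero_le_power2[of "y/2 - 1"] by (simp add: power2_eq_square algebra_simps)
      also have "\<dots> \<le> exp (y\<^sup>2 / 4)" by (rule exp_ge_add_one_self)
      finally have "y * exp (- y\<^sup>2 / 4) \<le> exp (y\<^sup>2 / 4) * exp (- y\<^sup>2 / 4)" by (intro mult_right_mono) auto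
      then show ?thesis by (simp flip: exp_add)
    qed
    have "\<bar>x \<bullet> b\<bar> \<le> norm x" by (rule Basis_le_norm[OF b])
    also have "\<dots> \<le> norm (x - a) + norm a" using norm_triangle_ineq[of "x - a" a] by simp
    finally have "\<bar>x \<bullet> b\<bar> * exp (- (norm (x - a))\<^sup>2 / 4) \<le> (norm (x - a) + norm a) * exp (- (norm (x - a))\<^sup>2 / 4)"
      by (intro mult_right_mono) auto
    also have "\<dots> \<le> 1 + norm a"
      using yexp[of "norm (x - a)"] mult_left_mono[OF le1[of "norm (x - a)"] norm_ge_zero[of a]] by (simp add: distrib_right)
    finally have "K * (\<bar>x \<bullet> b\<bar> * exp (- (norm (x - a))\<^sup>2 / 4)) \<le> K * (1 + norm a)" by (rule mult_left_mono[OF _ K0])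
    then show "\<bar>sqrt (mehler_weight t x) * (x \<bullet> b)\<bar> \<le> K * (1 + norm a)"
      unfolding eq using K0 by (simp add: abs_mult mult_ac)
  qed
qed

text \<open>
  Only a lower bound for \<open>\<integral> G(w j)\<close> is assumed, since the inequality bounds this integral from above. In the
  case of equality the deficits of \<open>w j\<close> tend to zero; they are nonnegative, so by Fatou's lemma
  the Cauchy-Schwarz gap of the limit vanishes for almost every \<open>t\<close>. A single such \<open>t\<close> suffices: the kernel is positive
  everywhere, so equality in Cauchy-Schwarz makes the twisted gradient of \<open>u\<close> a constant multiple \<open>\<beta>\<close> of \<open>u\<close>
  almost everywhere.
\<close>

lemma logsob_limit:
  fixes u :: "'a::euclidean_space \<Rightarrow> real" and g :: "'a \<Rightarrow> 'a" and m I :: real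
  assumes w: "\<And>j. C1c (w j) (Dw j)" and wu: "l2conv lborel w u"
    and Dg: "\<And>b. b \<in> Basis \<Longrightarrow> l2conv lborel (\<lambda>j x. Dw j x \<bullet> b) (\<lambda>x. g x \<bullet> b)"
    and G: "\<And>\<epsilon>. 0 < \<epsilon> \<Longrightarrow> eventually (\<lambda>j. I - \<epsilon> \<le> (\<integral>x. G_log (w j x) \<partial>lborel)) sequentially"
    and m_def: "m = (\<integral>x. (u x)\<^sup>2 \<partial>lborel)" and m: "0 < m"
  shows "2 * I + real DIM('a) * m + real DIM('a) / 2 * ln (2 * pi) * m - m * ln m \<le> 2 * (\<Sum>b\<in>Basis. \<integral>x. (g x \<bullet> b)\<^sup>2 \<partial>lborel)"
    and "2 * I + real DIM('a) * m + real DIM('a) / 2 * ln (2 * pi) * m - m * ln m = 2 * (\<Sum>b\<in>Basis. \<integral>x. (g x \<bullet> b)\<^sup>2 \<partial>lborel)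
      \<Longrightarrow> \<exists>\<beta>. AE x in lborel. g x = u x *\<^sub>R (\<beta> - x /\<^sub>R 2)"
proof -
  define r where "r t x = sqrt (mehler_weight t x)" for t x :: 'a
  have r2: "r t x * r t x = mehler_weight t x" for t x using mehler_weight_pos[of t x] by (simp add: r_def)
  have rpos: "0 < r t x" for t x using mehler_weight_pos[of t x] by (simp add: r_def)
  have [measurable]: "r t \<in> borel_measurable borel" for t unfolding r_def[abs_def] by measurable
  have lw: "l2conv lborel (\<lambda>j x. r t x * w j x) (\<lambda>x. r t x * u x)" for t
  proof -
    obtain C where "\<And>x. \<bar>r t x\<bar> \<le> C" using mehler_weight_bounds(1)[of t] by (auto simp: r_def)
    then show ?thesis by (intro l2conv_bounded_mult[OF wu]) auto
  qed
  have ltw: "l2conv lborel (\<lambda>j x. r t x * twist (w j) (Dw j) b x) (\<lambda>x. r t x * twist u g b x)" if b: "b \<in> Basis" for t b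
  proof -
    obtain C where C: "\<And>x. \<bar>r t x\<bar> \<le> C" using mehler_weight_bounds(1)[of t] by (auto simp: r_def)
    obtain C' where C': "\<And>x. \<bar>r t x * (x \<bullet> b)\<bar> \<le> C'" using mehler_weight_bounds(2)[OF b, of t] by (auto simp: r_def)
    have C'': "\<bar>r t x * (x \<bullet> b) / 2\<bar> \<le> C'" for x using C'[of x] by simp
    have "l2conv lborel (\<lambda>j x. r t x * (Dw j x \<bullet> b) + r t x * (x \<bullet> b) / 2 * w j x) (\<lambda>x. r t x * (g x \<bullet> b) + r t x * (x \<bullet> b) / 2 * u x)"
      by (intro l2conv_add l2conv_bounded_mult[OF Dg[OF b] _ C] l2conv_bounded_mult[OF wu _ C'']) auto
    then show ?thesis by (simp add: twist_def algebra_simps)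
  qed
  define P where "P j t = (\<integral>x. (w j x)\<^sup>2 * mehler_weight t x \<partial>lborel)" for j t
  define Q where "Q b j t = (\<integral>x. (w j x * twist (w j) (Dw j) b x) * mehler_weight t x \<partial>lborel)" for b j t
  define R where "R b j t = (\<integral>x. (twist (w j) (Dw j) b x)\<^sup>2 * mehler_weight t x \<partial>lborel)" for b j t
  define P' where "P' t = (\<integral>x. (r t x * u x)\<^sup>2 \<partial>lborel)" for t
  define Q' where "Q' b t = (\<integral>x. (r t x * u x) * (r t x * twist u g b x) \<partial>lborel)" for b t
  define R' where "R' b t = (\<integral>x. (r t x * twist u g b x)\<^sup>2 \<partial>lborel)" for b t
  have P_eq: "P j t = (\<integral>x. (r t x * w j x)\<^sup>2 \<partial>lborel)" for j t
    unfolding P_def by (simp add: r2[symmetric] power2_eq_square mult_ac)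
  have R_eq: "R b j t = (\<integral>x. (r t x * twist (w j) (Dw j) b x)\<^sup>2 \<partial>lborel)" for b j t
    unfolding R_def by (simp add: r2[symmetric] power2_eq_square mult_ac)
  have Q_eq: "Q b j t = (\<integral>x. (r t x * w j x) * (r t x * twist (w j) (Dw j) b x) \<partial>lborel)" for b j t
    unfolding Q_def by (simp add: r2[symmetric] power2_eq_square mult_ac)
  have Pl: "(\<lambda>j. P j t) \<longlonglongrightarrow> P' t" for t unfolding P_eq P'_def by (rule l2conv_square[OF lw])
  have Rl: "(\<lambda>j. R b j t) \<longlonglongrightarrow> R' b t" if "b \<in> Basis" for t b unfolding R_eq R'_def by (rule l2conv_square[OF ltw[OF that]])
  have Ql: "(\<lambda>j. Q b j t) \<longlonglongrightarrow> Q' b t" if "b \<in> Basis" for t b unfolding Q_eq Q'_def by (rule l2conv_mult[OF lw ltw[OF that]])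
  have lu: "l2 lborel u" using wu by (simp add: l2conv_def)
  have lru: "l2 lborel (\<lambda>x. r t x * u x)" for t using lw[of t] by (simp add: l2conv_def)
  have lrt: "l2 lborel (\<lambda>x. r t x * twist u g b x)" if "b \<in> Basis" for t b using ltw[OF that, of t] by (simp add: l2conv_def)
  have [measurable]: "u \<in> borel_measurable borel" using l2_measurable[OF lu] by simp
  have P'pos: "0 < P' t" for t
  proof (rule ccontr)
    assume "\<not> 0 < P' t"
    moreover have "0 \<le> P' t" unfolding P'_def by simp
    ultimately have "P' t = 0" by simp
    then have "AE x in lborel. (r t x * u x)\<^sup>2 = 0"
      unfolding P'_def using l2_square[OF lru[of t]] by (subst (asm) integral_nonneg_eq_0_iff_AE) auto
    then have "AE x in lborel. (u x)\<^sup>2 = 0" by eventually_elim (use rpos[of t] in \<open>auto simp: less_imp_neq[symmetric]\<close>)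
    then have "m = (\<integral>x. 0 \<partial>(lborel :: 'a measure))" unfolding m_def by (intro integral_cong_AE) auto
    then show False using m by simp
  qed
  \<comment> \<open>regularisation parameter tending to zero along the sequence\<close>
  define e where "e j = 1 / real (Suc j)" for j
  have e: "0 < e j" for j by (simp add: e_def)
  have e0: "e \<longlonglongrightarrow> 0" unfolding e_def[abs_def] using LIMSEQ_inverse_real_of_nat by (simp add: inverse_eq_divide)
  have ele: "(\<lambda>j. e j * ln (e j)) \<longlonglongrightarrow> 0" unfolding e_def[abs_def] by real_asymp
  define d where "d b j t = R b j t - (Q b j t)\<^sup>2 / (P j t + e j)" for b j t
  have P0: "0 \<le> P j t" "0 \<le> R b j t" for b j t unfolding P_eq R_eq by simp_all
  have d0: "0 \<le> d b j t" if "b \<in> Basis" for b j t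
  proof -
    have "l2 lborel (\<lambda>x. r t x * w j x)" "l2 lborel (\<lambda>x. r t x * twist (w j) (Dw j) b x)"
      using lw[of t] ltw[OF that, of t] by (auto simp: l2conv_def)
    from l2_cauchy_schwarz[OF this] have "(Q b j t)\<^sup>2 \<le> P j t * R b j t" by (simp add: P_eq Q_eq R_eq)
    also have "\<dots> \<le> R b j t * (P j t + e j)" using P0(1)[of j t] P0(2)[of b j t] e[of j] by (simp add: algebra_simps)
    finally show ?thesis using P0(1)[of j t] e[of j] by (simp add: d_def divide_le_eq add_nonneg_pos)
  qed
  define M where "M j = (\<integral>x. (w j x)\<^sup>2 \<partial>lborel)" for j
  define E where "E j = (\<Sum>b\<in>Basis. \<integral>x. (Dw j x \<bullet> b)\<^sup>2 \<partial>lborel)" for j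
  define S where "S j = (\<Sum>b\<in>Basis. \<integral>t. d b j t \<partial>gaussE)" for j
  define K where "K = real DIM('a) + real DIM('a) / 2 * ln (2 * pi)"
  define rhs where "rhs j = 2 * E j - K * M j - e j * ln (e j) + (M j + e j) * ln (M j + e j)" for j
  define rhs' where "rhs' = 2 * (\<Sum>b\<in>Basis. \<integral>x. (g x \<bullet> b)\<^sup>2 \<partial>lborel) - K * m + m * ln m"
  have Ml: "M \<longlonglongrightarrow> m" unfolding M_def[abs_def] m_def by (rule l2conv_square[OF wu])
  have El: "E \<longlonglongrightarrow> (\<Sum>b\<in>Basis. \<integral>x. (g x \<bullet> b)\<^sup>2 \<partial>lborel)"
    unfolding E_def[abs_def] by (rule tendsto_sum) (rule l2conv_square[OF Dg])
  have "rhs \<longlonglongrightarrow> 2 * (\<Sum>b\<in>Basis. \<integral>x. (g x \<bullet> b)\<^sup>2 \<partial>lborel) - K * m - 0 + (m + 0) * ln (m + 0)"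
    unfolding rhs_def[abs_def] using m by (intro tendsto_intros El Ml e0 ele) auto
  then have rhsl: "rhs \<longlonglongrightarrow> rhs'" by (simp add: rhs'_def)
  have ineq: "2 * (\<integral>x. G_log (w j x) \<partial>lborel) + S j \<le> rhs j" for j
    using lebesgue_logsob_deficit(1)[OF w[of j] e[of j]]
    by (simp add: rhs_def S_def d_def P_def Q_def R_def E_def M_def K_def algebra_simps)
  have S0: "0 \<le> S j" for j unfolding S_def by (intro sum_nonneg integral_nonneg_AE AE_I2 d0)
  have up: "eventually (\<lambda>j. S j \<le> rhs j - 2 * I + 2 * \<epsilon>) sequentially" if "0 < \<epsilon>" for \<epsilon>
    using G[OF that]
  proof eventually_elim
    case (elim j)
    then show ?case using ineq[of j] by linarith
  qed
  have main: "2 * I \<le> rhs'"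
  proof (rule field_le_epsilon)
    fix \<epsilon> :: real assume "0 < \<epsilon>"
    then have "eventually (\<lambda>j. 2 * I - \<epsilon> \<le> rhs j) sequentially"
      using up[of "\<epsilon>/2"] by (auto elim!: eventually_mono) (smt (verit) S0)
    then have "2 * I - \<epsilon> \<le> rhs'" by (intro tendsto_lowerbound[OF rhsl]) auto
    then show "2 * I \<le> rhs' + \<epsilon>" by simp
  qed
  then show "2 * I + real DIM('a) * m + real DIM('a) / 2 * ln (2 * pi) * m - m * ln m \<le> 2 * (\<Sum>b\<in>Basis. \<integral>x. (g x \<bullet> b)\<^sup>2 \<partial>lborel)"
    by (simp add: rhs'_def K_def algebra_simps)
  assume eq: "2 * I + real DIM('a) * m + real DIM('a) / 2 * ln (2 * pi) * m - m * ln m = 2 * (\<Sum>b\<in>Basis. \<integral>x. (g x \<bullet> b)\<^sup>2 \<partial>lborel)"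
  then have eq': "rhs' = 2 * I" by (simp add: rhs'_def K_def algebra_simps)
  have Sl: "S \<longlonglongrightarrow> 0"
  proof (rule LIMSEQ_I)
    fix \<epsilon> :: real assume "0 < \<epsilon>"
    then have "eventually (\<lambda>j. \<bar>rhs j - rhs'\<bar> < \<epsilon>/4) sequentially"
      using rhsl[THEN tendstoD, of "\<epsilon>/4"] by (simp add: dist_real_def)
    moreover have "eventually (\<lambda>j. S j \<le> rhs j - 2 * I + 2 * (\<epsilon>/4)) sequentially" using \<open>0 < \<epsilon>\<close> by (intro up) auto
    ultimately have "eventually (\<lambda>j. norm (S j - 0) < \<epsilon>) sequentially"
    proof eventually_elim
      case (elim j)
      then have "rhs j - rhs' < \<epsilon>/4" by linarith
      then have "S j < \<epsilon>" using elim(2) eq' \<open>0 < \<epsilon>\<close> by linarith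
      then show ?case using S0[of j] by simp
    qed
    then show "\<exists>N. \<forall>n\<ge>N. norm (S n - 0) < \<epsilon>" by (simp add: eventually_sequentially)
  qed
  have di: "integrable gaussE (d b j)" if "b \<in> Basis" for b j
    using lebesgue_logsob_deficit(3)[OF w[of j] e[of j] that] by (simp add: d_def[abs_def] P_def Q_def R_def)
  have nn: "(\<integral>\<^sup>+t. ennreal (\<Sum>b\<in>Basis. d b j t) \<partial>gaussE) = ennreal (S j)" for j
  proof -
    have "(\<integral>\<^sup>+t. ennreal (\<Sum>b\<in>Basis. d b j t) \<partial>gaussE) = ennreal (\<integral>t. (\<Sum>b\<in>Basis. d b j t) \<partial>gaussE)"
      by (intro nn_integral_eq_integral Bochner_Integration.integrable_sum di AE_I2 sum_nonneg d0)
    also have "(\<integral>t. (\<Sum>b\<in>Basis. d b j t) \<partial>gaussE) = S j"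
      unfolding S_def by (rule Bochner_Integration.integral_sum[OF di])
    finally show ?thesis .
  qed
  have dm: "(\<lambda>t. ennreal (\<Sum>b\<in>Basis. d b j t)) \<in> borel_measurable gaussE" for j
    by (intro measurable_compose[OF _ measurable_ennreal] borel_measurable_sum borel_measurable_integrable di)
  define d' where "d' b t = R' b t - (Q' b t)\<^sup>2 / P' t" for b t
  have dl: "(\<lambda>j. d b j t) \<longlonglongrightarrow> d' b t" if "b \<in> Basis" for b t
  proof -
    have "(\<lambda>j. d b j t) \<longlonglongrightarrow> R' b t - (Q' b t)\<^sup>2 / (P' t + 0)"
      unfolding d_def using P'pos[of t] by (intro tendsto_intros Rl Ql Pl e0 that) auto
    then show ?thesis by (simp add: d'_def)
  qed
  have lim: "liminf (\<lambda>j. ennreal (\<Sum>b\<in>Basis. d b j t)) = ennreal (\<Sum>b\<in>Basis. d' b t)" for t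
    by (intro lim_imp_Liminf tendsto_ennrealI tendsto_sum dl) auto
  have "(\<integral>\<^sup>+t. liminf (\<lambda>j. ennreal (\<Sum>b\<in>Basis. d b j t)) \<partial>gaussE) \<le> liminf (\<lambda>j. ennreal (S j))"
    unfolding nn[symmetric] by (rule nn_integral_liminf[OF dm])
  also have "liminf (\<lambda>j. ennreal (S j)) = ennreal 0" by (intro lim_imp_Liminf tendsto_ennrealI Sl) auto
  finally have "(\<integral>\<^sup>+t. liminf (\<lambda>j. ennreal (\<Sum>b\<in>Basis. d b j t)) \<partial>gaussE) = 0" by simp
  then have "AE t in gaussE. liminf (\<lambda>j. ennreal (\<Sum>b\<in>Basis. d b j t)) = 0"
    by (subst (asm) nn_integral_0_iff_AE) (intro borel_measurable_liminf dm)
  then have ae: "AE t in gaussE. (\<Sum>b\<in>Basis. d' b t) \<le> 0" unfolding lim by eventually_elim (simp add: ennreal_eq_0_iff)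
  obtain t where t: "(\<Sum>b\<in>Basis. d' b t) \<le> 0"
  proof (rule ccontr)
    assume "\<not> thesis"
    then have "\<And>t. \<not> (\<Sum>b\<in>Basis. d' b t) \<le> 0" using that by blast
    with ae have "AE t in (gaussE :: 'a measure). False" by auto
    then show False by (simp add: gaussE.AE_False)
  qed
  have d'0: "0 \<le> d' b t" if "b \<in> Basis" for b
    using dl[OF that, of t] d0[OF that] by (intro LIMSEQ_le_const) auto
  have dz: "d' b t = 0" if "b \<in> Basis" for b
    using t d'0 that sum_nonneg_eq_0_iff[of Basis "\<lambda>b. d' b t"] sum_nonneg[of Basis "\<lambda>b. d' b t"] by (auto intro: antisym)
  define \<beta> where "\<beta> = (\<Sum>b\<in>Basis. (Q' b t / P' t) *\<^sub>R b)"
  have tw: "AE x in lborel. twist u g b x = (\<beta> \<bullet> b) * u x" if b: "b \<in> Basis" for b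
  proof -
    define c where "c = \<beta> \<bullet> b"
    have c: "c = Q' b t / P' t" unfolding c_def \<beta>_def by (rule inner_sum_scale_Basis[OF b])
    have l: "l2 lborel (\<lambda>x. r t x * twist u g b x - c * (r t x * u x))" by (intro l2_diff l2_cmult lrt lru b)
    have "(\<integral>x. (r t x * twist u g b x - c * (r t x * u x))\<^sup>2 \<partial>lborel)
       = (\<integral>x. (r t x * twist u g b x)\<^sup>2 - 2 * c * ((r t x * u x) * (r t x * twist u g b x)) + c\<^sup>2 * (r t x * u x)\<^sup>2 \<partial>lborel)"
      by (intro Bochner_Integration.integral_cong refl) (simp add: power2_eq_square algebra_simps)
    also have "\<dots> = R' b t - 2 * c * Q' b t + c\<^sup>2 * P' t"
      using l2_square[OF lru[of t]] l2_square[OF lrt[OF b, of t]] l2_mult_integrable[OF lru[of t] lrt[OF b, of t]]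
      by (simp add: R'_def P'_def Q'_def)
    also have "\<dots> = d' b t" using P'pos[of t] by (simp add: c d'_def power2_eq_square field_simps)
    also have "\<dots> = 0" by (rule dz[OF b])
    finally have "AE x in lborel. (r t x * twist u g b x - c * (r t x * u x))\<^sup>2 = 0"
      using l2_square[OF l] by (subst (asm) integral_nonneg_eq_0_iff_AE) auto
    then show ?thesis
    proof eventually_elim
      case (elim x)
      then have "r t x * (twist u g b x - c * u x) = 0" by (simp add: algebra_simps)
      then show ?case using rpos[of t x] by (simp add: c_def)
    qed
  qed
  have "AE x in lborel. \<forall>b\<in>Basis. twist u g b x = (\<beta> \<bullet> b) * u x"
    by (rule AE_finite_allI[OF finite_Basis tw])
  then have "AE x in lborel. g x = u x *\<^sub>R (\<beta> - x /\<^sub>R 2)"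
  proof eventually_elim
    case (elim x)
    show ?case
    proof (rule euclidean_eqI)
      fix b :: 'a assume "b \<in> Basis"
      then have "g x \<bullet> b + u x * (x \<bullet> b) / 2 = (\<beta> \<bullet> b) * u x" using elim by (simp add: twist_def)
      then show "g x \<bullet> b = (u x *\<^sub>R (\<beta> - x /\<^sub>R 2)) \<bullet> b" by (simp add: inner_diff_left algebra_simps)
    qed
  qed
  then show "\<exists>\<beta>. AE x in lborel. g x = u x *\<^sub>R (\<beta> - x /\<^sub>R 2)" by blast
qed

section \<open>Borel representatives and weak gradients in D12\<close>

lemma GDERIV_unique:
  assumes "GDERIV f x :> D" "GDERIV f x :> D'"
  shows "D = D'"
proof -
  have "(\<lambda>h. h \<bullet> D) = (\<lambda>h. h \<bullet> D')"
    using assms unfolding gderiv_def by (rule has_derivative_unique)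
  then have "(D - D') \<bullet> D = (D - D') \<bullet> D'" by (rule fun_cong)
  then have "(D - D') \<bullet> (D - D') = 0" by (simp add: inner_diff_right)
  then show ?thesis by simp
qed

lemma grad_eq: "GDERIV f x :> D \<Longrightarrow> grad f x = D"
  unfolding grad_def by (rule the_equality, assumption) (rule GDERIV_unique)

lemma GDERIV_zero_outside:
  assumes D: "GDERIV f x :> D" and x: "x \<notin> closure {x. f x \<noteq> 0}"
  shows "D = 0"
proof -
  have "eventually (\<lambda>y. y \<in> - closure {x. f x \<noteq> 0}) (nhds x)"
    using x by (intro eventually_nhds_in_open) auto
  moreover have "- closure {x. f x \<noteq> 0} \<subseteq> {y. 0 = f y}"
    using closure_subset[of "{x. f x \<noteq> 0}"] by auto
  ultimately have "eventually (\<lambda>y. 0 = f y) (nhds x)"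
    by (auto elim: eventually_mono)
  then have ev: "0 = f x" "eventually (\<lambda>y. 0 = f y) (at x)" by (simp_all add: eventually_nhds_conv_at)
  have "GDERIV (\<lambda>_. 0) x :> 0" by (rule GDERIV_const)
  then have "GDERIV f x :> 0" unfolding gderiv_def
    by (rule has_derivative_transform_eventually[OF _ ev(2,1)]) simp
  then show ?thesis using D by (rule GDERIV_unique[symmetric])
qed

lemma test_function_GDERIV:
  assumes "test_function \<phi>"
  shows "GDERIV \<phi> x :> grad \<phi> x"
proof -
  have "C_k (Suc 0) \<phi>" using assms by (simp only: test_function_def)
  then obtain g where "\<And>x. GDERIV \<phi> x :> g x" by auto
  then show ?thesis using grad_eq by metis
qed

lemma test_function_C_k_partial:
  assumes "test_function \<phi>"
  shows "C_k k (\<lambda>x. grad \<phi> x $ i)"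
proof -
  have "C_k (Suc k) \<phi>" using assms by (simp only: test_function_def)
  then obtain g where g: "\<And>x. GDERIV \<phi> x :> g x" "\<And>i. C_k k (\<lambda>x. g x $ i)" by auto
  then have "grad \<phi> = g" using grad_eq by blast
  then show ?thesis using g(2) by simp
qed

text \<open>
  This is where infinite differentiability of test functions matters: \<open>D12_approx_grad_unique\<close> tests with
  derivatives of test functions.
\<close>

lemma test_function_partial:
  assumes t: "test_function (\<phi> :: real ^ 'n \<Rightarrow> real)"
  shows "test_function (\<lambda>x. grad \<phi> x $ i)"
  unfolding test_function_def
proof (intro conjI allI test_function_C_k_partial t)
  have "{x. grad \<phi> x $ i \<noteq> 0} \<subseteq> closure {x. \<phi> x \<noteq> 0}"
    using GDERIV_zero_outside[OF test_function_GDERIV[OF t]] by fastforce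
  then have "closure {x. grad \<phi> x $ i \<noteq> 0} \<subseteq> closure {x. \<phi> x \<noteq> 0}"
    by (simp add: closure_minimal)
  moreover have "compact (closure {x. \<phi> x \<noteq> 0})" using t by (simp add: test_function_def)
  ultimately show "compact (closure {x. grad \<phi> x $ i \<noteq> 0})"
    by (meson bounded_subset closed_closure compact_eq_bounded_closed)
qed

lemma test_function_C1c:
  assumes t: "test_function (\<phi> :: real ^ 'n \<Rightarrow> real)"
  shows "C1c \<phi> (grad \<phi>)"
  unfolding C1c_def
proof (intro conjI allI test_function_GDERIV t)
  have "continuous_on UNIV (\<lambda>x. grad \<phi> x $ i)" for i
    using test_function_C_k_partial[OF t, of 0 i] unfolding C_k.simps(1) .
  then have "continuous_on UNIV (\<lambda>x. \<chi> i. grad \<phi> x $ i)" by (rule continuous_on_vec_lambda)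
  then show "continuous_on UNIV (grad \<phi>)" by simp
  have "bounded (closure {x. \<phi> x \<noteq> 0})" using t by (simp add: test_function_def compact_imp_bounded)
  then obtain R where R: "\<And>x. x \<in> closure {x. \<phi> x \<noteq> 0} \<Longrightarrow> norm x \<le> R" by (auto simp: bounded_iff)
  show "\<exists>R. \<forall>x. R < norm x \<longrightarrow> \<phi> x = 0 \<and> grad \<phi> x = 0"
  proof (intro exI[of _ R] allI impI)
    fix x :: "real ^ 'n" assume "R < norm x"
    then have x: "x \<notin> closure {x. \<phi> x \<noteq> 0}" using R by force
    then have "\<phi> x = 0" using closure_subset[of "{x. \<phi> x \<noteq> 0}"] by auto
    moreover have "grad \<phi> x = 0" by (rule GDERIV_zero_outside[OF test_function_GDERIV[OF t] x])
    ultimately show "\<phi> x = 0 \<and> grad \<phi> x = 0" ..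
  qed
qed

lemma C1c_support_l2:
  assumes w: "C1c w Dw" and c: "continuous_on UNIV f" and f: "\<And>x. w x = 0 \<Longrightarrow> Dw x = 0 \<Longrightarrow> f x = (0::real)"
  shows "l2 lborel f"
proof -
  have "continuous_on UNIV (\<lambda>x. (f x)\<^sup>2)" by (intro continuous_intros c)
  from C1c_integrable(1)[OF w this] C1c_integrable(2)[OF w c] f show ?thesis by (simp add: l2_def)
qed

lemma C1c_l2_function_and_partial:
  assumes w: "C1c w Dw"
  shows "l2 lborel w" "l2 lborel (\<lambda>x. Dw x \<bullet> b)"
  using C1c_support_l2[OF w C1cD(2)[OF w]] C1c_support_l2[OF w continuous_on_inner[OF C1cD(3)[OF w] continuous_on_const], of b] by simp_all

lemma C1c_mult:
  assumes v: "\<And>x. GDERIV v x :> Dv x" "continuous_on UNIV Dv" and w: "C1c w Dw"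
  shows "C1c (\<lambda>x. v x * w x) (\<lambda>x. v x *\<^sub>R Dw x + w x *\<^sub>R Dv x)"
  unfolding C1c_def
proof (intro conjI allI)
  show "GDERIV (\<lambda>x. v x * w x) x :> v x *\<^sub>R Dw x + w x *\<^sub>R Dv x" for x
    by (rule GDERIV_mult[OF v(1) C1cD(1)[OF w]])
  show "continuous_on UNIV (\<lambda>x. v x *\<^sub>R Dw x + w x *\<^sub>R Dv x)"
    by (intro continuous_intros v C1cD[OF w] GDERIV_continuous[OF v(1)])
  obtain R where "\<And>x. R < norm x \<Longrightarrow> w x = 0 \<and> Dw x = 0" using C1cD(4)[OF w] by blast
  then show "\<exists>R. \<forall>x. R < norm x \<longrightarrow> v x * w x = 0 \<and> v x *\<^sub>R Dw x + w x *\<^sub>R Dv x = 0"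
    by (auto intro!: exI[of _ R])
qed

lemma C1c_product_ibp:
  fixes v w :: "'a::euclidean_space \<Rightarrow> real"
  assumes v: "C1c v Dv" and w: "C1c w Dw" and b: "b \<in> Basis"
  shows "(\<integral>x. (Dv x \<bullet> b) * w x \<partial>lborel) = - (\<integral>x. v x * (Dw x \<bullet> b) \<partial>lborel)"
proof -
  have "C1c (\<lambda>x. v x * w x) (\<lambda>x. v x *\<^sub>R Dw x + w x *\<^sub>R Dv x)"
    using C1cD[OF v] by (intro C1c_mult w) auto
  from integral_partial_eq_0[OF this b]
  have "0 = (\<integral>x. v x * (Dw x \<bullet> b) + (Dv x \<bullet> b) * w x \<partial>lborel)" by (simp add: inner_add_left mult.commute)
  also have "\<dots> = (\<integral>x. v x * (Dw x \<bullet> b) \<partial>lborel) + (\<integral>x. (Dv x \<bullet> b) * w x \<partial>lborel)"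
    by (intro Bochner_Integration.integral_add l2_mult_integrable C1c_l2_function_and_partial[OF v] C1c_l2_function_and_partial[OF w])
  finally show ?thesis by simp
qed

lemma l2conv_nn:
  assumes fs: "\<And>j. l2 M (fs j)" and f[measurable]: "f \<in> borel_measurable M"
    and lim: "(\<lambda>j. \<integral>\<^sup>+x. ennreal ((fs j x - f x)\<^sup>2) \<partial>M) \<longlonglongrightarrow> 0"
  shows "l2conv M fs f"
proof -
  note [measurable] = l2_measurable[OF fs]
  have "eventually (\<lambda>j. (\<integral>\<^sup>+x. ennreal ((fs j x - f x)\<^sup>2) \<partial>M) < 1) sequentially"
    using lim by (rule order_tendstoD) simp
  then obtain j where j: "(\<integral>\<^sup>+x. ennreal ((fs j x - f x)\<^sup>2) \<partial>M) < 1" by (auto simp: eventually_sequentially)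
  then have "(\<integral>\<^sup>+x. ennreal ((fs j x - f x)\<^sup>2) \<partial>M) < \<infinity>" using less_trans[OF _ ennreal_one_less_top] by auto
  then have "integrable M (\<lambda>x. (fs j x - f x)\<^sup>2)" by (intro integrableI_nonneg) auto
  then have "l2 M (\<lambda>x. fs j x - f x)" by (simp add: l2_def)
  then have "l2 M (\<lambda>x. fs j x - (fs j x - f x))" by (rule l2_diff[OF fs])
  then have lf: "l2 M f" by simp
  have "(\<lambda>j. enn2real (\<integral>\<^sup>+x. ennreal ((fs j x - f x)\<^sup>2) \<partial>M)) \<longlonglongrightarrow> 0"
    using tendsto_enn2real[where l=0] lim by simp
  then have "(\<lambda>j. \<integral>x. (fs j x - f x)\<^sup>2 \<partial>M) \<longlonglongrightarrow> 0"
    by (subst integral_eq_nn_integral) auto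
  then show ?thesis using fs lf by (simp add: l2conv_def)
qed

text \<open>
  The approximation in \<open>has_D12_gradient\<close> with Borel representatives, so that products and translates
  are measurable for \<open>lborel\<close>.
\<close>

definition D12_approx :: "(real ^ 'n \<Rightarrow> real) \<Rightarrow> (real ^ 'n \<Rightarrow> real ^ 'n) \<Rightarrow> (nat \<Rightarrow> real ^ 'n \<Rightarrow> real) \<Rightarrow> bool" where
  "D12_approx u g \<phi> \<longleftrightarrow> u \<in> borel_measurable borel \<and> g \<in> borel_measurable borel \<and> (\<forall>k. test_function (\<phi> k)) \<and>
     (\<lambda>k. \<integral>\<^sup>+x. ennreal ((norm (grad (\<phi> k) x - g x))\<^sup>2) \<partial>lborel) \<longlonglongrightarrow> 0 \<and>
     (\<lambda>k. \<integral>\<^sup>+x. ennreal (\<bar>\<phi> k x - u x\<bar> powr critical_exponent CARD('n)) \<partial>lborel) \<longlonglongrightarrow> 0"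

lemma borel_representative_vec:
  fixes g :: "real ^ 'n \<Rightarrow> real ^ 'n"
  assumes "g \<in> borel_measurable lebesgue"
  shows "\<exists>g0 \<in> borel_measurable borel. AE x in lborel. g x = g0 x"
proof -
  have "\<forall>i. \<exists>f \<in> borel_measurable lborel. AE x in lborel. g x $ i = f x"
  proof
    fix i
    have "(\<lambda>y. y $ i) \<in> borel_measurable (borel :: (real ^ 'n) measure)" by (intro borel_measurable_continuous_onI continuous_intros)
    then have "(\<lambda>x. g x $ i) \<in> borel_measurable lebesgue" using measurable_compose[OF assms] by blast
    then show "\<exists>f \<in> borel_measurable lborel. AE x in lborel. g x $ i = f x" by (rule completion_ex_borel_measurable_real)
  qed
  then obtain f where f: "\<And>i. f i \<in> borel_measurable lborel" "\<And>i. AE x in lborel. g x $ i = f i x" by metis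
  have m: "(\<lambda>x. \<chi> i. f i x) \<in> borel_measurable borel"
  proof (rule borel_measurable_euclidean_space[THEN iffD2], rule ballI)
    fix b :: "real ^ 'n" assume "b \<in> Basis"
    then obtain i where "b = axis i 1" by (auto simp: Basis_vec_def)
    then show "(\<lambda>x. (\<chi> i. f i x) \<bullet> b) \<in> borel_measurable borel" using f(1)[of i] by (simp add: inner_axis)
  qed
  have "AE x in lborel. \<forall>i\<in>UNIV. g x $ i = f i x" using f(2) by (intro AE_finite_allI) auto
  then have e: "AE x in lborel. g x = (\<chi> i. f i x)" by eventually_elim (simp add: vec_eq_iff)
  show ?thesis by (rule bexI[where x="\<lambda>x. \<chi> i. f i x"]) (rule e, rule m)
qed

lemma has_D12_gradient_approx:
  assumes "has_D12_gradient u g"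
  shows "\<exists>u0 g0 \<phi>. D12_approx u0 g0 \<phi> \<and> (AE x in lborel. u x = u0 x) \<and> (AE x in lborel. g x = g0 x)"
proof -
  obtain \<phi> where m: "u \<in> borel_measurable lebesgue" "g \<in> borel_measurable lebesgue" and t: "\<forall>k. test_function (\<phi> k)"
    and l: "(\<lambda>k. \<integral>\<^sup>+x. ennreal ((norm (grad (\<phi> k) x - g x))\<^sup>2) \<partial>lebesgue) \<longlonglongrightarrow> 0"
      "(\<lambda>k. \<integral>\<^sup>+x. ennreal (\<bar>\<phi> k x - u x\<bar> powr critical_exponent CARD('a)) \<partial>lebesgue) \<longlonglongrightarrow> 0"
    using assms unfolding has_D12_gradient_def by blast
  obtain u0 where u0: "u0 \<in> borel_measurable lborel" "AE x in lborel. u x = u0 x"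
    using completion_ex_borel_measurable_real[OF m(1)] by blast
  obtain g0 where g0: "g0 \<in> borel_measurable borel" "AE x in lborel. g x = g0 x"
    using borel_representative_vec[OF m(2)] by blast
  have e1: "(\<integral>\<^sup>+x. ennreal ((norm (grad (\<phi> k) x - g x))\<^sup>2) \<partial>lborel) = (\<integral>\<^sup>+x. ennreal ((norm (grad (\<phi> k) x - g0 x))\<^sup>2) \<partial>lborel)" for k
    using g0(2) by (intro nn_integral_cong_AE) auto
  have e2: "(\<integral>\<^sup>+x. ennreal (\<bar>\<phi> k x - u x\<bar> powr critical_exponent CARD('a)) \<partial>lborel) = (\<integral>\<^sup>+x. ennreal (\<bar>\<phi> k x - u0 x\<bar> powr critical_exponent CARD('a)) \<partial>lborel)" for k
    using u0(2) by (intro nn_integral_cong_AE) auto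
  have "D12_approx u0 g0 \<phi>"
    using l u0(1) g0(1) t unfolding D12_approx_def nn_integral_completion e1 e2 by simp
  then show ?thesis using u0 g0 by blast
qed

lemma D12_approxD:
  assumes "D12_approx u g \<phi>"
  shows "u \<in> borel_measurable borel" "g \<in> borel_measurable borel" "C1c (\<phi> k) (grad (\<phi> k))" "test_function (\<phi> k)"
  using assms by (simp_all add: D12_approx_def test_function_C1c)

lemma D12_grad_l2conv:
  assumes a: "D12_approx u g \<phi>" and b: "b \<in> Basis"
  shows "l2conv lborel (\<lambda>k x. grad (\<phi> k) x \<bullet> b) (\<lambda>x. g x \<bullet> b)"
proof (rule l2conv_nn)
  show "l2 lborel (\<lambda>x. grad (\<phi> k) x \<bullet> b)" for k by (rule C1c_l2_function_and_partial(2)[OF D12_approxD(3)[OF a]])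
  have [measurable]: "g \<in> borel_measurable borel" by (rule D12_approxD[OF a])
  show "(\<lambda>x. g x \<bullet> b) \<in> borel_measurable lborel" by measurable
  have l: "(\<lambda>k. \<integral>\<^sup>+x. ennreal ((norm (grad (\<phi> k) x - g x))\<^sup>2) \<partial>lborel) \<longlonglongrightarrow> 0" using a by (simp add: D12_approx_def)
  show "(\<lambda>k. \<integral>\<^sup>+x. ennreal ((grad (\<phi> k) x \<bullet> b - g x \<bullet> b)\<^sup>2) \<partial>lborel) \<longlonglongrightarrow> 0"
  proof (rule tendsto_sandwich[OF _ _ tendsto_const l])
    show "\<forall>\<^sub>F k in sequentially. (\<integral>\<^sup>+x. ennreal ((grad (\<phi> k) x \<bullet> b - g x \<bullet> b)\<^sup>2) \<partial>lborel) \<le> (\<integral>\<^sup>+x. ennreal ((norm (grad (\<phi> k) x - g x))\<^sup>2) \<partial>lborel)"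
    proof (intro always_eventually allI nn_integral_mono ennreal_leI)
      fix k x
      have "\<bar>(grad (\<phi> k) x - g x) \<bullet> b\<bar>\<^sup>2 \<le> (norm (grad (\<phi> k) x - g x))\<^sup>2" by (intro power_mono Basis_le_norm b) auto
      then show "(grad (\<phi> k) x \<bullet> b - g x \<bullet> b)\<^sup>2 \<le> (norm (grad (\<phi> k) x - g x))\<^sup>2" by (simp add: inner_diff_left)
    qed
  qed simp
qed

lemma critical_exponent_gt_2:
  assumes "N \<ge> 3" shows "critical_exponent N > 2"
  using assms by (simp add: critical_exponent_def field_simps)

text \<open>
  The critical exponent exceeds two, so on a ball convergence in the larger exponent implies convergence in mean
  square; pointwise, \<open>d\<^sup>2 \<le> \<epsilon>\<^sup>2 + \<epsilon> powr (2 - p) * |d| powr p\<close>.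
\<close>

lemma D12_local_l2conv:
  fixes \<phi> :: "nat \<Rightarrow> real ^ 'n \<Rightarrow> real"
  assumes a: "D12_approx u g \<phi>" and N: "CARD('n) \<ge> 3"
  shows "l2conv lborel (\<lambda>k x. indicator (cball 0 R) x * \<phi> k x) (\<lambda>x. indicator (cball 0 R) x * u x)"
proof (rule l2conv_nn)
  define p where "p = critical_exponent CARD('n)"
  have p: "p > 2" unfolding p_def by (rule critical_exponent_gt_2[OF N])
  have [measurable]: "u \<in> borel_measurable borel" by (rule D12_approxD[OF a])
  have [measurable]: "cball (0 :: real ^ 'n) R \<in> sets borel" by simp
  have [measurable]: "\<phi> k \<in> borel_measurable borel" for k
    using C1cD(2)[OF D12_approxD(3)[OF a]] by (rule borel_measurable_continuous_onI)
  show "l2 lborel (\<lambda>x. indicator (cball 0 R) x * \<phi> k x)" for k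
    by (rule l2_bound[OF C1c_l2_function_and_partial(1)[OF D12_approxD(3)[OF a]], where C=1]) (auto simp: indicator_def)
  show "(\<lambda>x. indicator (cball 0 R) x * u x) \<in> borel_measurable lborel" by measurable
  define P where "P k = (\<integral>\<^sup>+x. ennreal (\<bar>\<phi> k x - u x\<bar> powr p) \<partial>lborel)" for k
  have P: "P \<longlonglongrightarrow> 0" using a by (simp add: D12_approx_def P_def[abs_def] p_def)
  define V where "V = measure lborel (cball (0 :: real ^ 'n) R)"
  have V: "emeasure lborel (cball (0 :: real ^ 'n) R) = ennreal V" "0 \<le> V"
    unfolding V_def using emeasure_cball_less_top[of "0 :: real ^ 'n" R] by (auto intro!: emeasure_eq_ennreal_measure)
  show "(\<lambda>k. \<integral>\<^sup>+x. ennreal ((indicator (cball 0 R) x * \<phi> k x - indicator (cball 0 R) x * u x)\<^sup>2) \<partial>lborel) \<longlonglongrightarrow> 0"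
  proof (rule order_tendstoI)
    fix y :: ennreal assume "0 < y"
    then obtain y' where y': "0 < y'" "y' < y" using dense by blast
    then obtain \<delta> where \<delta>: "y' = ennreal \<delta>" "0 < \<delta>" by (cases y') auto
    define \<epsilon> where "\<epsilon> = sqrt (\<delta> / (2 * (V + 1)))"
    have \<epsilon>: "0 < \<epsilon>" using \<delta> V by (simp add: \<epsilon>_def)
    have \<epsilon>V: "\<epsilon>\<^sup>2 * V \<le> \<delta> / 2"
    proof -
      have "\<epsilon>\<^sup>2 = \<delta> / (2 * (V + 1))" using \<delta> V by (simp add: \<epsilon>_def)
      then have "2 * (\<epsilon>\<^sup>2 * V) + 2 * \<epsilon>\<^sup>2 = \<delta>" using V by (simp add: field_simps)
      then show ?thesis using zero_le_power2[of \<epsilon>] by linarith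
    qed
    define c where "c = \<epsilon> powr (2 - p)"
    have c: "0 < c" using \<epsilon> by (simp add: c_def)
    have pt: "d\<^sup>2 \<le> \<epsilon>\<^sup>2 + c * \<bar>d\<bar> powr p" for d :: real
    proof (cases "\<bar>d\<bar> \<le> \<epsilon>")
      case True
      then have "d\<^sup>2 \<le> \<epsilon>\<^sup>2" using abs_le_square_iff[of d \<epsilon>] \<epsilon> by simp
      then show ?thesis using c by (simp add: add_increasing2)
    next
      case False
      then have d: "\<epsilon> < \<bar>d\<bar>" "0 < \<bar>d\<bar>" using \<epsilon> by auto
      have "d\<^sup>2 = \<bar>d\<bar> powr 2" using d by simp
      also have "\<dots> = \<bar>d\<bar> powr (2 - p) * \<bar>d\<bar> powr p" by (simp flip: powr_add)
      also have "\<dots> \<le> c * \<bar>d\<bar> powr p"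
        unfolding c_def using d \<epsilon> p by (intro mult_right_mono powr_mono2') auto
      finally show ?thesis by (simp add: add_increasing)
    qed
    have "eventually (\<lambda>k. P k < ennreal (\<delta> / (2 * c))) sequentially"
      using P by (rule order_tendstoD) (use \<delta> c in simp)
    then show "eventually (\<lambda>k. (\<integral>\<^sup>+x. ennreal ((indicator (cball 0 R) x * \<phi> k x - indicator (cball 0 R) x * u x)\<^sup>2) \<partial>lborel) < y) sequentially"
    proof eventually_elim
      case (elim k)
      have "(\<integral>\<^sup>+x. ennreal ((indicator (cball 0 R) x * \<phi> k x - indicator (cball 0 R) x * u x)\<^sup>2) \<partial>lborel)
         \<le> (\<integral>\<^sup>+x. ennreal (\<epsilon>\<^sup>2) * indicator (cball 0 R) x + ennreal c * ennreal (\<bar>\<phi> k x - u x\<bar> powr p) \<partial>lborel)"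
      proof (rule nn_integral_mono)
        fix x
        show "ennreal ((indicator (cball 0 R) x * \<phi> k x - indicator (cball 0 R) x * u x)\<^sup>2)
          \<le> ennreal (\<epsilon>\<^sup>2) * indicator (cball 0 R) x + ennreal c * ennreal (\<bar>\<phi> k x - u x\<bar> powr p)"
          using ennreal_leI[OF pt[of "\<phi> k x - u x"]] c
          by (cases "x \<in> cball 0 R") (simp_all add: ennreal_plus ennreal_mult)
      qed
      also have "\<dots> = ennreal (\<epsilon>\<^sup>2) * ennreal V + ennreal c * P k"
        unfolding P_def by (subst nn_integral_add) (simp_all add: nn_integral_cmult V)
      also have "\<dots> \<le> ennreal (\<epsilon>\<^sup>2 * V) + ennreal c * ennreal (\<delta> / (2 * c))"
        using elim V by (intro add_mono mult_left_mono) (auto simp: ennreal_mult)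
      also have "\<dots> = ennreal (\<epsilon>\<^sup>2 * V + \<delta> / 2)"
        using c \<delta> V by (simp flip: ennreal_mult ennreal_plus)
      also have "\<dots> \<le> ennreal \<delta>" using \<epsilon>V by (intro ennreal_leI) simp
      also have "\<dots> < y" using y' \<delta> by simp
      finally show ?case .
    qed
  qed auto
qed

lemma l2conv_const: "l2 M f \<Longrightarrow> l2conv M (\<lambda>_. f) f"
  by (simp add: l2conv_def)

lemma D12_weak_derivative:
  fixes \<phi> :: "nat \<Rightarrow> real ^ 'n \<Rightarrow> real"
  assumes a: "D12_approx u g \<phi>" and N: "CARD('n) \<ge> 3" and v: "C1c v Dv" and b: "b \<in> Basis"
  shows "(\<integral>x. (g x \<bullet> b) * v x \<partial>lborel) = - (\<integral>x. u x * (Dv x \<bullet> b) \<partial>lborel)"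
proof -
  obtain R where R: "\<And>x. R < norm x \<Longrightarrow> v x = 0 \<and> Dv x = 0" using C1cD(4)[OF v] by blast
  have i: "indicator (cball 0 R) x * y * (Dv x \<bullet> b) = y * (Dv x \<bullet> b)" for x and y :: real
    using R[of x] by (auto simp: indicator_def)
  have "(\<lambda>k. \<integral>x. (grad (\<phi> k) x \<bullet> b) * v x \<partial>lborel) \<longlonglongrightarrow> (\<integral>x. (g x \<bullet> b) * v x \<partial>lborel)"
    by (rule l2conv_mult[OF D12_grad_l2conv[OF a b] l2conv_const[OF C1c_l2_function_and_partial(1)[OF v]]])
  moreover have "(\<integral>x. (grad (\<phi> k) x \<bullet> b) * v x \<partial>lborel) = - (\<integral>x. \<phi> k x * (Dv x \<bullet> b) \<partial>lborel)" for k
    by (rule C1c_product_ibp[OF D12_approxD(3)[OF a] v b])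
  ultimately have 1: "(\<lambda>k. - (\<integral>x. \<phi> k x * (Dv x \<bullet> b) \<partial>lborel)) \<longlonglongrightarrow> (\<integral>x. (g x \<bullet> b) * v x \<partial>lborel)" by simp
  have "(\<lambda>k. \<integral>x. indicator (cball 0 R) x * \<phi> k x * (Dv x \<bullet> b) \<partial>lborel) \<longlonglongrightarrow> (\<integral>x. indicator (cball 0 R) x * u x * (Dv x \<bullet> b) \<partial>lborel)"
    by (rule l2conv_mult[OF D12_local_l2conv[OF a N] l2conv_const[OF C1c_l2_function_and_partial(2)[OF v]]])
  then have "(\<lambda>k. - (\<integral>x. \<phi> k x * (Dv x \<bullet> b) \<partial>lborel)) \<longlonglongrightarrow> - (\<integral>x. u x * (Dv x \<bullet> b) \<partial>lborel)"
    unfolding i by (rule tendsto_minus)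
  with 1 show ?thesis by (rule LIMSEQ_unique)
qed

text \<open>
  The difference \<open>d\<close> of two gradients of the same function is orthogonal to all test functions by
  \<open>D12_weak_derivative\<close>. The partial derivatives of both approximating sequences are test
  functions and converge to the two gradients, so \<open>d\<close> is orthogonal to both of these and hence to itself.
\<close>

lemma D12_approx_grad_unique:
  fixes \<phi> :: "nat \<Rightarrow> real ^ 'n \<Rightarrow> real"
  assumes a: "D12_approx u g \<phi>" and a': "D12_approx u' g' \<phi>'" and u: "AE x in lborel. u x = u' x" and N: "CARD('n) \<ge> 3"
  shows "AE x in lborel. g x = g' x"
proof -
  have "AE x in lborel. g x \<bullet> b = g' x \<bullet> b" if b: "b \<in> Basis" for b
  proof -
    obtain i where i: "b = axis i 1" using b by (auto simp: Basis_vec_def)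
    have [measurable]: "u \<in> borel_measurable borel" "u' \<in> borel_measurable borel" using D12_approxD[OF a] D12_approxD[OF a'] by auto
    have lg: "l2 lborel (\<lambda>x. g x \<bullet> b)" "l2 lborel (\<lambda>x. g' x \<bullet> b)"
      using D12_grad_l2conv[OF a b] D12_grad_l2conv[OF a' b] by (auto simp: l2conv_def)
    define d where "d x = g x \<bullet> b - g' x \<bullet> b" for x
    have ld: "l2 lborel d" unfolding d_def[abs_def] using lg by (rule l2_diff)
    have z: "(\<integral>x. d x * v x \<partial>lborel) = 0" if v: "test_function v" for v
    proof -
      note c = test_function_C1c[OF v]
      have "(\<integral>x. d x * v x \<partial>lborel) = (\<integral>x. (g x \<bullet> b) * v x - (g' x \<bullet> b) * v x \<partial>lborel)"
        by (simp add: d_def left_diff_distrib)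
      also have "\<dots> = (\<integral>x. (g x \<bullet> b) * v x \<partial>lborel) - (\<integral>x. (g' x \<bullet> b) * v x \<partial>lborel)"
        by (intro Bochner_Integration.integral_diff l2_mult_integrable lg C1c_l2_function_and_partial[OF c])
      also have "\<dots> = - (\<integral>x. u x * (grad v x \<bullet> b) \<partial>lborel) + (\<integral>x. u' x * (grad v x \<bullet> b) \<partial>lborel)"
        using D12_weak_derivative[OF a N c b] D12_weak_derivative[OF a' N c b] by simp
      also have "(\<integral>x. u x * (grad v x \<bullet> b) \<partial>lborel) = (\<integral>x. u' x * (grad v x \<bullet> b) \<partial>lborel)"
      proof (rule integral_cong_AE)
        have [measurable]: "(\<lambda>x. grad v x \<bullet> b) \<in> borel_measurable borel" using l2_measurable[OF C1c_l2_function_and_partial(2)[OF c]] by simp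
        show "(\<lambda>x. u x * (grad v x \<bullet> b)) \<in> borel_measurable lborel" "(\<lambda>x. u' x * (grad v x \<bullet> b)) \<in> borel_measurable lborel" by measurable
        show "AE x in lborel. u x * (grad v x \<bullet> b) = u' x * (grad v x \<bullet> b)" using u by eventually_elim simp
      qed
      finally show ?thesis by simp
    qed
    have t: "test_function (\<lambda>x. grad (\<phi> k) x \<bullet> b)" "test_function (\<lambda>x. grad (\<phi>' k) x \<bullet> b)" for k
      using test_function_partial[OF D12_approxD(4)[OF a], of k i] test_function_partial[OF D12_approxD(4)[OF a'], of k i]
      by (auto simp: i inner_axis)
    have zl: "(\<integral>x. d x * (g x \<bullet> b) \<partial>lborel) = 0" "(\<integral>x. d x * (g' x \<bullet> b) \<partial>lborel) = 0"
      using l2conv_mult[OF l2conv_const[OF ld] D12_grad_l2conv[OF a b]] l2conv_mult[OF l2conv_const[OF ld] D12_grad_l2conv[OF a' b]]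
      by (simp_all add: z[OF t(1)] z[OF t(2)] LIMSEQ_const_iff)
    have "(\<integral>x. (d x)\<^sup>2 \<partial>lborel) = (\<integral>x. d x * (g x \<bullet> b) - d x * (g' x \<bullet> b) \<partial>lborel)"
      by (intro Bochner_Integration.integral_cong refl) (simp add: d_def power2_eq_square algebra_simps)
    also have "\<dots> = 0" using zl by (subst Bochner_Integration.integral_diff) (auto intro!: l2_mult_integrable ld lg)
    finally have "AE x in lborel. (d x)\<^sup>2 = 0" using l2_square[OF ld] by (subst (asm) integral_nonneg_eq_0_iff_AE) auto
    then show ?thesis by eventually_elim (simp add: d_def)
  qed
  then have "AE x in lborel. \<forall>b\<in>Basis. g x \<bullet> b = g' x \<bullet> b" by (intro AE_finite_allI) auto
  then show ?thesis proof eventually_elim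
    case (elim x)
    show ?case by (rule euclidean_eqI) (use elim in simp)
  qed
qed

section \<open>Approximation by compactly supported functions\<close>

lemma G_log_isCont: "isCont G_log s"
proof (cases "s = 0")
  case False
  then have ev: "eventually (\<lambda>x. x\<^sup>2 * ln \<bar>x\<bar> = G_log x) (nhds s)"
    using t1_space_nhds[of s 0] by (auto elim!: eventually_mono simp: G_log_def)
  have "((\<lambda>x. x\<^sup>2 * ln \<bar>x\<bar>) \<longlongrightarrow> s\<^sup>2 * ln \<bar>s\<bar>) (at s)"
    using False by (intro tendsto_intros) auto
  then have "(G_log \<longlongrightarrow> s\<^sup>2 * ln \<bar>s\<bar>) (at s)"
    by (rule Lim_transform_eventually) (use ev in \<open>simp add: eventually_nhds_conv_at\<close>)
  then show ?thesis using False by (simp add: isCont_def G_log_def)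
next
  case True
  have "(G_log \<longlongrightarrow> 0) (at 0)"
  proof (rule Lim_null_comparison)
    show "\<forall>\<^sub>F x in at 0. norm (G_log x) \<le> \<bar>x\<bar> * (1 + x\<^sup>2)"
    proof (rule always_eventually, rule allI)
      fix x :: real
      have "norm (G_log x) = \<bar>x\<bar> * \<bar>\<bar>x\<bar> * ln \<bar>x\<bar>\<bar>"
        by (simp add: G_log_def abs_mult power2_eq_square)
      also have "\<dots> \<le> \<bar>x\<bar> * (1 + \<bar>x\<bar>\<^sup>2)" by (intro mult_left_mono abs_x_ln_x_le) auto
      finally show "norm (G_log x) \<le> \<bar>x\<bar> * (1 + x\<^sup>2)" by simp
    qed
    show "((\<lambda>x::real. \<bar>x\<bar> * (1 + x\<^sup>2)) \<longlongrightarrow> 0) (at 0)" by (auto intro!: tendsto_eq_intros)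
  qed
  then show ?thesis using True by (simp add: isCont_def G_log_def)
qed

lemma measurable_G_log [measurable]: "G_log \<in> borel_measurable borel"
  by (intro borel_measurable_continuous_onI continuous_at_imp_continuous_on ballI G_log_isCont)

text \<open>
  The bound \<open>- x * ln x \<le> 1\<close> at \<open>x = s\<^sup>2\<close>. On sets of finite measure \<open>G\<close> thus has an integrable
  minorant, as Fatou's lemma requires.
\<close>

lemma G_log_lower: "- (1/2) \<le> G_log s"
proof -
  have "- (x * ln x) \<le> 1" if "0 \<le> x" for x :: real
  proof (cases "x = 0")
    case False
    then have x: "0 < x" using that by simp
    have "x * ln (1/x) \<le> x * (1/x - 1)" using x by (intro mult_left_mono ln_le_minus_one) auto
    also have "x * (1/x - 1) = 1 - x" using x by (simp add: right_diff_distrib)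
    finally show ?thesis using x by (simp add: ln_div)
  qed simp
  from this[of "s\<^sup>2"] show ?thesis using G_log_eq[of s] by simp
qed

lemma G_log_mult_bound:
  assumes "0 \<le> t" "t \<le> 1"
  shows "\<bar>G_log (t * s)\<bar> \<le> \<bar>G_log s\<bar> + s\<^sup>2"
proof (cases "t = 0 \<or> s = 0")
  case False
  then have ts: "0 < t" "s \<noteq> 0" using assms by auto
  have "G_log (t * s) = t\<^sup>2 * G_log s + s\<^sup>2 * G_log t"
    using ts by (simp add: G_log_def abs_mult ln_mult power_mult_distrib algebra_simps)
  then have "\<bar>G_log (t * s)\<bar> \<le> t\<^sup>2 * \<bar>G_log s\<bar> + s\<^sup>2 * \<bar>G_log t\<bar>"
    using abs_triangle_ineq[of "t\<^sup>2 * G_log s" "s\<^sup>2 * G_log t"] by (simp add: abs_mult)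
  also have "t\<^sup>2 * \<bar>G_log s\<bar> \<le> \<bar>G_log s\<bar>" using assms by (intro mult_left_le_one_le) (auto simp: power_le_one)
  also have "\<bar>G_log t\<bar> \<le> 1"
  proof -
    have "t\<^sup>2 \<le> 1" using assms by (simp add: power_le_one)
    then have "(t\<^sup>2)\<^sup>2 \<le> 1" using assms by (simp add: power_le_one)
    then have "\<bar>2 * G_log t\<bar> \<le> 2" using abs_x_ln_x_le[of "t\<^sup>2"] G_log_eq[of t] by simp
    then show ?thesis by simp
  qed
  then have "s\<^sup>2 * \<bar>G_log t\<bar> \<le> s\<^sup>2" by (intro mult_left_le) auto
  finally show ?thesis by simp
qed (auto simp: G_log_def)

lemma square_max_deriv: "((\<lambda>s::real. (max 0 s)\<^sup>2) has_real_derivative 2 * max 0 s) (at s)"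
proof -
  consider "0 < s" | "s < 0" | "s = 0" by linarith
  then show ?thesis
  proof cases
    case 1
    have "((\<lambda>s. s\<^sup>2) has_real_derivative 2 * s) (at s)" by (auto intro!: derivative_eq_intros)
    moreover have "eventually (\<lambda>x. x\<^sup>2 = (max 0 x)\<^sup>2) (nhds s)"
      using 1 eventually_nhds_in_open[of "{0<..}" s] by (auto elim!: eventually_mono)
    ultimately show ?thesis using 1 DERIV_cong_ev[of s s "\<lambda>s. s\<^sup>2" "\<lambda>s. (max 0 s)\<^sup>2" "2 * s" "2 * max 0 s"] by simp
  next
    case 2
    have "((\<lambda>s::real. 0::real) has_real_derivative 0) (at s)" by simp
    moreover have "eventually (\<lambda>x. 0 = (max 0 x)\<^sup>2) (nhds s)"
      using 2 eventually_nhds_in_open[of "{..<0}" s] by (auto elim!: eventually_mono simp: max_def)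
    ultimately show ?thesis using 2 DERIV_cong_ev[of s s "\<lambda>s. 0" "\<lambda>s. (max 0 s)\<^sup>2" 0 "2 * max 0 s"] by simp
  next
    case 3
    have "((\<lambda>h. (max 0 h)\<^sup>2 / h) \<longlongrightarrow> 0) (at (0::real))"
    proof (rule Lim_null_comparison)
      show "\<forall>\<^sub>F h in at (0::real). norm ((max 0 h)\<^sup>2 / h) \<le> \<bar>h\<bar>"
        by (rule always_eventually) (auto simp: max_def power2_eq_square)
      show "((\<lambda>h::real. \<bar>h\<bar>) \<longlongrightarrow> 0) (at 0)" by (auto intro!: tendsto_eq_intros)
    qed
    then show ?thesis using 3 by (simp add: DERIV_def)
  qed
qed

text \<open>
  The square makes the truncated paraboloid continuously differentiable, which is enough for \<open>C1c\<close>.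
\<close>

definition cutoff :: "real \<Rightarrow> 'a::euclidean_space \<Rightarrow> real" where
  "cutoff R x = (max 0 (1 - (norm x)\<^sup>2 / R\<^sup>2))\<^sup>2"

definition Dcutoff :: "real \<Rightarrow> 'a::euclidean_space \<Rightarrow> 'a" where
  "Dcutoff R x = (2 * max 0 (1 - (norm x)\<^sup>2 / R\<^sup>2)) *\<^sub>R ((- 2 / R\<^sup>2) *\<^sub>R x)"

lemma cutoff_GDERIV: "GDERIV (cutoff R) x :> Dcutoff R x"
proof -
  have "GDERIV (\<lambda>x. 1 - (norm x)\<^sup>2 * (1 / R\<^sup>2)) x :> 0 - ((norm x)\<^sup>2 *\<^sub>R 0 + (1 / R\<^sup>2) *\<^sub>R (2 *\<^sub>R x))"
    by (intro GDERIV_diff GDERIV_const GDERIV_mult GDERIV_norm_sq)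
  from GDERIV_DERIV_compose[OF this square_max_deriv]
  show ?thesis by (simp add: cutoff_def[abs_def] Dcutoff_def)
qed

lemma cutoff_bounds: "0 \<le> cutoff R x" "cutoff R x \<le> 1"
proof -
  have "0 \<le> (norm x)\<^sup>2 / R\<^sup>2" by simp
  then show "0 \<le> cutoff R x" "cutoff R x \<le> 1" by (auto simp: cutoff_def intro!: power_le_one)
qed

lemma cutoff_abs: "\<bar>cutoff R x\<bar> \<le> 1"
  using cutoff_bounds[of R x] by simp

lemma cutoff_outside:
  assumes "0 < R" "R \<le> norm x" shows "cutoff R x = 0" "Dcutoff R x = 0"
proof -
  have "R\<^sup>2 \<le> (norm x)\<^sup>2" using assms by (intro power_mono) auto
  then have "1 \<le> (norm x)\<^sup>2 / R\<^sup>2" using assms by simp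
  then have "max 0 (1 - (norm x)\<^sup>2 / R\<^sup>2) = 0" by simp
  then show "cutoff R x = 0" "Dcutoff R x = 0" by (simp_all only: cutoff_def Dcutoff_def) simp_all
qed

lemma Dcutoff_bound:
  assumes R: "0 < R" and b: "b \<in> Basis"
  shows "\<bar>Dcutoff R x \<bullet> b\<bar> \<le> 4 / R"
proof (cases "R \<le> norm x")
  case False
  define k where "k = max 0 (1 - (norm x)\<^sup>2 / R\<^sup>2)"
  have k: "0 \<le> k" "k \<le> 1" by (auto simp: k_def)
  have "\<bar>x \<bullet> b\<bar> \<le> R" using Basis_le_norm[OF b, of x] False by linarith
  then have "k * \<bar>x \<bullet> b\<bar> \<le> 1 * R" using k R by (intro mult_mono) auto
  then have "k * \<bar>x \<bullet> b\<bar> * 4 / R\<^sup>2 \<le> R * 4 / R\<^sup>2" by (intro divide_right_mono) auto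
  moreover have "\<bar>Dcutoff R x \<bullet> b\<bar> = k * \<bar>x \<bullet> b\<bar> * 4 / R\<^sup>2"
    unfolding Dcutoff_def k_def[symmetric] using k by (simp add: abs_mult)
  ultimately show ?thesis using R by (simp add: power2_eq_square)
next
  case True
  have "Dcutoff R x = 0" by (rule cutoff_outside(2)[OF R True])
  then show ?thesis using R by simp
qed

lemma continuous_Dcutoff: "continuous_on UNIV (Dcutoff R)"
  unfolding Dcutoff_def[abs_def] by (cases "R = 0") (auto intro!: continuous_intros)

lemma cutoff_measurable [measurable]: "cutoff R \<in> borel_measurable borel" "(\<lambda>x. Dcutoff R x \<bullet> b) \<in> borel_measurable borel"
  using GDERIV_continuous[OF cutoff_GDERIV] continuous_on_inner[OF continuous_Dcutoff continuous_on_const]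
  by (auto intro: borel_measurable_continuous_onI)

lemma cutoff_tendsto_1: "(\<lambda>j. cutoff (real (Suc j)) x) \<longlonglongrightarrow> 1"
proof -
  have "(\<lambda>j. (norm x)\<^sup>2 / (real (Suc j))\<^sup>2) \<longlonglongrightarrow> 0" by real_asymp
  then have "(\<lambda>j. (max 0 (1 - (norm x)\<^sup>2 / (real (Suc j))\<^sup>2))\<^sup>2) \<longlonglongrightarrow> (max 0 (1 - 0))\<^sup>2" by (intro tendsto_intros)
  then show ?thesis by (simp add: cutoff_def)
qed

text \<open>
  A subsequence converges almost everywhere, and passing to it preserves both norm limits.
\<close>

lemma D12_approx_AE:
  fixes \<phi> :: "nat \<Rightarrow> real ^ 'n \<Rightarrow> real"
  assumes a: "D12_approx u g \<phi>" and N: "CARD('n) \<ge> 3"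
  shows "\<exists>\<phi>'. D12_approx u g \<phi>' \<and> (AE x in lborel. (\<lambda>k. \<phi>' k x) \<longlonglongrightarrow> u x)"
proof -
  define p where "p = critical_exponent CARD('n)"
  have p: "p > 2" unfolding p_def by (rule critical_exponent_gt_2[OF N])
  have [measurable]: "u \<in> borel_measurable borel" by (rule D12_approxD[OF a])
  have m[measurable]: "\<phi> k \<in> borel_measurable borel" for k
    using C1cD(2)[OF D12_approxD(3)[OF a]] by (rule borel_measurable_continuous_onI)
  have l: "(\<lambda>k. \<integral>\<^sup>+x. ennreal ((norm (grad (\<phi> k) x - g x))\<^sup>2) \<partial>lborel) \<longlonglongrightarrow> 0"
      "(\<lambda>k. \<integral>\<^sup>+x. ennreal (\<bar>\<phi> k x - u x\<bar> powr p) \<partial>lborel) \<longlonglongrightarrow> 0" using a by (auto simp: D12_approx_def p_def)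
  have sub: "D12_approx u g (\<lambda>k. \<phi> (r k))" if "filterlim r at_top sequentially" for r
    using a filterlim_compose[OF l(1) that] filterlim_compose[OF l(2) that] by (simp add: D12_approx_def p_def)
  have "eventually (\<lambda>k. (\<integral>\<^sup>+x. ennreal (\<bar>\<phi> k x - u x\<bar> powr p) \<partial>lborel) < 1) sequentially"
    using l(2) by (rule order_tendstoD) simp
  then obtain n where n: "\<And>k. k \<ge> n \<Longrightarrow> (\<integral>\<^sup>+x. ennreal (\<bar>\<phi> k x - u x\<bar> powr p) \<partial>lborel) < 1" by (auto simp: eventually_sequentially)
  define d where "d k x = \<bar>\<phi> (k + n) x - u x\<bar> powr p" for k x
  have di: "integrable lborel (d k)" for k
  proof (rule integrableI_nonneg)
    show "(\<integral>\<^sup>+x. ennreal (d k x) \<partial>lborel) < \<infinity>"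
      using less_trans[OF n[of "k + n"] ennreal_one_less_top] by (simp add: d_def)
  qed (auto simp: d_def[abs_def])
  have "(\<lambda>k. enn2real (\<integral>\<^sup>+x. ennreal (\<bar>\<phi> (k + n) x - u x\<bar> powr p) \<partial>lborel)) \<longlonglongrightarrow> 0"
    using LIMSEQ_ignore_initial_segment[OF tendsto_enn2real[where l=0, simplified, OF l(2)], of n] by simp
  then have "(\<lambda>k. \<integral>x. norm (d k x) \<partial>lborel) \<longlonglongrightarrow> 0"
    by (subst integral_eq_nn_integral) (auto simp: d_def[abs_def])
  from tendsto_L1_AE_subseq[OF di this] obtain r where r: "strict_mono r" "AE x in lborel. (\<lambda>k. d (r k) x) \<longlonglongrightarrow> 0" by blast
  have fl: "filterlim (\<lambda>k. r k + n) at_top sequentially"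
    using filterlim_subseq[OF r(1)] by (rule filterlim_at_top_mono) simp
  have "AE x in lborel. (\<lambda>k. \<phi> (r k + n) x) \<longlonglongrightarrow> u x"
    using r(2)
  proof eventually_elim
    case (elim x)
    then have "(\<lambda>k. d (r k) x powr (1 / p)) \<longlonglongrightarrow> 0"
      using p by (intro tendsto_zero_powrI[where b="1/p"]) (auto simp: d_def)
    then have "(\<lambda>k. \<bar>\<phi> (r k + n) x - u x\<bar>) \<longlonglongrightarrow> 0" using p by (simp add: d_def powr_powr)
    then show ?case using LIM_zero_cancel tendsto_rabs_zero_iff by blast
  qed
  then show ?thesis using sub[OF fl] by blast
qed

lemma G_log_Fatou:
  fixes w :: "nat \<Rightarrow> 'a::euclidean_space \<Rightarrow> real"
  assumes [measurable]: "\<And>k. w k \<in> borel_measurable borel" "v \<in> borel_measurable borel"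
    and ae: "AE x in lborel. (\<lambda>k. w k x) \<longlonglongrightarrow> v x"
    and R: "\<And>k x. R < norm x \<Longrightarrow> w k x = 0" "\<And>x. R < norm x \<Longrightarrow> v x = 0"
    and iw: "\<And>k. integrable lborel (\<lambda>x. G_log (w k x))" and iv: "integrable lborel (\<lambda>x. G_log (v x))"
    and \<epsilon>: "0 < \<epsilon>"
  shows "eventually (\<lambda>k. (\<integral>x. G_log (v x) \<partial>lborel) - \<epsilon> \<le> (\<integral>x. G_log (w k x) \<partial>lborel)) sequentially"
proof -
  have [measurable]: "cball (0 :: 'a) R \<in> sets borel" by simp
  define i :: "'a \<Rightarrow> real" where "i x = 1/2 * indicator (cball 0 R) x" for x
  have ii: "integrable lborel i" unfolding i_def[abs_def]
    by (intro integrable_mult_right integrable_real_indicator) (auto simp: emeasure_cball_less_top)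
  define c where "c = (\<integral>x. i x \<partial>lborel)"
  have nn: "(\<integral>\<^sup>+x. ennreal (G_log (f x) + i x) \<partial>lborel) = ennreal ((\<integral>x. G_log (f x) \<partial>lborel) + c)"
    and pos: "0 \<le> (\<integral>x. G_log (f x) \<partial>lborel) + c"
    if "\<And>x. R < norm x \<Longrightarrow> f x = 0" "integrable lborel (\<lambda>x. G_log (f x))" for f :: "'a \<Rightarrow> real"
  proof -
    have p: "0 \<le> G_log (f x) + i x" for x
      using G_log_lower[of "f x"] that(1)[of x] by (cases "R < norm x") (auto simp: i_def indicator_def G_log_def)
    have e: "(\<integral>x. G_log (f x) + i x \<partial>lborel) = (\<integral>x. G_log (f x) \<partial>lborel) + c" using that(2) ii by (simp add: c_def)
    show "(\<integral>\<^sup>+x. ennreal (G_log (f x) + i x) \<partial>lborel) = ennreal ((\<integral>x. G_log (f x) \<partial>lborel) + c)"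
      unfolding e[symmetric] by (rule nn_integral_eq_integral) (use that(2) ii p in auto)
    show "0 \<le> (\<integral>x. G_log (f x) \<partial>lborel) + c" unfolding e[symmetric] using p by (intro integral_nonneg_AE AE_I2)
  qed
  have [measurable]: "i \<in> borel_measurable borel" unfolding i_def[abs_def] by measurable
  have "ennreal ((\<integral>x. G_log (v x) \<partial>lborel) + c) = (\<integral>\<^sup>+x. ennreal (G_log (v x) + i x) \<partial>lborel)"
    by (rule nn[OF R(2) iv, symmetric])
  also have "\<dots> = (\<integral>\<^sup>+x. liminf (\<lambda>k. ennreal (G_log (w k x) + i x)) \<partial>lborel)"
  proof (rule nn_integral_cong_AE)
    show "AE x in lborel. ennreal (G_log (v x) + i x) = liminf (\<lambda>k. ennreal (G_log (w k x) + i x))"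
      using ae
    proof eventually_elim
      case (elim x)
      have "(\<lambda>k. G_log (w k x)) \<longlonglongrightarrow> G_log (v x)" using G_log_isCont elim by (rule isCont_tendsto_compose)
      then have "(\<lambda>k. ennreal (G_log (w k x) + i x)) \<longlonglongrightarrow> ennreal (G_log (v x) + i x)" by (intro tendsto_ennrealI tendsto_intros)
      then show ?case by (intro lim_imp_Liminf[symmetric]) auto
    qed
  qed
  also have "\<dots> \<le> liminf (\<lambda>k. \<integral>\<^sup>+x. ennreal (G_log (w k x) + i x) \<partial>lborel)"
    by (rule nn_integral_liminf) measurable
  also have "\<dots> = liminf (\<lambda>k. ennreal ((\<integral>x. G_log (w k x) \<partial>lborel) + c))" by (simp add: nn[OF R(1) iw])
  finally have le: "ennreal ((\<integral>x. G_log (v x) \<partial>lborel) + c) \<le> liminf (\<lambda>k. ennreal ((\<integral>x. G_log (w k x) \<partial>lborel) + c))" .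
  show ?thesis
  proof (cases "(\<integral>x. G_log (v x) \<partial>lborel) + c - \<epsilon> < 0")
    case True
    then show ?thesis using pos[OF R(1) iw] by (intro always_eventually allI) (smt (verit))
  next
    case False
    then have "ennreal ((\<integral>x. G_log (v x) \<partial>lborel) + c - \<epsilon>) < ennreal ((\<integral>x. G_log (v x) \<partial>lborel) + c)"
      using \<epsilon> by (intro ennreal_lessI) auto
    then have "ennreal ((\<integral>x. G_log (v x) \<partial>lborel) + c - \<epsilon>) < liminf (\<lambda>k. ennreal ((\<integral>x. G_log (w k x) \<partial>lborel) + c))" using le by (rule less_le_trans)
    then have "eventually (\<lambda>k. ennreal ((\<integral>x. G_log (v x) \<partial>lborel) + c - \<epsilon>) < ennreal ((\<integral>x. G_log (w k x) \<partial>lborel) + c)) sequentially"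
      by (rule less_LiminfD)
    then show ?thesis
    proof eventually_elim
      case (elim k)
      then have "(\<integral>x. G_log (v x) \<partial>lborel) + c - \<epsilon> < (\<integral>x. G_log (w k x) \<partial>lborel) + c" using False by (subst (asm) ennreal_less_iff) auto
      then show ?case by simp
    qed
  qed
qed

lemma l2conv_cutoff:
  assumes l: "l2 lborel f"
  shows "l2conv lborel (\<lambda>j x. cutoff (real (Suc j)) x * f x) f"
  unfolding l2conv_def
proof (intro conjI allI l)
  note [measurable] = l2_measurable[OF l]
  show lj: "l2 lborel (\<lambda>x. cutoff (real (Suc j)) x * f x)" for j
  proof (rule l2_bound[OF l, where C=1])
    show "\<bar>cutoff (real (Suc j)) x * f x\<bar> \<le> 1 * \<bar>f x\<bar>" for x
      unfolding abs_mult by (rule mult_right_mono[OF cutoff_abs]) simp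
  qed measurable
  have "(\<lambda>j. \<integral>x. (cutoff (real (Suc j)) x * f x - f x)\<^sup>2 \<partial>lborel) \<longlonglongrightarrow> (\<integral>x. 0 \<partial>(lborel :: 'a measure))"
  proof (rule integral_dominated_convergence[where w="\<lambda>x. (f x)\<^sup>2"])
    show "AE x in lborel. (\<lambda>j. (cutoff (real (Suc j)) x * f x - f x)\<^sup>2) \<longlonglongrightarrow> 0"
    proof (rule AE_I2)
      fix x :: 'a
      have "(\<lambda>j. (cutoff (real (Suc j)) x * f x - f x)\<^sup>2) \<longlonglongrightarrow> (1 * f x - f x)\<^sup>2" by (intro tendsto_intros cutoff_tendsto_1)
      then show "(\<lambda>j. (cutoff (real (Suc j)) x * f x - f x)\<^sup>2) \<longlonglongrightarrow> 0" by simp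
    qed
    show "AE x in lborel. norm ((cutoff (real (Suc j)) x * f x - f x)\<^sup>2) \<le> (f x)\<^sup>2" for j
    proof (rule AE_I2)
      fix x :: 'a
      define k where "k = cutoff (real (Suc j)) x"
      have "0 \<le> k" "k \<le> 1" unfolding k_def by (rule cutoff_bounds)+
      then have "(1 - k)\<^sup>2 \<le> 1" by (intro power_le_one) auto
      then have "(1 - k)\<^sup>2 * (f x)\<^sup>2 \<le> (f x)\<^sup>2" by (intro mult_left_le_one_le) auto
      moreover have "(k * f x - f x)\<^sup>2 = (1 - k)\<^sup>2 * (f x)\<^sup>2" by (simp add: power2_eq_square algebra_simps)
      ultimately show "norm ((k * f x - f x)\<^sup>2) \<le> (f x)\<^sup>2" by simp
    qed
    show "integrable lborel (\<lambda>x. (f x)\<^sup>2)" by (rule l2_square[OF l])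
  qed measurable
  then show "(\<lambda>j. \<integral>x. (cutoff (real (Suc j)) x * f x - f x)\<^sup>2 \<partial>lborel) \<longlonglongrightarrow> 0" by simp
qed

lemma l2conv_perturb:
  assumes f: "l2conv M fs f" and h: "\<And>j. l2 M (hs j)"
    and d: "(\<lambda>j. \<integral>x. (hs j x - fs j x)\<^sup>2 \<partial>M) \<longlonglongrightarrow> 0"
  shows "l2conv M hs f"
proof -
  have l: "l2 M (fs j)" "l2 M f" for j using f by (auto simp: l2conv_def)
  have "l2 M (\<lambda>_. 0)" by (rule l2_bound[OF l(2), where C=0]) auto
  then have "l2conv M (\<lambda>j x. hs j x - fs j x) (\<lambda>_. 0)"
    using d h l by (simp add: l2conv_def l2_diff)
  from l2conv_add[OF f this] show ?thesis by simp
qed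

text \<open>
  Cut off at radius \<open>j + 1\<close> and replace \<open>u\<close> by a late member of the approximating sequence. With the radius fixed, the
  products converge in mean square, and \<open>\<integral> G\<close> is lower semicontinuous by \<open>G_log_Fatou\<close>. As the radius
  grows, the cutoffs of \<open>u\<close> itself converge; the gradient of the cutoff contributes \<open>O(1/j)\<close> times the norm of \<open>u\<close>,
  and this is where square integrability of \<open>u\<close> enters. A diagonal choice combines the two limits.
\<close>

lemma D12_smooth_approximation:
  fixes \<phi> :: "nat \<Rightarrow> real ^ 'n \<Rightarrow> real"
  assumes a0: "D12_approx u g \<phi>" and N: "CARD('n) \<ge> 3" and lu: "l2 lborel u" and iG: "integrable lborel (\<lambda>x. G_log (u x))"
  shows "\<exists>w Dw. (\<forall>j. C1c (w j) (Dw j)) \<and> l2conv lborel w u \<and>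
     (\<forall>b\<in>Basis. l2conv lborel (\<lambda>j x. Dw j x \<bullet> b) (\<lambda>x. g x \<bullet> b)) \<and>
     (\<forall>\<epsilon>>0. eventually (\<lambda>j. (\<integral>x. G_log (u x) \<partial>lborel) - \<epsilon> \<le> (\<integral>x. G_log (w j x) \<partial>lborel)) sequentially)"
proof -
  obtain \<psi> where a: "D12_approx u g \<psi>" and ae: "AE x in lborel. (\<lambda>k. \<psi> k x) \<longlonglongrightarrow> u x"
    using D12_approx_AE[OF a0 N] by blast
  have [measurable]: "u \<in> borel_measurable borel" by (rule D12_approxD[OF a])
  have [measurable]: "\<psi> k \<in> borel_measurable borel" for k
    using C1cD(2)[OF D12_approxD(3)[OF a]] by (rule borel_measurable_continuous_onI)
  define \<eta> :: "nat \<Rightarrow> real ^ 'n \<Rightarrow> real" where "\<eta> j = cutoff (real (Suc j))" for j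
  define D\<eta> :: "nat \<Rightarrow> real ^ 'n \<Rightarrow> real ^ 'n" where "D\<eta> j = Dcutoff (real (Suc j))" for j
  define W where "W j k x = \<eta> j x * \<psi> k x" for j k x
  define DW where "DW j k x = \<eta> j x *\<^sub>R grad (\<psi> k) x + \<psi> k x *\<^sub>R D\<eta> j x" for j k x
  have Wc: "C1c (W j k) (DW j k)" for j k
    unfolding W_def[abs_def] DW_def[abs_def] \<eta>_def D\<eta>_def
    by (rule C1c_mult[OF cutoff_GDERIV continuous_Dcutoff D12_approxD(3)[OF a]])
  have i\<eta>: "indicator (cball 0 (real (Suc j))) x * y * \<eta> j x = y * \<eta> j x" "indicator (cball 0 (real (Suc j))) x * y * (D\<eta> j x \<bullet> b) = y * (D\<eta> j x \<bullet> b)" for j x y b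
    using cutoff_outside[of "real (Suc j)" x] by (auto simp: indicator_def \<eta>_def D\<eta>_def simp del: of_nat_Suc)
  have \<eta>b: "\<bar>\<eta> j x\<bar> \<le> 1" for j x using cutoff_bounds[of "real (Suc j)" x] by (simp add: \<eta>_def)
  have D\<eta>b: "\<bar>D\<eta> j x \<bullet> b\<bar> \<le> 4 / real (Suc j)" if "b \<in> Basis" for j x b unfolding D\<eta>_def by (rule Dcutoff_bound[OF _ that]) simp
  have [measurable]: "\<eta> j \<in> borel_measurable borel" "(\<lambda>x. D\<eta> j x \<bullet> b) \<in> borel_measurable borel" for j b unfolding \<eta>_def D\<eta>_def by measurable
  define U where "U j x = \<eta> j x * u x" for j x
  define H where "H b j x = \<eta> j x * (g x \<bullet> b) + (D\<eta> j x \<bullet> b) * u x" for b j x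
  have WU: "l2conv lborel (W j) (U j)" for j
  proof -
    have "l2conv lborel (\<lambda>k x. \<eta> j x * (indicator (cball 0 (real (Suc j))) x * \<psi> k x)) (\<lambda>x. \<eta> j x * (indicator (cball 0 (real (Suc j))) x * u x))"
      by (rule l2conv_bounded_mult[OF D12_local_l2conv[OF a N] _ \<eta>b]) measurable
    then show ?thesis by (simp only: mult.commute[of "\<eta> j _"] i\<eta>) (simp only: W_def[abs_def] U_def[abs_def] mult.commute[of "\<eta> j _"])
  qed
  have DWH: "l2conv lborel (\<lambda>k x. DW j k x \<bullet> b) (H b j)" if b: "b \<in> Basis" for b j
  proof -
    have "l2conv lborel (\<lambda>k x. \<eta> j x * (grad (\<psi> k) x \<bullet> b) + (D\<eta> j x \<bullet> b) * (indicator (cball 0 (real (Suc j))) x * \<psi> k x))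
       (\<lambda>x. \<eta> j x * (g x \<bullet> b) + (D\<eta> j x \<bullet> b) * (indicator (cball 0 (real (Suc j))) x * u x))"
      by (rule l2conv_add[OF l2conv_bounded_mult[OF D12_grad_l2conv[OF a b] _ \<eta>b] l2conv_bounded_mult[OF D12_local_l2conv[OF a N] _ D\<eta>b[OF b]]]) measurable
    then show ?thesis by (simp only: mult.commute[of "D\<eta> j _ \<bullet> b"] i\<eta>) (simp only: DW_def[abs_def] H_def[abs_def] inner_add_left inner_scaleR_left mult.commute[of "D\<eta> j _ \<bullet> b"])
  qed
  have Uu: "l2conv lborel U u" unfolding U_def[abs_def] \<eta>_def by (rule l2conv_cutoff[OF lu])
  have lg: "l2 lborel (\<lambda>x. g x \<bullet> b)" if "b \<in> Basis" for b using D12_grad_l2conv[OF a that] by (simp add: l2conv_def)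
  have Hg: "l2conv lborel (H b) (\<lambda>x. g x \<bullet> b)" if b: "b \<in> Basis" for b
  proof (rule l2conv_perturb)
    show "l2conv lborel (\<lambda>j x. \<eta> j x * (g x \<bullet> b)) (\<lambda>x. g x \<bullet> b)" unfolding \<eta>_def by (rule l2conv_cutoff[OF lg[OF b]])
    show "l2 lborel (H b j)" for j using DWH[OF b, of j] by (simp add: l2conv_def)
    show "(\<lambda>j. \<integral>x. (H b j x - \<eta> j x * (g x \<bullet> b))\<^sup>2 \<partial>lborel) \<longlonglongrightarrow> 0"
    proof (rule tendsto_sandwich[OF _ _ tendsto_const])
      have "(\<lambda>j. (4 / real (Suc j))\<^sup>2) \<longlonglongrightarrow> 0" by real_asymp
      then have "(\<lambda>j. (4 / real (Suc j))\<^sup>2 * (\<integral>x. (u x)\<^sup>2 \<partial>lborel)) \<longlonglongrightarrow> 0 * (\<integral>x. (u x)\<^sup>2 \<partial>lborel)" by (intro tendsto_intros)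
      then show "(\<lambda>j. (4 / real (Suc j))\<^sup>2 * (\<integral>x. (u x)\<^sup>2 \<partial>lborel)) \<longlonglongrightarrow> 0" by simp
      show "\<forall>\<^sub>F j in sequentially. (\<integral>x. (H b j x - \<eta> j x * (g x \<bullet> b))\<^sup>2 \<partial>lborel) \<le> (4 / real (Suc j))\<^sup>2 * (\<integral>x. (u x)\<^sup>2 \<partial>lborel)"
      proof (rule always_eventually, rule allI)
        fix j
        have bd: "\<bar>(D\<eta> j x \<bullet> b) * u x\<bar> \<le> 4 / real (Suc j) * \<bar>u x\<bar>" for x
          unfolding abs_mult by (rule mult_right_mono[OF D\<eta>b[OF b]]) simp
        have "l2 lborel (\<lambda>x. (D\<eta> j x \<bullet> b) * u x)" by (rule l2_bound[OF lu _ bd]) measurable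
        then have "(\<integral>x. ((D\<eta> j x \<bullet> b) * u x)\<^sup>2 \<partial>lborel) \<le> (\<integral>x. (4 / real (Suc j))\<^sup>2 * (u x)\<^sup>2 \<partial>lborel)"
        proof (intro integral_mono l2_square integrable_mult_right lu)
          fix x
          have "\<bar>(D\<eta> j x \<bullet> b) * u x\<bar>\<^sup>2 \<le> (4 / real (Suc j) * \<bar>u x\<bar>)\<^sup>2" by (rule power_mono[OF bd]) simp
          then show "((D\<eta> j x \<bullet> b) * u x)\<^sup>2 \<le> (4 / real (Suc j))\<^sup>2 * (u x)\<^sup>2"
            by (simp only: power2_abs power_mult_distrib[of "4 / real (Suc j)"])
        qed
        then show "(\<integral>x. (H b j x - \<eta> j x * (g x \<bullet> b))\<^sup>2 \<partial>lborel) \<le> (4 / real (Suc j))\<^sup>2 * (\<integral>x. (u x)\<^sup>2 \<partial>lborel)"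
          by (simp add: H_def del: of_nat_Suc)
      qed
    qed simp
  qed
  have GUb: "\<bar>G_log (U j x)\<bar> \<le> \<bar>G_log (u x)\<bar> + (u x)\<^sup>2" for j x
    unfolding U_def \<eta>_def by (rule G_log_mult_bound[OF cutoff_bounds])
  have iB: "integrable lborel (\<lambda>x. \<bar>G_log (u x)\<bar> + (u x)\<^sup>2)" using iG l2_square[OF lu] by simp
  have mU[measurable]: "U j \<in> borel_measurable borel" for j unfolding U_def[abs_def] by measurable
  have iGU: "integrable lborel (\<lambda>x. G_log (U j x))" for j
    by (rule Bochner_Integration.integrable_bound[OF iB]) (use GUb in \<open>auto intro!: AE_I2 simp: order_trans[OF GUb abs_ge_self]\<close>)
  have GU: "(\<lambda>j. \<integral>x. G_log (U j x) \<partial>lborel) \<longlonglongrightarrow> (\<integral>x. G_log (u x) \<partial>lborel)"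
  proof (rule integral_dominated_convergence[OF _ _ iB])
    show "AE x in lborel. (\<lambda>j. G_log (U j x)) \<longlonglongrightarrow> G_log (u x)"
    proof (rule AE_I2)
      fix x
      have "(\<lambda>j. U j x) \<longlonglongrightarrow> 1 * u x" unfolding U_def \<eta>_def by (intro tendsto_intros cutoff_tendsto_1)
      then show "(\<lambda>j. G_log (U j x)) \<longlonglongrightarrow> G_log (u x)" using isCont_tendsto_compose[OF G_log_isCont] by simp
    qed
  qed (use GUb in auto)
  have ex: "\<exists>k. (\<integral>x. (W j k x - U j x)\<^sup>2 \<partial>lborel) < 1 / real (Suc j) \<and> (\<forall>b\<in>Basis. (\<integral>x. (DW j k x \<bullet> b - H b j x)\<^sup>2 \<partial>lborel) < 1 / real (Suc j))
     \<and> (\<integral>x. G_log (U j x) \<partial>lborel) - 1 / real (Suc j) \<le> (\<integral>x. G_log (W j k x) \<partial>lborel)" for j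
  proof -
    have 1: "eventually (\<lambda>k. (\<integral>x. (W j k x - U j x)\<^sup>2 \<partial>lborel) < 1 / real (Suc j)) sequentially"
      using WU[of j] unfolding l2conv_def by (intro order_tendstoD(2)) auto
    have 2: "eventually (\<lambda>k. \<forall>b\<in>Basis. (\<integral>x. (DW j k x \<bullet> b - H b j x)\<^sup>2 \<partial>lborel) < 1 / real (Suc j)) sequentially"
    proof (rule eventually_ball_finite[OF finite_Basis], rule ballI)
      fix b :: "real ^ 'n" assume "b \<in> Basis"
      from DWH[OF this, of j] show "eventually (\<lambda>k. (\<integral>x. (DW j k x \<bullet> b - H b j x)\<^sup>2 \<partial>lborel) < 1 / real (Suc j)) sequentially"
        unfolding l2conv_def by (intro order_tendstoD(2)) auto
    qed
    have 3: "eventually (\<lambda>k. (\<integral>x. G_log (U j x) \<partial>lborel) - 1 / real (Suc j) \<le> (\<integral>x. G_log (W j k x) \<partial>lborel)) sequentially"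
    proof (rule G_log_Fatou[where R="real (Suc j)"])
      show "AE x in lborel. (\<lambda>k. W j k x) \<longlonglongrightarrow> U j x" using ae by eventually_elim (auto simp: W_def U_def intro!: tendsto_intros)
      show "W j k x = 0" "U j x = 0" if "real (Suc j) < norm x" for k x
        using that cutoff_outside(1)[of "real (Suc j)" x] by (auto simp: W_def U_def \<eta>_def simp del: of_nat_Suc)
      show "integrable lborel (\<lambda>x. G_log (W j k x))" for k by (rule lebesgue_logsob_deficit(2)[OF Wc zero_less_one])
      show "W j k \<in> borel_measurable borel" for k unfolding W_def[abs_def] by measurable
    qed (use iGU in auto)
    show ?thesis using eventually_happens'[OF sequentially_bot eventually_conj[OF 1 eventually_conj[OF 2 3]]] by blast
  qed
  define k where "k j = (SOME k. (\<integral>x. (W j k x - U j x)\<^sup>2 \<partial>lborel) < 1 / real (Suc j) \<and> (\<forall>b\<in>Basis. (\<integral>x. (DW j k x \<bullet> b - H b j x)\<^sup>2 \<partial>lborel) < 1 / real (Suc j))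
     \<and> (\<integral>x. G_log (U j x) \<partial>lborel) - 1 / real (Suc j) \<le> (\<integral>x. G_log (W j k x) \<partial>lborel))" for j
  note kk = someI_ex[OF ex, folded k_def]
  have k: "(\<integral>x. (W j (k j) x - U j x)\<^sup>2 \<partial>lborel) < 1 / real (Suc j)"
    "b \<in> Basis \<Longrightarrow> (\<integral>x. (DW j (k j) x \<bullet> b - H b j x)\<^sup>2 \<partial>lborel) < 1 / real (Suc j)"
    "(\<integral>x. G_log (U j x) \<partial>lborel) - 1 / real (Suc j) \<le> (\<integral>x. G_log (W j (k j) x) \<partial>lborel)" for j b
    using kk[of j] by blast+
  have inv0: "(\<lambda>j. 1 / real (Suc j)) \<longlonglongrightarrow> 0" by real_asymp
  show ?thesis
  proof (intro exI[of _ "\<lambda>j. W j (k j)"] exI[of _ "\<lambda>j. DW j (k j)"] conjI allI ballI impI Wc)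
    show "l2conv lborel (\<lambda>j. W j (k j)) u"
    proof (rule l2conv_perturb[OF Uu])
      show "l2 lborel (W j (k j))" for j using WU[of j] by (simp add: l2conv_def)
      show "(\<lambda>j. \<integral>x. (W j (k j) x - U j x)\<^sup>2 \<partial>lborel) \<longlonglongrightarrow> 0"
        by (rule tendsto_sandwich[OF _ _ tendsto_const inv0]) (use k(1) in \<open>auto intro!: always_eventually less_imp_le simp del: of_nat_Suc\<close>)
    qed
    show "l2conv lborel (\<lambda>j x. DW j (k j) x \<bullet> b) (\<lambda>x. g x \<bullet> b)" if b: "b \<in> Basis" for b
    proof (rule l2conv_perturb[OF Hg[OF b]])
      show "l2 lborel (\<lambda>x. DW j (k j) x \<bullet> b)" for j using DWH[OF b, of j] by (simp add: l2conv_def)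
      show "(\<lambda>j. \<integral>x. (DW j (k j) x \<bullet> b - H b j x)\<^sup>2 \<partial>lborel) \<longlonglongrightarrow> 0"
        by (rule tendsto_sandwich[OF _ _ tendsto_const inv0]) (use k(2)[OF b] in \<open>auto intro!: always_eventually less_imp_le simp del: of_nat_Suc\<close>)
    qed
    fix \<epsilon> :: real assume \<epsilon>: "0 < \<epsilon>"
    have "(\<lambda>j. (\<integral>x. G_log (U j x) \<partial>lborel) - 1 / real (Suc j)) \<longlonglongrightarrow> (\<integral>x. G_log (u x) \<partial>lborel) - 0"
      by (intro tendsto_intros GU inv0)
    then have "eventually (\<lambda>j. (\<integral>x. G_log (u x) \<partial>lborel) - \<epsilon> < (\<integral>x. G_log (U j x) \<partial>lborel) - 1 / real (Suc j)) sequentially"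
      using \<epsilon> by (intro order_tendstoD(1)) auto
    then show "eventually (\<lambda>j. (\<integral>x. G_log (u x) \<partial>lborel) - \<epsilon> \<le> (\<integral>x. G_log (W j (k j) x) \<partial>lborel)) sequentially"
    proof eventually_elim
      case (elim j)
      then show ?case using k(3)[of j] by linarith
    qed
  qed
qed

section \<open>Functions with a prescribed logarithmic gradient\<close>

lemma AE_lborel_ex:
  assumes "AE x in (lborel :: 'a::euclidean_space measure). P x"
  shows "\<exists>x. P x"
proof (rule ccontr)
  assume "\<nexists>x. P x"
  then have "AE x in (lborel :: 'a measure). x \<notin> UNIV" using assms by simp
  then have "(UNIV :: 'a set) \<in> null_sets lborel" by (subst AE_iff_null_sets) auto
  then show False by (auto simp: null_sets_def emeasure_lborel_UNIV)
qed

lemma AE_lborel_affine: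
  fixes t :: "'a::euclidean_space"
  assumes c: "c \<noteq> 0" and m: "{x. P x} \<in> sets borel" and ae: "AE x in lborel. P (t + c *\<^sub>R x)"
  shows "AE x in lborel. P x"
proof -
  have "AE x in distr lborel borel (\<lambda>x. t + c *\<^sub>R x). P x"
    using m ae by (subst AE_distr_iff) auto
  then have "AE x in density (distr lborel borel (\<lambda>x. t + c *\<^sub>R x)) (\<lambda>_. ennreal (\<bar>c\<bar> ^ DIM('a))). P x"
    by (subst AE_density) auto
  then show ?thesis by (subst lborel_affine[OF c, of t])
qed

lemma l2_affine:
  fixes f :: "'a::euclidean_space \<Rightarrow> real"
  assumes "l2 lborel f" "c \<noteq> 0"
  shows "l2 lborel (\<lambda>x. f (t + c *\<^sub>R x))"
proof -
  have [measurable]: "f \<in> borel_measurable borel" using l2_measurable[OF assms(1)] by simp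
  show ?thesis using l2_square[OF assms(1)] integrable_lborel_affine[of "\<lambda>x. (f x)\<^sup>2" c t] assms(2) by (simp add: l2_def)
qed

lemma l2conv_affine:
  fixes f :: "'a::euclidean_space \<Rightarrow> real"
  assumes f: "l2conv lborel fs f" and c: "c \<noteq> 0"
  shows "l2conv lborel (\<lambda>j x. fs j (t + c *\<^sub>R x)) (\<lambda>x. f (t + c *\<^sub>R x))"
proof -
  have l: "l2 lborel (fs j)" "l2 lborel f" for j using f by (auto simp: l2conv_def)
  have [measurable]: "fs j \<in> borel_measurable borel" "f \<in> borel_measurable borel" for j
    using l2_measurable[OF l(1)] l2_measurable[OF l(2)] by simp_all
  have eq: "(\<integral>x. (fs j (t + c *\<^sub>R x) - f (t + c *\<^sub>R x))\<^sup>2 \<partial>lborel) = (1 / \<bar>c\<bar> ^ DIM('a)) * (\<integral>x. (fs j x - f x)\<^sup>2 \<partial>lborel)" for j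
    using integral_lborel_affine[of "\<lambda>x. (fs j x - f x)\<^sup>2" c t] c by simp
  have "(\<lambda>j. (1 / \<bar>c\<bar> ^ DIM('a)) * (\<integral>x. (fs j x - f x)\<^sup>2 \<partial>lborel)) \<longlonglongrightarrow> (1 / \<bar>c\<bar> ^ DIM('a)) * 0"
    using f by (intro tendsto_intros) (simp add: l2conv_def)
  then show ?thesis using l2_affine[OF l(1) c] l2_affine[OF l(2) c] unfolding l2conv_def eq by simp
qed

text \<open>
  The fundamental theorem of calculus on the segment, and Cauchy-Schwarz on \<open>[0, 1]\<close>.
\<close>

lemma line_increment_square:
  fixes z :: "'a::euclidean_space \<Rightarrow> real"
  assumes D: "\<And>x. GDERIV z x :> Dz x" and c: "continuous_on UNIV Dz"
  shows "ennreal ((z (x + v) - z x)\<^sup>2) \<le> (\<integral>\<^sup>+s. ennreal (indicator {0..1} s * (Dz (x + s *\<^sub>R v) \<bullet> v)\<^sup>2) \<partial>lborel)"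
proof -
  define f where "f s = Dz (x + s *\<^sub>R v) \<bullet> v" for s
  have cf: "continuous_on UNIV f"
    unfolding f_def[abs_def] by (intro continuous_on_inner continuous_on_const continuous_on_compose2[OF c]) (auto intro!: continuous_intros)
  have [measurable]: "f \<in> borel_measurable borel" using cf by (rule borel_measurable_continuous_onI)
  have i2: "integrable lborel (\<lambda>s. indicator {0..1} s * (f s)\<^sup>2)"
    using borel_integrable_atLeastAtMost'[of 0 1 "\<lambda>s. (f s)\<^sup>2"] continuous_on_power[OF continuous_on_subset[OF cf], of "{0..1}" 2]
    by (simp add: set_integrable_def)
  have sq: "(indicator {0..1} s * f s)\<^sup>2 = indicator {0..1} s * (f s)\<^sup>2" for s by (auto simp: indicator_def)
  have l1: "l2 lborel (\<lambda>s. indicator {0..1} s * f s)" using i2 by (simp add: l2_def sq)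
  have sq1: "(indicator {0..1} s)\<^sup>2 = (indicator {0..1} s :: real)" for s :: real by (auto simp: indicator_def)
  have l2': "l2 lborel (indicator {0..1} :: real \<Rightarrow> real)" by (auto simp: l2_def sq1)
  have F: "(\<integral>s. f s * indicator {0..1} s \<partial>lborel) = z (x + 1 *\<^sub>R v) - z (x + 0 *\<^sub>R v)"
  proof (rule integral_FTC_Icc_real)
    show "DERIV (\<lambda>s. z (x + s *\<^sub>R v)) s :> f s" for s unfolding f_def by (rule GDERIV_line[OF D])
    show "isCont f s" for s using cf by (simp add: continuous_on_eq_continuous_at)
  qed simp
  have "(\<integral>s. indicator {0..1} s * f s * indicator {0..1} s \<partial>lborel) = (\<integral>s. f s * indicator {0..1} s \<partial>lborel)"
    by (intro Bochner_Integration.integral_cong refl) (auto simp: indicator_def)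
  then have "(z (x + v) - z x)\<^sup>2 \<le> (\<integral>s. indicator {0..1} s * (f s)\<^sup>2 \<partial>lborel)"
    using l2_cauchy_schwarz[OF l1 l2'] F by (simp add: sq sq1)
  also have "ennreal \<dots> = (\<integral>\<^sup>+s. ennreal (indicator {0..1} s * (f s)\<^sup>2) \<partial>lborel)"
    using i2 by (intro nn_integral_eq_integral[symmetric]) auto
  finally show ?thesis by (simp add: f_def ennreal_leI)
qed

lemma translation_increment:
  fixes z :: "'a::euclidean_space \<Rightarrow> real"
  assumes D: "\<And>x. GDERIV z x :> Dz x" and c: "continuous_on UNIV Dz"
  shows "(\<integral>\<^sup>+x. ennreal ((indicator (cball 0 R) x * (z (x + v) - z x))\<^sup>2) \<partial>lborel)
     \<le> (\<integral>\<^sup>+x. ennreal ((indicator (cball 0 (R + norm v)) x * (Dz x \<bullet> v))\<^sup>2) \<partial>lborel)" (is "_ \<le> ?C")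
proof -
  have [measurable]: "(\<lambda>x. Dz x \<bullet> v) \<in> borel_measurable borel"
    by (intro borel_measurable_continuous_onI continuous_intros c)
  have [measurable]: "cball (0 :: 'a) r \<in> sets borel" for r by simp
  define k where "k x = ennreal ((indicator (cball 0 (R + norm v)) x * (Dz x \<bullet> v))\<^sup>2)" for x
  have [measurable]: "k \<in> borel_measurable borel" unfolding k_def[abs_def] by measurable
  have pt: "ennreal ((indicator (cball 0 R) x * (z (x + v) - z x))\<^sup>2) \<le> (\<integral>\<^sup>+s. indicator {0..1} s * k (x + s *\<^sub>R v) \<partial>lborel)" for x
  proof (cases "x \<in> cball 0 R")
    case True
    have "ennreal ((z (x + v) - z x)\<^sup>2) \<le> (\<integral>\<^sup>+s. ennreal (indicator {0..1} s * (Dz (x + s *\<^sub>R v) \<bullet> v)\<^sup>2) \<partial>lborel)"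
      by (rule line_increment_square[OF D c])
    also have "\<dots> \<le> (\<integral>\<^sup>+s. indicator {0..1} s * k (x + s *\<^sub>R v) \<partial>lborel)"
    proof (rule nn_integral_mono)
      fix s :: real
      show "ennreal (indicator {0..1} s * (Dz (x + s *\<^sub>R v) \<bullet> v)\<^sup>2) \<le> indicator {0..1} s * k (x + s *\<^sub>R v)"
      proof (cases "s \<in> {0..1}")
        case s: True
        have "norm (x + s *\<^sub>R v) \<le> norm x + \<bar>s\<bar> * norm v" using norm_triangle_ineq[of x "s *\<^sub>R v"] by simp
        also have "\<bar>s\<bar> * norm v \<le> norm v" using s by (intro mult_left_le_one_le) auto
        finally have "x + s *\<^sub>R v \<in> cball 0 (R + norm v)" using True by simp
        then show ?thesis using s by (simp add: k_def)
      qed simp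
    qed
    finally show ?thesis using True by simp
  qed simp
  have "(\<integral>\<^sup>+x. ennreal ((indicator (cball 0 R) x * (z (x + v) - z x))\<^sup>2) \<partial>lborel) \<le> (\<integral>\<^sup>+x. (\<integral>\<^sup>+s. indicator {0..1} s * k (x + s *\<^sub>R v) \<partial>lborel) \<partial>lborel)"
    by (rule nn_integral_mono) (rule pt)
  also have "\<dots> = (\<integral>\<^sup>+s. (\<integral>\<^sup>+x. indicator {0..1} s * k (x + s *\<^sub>R v) \<partial>lborel) \<partial>lborel)"
    by (rule lborel_pair.Fubini') measurable
  also have "\<dots> = (\<integral>\<^sup>+s. indicator {0..1::real} s * ?C \<partial>lborel)"
  proof (rule nn_integral_cong)
    fix s :: real
    have "(\<integral>\<^sup>+x. k x \<partial>lborel) = (\<integral>\<^sup>+x. k (s *\<^sub>R v + 1 *\<^sub>R x) \<partial>lborel)"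
      by (subst nn_integral_lborel_affine[where c=1 and t="s *\<^sub>R v"]) simp_all
    then have "(\<integral>\<^sup>+x. k (x + s *\<^sub>R v) \<partial>lborel) = ?C" by (simp add: add.commute k_def)
    then show "(\<integral>\<^sup>+x. indicator {0..1} s * k (x + s *\<^sub>R v) \<partial>lborel) = indicator {0..1} s * ?C"
      by (subst nn_integral_cmult) auto
  qed
  also have "\<dots> = ?C" by (subst nn_integral_multc) auto
  finally show ?thesis .
qed

text \<open>
  \<open>Z = u * exp (|x|\<^sup>2 / 4 - \<beta> \<bullet> x)\<close> has vanishing weak gradient. By \<open>translation_increment\<close> for the approximating
  functions, \<open>Z\<close> agrees almost everywhere with each of its translates, and Fubini's theorem yields one point \<open>x0\<close> such
  that \<open>Z (x0 + v) = Z x0\<close> for almost every \<open>v\<close>.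
\<close>

lemma log_gradient_rigidity:
  fixes u :: "'a::euclidean_space \<Rightarrow> real" and g :: "'a \<Rightarrow> 'a"
  assumes w: "\<And>j. C1c (w j) (Dw j)" and wu: "l2conv lborel w u"
    and Dg: "\<And>b. b \<in> Basis \<Longrightarrow> l2conv lborel (\<lambda>j x. Dw j x \<bullet> b) (\<lambda>x. g x \<bullet> b)"
    and ae: "AE x in lborel. g x = u x *\<^sub>R (\<beta> - x /\<^sub>R 2)"
  shows "\<exists>c. AE x in lborel. u x = c * exp (\<beta> \<bullet> x - (norm x)\<^sup>2 / 4)"
proof -
  have lu: "l2 lborel u" using wu by (simp add: l2conv_def)
  have mu[measurable]: "u \<in> borel_measurable borel" using l2_measurable[OF lu] by simp
  have [measurable]: "w j \<in> borel_measurable borel" for j using C1cD(2)[OF w] by (rule borel_measurable_continuous_onI)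
  define Q :: "'a \<Rightarrow> real" where "Q x = exp ((norm x)\<^sup>2 / 4 - \<beta> \<bullet> x)" for x
  define DQ where "DQ x = Q x *\<^sub>R (x /\<^sub>R 2 - \<beta>)" for x
  have QD: "GDERIV Q x :> DQ x" for x
  proof -
    have i: "GDERIV (\<lambda>x. \<beta> \<bullet> x) x :> \<beta>" for x
      unfolding gderiv_def by (auto intro!: derivative_eq_intros simp: inner_commute)
    have "GDERIV (\<lambda>x. (norm x)\<^sup>2 * (1/4) - \<beta> \<bullet> x) x :> ((norm x)\<^sup>2 *\<^sub>R 0 + (1/4) *\<^sub>R (2 *\<^sub>R x)) - \<beta>"
      by (intro GDERIV_diff GDERIV_mult GDERIV_const GDERIV_norm_sq i)
    then have "GDERIV (\<lambda>x. (norm x)\<^sup>2 / 4 - \<beta> \<bullet> x) x :> x /\<^sub>R 2 - \<beta>" by simp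
    from GDERIV_DERIV_compose[OF this DERIV_exp] show ?thesis unfolding Q_def[abs_def] DQ_def by simp
  qed
  have cQ: "continuous_on UNIV Q" by (rule GDERIV_continuous[OF QD])
  have cDQ: "continuous_on UNIV DQ" unfolding DQ_def[abs_def] by (intro continuous_intros cQ)
  have [measurable]: "Q \<in> borel_measurable borel" "(\<lambda>x. DQ x \<bullet> b) \<in> borel_measurable borel" for b
    by (intro borel_measurable_continuous_onI continuous_intros cQ cDQ)+
  have [measurable]: "cball (0 :: 'a) r \<in> sets borel" for r by simp
  define z where "z j x = Q x * w j x" for j x
  define Dz where "Dz j x = Q x *\<^sub>R Dw j x + w j x *\<^sub>R DQ x" for j x
  have zC: "C1c (z j) (Dz j)" for j unfolding z_def[abs_def] Dz_def[abs_def] by (rule C1c_mult[OF QD cDQ w])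
  define Z where "Z x = Q x * u x" for x
  have mZ[measurable]: "Z \<in> borel_measurable borel" unfolding Z_def[abs_def] by measurable
  have bnd: "\<exists>C. \<forall>x. \<bar>indicator (cball 0 r) x * f x\<bar> \<le> C" if "continuous_on UNIV f" for f :: "'a \<Rightarrow> real" and r
  proof -
    have "compact (f ` cball 0 r)" by (rule compact_continuous_image[OF continuous_on_subset[OF that] compact_cball]) simp
    then obtain B where B: "\<And>x. x \<in> cball 0 r \<Longrightarrow> norm (f x) \<le> B"
      using compact_imp_bounded bounded_iff by (metis imageI)
    then show ?thesis by (intro exI[of _ "max B 0"]) (auto simp: indicator_def le_max_iff_disj)
  qed
  have zl: "l2conv lborel (\<lambda>j x. indicator (cball 0 r) x * z j x) (\<lambda>x. indicator (cball 0 r) x * Z x)" for r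
  proof -
    obtain C where C: "\<And>x. \<bar>indicator (cball 0 r) x * Q x\<bar> \<le> C" using bnd[OF cQ] by blast
    have "l2conv lborel (\<lambda>j x. indicator (cball 0 r) x * Q x * w j x) (\<lambda>x. indicator (cball 0 r) x * Q x * u x)"
      by (rule l2conv_bounded_mult[OF wu _ C]) measurable
    then show ?thesis by (simp add: z_def Z_def mult.assoc)
  qed
  have Dzl: "(\<lambda>j. \<integral>x. (indicator (cball 0 r) x * (Dz j x \<bullet> b))\<^sup>2 \<partial>lborel) \<longlonglongrightarrow> 0" if b: "b \<in> Basis" for r b
  proof -
    obtain C where C: "\<And>x. \<bar>indicator (cball 0 r) x * Q x\<bar> \<le> C" using bnd[OF cQ] by blast
    obtain C' where C': "\<And>x. \<bar>indicator (cball 0 r) x * (DQ x \<bullet> b)\<bar> \<le> C'"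
      using bnd[OF continuous_on_inner[OF cDQ continuous_on_const]] by blast
    have l: "l2conv lborel (\<lambda>j x. indicator (cball 0 r) x * Q x * (Dw j x \<bullet> b) + indicator (cball 0 r) x * (DQ x \<bullet> b) * w j x)
       (\<lambda>x. indicator (cball 0 r) x * Q x * (g x \<bullet> b) + indicator (cball 0 r) x * (DQ x \<bullet> b) * u x)" (is "l2conv _ ?fs ?f")
      by (rule l2conv_add[OF l2conv_bounded_mult[OF Dg[OF b] _ C] l2conv_bounded_mult[OF wu _ C']]) measurable
    have "(\<integral>x. (?f x)\<^sup>2 \<partial>lborel) = (\<integral>x. 0 \<partial>(lborel :: 'a measure))"
    proof (rule integral_cong_AE)
      show "(\<lambda>x. (?f x)\<^sup>2) \<in> borel_measurable lborel" using l by (auto simp: l2conv_def dest!: l2_square)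
      show "AE x in lborel. (?f x)\<^sup>2 = 0"
        using ae
      proof eventually_elim
        case (elim x)
        have gb: "g x \<bullet> b = u x * (\<beta> \<bullet> b - (x \<bullet> b) / 2)" unfolding elim by (simp add: inner_diff_left)
        have Qb: "DQ x \<bullet> b = Q x * ((x \<bullet> b) / 2 - \<beta> \<bullet> b)" by (simp add: DQ_def inner_diff_left)
        show ?case unfolding gb Qb by (simp add: algebra_simps)
      qed
    qed simp
    then have "(\<lambda>j. \<integral>x. (?fs j x)\<^sup>2 \<partial>lborel) \<longlonglongrightarrow> 0" using l2conv_square[OF l] by simp
    then show ?thesis by (simp add: Dz_def inner_add_left algebra_simps)
  qed
  have tr: "AE x in lborel. Z (x + v) = Z x" for v
  proof -
    have step: "AE x in lborel. indicator (cball 0 r) x * (Z (x + v) - Z x) = 0" for r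
    proof -
      define r' where "r' = r + norm v"
      have sub: "x + v \<in> cball 0 r'" if "x \<in> cball 0 r" for x
        using that norm_triangle_ineq[of x v] by (simp add: r'_def)
      have l1: "l2conv lborel (\<lambda>j x. indicator (cball 0 r) x * (indicator (cball 0 r') (v + 1 *\<^sub>R x) * z j (v + 1 *\<^sub>R x)))
        (\<lambda>x. indicator (cball 0 r) x * (indicator (cball 0 r') (v + 1 *\<^sub>R x) * Z (v + 1 *\<^sub>R x)))"
        by (rule l2conv_bounded_mult[OF l2conv_affine[OF zl], where C=1]) (auto simp: indicator_def)
      have l1': "l2conv lborel (\<lambda>j x. indicator (cball 0 r) x * z j (x + v)) (\<lambda>x. indicator (cball 0 r) x * Z (x + v))"
      proof -
        have e: "indicator (cball 0 r) x * (indicator (cball 0 r') (v + 1 *\<^sub>R x) * y) = indicator (cball 0 r) x * y" for x and y :: real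
          using sub[of x] by (auto simp: indicator_def add.commute)
        show ?thesis using l1 unfolding e by (simp add: add.commute)
      qed
      have l2: "l2conv lborel (\<lambda>j x. indicator (cball 0 r) x * z j (x + v) + (-1) * (indicator (cball 0 r) x * z j x))
         (\<lambda>x. indicator (cball 0 r) x * Z (x + v) + (-1) * (indicator (cball 0 r) x * Z x))"
        by (rule l2conv_add[OF l1' l2conv_bounded_mult[OF zl, where C=1]]) auto
      have l3: "l2conv lborel (\<lambda>j x. indicator (cball 0 r) x * (z j (x + v) - z j x)) (\<lambda>x. indicator (cball 0 r) x * (Z (x + v) - Z x))"
        using l2 by (simp add: right_diff_distrib)
      have le: "(\<integral>x. (indicator (cball 0 r) x * (z j (x + v) - z j x))\<^sup>2 \<partial>lborel)
         \<le> (norm v)\<^sup>2 * (\<Sum>b\<in>Basis. \<integral>x. (indicator (cball 0 r') x * (Dz j x \<bullet> b))\<^sup>2 \<partial>lborel)" for j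
      proof -
        note cz = C1cD[OF zC[of j]]
        have li: "l2 lborel (\<lambda>x. indicator (cball 0 r') x * (Dz j x \<bullet> b))" for b
          by (rule l2_bound[OF C1c_l2_function_and_partial(2)[OF zC[of j], of b], where C=1])
            (use l2_measurable[OF C1c_l2_function_and_partial(2)[OF zC[of j], of b]] in \<open>auto simp: indicator_def\<close>)
        have lz: "l2 lborel (\<lambda>x. indicator (cball 0 r) x * (z j (x + v) - z j x))" using l3 by (simp add: l2conv_def)
        have "ennreal (\<integral>x. (indicator (cball 0 r) x * (z j (x + v) - z j x))\<^sup>2 \<partial>lborel)
          = (\<integral>\<^sup>+x. ennreal ((indicator (cball 0 r) x * (z j (x + v) - z j x))\<^sup>2) \<partial>lborel)"
          by (rule nn_integral_eq_integral[OF l2_square[OF lz], symmetric]) simp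
        also have "\<dots> \<le> (\<integral>\<^sup>+x. ennreal ((indicator (cball 0 r') x * (Dz j x \<bullet> v))\<^sup>2) \<partial>lborel)"
          unfolding r'_def by (rule translation_increment[OF cz(1,3)])
        also have "\<dots> = ennreal (\<integral>x. (indicator (cball 0 r') x * (Dz j x \<bullet> v))\<^sup>2 \<partial>lborel)"
          by (rule nn_integral_eq_integral[OF l2_square[OF li]]) simp
        finally have "(\<integral>x. (indicator (cball 0 r) x * (z j (x + v) - z j x))\<^sup>2 \<partial>lborel) \<le> (\<integral>x. (indicator (cball 0 r') x * (Dz j x \<bullet> v))\<^sup>2 \<partial>lborel)"
          by (subst (asm) ennreal_le_iff) auto
        also have "\<dots> \<le> (\<integral>x. (norm v)\<^sup>2 * (\<Sum>b\<in>Basis. (indicator (cball 0 r') x * (Dz j x \<bullet> b))\<^sup>2) \<partial>lborel)"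
        proof (rule integral_mono)
          show "integrable lborel (\<lambda>x. (indicator (cball 0 r') x * (Dz j x \<bullet> v))\<^sup>2)" by (rule l2_square[OF li])
          show "integrable lborel (\<lambda>x. (norm v)\<^sup>2 * (\<Sum>b\<in>Basis. (indicator (cball 0 r') x * (Dz j x \<bullet> b))\<^sup>2))"
            by (intro integrable_mult_right Bochner_Integration.integrable_sum l2_square[OF li])
          fix x
          have "(Dz j x \<bullet> v)\<^sup>2 \<le> (norm (Dz j x) * norm v)\<^sup>2"
            using Cauchy_Schwarz_ineq2[of "Dz j x" v] by (metis abs_ge_zero power2_abs power_mono)
          also have "\<dots> = (norm v)\<^sup>2 * (\<Sum>b\<in>Basis. (Dz j x \<bullet> b)\<^sup>2)"
            unfolding power_mult_distrib power2_norm_eq_inner[of "Dz j x"] euclidean_inner[of "Dz j x" "Dz j x"] by (simp add: power2_eq_square)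
          finally show "(indicator (cball 0 r') x * (Dz j x \<bullet> v))\<^sup>2 \<le> (norm v)\<^sup>2 * (\<Sum>b\<in>Basis. (indicator (cball 0 r') x * (Dz j x \<bullet> b))\<^sup>2)"
            by (auto simp: indicator_def)
        qed
        also have "\<dots> = (norm v)\<^sup>2 * (\<Sum>b\<in>Basis. \<integral>x. (indicator (cball 0 r') x * (Dz j x \<bullet> b))\<^sup>2 \<partial>lborel)"
          by (simp add: Bochner_Integration.integral_sum[OF l2_square[OF li]])
        finally show ?thesis .
      qed
      have lim0: "(\<lambda>j. (norm v)\<^sup>2 * (\<Sum>b\<in>Basis. \<integral>x. (indicator (cball 0 r') x * (Dz j x \<bullet> b))\<^sup>2 \<partial>lborel)) \<longlonglongrightarrow> 0"
        by (rule tendsto_mult_right_zero, rule tendsto_null_sum) (rule Dzl)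
      have "(\<integral>x. (indicator (cball 0 r) x * (Z (x + v) - Z x))\<^sup>2 \<partial>lborel) \<le> 0"
        by (rule LIMSEQ_le[OF l2conv_square[OF l3] lim0]) (use le in auto)
      then have "(\<integral>x. (indicator (cball 0 r) x * (Z (x + v) - Z x))\<^sup>2 \<partial>lborel) = 0"
        by (intro antisym) auto
      moreover have "integrable lborel (\<lambda>x. (indicator (cball 0 r) x * (Z (x + v) - Z x))\<^sup>2)" using l3 by (auto simp: l2conv_def dest: l2_square)
      ultimately have "AE x in lborel. (indicator (cball 0 r) x * (Z (x + v) - Z x))\<^sup>2 = 0"
        by (subst (asm) integral_nonneg_eq_0_iff_AE) auto
      then show ?thesis by eventually_elim simp
    qed
    have "AE x in lborel. \<forall>n::nat. indicator (cball 0 (real n)) x * (Z (x + v) - Z x) = 0"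
      by (intro AE_all_countable[THEN iffD2] allI step)
    then show ?thesis
    proof eventually_elim
      case (elim x)
      obtain n :: nat where "norm x < n" using reals_Archimedean2 by blast
      then have "x \<in> cball 0 (real n)" by simp
      with elim[rule_format, of n] show ?case by simp
    qed
  qed
  have "AE x in lborel. AE v in lborel. Z (x + v) = Z x"
  proof (subst lborel_pair.AE_commute)
    show "{p \<in> space (lborel \<Otimes>\<^sub>M lborel). Z (fst p + snd p) = Z (fst p)} \<in> sets (lborel \<Otimes>\<^sub>M (lborel :: 'a measure))" by measurable
  qed (use tr in simp)
  then obtain x0 where "AE v in lborel. Z (x0 + v) = Z x0" using AE_lborel_ex by blast
  then have "AE y in lborel. Z y = Z x0"
    by (intro AE_lborel_affine[where c=1 and t=x0 and P="\<lambda>y. Z y = Z x0"]) auto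
  then have "AE x in lborel. u x = Z x0 * exp (\<beta> \<bullet> x - (norm x)\<^sup>2 / 4)"
  proof eventually_elim
    case (elim x)
    have "exp (\<beta> \<bullet> x - (norm x)\<^sup>2 / 4) * Q x = 1" unfolding Q_def by (simp flip: exp_add)
    then have "u x = exp (\<beta> \<bullet> x - (norm x)\<^sup>2 / 4) * Z x" by (simp add: Z_def flip: mult.assoc)
    then show ?case unfolding elim by (simp only: mult.commute)
  qed
  then show ?thesis by blast
qed

section \<open>Optimising scale and amplitude\<close>

lemma C1c_scale:
  fixes w :: "'a::euclidean_space \<Rightarrow> real"
  assumes w: "C1c w Dw" and s: "0 < s"
  shows "C1c (\<lambda>x. w (0 + s *\<^sub>R x)) (\<lambda>x. s *\<^sub>R Dw (0 + s *\<^sub>R x))"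
  unfolding C1c_def
proof (intro conjI allI)
  show "GDERIV (\<lambda>x. w (0 + s *\<^sub>R x)) x :> s *\<^sub>R Dw (0 + s *\<^sub>R x)" for x
  proof -
    have "(w has_derivative (\<lambda>h. h \<bullet> Dw (s *\<^sub>R x))) (at (s *\<^sub>R x))" using C1cD(1)[OF w, of "s *\<^sub>R x"] by (simp add: gderiv_def)
    moreover have "((\<lambda>x. s *\<^sub>R x) has_derivative (\<lambda>h. s *\<^sub>R h)) (at x)" by (auto intro!: derivative_eq_intros)
    ultimately have "((\<lambda>x. w (s *\<^sub>R x)) has_derivative (\<lambda>h. (s *\<^sub>R h) \<bullet> Dw (s *\<^sub>R x))) (at x)"
      by (rule has_derivative_compose[rotated])
    then show ?thesis by (simp add: gderiv_def)
  qed
  show "continuous_on UNIV (\<lambda>x. s *\<^sub>R Dw (0 + s *\<^sub>R x))"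
    by (intro continuous_on_scaleR continuous_on_const continuous_on_compose2[OF C1cD(3)[OF w]]) (auto intro!: continuous_intros)
  obtain R where R: "\<And>x. R < norm x \<Longrightarrow> w x = 0 \<and> Dw x = 0" using C1cD(4)[OF w] by blast
  show "\<exists>R. \<forall>x. R < norm x \<longrightarrow> w (0 + s *\<^sub>R x) = 0 \<and> s *\<^sub>R Dw (0 + s *\<^sub>R x) = 0"
  proof (intro exI[of _ "R / s"] allI impI)
    fix x :: 'a assume "R / s < norm x"
    then have "R < norm (s *\<^sub>R x)" using s by (simp add: field_simps)
    then show "w (0 + s *\<^sub>R x) = 0 \<and> s *\<^sub>R Dw (0 + s *\<^sub>R x) = 0" using R by simp
  qed
qed

text \<open>
  \<open>logsob_limit\<close> for the dilation \<open>x \<mapsto> u (s x)\<close>, all of whose integrals carry the Jacobian factor \<open>k\<close>.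
\<close>

lemma scaled_logsob:
  fixes u :: "'a::euclidean_space \<Rightarrow> real" and g :: "'a \<Rightarrow> 'a" and m I E s :: real
  assumes w: "\<And>j. C1c (w j) (Dw j)" and wu: "l2conv lborel w u"
    and Dg: "\<And>b. b \<in> Basis \<Longrightarrow> l2conv lborel (\<lambda>j x. Dw j x \<bullet> b) (\<lambda>x. g x \<bullet> b)"
    and G: "\<And>\<epsilon>. 0 < \<epsilon> \<Longrightarrow> eventually (\<lambda>j. I - \<epsilon> \<le> (\<integral>x. G_log (w j x) \<partial>lborel)) sequentially"
    and m_def: "m = (\<integral>x. (u x)\<^sup>2 \<partial>lborel)" and m: "0 < m"
    and E_def: "E = (\<Sum>b\<in>Basis. \<integral>x. (g x \<bullet> b)\<^sup>2 \<partial>lborel)" and s: "0 < s"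
  defines "K \<equiv> real DIM('a) + real DIM('a) / 2 * ln (2 * pi)"
  shows "2 * I + K * m - m * (ln m - real DIM('a) * ln s) \<le> 2 * s\<^sup>2 * E"
    and "2 * I + K * m - m * (ln m - real DIM('a) * ln s) = 2 * s\<^sup>2 * E \<Longrightarrow>
      \<exists>c y. AE x in lborel. u x = c * exp (- (norm (x - y))\<^sup>2 / (4 * s\<^sup>2))"
proof -
  have s0: "s \<noteq> 0" using s by simp
  define k where "k = 1 / s ^ DIM('a)"
  have k: "0 < k" using s by (simp add: k_def)
  have lnk: "ln k = - real DIM('a) * ln s" using s by (simp add: k_def ln_div ln_realpow)
  have lu: "l2 lborel u" using wu by (simp add: l2conv_def)
  have mu[measurable]: "u \<in> borel_measurable borel" using l2_measurable[OF lu] by simp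
  have mw[measurable]: "w j \<in> borel_measurable borel" for j using C1cD(2)[OF w] by (rule borel_measurable_continuous_onI)
  have lg: "l2 lborel (\<lambda>x. g x \<bullet> b)" if "b \<in> Basis" for b using Dg[OF that] by (simp add: l2conv_def)
  have sc: "(\<integral>x. f (0 + s *\<^sub>R x) \<partial>lborel) = k * (\<integral>x. f x \<partial>lborel)" if "f \<in> borel_measurable borel" for f :: "'a \<Rightarrow> real"
    using integral_lborel_affine[OF that s0, of 0] s by (simp add: k_def)
  define u' where "u' x = u (0 + s *\<^sub>R x)" for x
  define g' where "g' x = s *\<^sub>R g (0 + s *\<^sub>R x)" for x
  define w' where "w' j x = w j (0 + s *\<^sub>R x)" for j x
  define Dw' where "Dw' j x = s *\<^sub>R Dw j (0 + s *\<^sub>R x)" for j x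
  have w'C: "C1c (w' j) (Dw' j)" for j unfolding w'_def[abs_def] Dw'_def[abs_def] by (rule C1c_scale[OF w s])
  have w'u: "l2conv lborel w' u'" unfolding w'_def[abs_def] u'_def[abs_def] by (rule l2conv_affine[OF wu s0])
  have D'g: "l2conv lborel (\<lambda>j x. Dw' j x \<bullet> b) (\<lambda>x. g' x \<bullet> b)" if b: "b \<in> Basis" for b
  proof -
    have "l2conv lborel (\<lambda>j x. s * (Dw j (0 + s *\<^sub>R x) \<bullet> b)) (\<lambda>x. s * (g (0 + s *\<^sub>R x) \<bullet> b))"
      by (rule l2conv_bounded_mult[OF l2conv_affine[OF Dg[OF b] s0], where C="\<bar>s\<bar>"]) auto
    then show ?thesis by (simp add: Dw'_def g'_def)
  qed
  have mm: "k * m = (\<integral>x. (u' x)\<^sup>2 \<partial>lborel)" unfolding u'_def m_def by (rule sc[symmetric]) measurable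
  have EE: "(\<Sum>b\<in>Basis. \<integral>x. (g' x \<bullet> b)\<^sup>2 \<partial>lborel) = k * (s\<^sup>2 * E)"
  proof -
    have "(\<integral>x. (g' x \<bullet> b)\<^sup>2 \<partial>lborel) = k * (s\<^sup>2 * (\<integral>x. (g x \<bullet> b)\<^sup>2 \<partial>lborel))" if "b \<in> Basis" for b
    proof -
      have [measurable]: "(\<lambda>x. g x \<bullet> b) \<in> borel_measurable borel" using l2_measurable[OF lg[OF that]] by simp
      have "(\<integral>x. s\<^sup>2 * (g (0 + s *\<^sub>R x) \<bullet> b)\<^sup>2 \<partial>lborel) = k * (\<integral>x. s\<^sup>2 * (g x \<bullet> b)\<^sup>2 \<partial>lborel)"
        by (rule sc) measurable
      then show ?thesis by (simp add: g'_def power_mult_distrib)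
    qed
    then show ?thesis unfolding E_def by (simp add: sum_distrib_left)
  qed
  have GG: "eventually (\<lambda>j. k * I - \<epsilon> \<le> (\<integral>x. G_log (w' j x) \<partial>lborel)) sequentially" if "0 < \<epsilon>" for \<epsilon>
    using G[OF divide_pos_pos[OF that k]]
  proof eventually_elim
    case (elim j)
    have "(\<integral>x. G_log (w' j x) \<partial>lborel) = k * (\<integral>x. G_log (w j x) \<partial>lborel)" unfolding w'_def by (rule sc) measurable
    moreover have "k * (I - \<epsilon> / k) \<le> k * (\<integral>x. G_log (w j x) \<partial>lborel)" using elim k by (intro mult_left_mono) auto
    ultimately show ?case using k by (simp add: right_diff_distrib)
  qed
  have km: "0 < k * m" using k m by simp
  note L = logsob_limit[OF w'C w'u D'g GG mm km, unfolded EE]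
  have lhs: "2 * (k * I) + real DIM('a) * (k * m) + real DIM('a) / 2 * ln (2 * pi) * (k * m) - (k * m) * ln (k * m)
     = k * (2 * I + K * m - m * (ln m - real DIM('a) * ln s))"
    using k m by (simp add: ln_mult lnk K_def algebra_simps)
  have rhs: "2 * (k * (s\<^sup>2 * E)) = k * (2 * s\<^sup>2 * E)" by simp
  show "2 * I + K * m - m * (ln m - real DIM('a) * ln s) \<le> 2 * s\<^sup>2 * E"
    using L(1) k unfolding lhs rhs by (simp only: mult_le_cancel_left_pos)
  assume eq: "2 * I + K * m - m * (ln m - real DIM('a) * ln s) = 2 * s\<^sup>2 * E"
  have "2 * (k * I) + real DIM('a) * (k * m) + real DIM('a) / 2 * ln (2 * pi) * (k * m) - (k * m) * ln (k * m) = 2 * (k * (s\<^sup>2 * E))"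
    unfolding lhs rhs using eq by simp
  then have "\<exists>\<beta>. AE x in lborel. g' x = u' x *\<^sub>R (\<beta> - x /\<^sub>R 2)"
    by (intro L(2))
  then obtain \<beta> where "AE x in lborel. g' x = u' x *\<^sub>R (\<beta> - x /\<^sub>R 2)" by blast
  from log_gradient_rigidity[OF w'C w'u D'g this]
  obtain c where c: "AE x in lborel. u' x = c * exp (\<beta> \<bullet> x - (norm x)\<^sup>2 / 4)" by blast
  \<comment> \<open>centre found by completing the square in \<open>\<beta> \<bullet> x - |x|\<^sup>2 / 4\<close> and scaling back\<close>
  define y where "y = (2 * s) *\<^sub>R \<beta>"
  define c' where "c' = c * exp ((norm y)\<^sup>2 / (4 * s\<^sup>2))"
  have sq: "\<beta> \<bullet> x - (norm x)\<^sup>2 / 4 = (norm y)\<^sup>2 / (4 * s\<^sup>2) + - (norm (0 + s *\<^sub>R x - y))\<^sup>2 / (4 * s\<^sup>2)" for x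
    unfolding y_def power2_norm_eq_inner using s0
    by (simp add: inner_simps inner_commute power2_eq_square field_simps)
  have "AE x in lborel. u (0 + s *\<^sub>R x) = c' * exp (- (norm (0 + s *\<^sub>R x - y))\<^sup>2 / (4 * s\<^sup>2))"
    using c
  proof eventually_elim
    case (elim x)
    then show ?case unfolding sq exp_add u'_def c'_def by (simp only: mult.assoc)
  qed
  then have "AE x in lborel. u x = c' * exp (- (norm (x - y))\<^sup>2 / (4 * s\<^sup>2))"
    by (rule AE_lborel_affine[OF s0, rotated, where P="\<lambda>x. u x = c' * exp (- (norm (x - y))\<^sup>2 / (4 * s\<^sup>2))" and t=0]) measurable
  then show "\<exists>c y. AE x in lborel. u x = c * exp (- (norm (x - y))\<^sup>2 / (4 * s\<^sup>2))" by blast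
qed

definition sharp_C :: "nat \<Rightarrow> real" where
  "sharp_C N = critical_exponent N * (real N / 2) powr (2 / (real N - 2))
             * exp (2 * (real N - 1) / (real N - 2)) * pi powr (real N / (real N - 2))"

lemma sharp_C_pos: "N \<ge> 3 \<Longrightarrow> 0 < sharp_C N"
  by (auto simp: sharp_C_def critical_exponent_def intro!: mult_pos_pos divide_pos_pos)

lemma ln_sharp_C:
  assumes N: "N \<ge> 3"
  shows "(real N - 2) * ln (sharp_C N) = (real N - 2) * (ln 4 + ln (real N / 2) - ln (real N - 2)) + 2 * ln (real N / 2) + 2 * (real N - 1) + real N * ln pi"
proof -
  define n where "n = real N"
  have n: "n \<ge> 3" using N by (simp add: n_def)
  have ce: "critical_exponent N = 4 * (n / 2) / (n - 2)" by (simp add: critical_exponent_def n_def)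
  have lce: "ln (critical_exponent N) = ln 4 + ln (n / 2) - ln (n - 2)"
  proof -
    have "ln (4 * (n / 2) / (n - 2)) = ln (4 * (n / 2)) - ln (n - 2)" using n by (subst ln_div) auto
    also have "ln (4 * (n / 2)) = ln 4 + ln (n / 2)" by (rule ln_mult_pos) (use n in auto)
    finally show ?thesis unfolding ce .
  qed
  have cp: "0 < critical_exponent N" unfolding ce using n by simp
  have "ln (sharp_C N) = ln (critical_exponent N) + 2 / (n - 2) * ln (n / 2) + 2 * (n - 1) / (n - 2) + n / (n - 2) * ln pi"
    unfolding sharp_C_def n_def[symmetric] using cp n by (simp add: ln_mult_pos ln_powr mult_pos_pos)
  then have "(n - 2) * ln (sharp_C N) = (n - 2) * ln (critical_exponent N) + 2 * ln (n / 2) + 2 * (n - 1) + n * ln pi"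
    using n by (simp add: distrib_left)
  then show ?thesis unfolding lce n_def .
qed

text \<open>
  The scale \<open>s0\<close> minimises \<open>2 s\<^sup>2 E - real N * m * ln s\<close>. What is left is
  \<open>2 I \<le> (n - 2)/2 * m * (1 + ln (M / m))\<close>, and \<open>ln x \<le> x - 1\<close> at \<open>x = M / m\<close> bounds the right-hand side by
  \<open>(n - 2)/2 * M\<close>, with equality only for \<open>m = M\<close>. The value of the sharp constant is what makes the
  additive constants collect into \<open>ln M\<close>.
\<close>

lemma optimise_scale_and_amplitude:
  fixes m E I :: real and N :: nat
  assumes N: "N \<ge> 3" and m: "0 < m" and E0: "0 \<le> E"
    and H: "\<And>s. 0 < s \<Longrightarrow> 2 * I + (real N + real N / 2 * ln (2 * pi)) * m - m * (ln m - real N * ln s) \<le> 2 * s\<^sup>2 * E"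
  defines "s0 \<equiv> sqrt (real N * m / (4 * E))"
  shows "0 < E" and "sharp_C N * I \<le> E powr (real N / (real N - 2))"
    and "sharp_C N * I = E powr (real N / (real N - 2)) \<Longrightarrow>
       2 * I + (real N + real N / 2 * ln (2 * pi)) * m - m * (ln m - real N * ln s0) = 2 * s0\<^sup>2 * E
       \<and> (real N - 2) * sharp_C N * m = 4 * E powr (real N / (real N - 2))"
proof -
  define n where "n = real N"
  have n: "n \<ge> 3" using N by (simp add: n_def)
  define K where "K = n + n / 2 * ln (2 * pi)"
  show E: "0 < E"
  proof (rule ccontr)
    assume "\<not> 0 < E"
    then have "E = 0" using E0 by simp
    then have H0: "2 * I + K * m - m * (ln m - n * ln s) \<le> 0" if "0 < s" for s
      using H[OF that] by (simp add: K_def n_def)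
    \<comment> \<open>with \<open>E = 0\<close> the hypothesis fails for \<open>s = exp t\<close>, as \<open>ln s\<close> is unbounded\<close>
    define t where "t = (\<bar>2 * I + K * m - m * ln m\<bar> + 1) / (m * n)"
    have "m * n * t = \<bar>2 * I + K * m - m * ln m\<bar> + 1" using m n by (simp add: t_def)
    moreover have "2 * I + K * m - m * (ln m - n * t) \<le> 0" using H0[of "exp t"] by simp
    ultimately show False by (simp add: algebra_simps)
  qed
  have s0: "0 < s0" "s0\<^sup>2 = n * m / (4 * E)" using E m n by (auto simp: s0_def n_def)
  have lns0: "ln s0 = (ln n + ln m - ln 4 - ln E) / 2"
    unfolding s0_def n_def[symmetric] using E m n by (simp add: ln_sqrt ln_div ln_mult_pos)
  have CN: "0 < sharp_C N" by (rule sharp_C_pos[OF N])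
  define \<alpha> where "\<alpha> = n / (n - 2)"
  define M where "M = 4 * E powr \<alpha> / ((n - 2) * sharp_C N)"
  have M: "0 < M" using E CN n by (simp add: M_def)
  have lnM: "(n - 2) * ln M = n * ln E - (n - 2) * ln (n / 2) - 2 * ln (n / 2) - 2 * (n - 1) - n * ln pi"
  proof -
    have "ln M = ln 4 + \<alpha> * ln E - ln (n - 2) - ln (sharp_C N)"
      unfolding M_def using E CN n by (simp add: ln_div ln_mult_pos ln_powr)
    then have "(n - 2) * ln M = (n - 2) * (ln 4 - ln (n - 2)) + (n - 2) * (\<alpha> * ln E) - (n - 2) * ln (sharp_C N)"
      by (simp only:) (simp add: algebra_simps)
    moreover have "(n - 2) * (\<alpha> * ln E) = n * ln E" using n by (simp add: \<alpha>_def)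
    ultimately have "(n - 2) * ln M = (n - 2) * (ln 4 - ln (n - 2)) + n * ln E - (n - 2) * ln (sharp_C N)" by simp
    then show ?thesis using ln_sharp_C[OF N] unfolding n_def[symmetric] by (simp add: algebra_simps)
  qed
  have l2: "ln (n / 2) = ln n - ln 2" "ln (2 * pi) = ln 2 + ln pi" "ln (4::real) = 2 * ln 2"
    using n ln_realpow[of 2 2] by (auto simp: ln_div ln_mult_pos)
  have key: "m * (ln m - n * ln s0) - K * m + 2 * s0\<^sup>2 * E = (n - 2) / 2 * (m * (1 + ln M - ln m))"
  proof -
    have e: "2 * s0\<^sup>2 * E = m * (n / 2)" using s0(2) E by simp
    have "ln m - n * ln s0 - K + n / 2 = (n - 2) / 2 * (1 + ln M - ln m)"
      using lnM unfolding lns0 K_def l2 by (simp add: field_simps)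
    then have "m * (ln m - n * ln s0 - K + n / 2) = (n - 2) / 2 * (m * (1 + ln M - ln m))"
      by (simp only: mult.left_commute)
    moreover have "m * (ln m - n * ln s0) - K * m + m * (n / 2) = m * (ln m - n * ln s0 - K + n / 2)"
      by (simp only: right_diff_distrib distrib_left mult.commute[of K])
    ultimately show ?thesis unfolding e by simp
  qed
  have H1: "2 * I \<le> (n - 2) / 2 * (m * (1 + ln M - ln m))"
    using H[OF s0(1), folded n_def, folded K_def] key by linarith
  have amp: "m * (1 + ln M - ln m) \<le> M"
  proof -
    have "ln (M / m) \<le> M / m - 1" by (rule ln_le_minus_one) (use M m in simp)
    then have "1 + ln M - ln m \<le> M / m" using M m by (simp add: ln_div)
    then show ?thesis using m by (simp add: field_simps)
  qed
  have amp_eq: "M = m" if "m * (1 + ln M - ln m) = M"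
  proof -
    have "1 + ln M - ln m = M / m" using that m by (simp add: field_simps)
    then have "ln (M / m) = M / m - 1" using M m by (simp add: ln_div)
    then have "M / m = 1" using M m by (intro ln_eq_minus_one) auto
    then show ?thesis using m by simp
  qed
  have ME: "(n - 2) * sharp_C N * M = 4 * E powr \<alpha>" using CN n by (simp add: M_def)
  have "4 * (sharp_C N * I) \<le> 4 * E powr \<alpha>"
  proof -
    have "0 \<le> (n - 2) / 2" using n by simp
    from mult_left_mono[OF amp this] have "2 * I \<le> (n - 2) / 2 * M" using H1 by linarith
    then have "2 * sharp_C N * (2 * I) \<le> 2 * sharp_C N * ((n - 2) / 2 * M)" using CN by (intro mult_left_mono) auto
    then show ?thesis using ME by (simp add: algebra_simps)
  qed
  then show "sharp_C N * I \<le> E powr (real N / (real N - 2))" by (simp add: \<alpha>_def n_def)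
  assume "sharp_C N * I = E powr (real N / (real N - 2))"
  then have eq: "sharp_C N * I = E powr \<alpha>" by (simp add: \<alpha>_def n_def)
  have I_eq: "2 * I = (n - 2) / 2 * M"
  proof -
    have "sharp_C N * (4 * I) = sharp_C N * ((n - 2) * M)" using eq ME by (simp add: algebra_simps)
    then show ?thesis using CN by simp
  qed
  have ampe: "m * (1 + ln M - ln m) = M"
  proof (rule antisym[OF amp])
    have "(n - 2) / 2 * M \<le> (n - 2) / 2 * (m * (1 + ln M - ln m))" using H1 I_eq by simp
    then show "M \<le> m * (1 + ln M - ln m)" using n by (subst (asm) mult_le_cancel_left_pos) auto
  qed
  have "2 * I + K * m - m * (ln m - n * ln s0) = 2 * s0\<^sup>2 * E"
    using key unfolding ampe I_eq by simp
  moreover have "(n - 2) * sharp_C N * m = 4 * E powr \<alpha>" using ME amp_eq[OF ampe] by simp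
  ultimately show "2 * I + (real N + real N / 2 * ln (2 * pi)) * m - m * (ln m - real N * ln s0) = 2 * s0\<^sup>2 * E
       \<and> (real N - 2) * sharp_C N * m = 4 * E powr (real N / (real N - 2))"
    by (simp add: K_def n_def \<alpha>_def)
qed

section \<open>Gaussian integrals and smooth bump functions\<close>

lemma integral_std_gauss_square: "integrable std_gauss (\<lambda>x. x\<^sup>2)" "(\<integral>x. x\<^sup>2 \<partial>std_gauss) = 1"
proof -
  have h: "has_bochner_integral lborel (\<lambda>x. std_normal_density x * x ^ (2 * 1)) (fact (2 * 1) / (2 ^ 1 * fact 1))"
    by (rule std_normal_moment_even)
  then show "(\<integral>x. x\<^sup>2 \<partial>std_gauss) = 1"
    by (subst integral_std_gauss) (auto simp: has_bochner_integral_iff)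
  show "integrable std_gauss (\<lambda>x. x\<^sup>2)"
    unfolding std_gauss_def by (subst integrable_density) (use h in \<open>auto simp: has_bochner_integral_iff\<close>)
qed

lemma gaussE_second_moment:
  fixes b :: "'a::euclidean_space"
  assumes b: "b \<in> Basis"
  shows "integrable gaussE (\<lambda>x. (x \<bullet> b)\<^sup>2)" "(\<integral>x. (x \<bullet> b)\<^sup>2 \<partial>gaussE) = 1"
proof -
  interpret S: product_sigma_finite "\<lambda>_::'a. std_gauss" by standard
  let ?S = "\<lambda>f. \<Sum>b\<in>Basis. f b *\<^sub>R b :: 'a"
  define f where "f i y = (if i = b then y\<^sup>2 else 1)" for i :: 'a and y :: real
  have fi: "integrable std_gauss (f i)" "(\<integral>y. f i y \<partial>std_gauss) = 1" for i
    unfolding f_def[abs_def] using integral_std_gauss_square std_gauss.prob_space by (cases "i = b"; simp)+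
  have p: "(\<Prod>i\<in>Basis. f i (x i)) = (x b)\<^sup>2" for x
  proof -
    have "(\<Prod>i\<in>Basis. f i (x i)) = f b (x b) * (\<Prod>i\<in>Basis - {b}. f i (x i))" by (rule prod.remove) (use b in auto)
    also have "(\<Prod>i\<in>Basis - {b}. f i (x i)) = 1" by (rule prod.neutral) (auto simp: f_def)
    finally show ?thesis by (simp add: f_def)
  qed
  have mS: "?S \<in> measurable (gauss_PiM Basis) borel" by measurable
  have i: "integrable (gauss_PiM Basis) (\<lambda>x. (x b)\<^sup>2)" "(\<integral>x. (x b)\<^sup>2 \<partial>gauss_PiM Basis) = 1"
    using S.product_integrable_prod[of Basis f] S.product_integral_prod[of Basis f] fi unfolding p by auto
  show "integrable gaussE (\<lambda>x. (x \<bullet> b)\<^sup>2)" "(\<integral>x. (x \<bullet> b)\<^sup>2 \<partial>gaussE) = 1"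
    unfolding gaussE_eq_distr using i by (simp_all add: integrable_distr_eq[OF mS] integral_distr[OF mS] inner_sum_scale_Basis[OF b])
qed

lemma gaussE_norm_square:
  "integrable gaussE (\<lambda>x::'a::euclidean_space. (norm x)\<^sup>2)" "(\<integral>x. (norm (x::'a))\<^sup>2 \<partial>gaussE) = DIM('a)"
proof -
  have e: "(\<lambda>x::'a. (norm x)\<^sup>2) = (\<lambda>x. \<Sum>b\<in>Basis. (x \<bullet> b)\<^sup>2)"
  proof
    fix x :: 'a
    show "(norm x)\<^sup>2 = (\<Sum>b\<in>Basis. (x \<bullet> b)\<^sup>2)"
      unfolding power2_norm_eq_inner euclidean_inner[of x x] by (simp add: power2_eq_square)
  qed
  show "integrable gaussE (\<lambda>x::'a. (norm x)\<^sup>2)" unfolding e by (intro Bochner_Integration.integrable_sum gaussE_second_moment)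
  show "(\<integral>x. (norm (x::'a))\<^sup>2 \<partial>gaussE) = DIM('a)"
    unfolding e by (subst Bochner_Integration.integral_sum) (simp_all add: gaussE_second_moment)
qed

text \<open>
  Translation and scaling reduce all four claims to total mass and second moment of the standard Gaussian.
\<close>

lemma gaussian_integrals:
  fixes y :: "'a::euclidean_space"
  assumes a: "0 < a"
  shows "integrable lborel (\<lambda>x. exp (- a * (norm (x - y))\<^sup>2))"
    and "(\<integral>x. exp (- a * (norm (x - y))\<^sup>2) \<partial>lborel) = (pi / a) powr (DIM('a) / 2)"
    and "integrable lborel (\<lambda>x. (norm (x - y))\<^sup>2 * exp (- a * (norm (x - y))\<^sup>2))"
    and "(\<integral>x. (norm (x - y))\<^sup>2 * exp (- a * (norm (x - y))\<^sup>2) \<partial>lborel) = DIM('a) / (2 * a) * (pi / a) powr (DIM('a) / 2)"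
proof -
  define c where "c = sqrt (2 * a)"
  have c: "0 < c" "c\<^sup>2 = 2 * a" using a by (auto simp: c_def)
  define k where "k = (1 / sqrt (2 * pi)) ^ DIM('a)"
  have k: "0 < k" by (simp add: k_def)
  have ce: "- (c *\<^sub>R y) + c *\<^sub>R x = c *\<^sub>R (x - y)" for x by (simp add: algebra_simps)
  have nc: "(norm (c *\<^sub>R (x - y)))\<^sup>2 = 2 * a * (norm (x - y))\<^sup>2" for x using c by (simp add: power_mult_distrib)
  have gd: "gauss_dens (- (c *\<^sub>R y) + c *\<^sub>R x) = k * exp (- a * (norm (x - y))\<^sup>2)" for x
    unfolding gauss_dens_def k_def[symmetric] ce nc by simp
  have main: "integrable lborel (\<lambda>x. exp (- a * (norm (x - y))\<^sup>2) * f (c *\<^sub>R (x - y)))"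
      "k * c ^ DIM('a) * (\<integral>x. exp (- a * (norm (x - y))\<^sup>2) * f (c *\<^sub>R (x - y)) \<partial>lborel) = (\<integral>x. f x \<partial>gaussE)"
    if i: "integrable gaussE f" and [measurable]: "f \<in> borel_measurable borel" for f :: "'a \<Rightarrow> real"
  proof -
    have i1: "integrable lborel (\<lambda>x. gauss_dens x * f x)" using i by (simp add: integral_gaussE(2))
    have "integrable lborel (\<lambda>x. gauss_dens (- (c *\<^sub>R y) + c *\<^sub>R x) * f (- (c *\<^sub>R y) + c *\<^sub>R x))"
      using i1 integrable_lborel_affine[of "\<lambda>x. gauss_dens x * f x" c "- (c *\<^sub>R y)"] c by simp
    then have "integrable lborel (\<lambda>x. k * (exp (- a * (norm (x - y))\<^sup>2) * f (c *\<^sub>R (x - y))))"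
      unfolding gd unfolding ce by (simp only: mult.assoc)
    then show "integrable lborel (\<lambda>x. exp (- a * (norm (x - y))\<^sup>2) * f (c *\<^sub>R (x - y)))" using k by simp
    have "(\<integral>x. f x \<partial>gaussE) = \<bar>c\<bar> ^ DIM('a) * (\<integral>x. gauss_dens (- (c *\<^sub>R y) + c *\<^sub>R x) * f (- (c *\<^sub>R y) + c *\<^sub>R x) \<partial>lborel)"
      unfolding integral_gaussE(1)[OF that(2)] by (rule integral_lborel_affine) (use c in auto)
    also have "\<dots> = \<bar>c\<bar> ^ DIM('a) * (\<integral>x. k * (exp (- a * (norm (x - y))\<^sup>2) * f (c *\<^sub>R (x - y))) \<partial>lborel)"
      unfolding gd unfolding ce by (simp only: mult.assoc)
    finally show "k * c ^ DIM('a) * (\<integral>x. exp (- a * (norm (x - y))\<^sup>2) * f (c *\<^sub>R (x - y)) \<partial>lborel) = (\<integral>x. f x \<partial>gaussE)"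
      using c by simp
  qed
  have kc: "k * c ^ DIM('a) * (pi / a) powr (DIM('a) / 2) = 1"
  proof -
    have "(pi / a) powr (DIM('a) / 2) = sqrt (pi / a) ^ DIM('a)"
    proof -
      have "(pi / a) powr (DIM('a) / 2) = ((pi / a) powr (1/2)) powr DIM('a)" by (simp add: powr_powr)
      also have "\<dots> = sqrt (pi / a) ^ DIM('a)" using a by (simp add: powr_half_sqrt powr_realpow)
      finally show ?thesis .
    qed
    moreover have "1 / sqrt (2 * pi) * c * sqrt (pi / a) = 1"
      unfolding c_def using a by (simp add: real_sqrt_mult real_sqrt_divide field_simps)
    ultimately show ?thesis unfolding k_def by (simp only: power_mult_distrib[symmetric]) simp
  qed
  have kc0: "k * c ^ DIM('a) \<noteq> 0" using k c by simp
  have one: "integrable gaussE (\<lambda>_::'a. 1 :: real)" by simp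
  show "integrable lborel (\<lambda>x. exp (- a * (norm (x - y))\<^sup>2))" using main(1)[OF one] by simp
  have "k * c ^ DIM('a) * (\<integral>x. exp (- a * (norm (x - y))\<^sup>2) \<partial>lborel) = 1" using main(2)[OF one] by simp
  then have "k * c ^ DIM('a) * (\<integral>x. exp (- a * (norm (x - y))\<^sup>2) \<partial>lborel) = k * c ^ DIM('a) * (pi / a) powr (DIM('a) / 2)" by (simp only: kc)
  then show "(\<integral>x. exp (- a * (norm (x - y))\<^sup>2) \<partial>lborel) = (pi / a) powr (DIM('a) / 2)" using kc0 by (simp only: mult_cancel_left) simp
  have eq: "exp (- a * (norm (x - y))\<^sup>2) * (norm (c *\<^sub>R (x - y)))\<^sup>2 = 2 * a * ((norm (x - y))\<^sup>2 * exp (- a * (norm (x - y))\<^sup>2))" for x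
    unfolding nc by simp
  show "integrable lborel (\<lambda>x. (norm (x - y))\<^sup>2 * exp (- a * (norm (x - y))\<^sup>2))"
    using main(1)[OF gaussE_norm_square(1)] a unfolding eq by simp
  have "k * c ^ DIM('a) * (2 * a * (\<integral>x. (norm (x - y))\<^sup>2 * exp (- a * (norm (x - y))\<^sup>2) \<partial>lborel)) = DIM('a)"
    using main(2)[OF gaussE_norm_square(1)] unfolding eq gaussE_norm_square(2) by simp
  also have "\<dots> = k * c ^ DIM('a) * (2 * a * (DIM('a) / (2 * a) * (pi / a) powr (DIM('a) / 2)))"
    using kc a by simp
  finally have "2 * a * (\<integral>x. (norm (x - y))\<^sup>2 * exp (- a * (norm (x - y))\<^sup>2) \<partial>lborel) = 2 * a * (DIM('a) / (2 * a) * (pi / a) powr (DIM('a) / 2))"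
    using kc0 by (simp only: mult_cancel_left) simp
  then show "(\<integral>x. (norm (x - y))\<^sup>2 * exp (- a * (norm (x - y))\<^sup>2) \<partial>lborel) = DIM('a) / (2 * a) * (pi / a) powr (DIM('a) / 2)"
    by (subst (asm) mult_cancel_left) (use a in simp)
qed

text \<open>
  All derivatives of \<open>exp (- 1/t)\<close> have this form, so the family is closed under differentiation, and smoothness of
  \<open>exp (- 1/t)\<close> at zero follows for all members at once.
\<close>

definition bump_fun :: "real poly \<Rightarrow> real \<Rightarrow> real" where
  "bump_fun p t = (if 0 < t then poly p (1 / t) * exp (- (1 / t)) else 0)"

lemma poly_exp_tendsto_0: "((\<lambda>y. poly p y * exp (- y)) \<longlongrightarrow> 0) at_top" for p :: "real poly"
proof -
  have "((\<lambda>y. coeff p i * (y ^ i / exp y)) \<longlongrightarrow> 0) at_top" for i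
    by (rule tendsto_mult_right_zero) (rule tendsto_power_div_exp_0)
  then have "((\<lambda>y. \<Sum>i\<le>degree p. coeff p i * (y ^ i / exp y)) \<longlongrightarrow> 0) at_top"
    by (intro tendsto_null_sum)
  moreover have "(\<lambda>y. \<Sum>i\<le>degree p. coeff p i * (y ^ i / exp y)) = (\<lambda>y. poly p y * exp (- y))"
    by (simp add: poly_altdef exp_minus divide_inverse sum_distrib_right mult.assoc)
  ultimately show ?thesis by simp
qed

lemma bump_fun_deriv: "(bump_fun p has_real_derivative bump_fun ([:0, 0, 1:] * (p - pderiv p)) t) (at t)"
proof -
  define p' where "p' = [:0, 0, 1:] * (p - pderiv p)"
  consider "0 < t" | "t < 0" | "t = 0" by linarith
  then have "(bump_fun p has_real_derivative bump_fun p' t) (at t)"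
  proof cases
    case 1
    have "((\<lambda>t. 1 / t) has_real_derivative - (1 / t\<^sup>2)) (at t)"
      using 1 by (auto intro!: derivative_eq_intros simp: power2_eq_square)
    from DERIV_chain2[OF poly_DERIV this, of p] this
    have "((\<lambda>t. poly p (1 / t) * exp (- (1 / t))) has_real_derivative
        (poly (pderiv p) (1 / t) * - (1 / t\<^sup>2)) * exp (- (1 / t)) + (exp (- (1 / t)) * - (- (1 / t\<^sup>2))) * poly p (1 / t)) (at t)"
      by (intro DERIV_mult DERIV_fun_exp DERIV_minus)
    moreover have "(poly (pderiv p) (1 / t) * - (1 / t\<^sup>2)) * exp (- (1 / t)) + (exp (- (1 / t)) * - (- (1 / t\<^sup>2))) * poly p (1 / t) = bump_fun p' t"
      using 1 by (simp add: bump_fun_def p'_def power2_eq_square algebra_simps)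
    ultimately have "((\<lambda>t. poly p (1 / t) * exp (- (1 / t))) has_real_derivative bump_fun p' t) (at t)" by simp
    moreover have "eventually (\<lambda>x. poly p (1 / x) * exp (- (1 / x)) = bump_fun p x) (nhds t)"
      using 1 eventually_nhds_in_open[of "{0<..}" t] by (auto elim!: eventually_mono simp: bump_fun_def)
    ultimately show ?thesis by (subst (asm) DERIV_cong_ev[OF refl _ refl]) auto
  next
    case 2
    have "((\<lambda>_. 0::real) has_real_derivative bump_fun p' t) (at t)" using 2 by (simp add: bump_fun_def)
    moreover have "eventually (\<lambda>x. 0 = bump_fun p x) (nhds t)"
      using 2 eventually_nhds_in_open[of "{..<0}" t] by (auto elim!: eventually_mono simp: bump_fun_def)
    ultimately show ?thesis by (subst (asm) DERIV_cong_ev[OF refl _ refl]) auto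
  next
    case 3
    have "((\<lambda>h. bump_fun p h / h) \<longlongrightarrow> 0) (at_right 0)"
    proof -
      have "((\<lambda>h. poly (pCons 0 p) (inverse h) * exp (- inverse h)) \<longlongrightarrow> 0) (at_right 0)"
        by (rule filterlim_compose[OF poly_exp_tendsto_0 filterlim_inverse_at_top_right])
      moreover have "eventually (\<lambda>h. poly (pCons 0 p) (inverse h) * exp (- inverse h) = bump_fun p h / h) (at_right 0)"
        unfolding eventually_at_right_field by (intro exI[of _ 1]) (auto simp: bump_fun_def divide_inverse)
      ultimately show ?thesis by (rule Lim_transform_eventually)
    qed
    moreover have "((\<lambda>h. bump_fun p h / h) \<longlongrightarrow> 0) (at_left 0)"
    proof (rule tendsto_eventually)
      show "eventually (\<lambda>h. bump_fun p h / h = 0) (at_left 0)"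
        unfolding eventually_at_left_field by (intro exI[of _ "-1"]) (auto simp: bump_fun_def)
    qed
    ultimately have "((\<lambda>h. bump_fun p h / h) \<longlongrightarrow> 0) (at 0)" by (simp add: filterlim_split_at)
    then show ?thesis using 3 by (simp add: DERIV_def bump_fun_def)
  qed
  then show ?thesis by (simp add: p'_def)
qed

lemma C_k_SucD: "C_k (Suc k) f \<Longrightarrow> C_k k f"
proof (induction k arbitrary: f)
  case 0
  then obtain g where "\<And>x. GDERIV f x :> g x" by auto
  then have "continuous_on UNIV f" by (rule GDERIV_continuous)
  then show ?case by simp
next
  case (Suc k)
  then obtain g where "\<And>x. GDERIV f x :> g x" "\<And>i. C_k (Suc k) (\<lambda>x. g x $ i)" by (auto simp only: C_k.simps(2)[of "Suc k"])
  then show ?case using Suc.IH unfolding C_k.simps(2) by blast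
qed

lemma C_k_const: "C_k k (\<lambda>_. c)"
proof (induction k arbitrary: c)
  case (Suc k)
  show ?case unfolding C_k.simps(2) by (intro exI[of _ "\<lambda>_. 0"]) (auto simp: GDERIV_const Suc)
qed simp

lemma C_k_add: "C_k k f \<Longrightarrow> C_k k g \<Longrightarrow> C_k k (\<lambda>x. f x + g x)"
proof (induction k arbitrary: f g)
  case (Suc k)
  then obtain f' g' where "\<And>x. GDERIV f x :> f' x" "\<And>i. C_k k (\<lambda>x. f' x $ i)" "\<And>x. GDERIV g x :> g' x" "\<And>i. C_k k (\<lambda>x. g' x $ i)" by auto
  then show ?case unfolding C_k.simps(2) by (intro exI[of _ "\<lambda>x. f' x + g' x"]) (auto intro: GDERIV_add Suc.IH)
qed (auto intro: continuous_on_add)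

lemma C_k_mult: "C_k k f \<Longrightarrow> C_k k g \<Longrightarrow> C_k k (\<lambda>x. f x * g x)"
proof (induction k arbitrary: f g)
  case (Suc k)
  then obtain f' g' where 1: "\<And>x. GDERIV f x :> f' x" "\<And>i. C_k k (\<lambda>x. f' x $ i)" "\<And>x. GDERIV g x :> g' x" "\<And>i. C_k k (\<lambda>x. g' x $ i)" by auto
  have 2: "C_k k f" "C_k k g" using C_k_SucD[OF Suc.prems(1)] C_k_SucD[OF Suc.prems(2)] .
  show ?case unfolding C_k.simps(2)
    by (intro exI[of _ "\<lambda>x. f x *\<^sub>R g' x + g x *\<^sub>R f' x"]) (auto intro!: GDERIV_mult C_k_add Suc.IH 1 2)
qed (auto intro: continuous_on_mult)

text \<open>
  A family closed under differentiation takes the place of an induction over the derivatives of the outer function.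
\<close>

lemma C_k_compose:
  assumes F: "\<And>f. f \<in> F \<Longrightarrow> \<exists>f'\<in>F. \<forall>t. (f has_real_derivative f' t) (at t)"
    and \<rho>: "\<And>k. C_k k \<rho>" and f: "f \<in> F"
  shows "C_k k (\<lambda>x. f (\<rho> x))"
  using f
proof (induction k arbitrary: f)
  case 0
  then obtain f' where "\<And>t. (f has_real_derivative f' t) (at t)" using F by blast
  then have "continuous_on UNIV f" by (auto intro!: DERIV_continuous_on)
  then show ?case using \<rho>[of 0] by (auto intro: continuous_on_compose2)
next
  case (Suc k)
  obtain f' where f': "f' \<in> F" "\<And>t. (f has_real_derivative f' t) (at t)" using F Suc.prems by blast
  obtain g where g: "\<And>x. GDERIV \<rho> x :> g x" "\<And>i. C_k k (\<lambda>x. g x $ i)" using \<rho>[of "Suc k"] by auto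
  show ?case unfolding C_k.simps(2)
    by (intro exI[of _ "\<lambda>x. f' (\<rho> x) *\<^sub>R g x"]) (auto intro!: GDERIV_DERIV_compose[OF g(1) f'(2)] C_k_mult Suc.IH f' g)
qed

lemma C_k_norm_sq: "C_k k (\<lambda>x. (norm (x - y))\<^sup>2 :: real)"
proof (cases k)
  case 0
  then show ?thesis by (auto intro!: continuous_intros)
next
  case (Suc j)
  have D: "GDERIV (\<lambda>x. (norm (x - y))\<^sup>2) x :> 2 *\<^sub>R (x - y)" for x
    unfolding gderiv_def power2_norm_eq_inner by (auto intro!: derivative_eq_intros simp: inner_commute)
  have L: "C_k j (\<lambda>x. 2 * ((x::real^'a) $ i - y $ i))" for i
  proof (cases j)
    case 0
    then show ?thesis by (auto intro!: continuous_intros)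
  next
    case (Suc l)
    have "GDERIV (\<lambda>x::real^'a. 2 * (x $ i - y $ i)) x :> 2 *\<^sub>R axis i 1" for x
    proof -
      have e: "x $ i = x \<bullet> axis i 1" for x :: "real^'a" by (simp add: inner_axis)
      show ?thesis unfolding gderiv_def e by (auto intro!: derivative_eq_intros)
    qed
    then show ?thesis using Suc by (auto intro!: exI[of _ "\<lambda>_. 2 *\<^sub>R axis i 1"] C_k_const)
  qed
  show ?thesis unfolding Suc C_k.simps(2) by (intro exI[of _ "\<lambda>x. 2 *\<^sub>R (x - y)"]) (use D L in auto)
qed

section \<open>Gaussians in D12\<close>

lemma sum_Basis_inner_sq: "(\<Sum>b\<in>Basis. ((v::'a::euclidean_space) \<bullet> b)\<^sup>2) = (norm v)\<^sup>2"
  unfolding power2_norm_eq_inner euclidean_inner[of v v] by (simp add: power2_eq_square)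

text \<open>
  Normalised to the value 1 at the centre \<open>y\<close>. Unlike \<open>cutoff\<close> it is smooth, because the functions approximating a
  Gaussian in \<open>D12\<close> have to be test functions.
\<close>

definition smooth_cutoff :: "real \<Rightarrow> 'a::euclidean_space \<Rightarrow> 'a \<Rightarrow> real" where
  "smooth_cutoff R y x = exp 1 * bump_fun 1 (1 - (norm (x - y))\<^sup>2 / R\<^sup>2)"

definition Dsmooth_cutoff :: "real \<Rightarrow> 'a::euclidean_space \<Rightarrow> 'a \<Rightarrow> 'a" where
  "Dsmooth_cutoff R y x = (exp 1 * bump_fun [:0, 0, 1:] (1 - (norm (x - y))\<^sup>2 / R\<^sup>2)) *\<^sub>R ((- 2 / R\<^sup>2) *\<^sub>R (x - y))"

lemma GDERIV_norm_sq_diff: "GDERIV (\<lambda>x::'a::euclidean_space. (norm (x - y))\<^sup>2) x :> 2 *\<^sub>R (x - y)"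
  unfolding gderiv_def power2_norm_eq_inner by (auto intro!: derivative_eq_intros simp: inner_commute)

lemma smooth_cutoff_GDERIV: "GDERIV (smooth_cutoff R y) x :> Dsmooth_cutoff R y x"
proof -
  have "GDERIV (\<lambda>x. 1 - (norm (x - y))\<^sup>2 * (1 / R\<^sup>2)) x :> 0 - ((norm (x - y))\<^sup>2 *\<^sub>R 0 + (1 / R\<^sup>2) *\<^sub>R (2 *\<^sub>R (x - y)))"
    by (intro GDERIV_diff GDERIV_const GDERIV_mult GDERIV_norm_sq_diff)
  from GDERIV_DERIV_compose[OF this DERIV_cmult[OF bump_fun_deriv[of 1], of "exp 1"]]
  show ?thesis by (simp add: smooth_cutoff_def[abs_def] Dsmooth_cutoff_def pderiv_1)
qed

lemma smooth_cutoff_bounds: "0 \<le> smooth_cutoff R y x" "smooth_cutoff R y x \<le> 1"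
proof -
  define t where "t = 1 - (norm (x - y))\<^sup>2 / R\<^sup>2"
  have t: "t \<le> 1" by (simp add: t_def)
  show "0 \<le> smooth_cutoff R y x" by (simp add: smooth_cutoff_def bump_fun_def)
  have "exp 1 * exp (- (1 / t)) \<le> 1" if "0 < t"
    using that t by (simp flip: exp_add)
  then show "smooth_cutoff R y x \<le> 1" unfolding smooth_cutoff_def t_def[symmetric] by (simp add: bump_fun_def)
qed

lemma smooth_cutoff_outside: "0 < R \<Longrightarrow> R \<le> norm (x - y) \<Longrightarrow> smooth_cutoff R y x = 0 \<and> Dsmooth_cutoff R y x = 0"
proof -
  assume R: "0 < R" "R \<le> norm (x - y)"
  then have "R\<^sup>2 \<le> (norm (x - y))\<^sup>2" by (intro power_mono) auto
  then have "1 \<le> (norm (x - y))\<^sup>2 / R\<^sup>2" using R by simp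
  then have "\<not> 0 < 1 - (norm (x - y))\<^sup>2 / R\<^sup>2" by linarith
  then show ?thesis unfolding smooth_cutoff_def Dsmooth_cutoff_def bump_fun_def by (simp only: if_False) simp
qed

lemma Dsmooth_cutoff_bound:
  assumes R: "0 < R"
  shows "norm (Dsmooth_cutoff R y x) \<le> 4 * exp 1 / R"
proof (cases "R \<le> norm (x - y)")
  case True
  then show ?thesis using smooth_cutoff_outside[OF R True] R by simp
next
  case False
  have b: "0 \<le> bump_fun [:0, 0, 1:] t" "bump_fun [:0, 0, 1:] t \<le> 2" for t
  proof -
    show "0 \<le> bump_fun [:0, 0, 1:] t" by (simp add: bump_fun_def)
    have "y * y * exp (- y) \<le> 2" if "0 < y" for y :: real
    proof -
      have "y * y \<le> 2 * exp y" using exp_lower_Taylor_quadratic[of y] that by (simp add: power2_eq_square)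
      then have "y * y * exp (- y) \<le> 2 * exp y * exp (- y)" by (intro mult_right_mono) auto
      also have "2 * exp y * exp (- y) = 2" by (simp add: exp_minus)
      finally show ?thesis .
    qed
    from this[of "1 / t"] show "bump_fun [:0, 0, 1:] t \<le> 2" by (simp add: bump_fun_def mult.assoc)
  qed
  define q where "q = bump_fun [:0, 0, 1:] (1 - (norm (x - y))\<^sup>2 / R\<^sup>2)"
  have q: "0 \<le> q" "q \<le> 2" unfolding q_def by (rule b)+
  have "norm (Dsmooth_cutoff R y x) = exp 1 * q * (2 / R\<^sup>2 * norm (x - y))"
    unfolding Dsmooth_cutoff_def q_def[symmetric] using q by (simp add: abs_mult)
  also have "\<dots> \<le> exp 1 * 2 * (2 / R\<^sup>2 * R)" using q False R by (intro mult_mono mult_left_mono) auto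
  also have "\<dots> = 4 * exp 1 / R" using R by (simp add: power2_eq_square)
  finally show ?thesis .
qed

lemma smooth_cutoff_tendsto: "(\<lambda>j. smooth_cutoff (real (Suc j)) y x) \<longlonglongrightarrow> 1"
proof -
  have "(\<lambda>j. (norm (x - y))\<^sup>2 / (real (Suc j))\<^sup>2) \<longlonglongrightarrow> 0" by real_asymp
  then have "(\<lambda>j. 1 - (norm (x - y))\<^sup>2 / (real (Suc j))\<^sup>2) \<longlonglongrightarrow> 1 - 0" by (intro tendsto_intros)
  then have l: "(\<lambda>j. 1 - (norm (x - y))\<^sup>2 / (real (Suc j))\<^sup>2) \<longlonglongrightarrow> 1" by simp
  have "(\<lambda>j. bump_fun 1 (1 - (norm (x - y))\<^sup>2 / (real (Suc j))\<^sup>2)) \<longlonglongrightarrow> bump_fun 1 1"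
    by (rule isCont_tendsto_compose[OF DERIV_isCont[OF bump_fun_deriv] l])
  then have "(\<lambda>j. exp 1 * bump_fun 1 (1 - (norm (x - y))\<^sup>2 / (real (Suc j))\<^sup>2)) \<longlonglongrightarrow> exp 1 * bump_fun 1 1"
    by (intro tendsto_intros)
  moreover have "exp 1 * bump_fun 1 1 = 1" by (simp add: bump_fun_def flip: exp_add)
  ultimately show ?thesis by (simp add: smooth_cutoff_def)
qed

lemma C_k_smooth_cutoff: "C_k k (smooth_cutoff R (y :: real ^ 'n))"
proof -
  have r: "C_k k (\<lambda>x. 1 + (- 1 / R\<^sup>2) * (norm (x - y))\<^sup>2)" for k
    by (intro C_k_add C_k_mult C_k_const C_k_norm_sq)
  have "C_k k (\<lambda>x. bump_fun 1 (1 + (- 1 / R\<^sup>2) * (norm (x - y))\<^sup>2))"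
  proof (rule C_k_compose[where F="range bump_fun" and f="bump_fun 1", OF _ r])
    show "\<exists>f'\<in>range bump_fun. \<forall>t. (f has_real_derivative f' t) (at t)" if "f \<in> range bump_fun" for f
      using that bump_fun_deriv by blast
  qed simp
  then have "C_k k (\<lambda>x. exp 1 * bump_fun 1 (1 + (- 1 / R\<^sup>2) * (norm (x - y))\<^sup>2))"
    by (intro C_k_mult C_k_const)
  then show ?thesis by (simp add: smooth_cutoff_def[abs_def])
qed

lemma C_k_gaussian: "C_k k (\<lambda>x. K * exp (a * (norm (x - (y :: real ^ 'n)))\<^sup>2))"
proof -
  have "\<exists>f'\<in>{\<lambda>t. c * exp (a * t) |c. True}. \<forall>t. (f has_real_derivative f' t) (at t)" if f: "f \<in> {\<lambda>t. c * exp (a * t) |c. True}" for f :: "real \<Rightarrow> real"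
  proof -
    obtain c where c: "f = (\<lambda>t. c * exp (a * t))" using f by auto
    have "(f has_real_derivative (c * a) * exp (a * t)) (at t)" for t
      unfolding c by (auto intro!: derivative_eq_intros)
    then show ?thesis by (intro bexI[of _ "\<lambda>t. (c * a) * exp (a * t)"]) auto
  qed
  then show ?thesis
    by (rule C_k_compose[where f="\<lambda>t. K * exp (a * t)"]) (auto intro: C_k_norm_sq)
qed

lemma nn_integral_tendsto_0:
  fixes f :: "nat \<Rightarrow> 'a \<Rightarrow> real"
  assumes [measurable]: "\<And>k. f k \<in> borel_measurable M" and w: "integrable M w"
    and le: "\<And>k x. 0 \<le> f k x" "\<And>k x. f k x \<le> w x" and lim: "\<And>x. (\<lambda>k. f k x) \<longlonglongrightarrow> 0"
  shows "(\<lambda>k. \<integral>\<^sup>+x. ennreal (f k x) \<partial>M) \<longlonglongrightarrow> 0"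
proof -
  have [measurable]: "w \<in> borel_measurable M" using w by simp
  have w0: "0 \<le> w x" for x using le order_trans by blast
  have "(\<lambda>k. \<integral>\<^sup>+x. ennreal (f k x) \<partial>M) \<longlonglongrightarrow> (\<integral>\<^sup>+x. ennreal 0 \<partial>M)"
  proof (rule nn_integral_dominated_convergence[where w="\<lambda>x. ennreal (w x)"])
    show "(\<integral>\<^sup>+x. ennreal (w x) \<partial>M) < \<infinity>" using nn_integral_eq_integral[OF w] w0 by simp
    show "AE x in M. (\<lambda>k. ennreal (f k x)) \<longlonglongrightarrow> ennreal 0" by (intro AE_I2 tendsto_ennrealI lim)
  qed (auto intro!: AE_I2 ennreal_leI le)
  then show ?thesis by simp
qed

lemma gaussian_D12_approx:
  fixes y :: "real ^ 'n" and K l :: real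
  assumes N: "CARD('n) \<ge> 3" and l: "0 < l"
  defines "U \<equiv> \<lambda>x. K * exp (- (l\<^sup>2 / 2) * (norm (x - y))\<^sup>2)"
  shows "\<exists>\<phi>. D12_approx U (\<lambda>x. (- l\<^sup>2 * U x) *\<^sub>R (x - y)) \<phi>"
proof -
  define DU where "DU x = (- l\<^sup>2 * U x) *\<^sub>R (x - y)" for x
  have UD: "GDERIV U x :> DU x" for x
  proof -
    have "((\<lambda>t. K * exp (- (l\<^sup>2 / 2) * t)) has_real_derivative K * exp (- (l\<^sup>2 / 2) * (norm (x - y))\<^sup>2) * - (l\<^sup>2 / 2)) (at ((norm (x - y))\<^sup>2))"
      by (auto intro!: derivative_eq_intros)
    from GDERIV_DERIV_compose[OF GDERIV_norm_sq_diff this]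
    show ?thesis unfolding U_def DU_def by (simp add: mult_ac)
  qed
  have cU: "continuous_on UNIV U" by (rule GDERIV_continuous[OF UD])
  have cDU: "continuous_on UNIV DU" unfolding DU_def[abs_def] by (intro continuous_intros cU)
  have [measurable]: "U \<in> borel_measurable borel" "DU \<in> borel_measurable borel"
    using cU cDU by (auto intro: borel_measurable_continuous_onI)
  define \<eta> where "\<eta> j = smooth_cutoff (real (Suc j)) y" for j
  define D\<eta> where "D\<eta> j = Dsmooth_cutoff (real (Suc j)) y" for j
  have \<eta>b: "0 \<le> \<eta> j x" "\<eta> j x \<le> 1" for j x unfolding \<eta>_def by (rule smooth_cutoff_bounds)+
  define \<phi> where "\<phi> j x = \<eta> j x * U x" for j x
  have test: "test_function (\<phi> j)" for j
    unfolding test_function_def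
  proof (intro conjI allI)
    show "C_k k (\<phi> j)" for k unfolding \<phi>_def[abs_def] U_def \<eta>_def by (intro C_k_mult C_k_smooth_cutoff C_k_gaussian)
    have "{x. \<phi> j x \<noteq> 0} \<subseteq> cball y (real (Suc j))"
    proof
      fix x assume "x \<in> {x. \<phi> j x \<noteq> 0}"
      then have "smooth_cutoff (real (Suc j)) y x \<noteq> 0" by (simp add: \<phi>_def \<eta>_def)
      then have "\<not> real (Suc j) \<le> norm (x - y)" using smooth_cutoff_outside[of "real (Suc j)" x y] by auto
      then show "x \<in> cball y (real (Suc j))" by (simp add: dist_norm norm_minus_commute)
    qed
    then have "closure {x. \<phi> j x \<noteq> 0} \<subseteq> cball y (real (Suc j))" by (intro closure_minimal) auto
    then show "compact (closure {x. \<phi> j x \<noteq> 0})"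
      by (meson bounded_cball bounded_subset closed_closure compact_eq_bounded_closed)
  qed
  have grad\<phi>: "grad (\<phi> j) x = \<eta> j x *\<^sub>R DU x + U x *\<^sub>R D\<eta> j x" for j x
    unfolding \<phi>_def[abs_def] \<eta>_def D\<eta>_def by (intro grad_eq GDERIV_mult smooth_cutoff_GDERIV UD)
  have mg: "grad (\<phi> j) \<in> borel_measurable borel" for j
    using C1cD(3)[OF test_function_C1c[OF test]] by (rule borel_measurable_continuous_onI)
  have m\<phi>: "\<phi> j \<in> borel_measurable borel" for j
    using C1cD(2)[OF test_function_C1c[OF test]] by (rule borel_measurable_continuous_onI)
  note [measurable] = mg m\<phi>
  have U2: "(U x)\<^sup>2 = K\<^sup>2 * exp (- (l\<^sup>2) * (norm (x - y))\<^sup>2)" for x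
    unfolding U_def by (simp add: power_mult_distrib exp_double[symmetric])
  have DU2: "(norm (DU x))\<^sup>2 = l ^ 4 * K\<^sup>2 * ((norm (x - y))\<^sup>2 * exp (- (l\<^sup>2) * (norm (x - y))\<^sup>2))" for x
    unfolding DU_def by (simp add: power_mult_distrib U2 power2_eq_square[of "l\<^sup>2"] flip: power_add)
  have l2: "0 < l\<^sup>2" using l by simp
  have iU2: "integrable lborel (\<lambda>x. (U x)\<^sup>2)" unfolding U2 using gaussian_integrals(1)[OF l2, of y] by simp
  have iDU2: "integrable lborel (\<lambda>x. (norm (DU x))\<^sup>2)" unfolding DU2 using gaussian_integrals(3)[OF l2, of y] by simp
  have D\<eta>b: "norm (D\<eta> j x) \<le> 4 * exp 1 / real (Suc j)" for j x unfolding D\<eta>_def by (rule Dsmooth_cutoff_bound) simp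
  have diff: "(norm (grad (\<phi> j) x - DU x))\<^sup>2 \<le> 2 * ((1 - \<eta> j x)\<^sup>2 * (norm (DU x))\<^sup>2) + 2 * ((norm (D\<eta> j x))\<^sup>2 * (U x)\<^sup>2)" for j x
  proof -
    have "grad (\<phi> j) x - DU x = (\<eta> j x - 1) *\<^sub>R DU x + U x *\<^sub>R D\<eta> j x" by (simp add: grad\<phi> algebra_simps)
    then have "norm (grad (\<phi> j) x - DU x) \<le> (1 - \<eta> j x) * norm (DU x) + norm (D\<eta> j x) * \<bar>U x\<bar>"
      using norm_triangle_ineq[of "(\<eta> j x - 1) *\<^sub>R DU x" "U x *\<^sub>R D\<eta> j x"] \<eta>b[of j x] by (simp add: mult.commute)
    then have "(norm (grad (\<phi> j) x - DU x))\<^sup>2 \<le> ((1 - \<eta> j x) * norm (DU x) + norm (D\<eta> j x) * \<bar>U x\<bar>)\<^sup>2" by (intro power_mono) auto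
    also have "\<dots> \<le> 2 * ((1 - \<eta> j x) * norm (DU x))\<^sup>2 + 2 * (norm (D\<eta> j x) * \<bar>U x\<bar>)\<^sup>2"
    proof -
      have "(a + b)\<^sup>2 \<le> 2 * a\<^sup>2 + 2 * b\<^sup>2" for a b :: real
        using zero_le_power2[of "a - b"] by (simp add: power2_eq_square algebra_simps)
      then show ?thesis .
    qed
    finally show ?thesis by (simp add: power_mult_distrib)
  qed
  define B :: real where "B = 2 * (4 * exp 1)\<^sup>2"
  have g1: "(\<lambda>j. \<integral>\<^sup>+x. ennreal ((norm (grad (\<phi> j) x - DU x))\<^sup>2) \<partial>lborel) \<longlonglongrightarrow> 0"
  proof (rule nn_integral_tendsto_0[where w="\<lambda>x. 2 * (norm (DU x))\<^sup>2 + B * (U x)\<^sup>2"])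
    show "integrable lborel (\<lambda>x. 2 * (norm (DU x))\<^sup>2 + B * (U x)\<^sup>2)" using iU2 iDU2 by simp
    show "(norm (grad (\<phi> j) x - DU x))\<^sup>2 \<le> 2 * (norm (DU x))\<^sup>2 + B * (U x)\<^sup>2" for j x
    proof -
      have "(1 - \<eta> j x)\<^sup>2 \<le> 1" using \<eta>b[of j x] by (intro power_le_one) auto
      then have a: "(1 - \<eta> j x)\<^sup>2 * (norm (DU x))\<^sup>2 \<le> 1 * (norm (DU x))\<^sup>2" by (intro mult_right_mono) auto
      have "4 * exp 1 / real (Suc j) \<le> 4 * exp 1" by (simp add: divide_le_eq)
      then have "norm (D\<eta> j x) \<le> 4 * exp 1" using D\<eta>b[of j x] by linarith
      then have "(norm (D\<eta> j x))\<^sup>2 \<le> (4 * exp 1)\<^sup>2" by (intro power_mono) auto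
      then have "(norm (D\<eta> j x))\<^sup>2 * (U x)\<^sup>2 \<le> (4 * exp 1)\<^sup>2 * (U x)\<^sup>2" by (intro mult_right_mono) auto
      with a diff[of j x] show ?thesis unfolding B_def by linarith
    qed
    show "(\<lambda>j. (norm (grad (\<phi> j) x - DU x))\<^sup>2) \<longlonglongrightarrow> 0" for x
    proof (rule tendsto_sandwich[OF _ _ tendsto_const])
      have "(\<lambda>j. norm (D\<eta> j x)) \<longlonglongrightarrow> 0"
      proof (rule tendsto_sandwich[OF _ _ tendsto_const])
        show "(\<lambda>j. 4 * exp 1 / real (Suc j)) \<longlonglongrightarrow> 0" by real_asymp
      qed (use D\<eta>b in auto)
      then have "(\<lambda>j. 2 * ((1 - \<eta> j x)\<^sup>2 * (norm (DU x))\<^sup>2) + 2 * ((norm (D\<eta> j x))\<^sup>2 * (U x)\<^sup>2)) \<longlonglongrightarrow> 2 * ((1 - 1)\<^sup>2 * (norm (DU x))\<^sup>2) + 2 * (0\<^sup>2 * (U x)\<^sup>2)"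
        unfolding \<eta>_def by (intro tendsto_intros smooth_cutoff_tendsto)
      then show "(\<lambda>j. 2 * ((1 - \<eta> j x)\<^sup>2 * (norm (DU x))\<^sup>2) + 2 * ((norm (D\<eta> j x))\<^sup>2 * (U x)\<^sup>2)) \<longlonglongrightarrow> 0" by simp
    qed (use diff in auto)
  qed (auto)
  define p where "p = critical_exponent CARD('n)"
  have p: "p > 2" unfolding p_def by (rule critical_exponent_gt_2[OF N])
  have Up: "\<bar>U x\<bar> powr p = \<bar>K\<bar> powr p * exp (- (p * l\<^sup>2 / 2) * (norm (x - y))\<^sup>2)" for x
    unfolding U_def abs_mult by (simp add: powr_mult exp_powr_real mult_ac)
  have g2: "(\<lambda>j. \<integral>\<^sup>+x. ennreal (\<bar>\<phi> j x - U x\<bar> powr p) \<partial>lborel) \<longlonglongrightarrow> 0"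
  proof (rule nn_integral_tendsto_0[where w="\<lambda>x. \<bar>U x\<bar> powr p"])
    show "integrable lborel (\<lambda>x. \<bar>U x\<bar> powr p)" unfolding Up
      using gaussian_integrals(1)[of "p * l\<^sup>2 / 2" y] p l by simp
    have e: "\<phi> j x - U x = (\<eta> j x - 1) * U x" for j x by (simp add: \<phi>_def algebra_simps)
    show "\<bar>\<phi> j x - U x\<bar> powr p \<le> \<bar>U x\<bar> powr p" for j x
      unfolding e using \<eta>b[of j x] p by (intro powr_mono2) (auto simp: abs_mult intro!: mult_left_le_one_le)
    show "(\<lambda>j. \<bar>\<phi> j x - U x\<bar> powr p) \<longlonglongrightarrow> 0" for x
    proof (rule tendsto_zero_powrI[where b=p])
      have "(\<lambda>j. \<bar>(\<eta> j x - 1) * U x\<bar>) \<longlonglongrightarrow> \<bar>(1 - 1) * U x\<bar>" unfolding \<eta>_def by (intro tendsto_intros smooth_cutoff_tendsto)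
      then show "(\<lambda>j. \<bar>\<phi> j x - U x\<bar>) \<longlonglongrightarrow> 0" unfolding e by simp
    qed (use p in auto)
  qed auto
  have "D12_approx U DU \<phi>" using g1 g2 test by (simp add: D12_approx_def p_def)
  then show ?thesis unfolding DU_def[abs_def] by blast
qed

text \<open>
  The exponent \<open>(n - 1)/2\<close> of the amplitude is exactly the one for which the explicit values of both sides agree. They do
  so for every \<open>l\<close>, in accordance with the scaling of the inequality.
\<close>

lemma gaussian_values:
  fixes y :: "'a::euclidean_space" and \<sigma> l :: real
  assumes l: "0 < l" and \<sigma>: "\<sigma>\<^sup>2 = 1" and N: "N = DIM('a)" "N \<ge> 3"
  defines "U \<equiv> \<lambda>x. \<sigma> * exp ((real N - 1) / 2) * exp (- (l\<^sup>2 / 2) * (norm (x - y))\<^sup>2)"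
  defines "E \<equiv> \<Sum>b\<in>Basis. \<integral>x. (((- l\<^sup>2 * U x) *\<^sub>R (x - y)) \<bullet> b)\<^sup>2 \<partial>lborel"
  defines "I \<equiv> \<integral>x. G_log (U x) \<partial>lborel"
  shows "integrable lborel (\<lambda>x. G_log (U x))" "0 < I" "sharp_C N * I = E powr (real N / (real N - 2))"
proof -
  define n where "n = real N"
  have n: "n \<ge> 3" using N by (simp add: n_def)
  define e where "e x = exp (- (l\<^sup>2) * (norm (x - y))\<^sup>2)" for x
  have l2: "0 < l\<^sup>2" using l by simp
  define S where "S = (pi / l\<^sup>2) powr (n / 2)"
  have S: "0 < S" using l2 by (simp add: S_def)
  note gi = gaussian_integrals[OF l2, of y, folded e_def, folded N(1), folded n_def, folded S_def]
  define k where "k = exp (n - 1)"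
  have k: "0 < k" by (simp add: k_def)
  have U2: "(U x)\<^sup>2 = k * e x" for x
    unfolding U_def e_def k_def n_def by (simp add: power_mult_distrib \<sigma> exp_double[symmetric])
  have \<sigma>1: "\<bar>\<sigma>\<bar> = 1" using \<sigma> by (auto simp: power2_eq_1_iff)
  have G: "G_log (U x) = k * ((n - 1) / 2 * e x - l\<^sup>2 / 2 * ((norm (x - y))\<^sup>2 * e x))" for x
  proof -
    have "U x \<noteq> 0" using \<sigma>1 by (auto simp: U_def)
    moreover have "ln \<bar>U x\<bar> = (n - 1) / 2 - l\<^sup>2 / 2 * (norm (x - y))\<^sup>2"
      unfolding U_def abs_mult \<sigma>1 n_def by (simp flip: exp_add)
    ultimately have "G_log (U x) = k * e x * ((n - 1) / 2 - l\<^sup>2 / 2 * (norm (x - y))\<^sup>2)" by (simp add: G_log_def U2)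
    then show ?thesis by (simp add: algebra_simps)
  qed
  show "integrable lborel (\<lambda>x. G_log (U x))" unfolding G using gi by simp
  define m where "m = k * S"
  have m: "0 < m" using k S by (simp add: m_def)
  have I: "I = m * ((n - 2) / 4)"
  proof -
    have "I = k * ((n - 1) / 2 * S - l\<^sup>2 / 2 * (n / (2 * l\<^sup>2) * S))" unfolding I_def G using gi by simp
    also have "l\<^sup>2 / 2 * (n / (2 * l\<^sup>2) * S) = n / 4 * S" using l2 by simp
    also have "k * ((n - 1) / 2 * S - n / 4 * S) = m * ((n - 2) / 4)" by (simp add: m_def field_simps)
    finally show ?thesis .
  qed
  show I0: "0 < I" unfolding I using m n by simp
  have E: "E = m * (n / 2 * l\<^sup>2)"
  proof -
    have eq: "(((- l\<^sup>2 * U x) *\<^sub>R (x - y)) \<bullet> b)\<^sup>2 = (l\<^sup>2)\<^sup>2 * k * (((x - y) \<bullet> b)\<^sup>2 * e x)" for x b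
    proof -
      have "(((- l\<^sup>2 * U x) *\<^sub>R (x - y)) \<bullet> b)\<^sup>2 = (l\<^sup>2)\<^sup>2 * (U x)\<^sup>2 * ((x - y) \<bullet> b)\<^sup>2"
        by (simp add: power_mult_distrib)
      then show ?thesis unfolding U2 by (simp only: mult_ac)
    qed
    have ib: "integrable lborel (\<lambda>x. ((x - y) \<bullet> b)\<^sup>2 * e x)" if "b \<in> Basis" for b
    proof (rule Bochner_Integration.integrable_bound[OF gi(3)])
      show "(\<lambda>x. ((x - y) \<bullet> b)\<^sup>2 * e x) \<in> borel_measurable lborel" unfolding e_def[abs_def] by measurable
      show "AE x in lborel. norm (((x - y) \<bullet> b)\<^sup>2 * e x) \<le> norm ((norm (x - y))\<^sup>2 * e x)"
      proof (rule AE_I2)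
        fix x
        have "\<bar>(x - y) \<bullet> b\<bar>\<^sup>2 \<le> (norm (x - y))\<^sup>2" by (intro power_mono Basis_le_norm that) auto
        then show "norm (((x - y) \<bullet> b)\<^sup>2 * e x) \<le> norm ((norm (x - y))\<^sup>2 * e x)"
          by (simp add: abs_mult mult_right_mono e_def)
      qed
    qed
    have "E = (l\<^sup>2)\<^sup>2 * k * (\<Sum>b\<in>Basis. \<integral>x. ((x - y) \<bullet> b)\<^sup>2 * e x \<partial>lborel)"
      unfolding E_def eq by (simp add: sum_distrib_left)
    also have "(\<Sum>b\<in>Basis. \<integral>x. ((x - y) \<bullet> b)\<^sup>2 * e x \<partial>lborel) = (\<integral>x. (\<Sum>b\<in>Basis. ((x - y) \<bullet> b)\<^sup>2 * e x) \<partial>lborel)"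
      by (rule Bochner_Integration.integral_sum[symmetric]) (rule ib)
    also have "\<dots> = (\<integral>x. (norm (x - y))\<^sup>2 * e x \<partial>lborel)"
      by (simp only: sum_distrib_right[symmetric] sum_Basis_inner_sq)
    also have "\<dots> = n / (2 * l\<^sup>2) * S" by (rule gi(4))
    also have "(l\<^sup>2)\<^sup>2 * k * (n / (2 * l\<^sup>2) * S) = m * (n / 2 * l\<^sup>2)" using l2 by (simp add: m_def power2_eq_square field_simps)
    finally show ?thesis .
  qed
  have E0: "0 < E" unfolding E using m n l2 by simp
  have lnm: "ln m = n - 1 + n / 2 * (ln pi - ln (l\<^sup>2))"
    unfolding m_def k_def S_def using l2 by (simp add: ln_mult_pos ln_powr ln_div)
  have lnm2: "2 * ln m = 2 * (n - 1) + n * (ln pi - ln (l\<^sup>2))" unfolding lnm by simp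
  have lnI: "ln I = ln m + ln (n - 2) - ln 4" unfolding I using m n by (simp add: ln_mult_pos ln_div)
  have lnE: "ln E = ln m + ln (n / 2) + ln (l\<^sup>2)"
  proof -
    have "ln E = ln m + ln (n / 2 * l\<^sup>2)" unfolding E using m n l2 by (intro ln_mult_pos) auto
    also have "ln (n / 2 * l\<^sup>2) = ln (n / 2) + ln (l\<^sup>2)" using n l2 by (intro ln_mult_pos) auto
    finally show ?thesis by simp
  qed
  have CN: "0 < sharp_C N" by (rule sharp_C_pos[OF N(2)])
  have "(n - 2) * ln (sharp_C N * I) = (n - 2) * ln (sharp_C N) + (n - 2) * ln I"
    using CN I0 by (simp add: ln_mult_pos distrib_left)
  also have "\<dots> = n * ln E"
    unfolding ln_sharp_C[OF N(2), folded n_def] lnI lnE using lnm2 by (simp add: algebra_simps)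
  finally have "ln (sharp_C N * I) = n / (n - 2) * ln E" using n by (simp add: field_simps)
  then have "ln (sharp_C N * I) = ln (E powr (n / (n - 2)))" using E0 by (simp add: ln_powr)
  then show "sharp_C N * I = E powr (real N / (real N - 2))"
    using CN I0 E0 by (subst (asm) ln_inj_iff) (auto simp: n_def)
qed

section \<open>The sharp inequality and its minimizers\<close>

lemma D12_approx_Lp:
  fixes \<phi> :: "nat \<Rightarrow> real ^ 'n \<Rightarrow> real"
  assumes a: "D12_approx u g \<phi>" and N: "CARD('n) \<ge> 3"
  defines "p \<equiv> critical_exponent CARD('n)"
  shows "integrable lborel (\<lambda>x. \<bar>u x\<bar> powr p)"
proof (rule integrableI_nonneg)
  have p: "p > 2" unfolding p_def by (rule critical_exponent_gt_2[OF N])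
  have [measurable]: "u \<in> borel_measurable borel" by (rule D12_approxD[OF a])
  have [measurable]: "\<phi> k \<in> borel_measurable borel" for k
    using C1cD(2)[OF D12_approxD(3)[OF a]] by (rule borel_measurable_continuous_onI)
  have l: "(\<lambda>k. \<integral>\<^sup>+x. ennreal (\<bar>\<phi> k x - u x\<bar> powr p) \<partial>lborel) \<longlonglongrightarrow> 0"
    using a by (simp add: D12_approx_def p_def)
  have "eventually (\<lambda>k. (\<integral>\<^sup>+x. ennreal (\<bar>\<phi> k x - u x\<bar> powr p) \<partial>lborel) < 1) sequentially"
    using l by (rule order_tendstoD) simp
  then obtain k where k: "(\<integral>\<^sup>+x. ennreal (\<bar>\<phi> k x - u x\<bar> powr p) \<partial>lborel) < 1" by (auto simp: eventually_sequentially)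
  have c: "continuous_on UNIV (\<lambda>x. \<bar>\<phi> k x\<bar> powr p)"
    using p by (intro continuous_on_powr' continuous_intros C1cD(2)[OF D12_approxD(3)[OF a]]) auto
  have i: "integrable lborel (\<lambda>x. \<bar>\<phi> k x\<bar> powr p)"
    by (rule C1c_integrable(1)[OF D12_approxD(3)[OF a] c]) simp
  have pt: "\<bar>u x\<bar> powr p \<le> 2 powr p * \<bar>\<phi> k x - u x\<bar> powr p + 2 powr p * \<bar>\<phi> k x\<bar> powr p" for x
  proof -
    define M where "M = max \<bar>\<phi> k x - u x\<bar> \<bar>\<phi> k x\<bar>"
    have "\<bar>\<phi> k x - u x\<bar> \<le> M" "\<bar>\<phi> k x\<bar> \<le> M" by (simp_all add: M_def)
    then have "\<bar>u x\<bar> \<le> 2 * M" by linarith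
    then have "\<bar>u x\<bar> powr p \<le> (2 * M) powr p" using p by (intro powr_mono2) auto
    also have "\<dots> = 2 powr p * M powr p" by (rule powr_mult)
    also have "M powr p \<le> \<bar>\<phi> k x - u x\<bar> powr p + \<bar>\<phi> k x\<bar> powr p" by (simp add: M_def max_def)
    finally show ?thesis by (simp add: distrib_left)
  qed
  have "(\<integral>\<^sup>+x. ennreal (\<bar>u x\<bar> powr p) \<partial>lborel) \<le> (\<integral>\<^sup>+x. ennreal (2 powr p) * ennreal (\<bar>\<phi> k x - u x\<bar> powr p) + ennreal (2 powr p * \<bar>\<phi> k x\<bar> powr p) \<partial>lborel)"
  proof (rule nn_integral_mono)
    fix x
    show "ennreal (\<bar>u x\<bar> powr p) \<le> ennreal (2 powr p) * ennreal (\<bar>\<phi> k x - u x\<bar> powr p) + ennreal (2 powr p * \<bar>\<phi> k x\<bar> powr p)"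
      using ennreal_leI[OF pt[of x]] by (simp add: ennreal_plus ennreal_mult)
  qed
  also have "\<dots> = ennreal (2 powr p) * (\<integral>\<^sup>+x. ennreal (\<bar>\<phi> k x - u x\<bar> powr p) \<partial>lborel) + (\<integral>\<^sup>+x. ennreal (2 powr p * \<bar>\<phi> k x\<bar> powr p) \<partial>lborel)"
    by (subst nn_integral_add) (simp_all add: nn_integral_cmult)
  also have "(\<integral>\<^sup>+x. ennreal (2 powr p * \<bar>\<phi> k x\<bar> powr p) \<partial>lborel) = ennreal (\<integral>x. 2 powr p * \<bar>\<phi> k x\<bar> powr p \<partial>lborel)"
    by (rule nn_integral_eq_integral) (use i in auto)
  also have "ennreal (2 powr p) * (\<integral>\<^sup>+x. ennreal (\<bar>\<phi> k x - u x\<bar> powr p) \<partial>lborel) + ennreal (\<integral>x. 2 powr p * \<bar>\<phi> k x\<bar> powr p \<partial>lborel) < \<infinity>"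
  proof -
    have "(\<integral>\<^sup>+x. ennreal (\<bar>\<phi> k x - u x\<bar> powr p) \<partial>lborel) < top" using k ennreal_one_less_top less_trans by blast
    then show ?thesis by (simp add: ennreal_mult_less_top)
  qed
  finally show "(\<integral>\<^sup>+x. ennreal (\<bar>u x\<bar> powr p) \<partial>lborel) < \<infinity>" .
  show "(\<lambda>x. \<bar>u x\<bar> powr p) \<in> borel_measurable lborel" by measurable
qed simp

text \<open>
  This makes the positive part of \<open>G(u)\<close> integrable on \<open>D12\<close>.
\<close>

lemma G_log_upper:
  assumes p: "p > 2"
  shows "G_log s \<le> 1 / (p - 2) * \<bar>s\<bar> powr p"
proof (cases "\<bar>s\<bar> \<le> 1")
  case True
  have "G_log s \<le> 0"
    using True by (auto simp: G_log_def intro!: mult_nonneg_nonpos)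
  also have "0 \<le> 1 / (p - 2) * \<bar>s\<bar> powr p" using p by simp
  finally show ?thesis .
next
  case False
  then have s: "1 < \<bar>s\<bar>" by simp
  have "ln (\<bar>s\<bar> powr (p - 2)) \<le> \<bar>s\<bar> powr (p - 2) - 1" using s by (intro ln_le_minus_one) auto
  then have "(p - 2) * ln \<bar>s\<bar> \<le> \<bar>s\<bar> powr (p - 2)" using s by (simp add: ln_powr)
  then have "ln \<bar>s\<bar> \<le> 1 / (p - 2) * \<bar>s\<bar> powr (p - 2)" using p by (simp add: field_simps)
  then have "s\<^sup>2 * ln \<bar>s\<bar> \<le> s\<^sup>2 * (1 / (p - 2) * \<bar>s\<bar> powr (p - 2))" by (intro mult_left_mono) auto
  also have "\<dots> = 1 / (p - 2) * (\<bar>s\<bar> powr 2 * \<bar>s\<bar> powr (p - 2))" using s by simp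
  also have "\<bar>s\<bar> powr 2 * \<bar>s\<bar> powr (p - 2) = \<bar>s\<bar> powr p"
    using powr_add[of "\<bar>s\<bar>" 2 "p - 2"] by simp
  finally show ?thesis using s by (simp add: G_log_def)
qed

text \<open>
  Where \<open>|s| \<le> exp (-1)\<close> the logarithm is at most \<open>-1\<close>, so \<open>- G s\<close> dominates \<open>s\<^sup>2\<close>; elsewhere the critical power
  does.
\<close>

lemma square_le_G_log:
  assumes p: "p > 2"
  shows "s\<^sup>2 \<le> max 0 (- G_log s) + exp (p - 2) * \<bar>s\<bar> powr p"
proof -
  consider "s = 0" | "s \<noteq> 0" "\<bar>s\<bar> \<le> exp (-1)" | "exp (-1) < \<bar>s\<bar>" by linarith
  then show ?thesis
  proof cases
    case 2
    then have "ln \<bar>s\<bar> \<le> ln (exp (-1))" by (subst ln_le_cancel_iff) auto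
    then have "ln \<bar>s\<bar> \<le> -1" by simp
    then have "s\<^sup>2 * 1 \<le> s\<^sup>2 * (- ln \<bar>s\<bar>)" by (intro mult_left_mono) auto
    then have "s\<^sup>2 \<le> - G_log s" using 2 by (simp add: G_log_def)
    then show ?thesis by (simp add: add_increasing2 le_max_iff_disj)
  next
    case 3
    have s: "0 < \<bar>s\<bar>" using 3 less_trans[OF exp_gt_zero 3] by simp
    have "1 \<le> exp 1 * \<bar>s\<bar>"
    proof -
      have "exp 1 * exp (-1) \<le> exp 1 * \<bar>s\<bar>" using 3 by (intro mult_left_mono) auto
      then show ?thesis by (simp flip: exp_add)
    qed
    then have "1 \<le> (exp 1 * \<bar>s\<bar>) powr (p - 2)" using p by (intro ge_one_powr_ge_zero) auto
    also have "\<dots> = exp (p - 2) * \<bar>s\<bar> powr (p - 2)" by (simp add: powr_mult exp_powr_real)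
    finally have "s\<^sup>2 * 1 \<le> s\<^sup>2 * (exp (p - 2) * \<bar>s\<bar> powr (p - 2))" by (intro mult_left_mono) auto
    also have "\<dots> = exp (p - 2) * (\<bar>s\<bar> powr 2 * \<bar>s\<bar> powr (p - 2))" using s by simp
    also have "\<bar>s\<bar> powr 2 * \<bar>s\<bar> powr (p - 2) = \<bar>s\<bar> powr p"
      using powr_add[of "\<bar>s\<bar>" 2 "p - 2"] by simp
    finally show ?thesis by (simp add: add_increasing)
  qed simp
qed

lemma extended_integral_AE_cong:
  assumes "AE x in lborel. f x = h x"
  shows "extended_integral f = enn2ereal (\<integral>\<^sup>+x. ennreal (h x) \<partial>lborel) - enn2ereal (\<integral>\<^sup>+x. ennreal (- h x) \<partial>lborel)"
proof -
  have "(\<integral>\<^sup>+x. ennreal (f x) \<partial>lborel) = (\<integral>\<^sup>+x. ennreal (h x) \<partial>lborel)" "(\<integral>\<^sup>+x. ennreal (- f x) \<partial>lborel) = (\<integral>\<^sup>+x. ennreal (- h x) \<partial>lborel)"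
    using assms by (auto intro!: nn_integral_cong_AE)
  then show ?thesis by (simp add: extended_integral_def nn_integral_completion)
qed

lemma extended_integral_integrable:
  assumes ae: "AE x in lborel. f x = h x" and i: "integrable lborel h"
  shows "extended_integral f = ereal (\<integral>x. h x \<partial>lborel)"
proof -
  define a b where "a = (\<integral>\<^sup>+x. ennreal (h x) \<partial>lborel)" and "b = (\<integral>\<^sup>+x. ennreal (- h x) \<partial>lborel)"
  have f: "a < top" "b < top" using i unfolding a_def b_def real_integrable_def by (auto simp: less_top)
  have "(\<integral>x. h x \<partial>lborel) = enn2real a - enn2real b" unfolding a_def b_def by (rule real_lebesgue_integral_def[OF i])
  moreover have "enn2ereal a = ereal (enn2real a)" using f(1) by (cases a) auto
  moreover have "enn2ereal b = ereal (enn2real b)" using f(2) by (cases b) auto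
  ultimately show ?thesis unfolding extended_integral_AE_cong[OF ae] a_def[symmetric] b_def[symmetric] by simp
qed

text \<open>
  The positive part of \<open>G(u)\<close> is always integrable. If the negative part is integrable as well, then
  \<open>square_le_G_log\<close> shows that \<open>u\<close> is square integrable.
\<close>

lemma D12_dichotomy:
  fixes \<phi> :: "nat \<Rightarrow> real ^ 'n \<Rightarrow> real"
  assumes a: "D12_approx u0 g0 \<phi>" and N: "CARD('n) \<ge> 3" and u: "AE x in lborel. u x = u0 x"
  shows "extended_integral (\<lambda>x. G_log (u x)) = - \<infinity> \<or>
    (l2 lborel u0 \<and> integrable lborel (\<lambda>x. G_log (u0 x)) \<and> extended_integral (\<lambda>x. G_log (u x)) = ereal (\<integral>x. G_log (u0 x) \<partial>lborel))"
proof -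
  define p where "p = critical_exponent CARD('n)"
  have p: "p > 2" unfolding p_def by (rule critical_exponent_gt_2[OF N])
  have [measurable]: "u0 \<in> borel_measurable borel" by (rule D12_approxD[OF a])
  have Lp: "integrable lborel (\<lambda>x. \<bar>u0 x\<bar> powr p)" unfolding p_def by (rule D12_approx_Lp[OF a N])
  have ae: "AE x in lborel. G_log (u x) = G_log (u0 x)" using u by eventually_elim simp
  have pos: "(\<integral>\<^sup>+x. ennreal (G_log (u0 x)) \<partial>lborel) < top"
  proof -
    have "(\<integral>\<^sup>+x. ennreal (G_log (u0 x)) \<partial>lborel) \<le> (\<integral>\<^sup>+x. ennreal (1 / (p - 2) * \<bar>u0 x\<bar> powr p) \<partial>lborel)"
      by (intro nn_integral_mono ennreal_leI G_log_upper p)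
    also have "\<dots> = ennreal (\<integral>x. 1 / (p - 2) * \<bar>u0 x\<bar> powr p \<partial>lborel)"
      by (rule nn_integral_eq_integral[OF integrable_mult_right[OF Lp]]) (use p in auto)
    also have "\<dots> < top" by simp
    finally show ?thesis .
  qed
  show ?thesis
  proof (cases "(\<integral>\<^sup>+x. ennreal (- G_log (u0 x)) \<partial>lborel) = top")
    case True
    obtain r where "(\<integral>\<^sup>+x. ennreal (G_log (u0 x)) \<partial>lborel) = ennreal r" "0 \<le> r" using pos by (cases "(\<integral>\<^sup>+x. ennreal (G_log (u0 x)) \<partial>lborel)") auto
    then have "extended_integral (\<lambda>x. G_log (u x)) = - \<infinity>"
      unfolding extended_integral_AE_cong[OF ae] True by simp
    then show ?thesis ..
  next
    case False
    have iG: "integrable lborel (\<lambda>x. G_log (u0 x))"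
      unfolding real_integrable_def using pos False by auto
    have "integrable lborel (\<lambda>x. (u0 x)\<^sup>2)"
    proof (rule Bochner_Integration.integrable_bound)
      show "integrable lborel (\<lambda>x. \<bar>G_log (u0 x)\<bar> + exp (p - 2) * \<bar>u0 x\<bar> powr p)"
        using iG Lp by (intro Bochner_Integration.integrable_add integrable_abs integrable_mult_right)
      show "AE x in lborel. norm ((u0 x)\<^sup>2) \<le> norm (\<bar>G_log (u0 x)\<bar> + exp (p - 2) * \<bar>u0 x\<bar> powr p)"
      proof (rule AE_I2)
        fix x
        have "(u0 x)\<^sup>2 \<le> \<bar>G_log (u0 x)\<bar> + exp (p - 2) * \<bar>u0 x\<bar> powr p"
          using square_le_G_log[OF p, of "u0 x"] by linarith
        then show "norm ((u0 x)\<^sup>2) \<le> norm (\<bar>G_log (u0 x)\<bar> + exp (p - 2) * \<bar>u0 x\<bar> powr p)" by simp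
      qed
    qed simp
    then have "l2 lborel u0" by (simp add: l2_def)
    then show ?thesis using iG extended_integral_integrable[OF ae iG] by blast
  qed
qed

text \<open>
  In the case of equality \<open>u\<close> is a Gaussian \<open>c * exp (- l\<^sup>2 |x - y|\<^sup>2 / 2)\<close> whose mass satisfies
  \<open>(n - 2) * sharp_C N * m = 4 * E powr (n / (n - 2))\<close>. As \<open>m\<close> and \<open>E\<close> are explicit in \<open>c\<close> and \<open>l\<close>, this
  equation determines \<open>c\<^sup>2\<close>; the scale \<open>l\<close> cancels.
\<close>

lemma D12_sharp_inequality_and_equality:
  fixes \<phi> :: "nat \<Rightarrow> real ^ 'n \<Rightarrow> real"
  assumes a: "D12_approx u g \<phi>" and N: "N = CARD('n)" "N \<ge> 3" and lu: "l2 lborel u" and iG: "integrable lborel (\<lambda>x. G_log (u x))"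
  defines "E \<equiv> \<Sum>b\<in>Basis. \<integral>x. (g x \<bullet> b)\<^sup>2 \<partial>lborel" and "I \<equiv> \<integral>x. G_log (u x) \<partial>lborel"
  shows "sharp_C N * I \<le> E powr (real N / (real N - 2))"
    and "\<not> (AE x in lborel. u x = 0) \<Longrightarrow> sharp_C N * I = E powr (real N / (real N - 2)) \<Longrightarrow>
      \<exists>l>0. \<exists>y. \<exists>\<sigma>\<in>{1, -1}. AE x in lborel. u x = \<sigma> * u_gauss l (x - y)"
proof -
  have N': "CARD('n) \<ge> 3" using N by simp
  have dim: "DIM(real ^ 'n) = N" using N by simp
  have [measurable]: "u \<in> borel_measurable borel" by (rule D12_approxD[OF a])
  define m where "m = (\<integral>x. (u x)\<^sup>2 \<partial>lborel)"
  have m0: "0 \<le> m" by (simp add: m_def)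
  have mz: "(AE x in lborel. u x = 0) \<longleftrightarrow> m = 0"
  proof -
    have "m = 0 \<longleftrightarrow> (AE x in lborel. (u x)\<^sup>2 = 0)"
      unfolding m_def using l2_square[OF lu] by (subst integral_nonneg_eq_0_iff_AE) auto
    then show ?thesis by simp
  qed
  have E0: "0 \<le> E" unfolding E_def by (intro sum_nonneg) simp
  obtain w Dw where w: "\<And>j. C1c (w j) (Dw j)" "l2conv lborel w u"
     "\<And>b. b \<in> Basis \<Longrightarrow> l2conv lborel (\<lambda>j x. Dw j x \<bullet> b) (\<lambda>x. g x \<bullet> b)"
     "\<And>\<epsilon>. 0 < \<epsilon> \<Longrightarrow> eventually (\<lambda>j. I - \<epsilon> \<le> (\<integral>x. G_log (w j x) \<partial>lborel)) sequentially"
    using D12_smooth_approximation[OF a N' lu iG] unfolding I_def by blast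
  note S = scaled_logsob[OF w m_def _ E_def[THEN meta_eq_to_obj_eq], unfolded dim]
  have H: "2 * I + (real N + real N / 2 * ln (2 * pi)) * m - m * (ln m - real N * ln s) \<le> 2 * s\<^sup>2 * E"
    if "0 < m" "0 < s" for s
    by (rule S(1)) (use that in auto)
  show "sharp_C N * I \<le> E powr (real N / (real N - 2))"
  proof (cases "m = 0")
    case True
    then have "AE x in lborel. u x = 0" using mz by simp
    then have "I = (\<integral>x. 0 \<partial>(lborel :: (real ^ 'n) measure))"
      unfolding I_def by (intro integral_cong_AE) (auto simp: G_log_def)
    then show ?thesis by simp
  next
    case False
    then have "0 < m" using m0 by simp
    then show ?thesis using H by (intro optimise_scale_and_amplitude(2)[OF N(2) _ E0]) auto
  qed
  assume nz: "\<not> (AE x in lborel. u x = 0)" and eq: "sharp_C N * I = E powr (real N / (real N - 2))"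
  have m: "0 < m" using nz mz m0 by simp
  define s where "s = sqrt (real N * m / (4 * E))"
  have E: "0 < E" by (rule optimise_scale_and_amplitude(1)[OF N(2) m E0 H[OF m]])
  have o: "2 * I + (real N + real N / 2 * ln (2 * pi)) * m - m * (ln m - real N * ln s) = 2 * s\<^sup>2 * E"
    "(real N - 2) * sharp_C N * m = 4 * E powr (real N / (real N - 2))"
    using optimise_scale_and_amplitude(3)[OF N(2) m E0 H[OF m] eq] unfolding s_def by auto
  define n where "n = real N"
  have n: "n \<ge> 3" using N by (simp add: n_def)
  have s: "0 < s" "s\<^sup>2 = n * m / (4 * E)" using E m n by (auto simp: s_def n_def)
  have "\<exists>c y. AE x in lborel. u x = c * exp (- (norm (x - y))\<^sup>2 / (4 * s\<^sup>2))"
    by (rule S(2)) (use m s o in auto)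
  then obtain c y where cy: "AE x in lborel. u x = c * exp (- (norm (x - y))\<^sup>2 / (4 * s\<^sup>2))" by blast
  \<comment> \<open>rewrites \<open>exp (- |x|\<^sup>2 / (4 s\<^sup>2))\<close> as \<open>exp (- l\<^sup>2 |x|\<^sup>2 / 2)\<close>\<close>
  define l where "l = 1 / (sqrt 2 * s)"
  have l: "0 < l" "l\<^sup>2 = 1 / (2 * s\<^sup>2)" using s by (auto simp: l_def power_mult_distrib power_divide)
  have le: "l\<^sup>2 / 2 = 1 / (4 * s\<^sup>2)" using l by simp
  have l2: "0 < l\<^sup>2" by (rule zero_less_power[OF l(1)])
  have E_l: "E = n / 2 * l\<^sup>2 * m"
  proof -
    have "n / 2 * l\<^sup>2 * m = n * m / (4 * s\<^sup>2)" unfolding l(2) by simp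
    also have "\<dots> = E" unfolding s(2) using E m n by (simp add: field_simps)
    finally show ?thesis by simp
  qed
  have m_c: "m = c\<^sup>2 * (pi / l\<^sup>2) powr (n / 2)"
  proof -
    have "m = (\<integral>x. c\<^sup>2 * exp (- (l\<^sup>2) * (norm (x - y))\<^sup>2) \<partial>lborel)"
      unfolding m_def
    proof (rule integral_cong_AE)
      show "AE x in lborel. (u x)\<^sup>2 = c\<^sup>2 * exp (- (l\<^sup>2) * (norm (x - y))\<^sup>2)"
        using cy
      proof eventually_elim
        case (elim x)
        have *: "(exp (- (norm (x - y))\<^sup>2 / (4 * s\<^sup>2)))\<^sup>2 = exp (- (l\<^sup>2) * (norm (x - y))\<^sup>2)"
          unfolding l(2) exp_double[symmetric] using s(1) by (simp add: field_simps)
        show ?case unfolding elim power_mult_distrib * ..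
      qed
    qed measurable
    also have "\<dots> = c\<^sup>2 * (pi / l\<^sup>2) powr (n / 2)"
      using gaussian_integrals(2)[OF l2, of y] dim by (simp add: n_def N(1))
    finally show ?thesis .
  qed
  have c0: "c \<noteq> 0" using m m_c by auto
  have CN: "0 < sharp_C N" by (rule sharp_C_pos[OF N(2)])
  have lnm: "2 * ln m = 2 * ln (c\<^sup>2) + n * (ln pi - ln (l\<^sup>2))"
  proof -
    have "ln m = ln (c\<^sup>2) + n / 2 * (ln pi - ln (l\<^sup>2))"
    proof -
      have "ln m = ln (c\<^sup>2) + ln ((pi / l\<^sup>2) powr (n / 2))"
        unfolding m_c by (rule ln_mult_pos) (use c0 l in auto)
      also have "ln ((pi / l\<^sup>2) powr (n / 2)) = n / 2 * ln (pi / l\<^sup>2)" using l(1) by (simp add: ln_powr)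
      also have "ln (pi / l\<^sup>2) = ln pi - ln (l\<^sup>2)" using l(1) by (simp add: ln_div)
      finally show ?thesis .
    qed
    then show ?thesis by (simp add: field_simps)
  qed
  have lnE: "ln E = ln (n / 2) + ln (l\<^sup>2) + ln m"
  proof -
    have "ln E = ln (n / 2 * l\<^sup>2) + ln m" unfolding E_l by (rule ln_mult_pos) (use n l2 m in auto)
    also have "ln (n / 2 * l\<^sup>2) = ln (n / 2) + ln (l\<^sup>2)" by (rule ln_mult_pos) (use n l2 in auto)
    finally show ?thesis .
  qed
  have *: "ln ((n - 2) * sharp_C N * m) = ln (4 * E powr (n / (n - 2)))" using o(2) by (simp add: n_def)
  have "ln (n - 2) + ln (sharp_C N) + ln m = ln 4 + n / (n - 2) * ln E"
  proof -
    have "ln ((n - 2) * sharp_C N * m) = ln ((n - 2) * sharp_C N) + ln m" by (rule ln_mult_pos) (use CN m n in auto)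
    moreover have "ln ((n - 2) * sharp_C N) = ln (n - 2) + ln (sharp_C N)" by (rule ln_mult_pos) (use CN n in auto)
    moreover have "ln (4 * E powr (n / (n - 2))) = ln 4 + ln (E powr (n / (n - 2)))" by (rule ln_mult_pos) (use E in auto)
    moreover have "ln (E powr (n / (n - 2))) = n / (n - 2) * ln E" using E by (simp add: ln_powr)
    ultimately show ?thesis using * by simp
  qed
  then have "(n - 2) * (ln (n - 2) + ln (sharp_C N) + ln m) = (n - 2) * (ln 4 + n / (n - 2) * ln E)" by simp
  also have "\<dots> = (n - 2) * ln 4 + n * ln E" using n by (simp add: field_simps)
  finally have "ln (c\<^sup>2) = n - 1"
    using lnm ln_sharp_C[OF N(2), folded n_def] unfolding lnE by (simp add: algebra_simps)
  then have "c\<^sup>2 = exp (n - 1)" using c0 by (metis exp_ln zero_less_power2)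
  also have "\<dots> = (exp ((n - 1) / 2))\<^sup>2" by (simp add: exp_double[symmetric])
  finally have "c = exp ((n - 1) / 2) \<or> c = - exp ((n - 1) / 2)" by (simp add: power2_eq_iff)
  then obtain \<sigma> where \<sigma>: "\<sigma> \<in> {1, -1::real}" "c = \<sigma> * exp ((n - 1) / 2)" by force
  have "AE x in lborel. u x = \<sigma> * u_gauss l (x - y)"
    using cy
  proof eventually_elim
    case (elim x)
    have "u_gauss l (x - y) = exp ((n - 1) / 2) * exp (- (norm (x - y))\<^sup>2 / (4 * s\<^sup>2))"
      unfolding u_gauss_def le n_def N(1) by (simp flip: exp_add)
    then show ?case unfolding elim \<sigma>(2) by simp
  qed
  then show "\<exists>l>0. \<exists>y. \<exists>\<sigma>\<in>{1, -1}. AE x in lborel. u x = \<sigma> * u_gauss l (x - y)" using l(1) \<sigma>(1) by blast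
qed

lemma has_D12_gradient_grad: "u \<in> D12 \<Longrightarrow> has_D12_gradient u (D12_grad u)"
  unfolding D12_def D12_grad_def using someI_ex[of "has_D12_gradient u"] by simp

text \<open>
  \<open>Dirichlet_energy\<close> refers to an arbitrarily chosen gradient; uniqueness allows it to be computed from any
  approximating sequence.
\<close>

lemma Dirichlet_energy_eq:
  fixes \<phi> :: "nat \<Rightarrow> real ^ 'n \<Rightarrow> real"
  assumes uD: "u \<in> D12" and a: "D12_approx u0 g0 \<phi>" and u: "AE x in lborel. u x = u0 x" and N: "CARD('n) \<ge> 3"
  shows "Dirichlet_energy u = (\<Sum>b\<in>Basis. \<integral>x. (g0 x \<bullet> b)\<^sup>2 \<partial>lborel)"
proof -
  note h = has_D12_gradient_grad[OF uD]
  obtain u1 g1 \<psi> where 1: "D12_approx u1 g1 \<psi>" "AE x in lborel. u x = u1 x" "AE x in lborel. D12_grad u x = g1 x"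
    using has_D12_gradient_approx[OF h] by blast
  have "AE x in lborel. u1 x = u0 x" using 1(2) u by eventually_elim simp
  from D12_approx_grad_unique[OF 1(1) a this N] 1(3)
  have g: "AE x in lborel. D12_grad u x = g0 x" by eventually_elim simp
  have m: "D12_grad u \<in> borel_measurable lebesgue" using h by (simp add: has_D12_gradient_def)
  have m0: "g0 \<in> borel_measurable borel" by (rule D12_approxD[OF a])
  have m0n: "(\<lambda>x. (norm (g0 x))\<^sup>2) \<in> borel_measurable lborel" using m0 by measurable
  have "Dirichlet_energy u = (LINT x|lebesgue. (norm (g0 x))\<^sup>2)"
    unfolding Dirichlet_energy_def
  proof (rule integral_cong_AE)
    show "(\<lambda>x. (norm (D12_grad u x))\<^sup>2) \<in> borel_measurable lebesgue" using m by measurable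
    show "(\<lambda>x. (norm (g0 x))\<^sup>2) \<in> borel_measurable lebesgue" by (rule measurable_completion[OF m0n])
    show "AE x in lebesgue. (norm (D12_grad u x))\<^sup>2 = (norm (g0 x))\<^sup>2"
      using AE_completion[OF g] by eventually_elim simp
  qed
  also have "\<dots> = (\<integral>x. (norm (g0 x))\<^sup>2 \<partial>lborel)" by (rule integral_completion[OF m0n])
  also have "\<dots> = (\<integral>x. (\<Sum>b\<in>Basis. (g0 x \<bullet> b)\<^sup>2) \<partial>lborel)" by (simp only: sum_Basis_inner_sq)
  also have "\<dots> = (\<Sum>b\<in>Basis. \<integral>x. (g0 x \<bullet> b)\<^sup>2 \<partial>lborel)"
  proof (rule Bochner_Integration.integral_sum)
    fix b :: "real ^ 'n" assume "b \<in> Basis"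
    then show "integrable lborel (\<lambda>x. (g0 x \<bullet> b)\<^sup>2)" using D12_grad_l2conv[OF a] by (auto simp: l2conv_def dest: l2_square)
  qed
  finally show ?thesis .
qed

text \<open>
  Positivity of \<open>\<integral> G(u)\<close> is what lets a single function attaining equality exclude all larger constants.
\<close>

lemma u_gauss_facts:
  fixes y :: "real ^ 'n" and u :: "real ^ 'n \<Rightarrow> real"
  assumes N: "N = CARD('n)" "N \<ge> 3" and l: "0 < l" and \<sigma>: "\<sigma> \<in> {1, -1}"
    and u: "AE x in lborel. u x = \<sigma> * u_gauss l (x - y)"
  shows "u \<in> D12" "\<not> (AE x in lborel. u x = 0)"
    and "\<exists>I>0. extended_integral (\<lambda>x. G_log (u x)) = ereal I \<and> sharp_C N * I = energy_power u"
proof -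
  define U where "U x = \<sigma> * exp ((real N - 1) / 2) * exp (- (l\<^sup>2 / 2) * (norm (x - y))\<^sup>2)" for x
  define g where "g x = (- l\<^sup>2 * U x) *\<^sub>R (x - y)" for x
  have Ueq: "\<sigma> * u_gauss l (x - y) = U x" for x
    unfolding U_def u_gauss_def N(1) by (simp flip: exp_add)
  have uU: "AE x in lborel. u x = U x" using u unfolding Ueq .
  have N': "CARD('n) \<ge> 3" using N by simp
  obtain \<phi> where a: "D12_approx U g \<phi>"
    using gaussian_D12_approx[OF N' l, where K="\<sigma> * exp ((real N - 1) / 2)" and y=y] unfolding U_def[abs_def] g_def[abs_def] by blast
  have mU: "U \<in> borel_measurable lebesgue" using D12_approxD(1)[OF a] by (intro measurable_completion) simp
  have mg: "g \<in> borel_measurable lebesgue" using D12_approxD(2)[OF a] by (intro measurable_completion) simp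
  have mu: "u \<in> borel_measurable lebesgue"
  proof (rule measurableI)
    fix A :: "real set" assume A: "A \<in> sets borel"
    have "{x. U x \<in> A} \<in> sets lebesgue" using measurable_sets[OF mU A] by (simp add: vimage_def)
    moreover have "AE x in lebesgue. x \<in> {x. U x \<in> A} \<longleftrightarrow> x \<in> {x. u x \<in> A}"
      using AE_completion[OF uU] by eventually_elim simp
    ultimately have "{x. u x \<in> A} \<in> sets lebesgue"
      using completion.in_sets_AE[where M=lborel and A="{x. U x \<in> A}" and B="{x. u x \<in> A}"] by simp
    then show "u -` A \<inter> space lebesgue \<in> sets lebesgue" by (simp add: vimage_def)
  qed simp
  have "has_D12_gradient u g"
    unfolding has_D12_gradient_def
  proof (intro conjI exI[of _ \<phi>] mu mg allI)
    show "test_function (\<phi> k)" for k by (rule D12_approxD(4)[OF a])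
    show "(\<lambda>k. \<integral>\<^sup>+x. ennreal ((norm (grad (\<phi> k) x - g x))\<^sup>2) \<partial>lebesgue) \<longlonglongrightarrow> 0"
      using a by (simp add: nn_integral_completion D12_approx_def)
    have "(\<integral>\<^sup>+x. ennreal (\<bar>\<phi> k x - u x\<bar> powr critical_exponent CARD('n)) \<partial>lborel) = (\<integral>\<^sup>+x. ennreal (\<bar>\<phi> k x - U x\<bar> powr critical_exponent CARD('n)) \<partial>lborel)" for k
      using uU by (intro nn_integral_cong_AE) auto
    then show "(\<lambda>k. \<integral>\<^sup>+x. ennreal (\<bar>\<phi> k x - u x\<bar> powr critical_exponent CARD('n)) \<partial>lebesgue) \<longlonglongrightarrow> 0"
      using a by (simp add: nn_integral_completion D12_approx_def)
  qed
  then show uD: "u \<in> D12" by (auto simp: D12_def)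
  have \<sigma>2: "\<sigma>\<^sup>2 = 1" using \<sigma> by auto
  have dim: "N = DIM(real ^ 'n)" using N by simp
  note gv = gaussian_values[OF l \<sigma>2 dim N(2), of y, folded U_def, folded g_def]
  have ae: "AE x in lborel. G_log (u x) = G_log (U x)" using uU by eventually_elim simp
  show "\<exists>I>0. extended_integral (\<lambda>x. G_log (u x)) = ereal I \<and> sharp_C N * I = energy_power u"
  proof (intro exI conjI)
    show "0 < (\<integral>x. G_log (U x) \<partial>lborel)" by (rule gv(2))
    show "extended_integral (\<lambda>x. G_log (u x)) = ereal (\<integral>x. G_log (U x) \<partial>lborel)"
      by (rule extended_integral_integrable[OF ae gv(1)])
    show "sharp_C N * (\<integral>x. G_log (U x) \<partial>lborel) = energy_power u"
      using gv(3) unfolding energy_power_def Dirichlet_energy_eq[OF uD a uU N'] N(1)[symmetric] .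
  qed
  show "\<not> (AE x in lborel. u x = 0)"
  proof
    assume "AE x in lborel. u x = 0"
    with uU have "AE x in lborel. U x = 0" by eventually_elim simp
    then obtain x where "U x = 0" using AE_lborel_ex by blast
    then show False using \<sigma> by (auto simp: U_def)
  qed
qed

lemma sharp_constant_sharp_C:
  assumes N: "N = CARD('n::finite)" "N \<ge> 3"
  shows "sharp_constant TYPE('n) G_log (sharp_C N)"
  unfolding sharp_constant_def
proof (intro conjI allI impI)
  have N': "CARD('n) \<ge> 3" using N by simp
  have CN: "0 < sharp_C N" by (rule sharp_C_pos[OF N(2)])
  show "Sobolev_inequality TYPE('n) G_log (sharp_C N)"
    unfolding Sobolev_inequality_def
  proof (rule ballI)
    fix u :: "real ^ 'n \<Rightarrow> real" assume uD: "u \<in> D12"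
    obtain u0 g0 \<phi> where a: "D12_approx u0 g0 \<phi>" "AE x in lborel. u x = u0 x"
      using has_D12_gradient_approx[OF has_D12_gradient_grad[OF uD]] by blast
    from D12_dichotomy[OF a(1) N' a(2)]
    show "ereal (energy_power u) \<ge> ereal (sharp_C N) * extended_integral (\<lambda>x. G_log (u x))"
    proof
      assume "extended_integral (\<lambda>x. G_log (u x)) = - \<infinity>"
      then show ?thesis using CN by simp
    next
      assume *: "l2 lborel u0 \<and> integrable lborel (\<lambda>x. G_log (u0 x)) \<and> extended_integral (\<lambda>x. G_log (u x)) = ereal (\<integral>x. G_log (u0 x) \<partial>lborel)"
      then show ?thesis
        using D12_sharp_inequality_and_equality(1)[OF a(1) N] unfolding energy_power_def Dirichlet_energy_eq[OF uD a N'] N(1)[symmetric] by simp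
    qed
  qed
  fix C' assume S: "Sobolev_inequality TYPE('n) G_log C'"
  define u :: "real ^ 'n \<Rightarrow> real" where "u x = 1 * u_gauss 1 (x - 0)" for x
  have ae: "AE x in lborel. u x = 1 * u_gauss 1 (x - 0)" by (simp add: u_def)
  have 1: "(1::real) \<in> {1, -1}" by simp
  note f = u_gauss_facts[OF N zero_less_one 1 ae]
  obtain I where I: "0 < I" "extended_integral (\<lambda>x. G_log (u x)) = ereal I" "sharp_C N * I = energy_power u" using f(3) by blast
  have "ereal (energy_power u) \<ge> ereal C' * extended_integral (\<lambda>x. G_log (u x))"
    using S f(1) unfolding Sobolev_inequality_def by blast
  then have "C' * I \<le> sharp_C N * I" unfolding I(2) I(3) by simp
  then show "C' \<le> sharp_C N" using I(1) by simp
qed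

theorem mainTheorem2:
  fixes N :: nat
  assumes N_def: "N = CARD('n::finite)"
    and N_ge: "N \<ge> 3"
  shows "sharp_constant TYPE('n) G_log
           (critical_exponent N * (real N / 2) powr (2 / (real N - 2))
             * exp (2 * (real N - 1) / (real N - 2)) * pi powr (real N / (real N - 2)))
       \<and> (\<forall>u :: real ^ 'n \<Rightarrow> real.
            minimizer G_log u \<longleftrightarrow>
              (\<exists>l > 0. \<exists>y. \<exists>\<sigma> \<in> {1, -1}.
                 AE x in lebesgue. u x = \<sigma> * u_gauss l (x - y)))"
  unfolding sharp_C_def[symmetric] AE_completion_iff
proof (intro conjI allI iffI)
  have N': "CARD('n) \<ge> 3" using N_def N_ge by simp
  note sC = sharp_constant_sharp_C[OF N_def N_ge]
  show "sharp_constant TYPE('n) G_log (sharp_C N)" by (rule sC)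
  fix u :: "real ^ 'n \<Rightarrow> real"
  show "minimizer G_log u" if "\<exists>l>0. \<exists>y. \<exists>\<sigma>\<in>{1, -1}. AE x in lborel. u x = \<sigma> * u_gauss l (x - y)"
  proof -
    obtain l y \<sigma> where "0 < l" "\<sigma> \<in> {1, -1}" "AE x in lborel. u x = \<sigma> * u_gauss l (x - y)" using \<open>\<exists>l>0. _\<close> by blast
    note f = u_gauss_facts[OF N_def N_ge this]
    show ?thesis unfolding minimizer_def AE_completion_iff
    proof (intro conjI f(1,2) exI[of _ "sharp_C N"] sC)
      show "ereal (energy_power u) = ereal (sharp_C N) * extended_integral (\<lambda>x. G_log (u x))" using f(3) by auto
    qed
  qed
  assume "minimizer G_log u"
  then obtain C where uD: "u \<in> D12" and nz: "\<not> (AE x in lborel. u x = 0)" and C: "sharp_constant TYPE('n) G_log C"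
    and eq: "ereal (energy_power u) = ereal C * extended_integral (\<lambda>x. G_log (u x))"
    unfolding minimizer_def AE_completion_iff by blast
  have "C = sharp_C N" using C sC unfolding sharp_constant_def by (meson order_antisym)
  note eq = eq[unfolded this]
  obtain u0 g0 \<phi> where a: "D12_approx u0 g0 \<phi>" "AE x in lborel. u x = u0 x"
    using has_D12_gradient_approx[OF has_D12_gradient_grad[OF uD]] by blast
  have "extended_integral (\<lambda>x. G_log (u x)) \<noteq> - \<infinity>" using eq sharp_C_pos[OF N_ge] by auto
  with D12_dichotomy[OF a(1) N' a(2)]
  have *: "l2 lborel u0" "integrable lborel (\<lambda>x. G_log (u0 x))" "extended_integral (\<lambda>x. G_log (u x)) = ereal (\<integral>x. G_log (u0 x) \<partial>lborel)" by auto
  have "\<not> (AE x in lborel. u0 x = 0)"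
  proof
    assume "AE x in lborel. u0 x = 0"
    with a(2) have "AE x in lborel. u x = 0" by eventually_elim simp
    with nz show False ..
  qed
  moreover have "sharp_C N * (\<integral>x. G_log (u0 x) \<partial>lborel) = (\<Sum>b\<in>Basis. \<integral>x. (g0 x \<bullet> b)\<^sup>2 \<partial>lborel) powr (real N / (real N - 2))"
    using eq unfolding *(3) energy_power_def Dirichlet_energy_eq[OF uD a N'] N_def[symmetric] by simp
  ultimately obtain l y \<sigma> where l: "0 < l" "\<sigma> \<in> {1, -1}" "AE x in lborel. u0 x = \<sigma> * u_gauss l (x - y)"
    using D12_sharp_inequality_and_equality(2)[OF a(1) N_def N_ge *(1,2)] by blast
  have "AE x in lborel. u x = \<sigma> * u_gauss l (x - y)" using a(2) l(3) by eventually_elim simp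
  then show "\<exists>l>0. \<exists>y. \<exists>\<sigma>\<in>{1, -1}. AE x in lborel. u x = \<sigma> * u_gauss l (x - y)" using l(1,2) by blast
qed

end
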